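(* Consider a three-chain linkage formed by open chains $A$, $B$, $Z$, with oriented cycle $\Gamma=AB$ and generic edge lengths, such that none of the cycles $AB$, $AZ$, $BZ$ (as polygonal linkages) has an aligned configuration. Let $P$ be a critical configuration of aligned type of the oriented area function $S$ on the reduced configuration space, that is, a critical point at which $Z$ is aligned and each of $A$ and $B$ is cyclic. Put $\overrightarrow{W}=\overrightarrow{IT}$. Then the Morse index of $S$ at $P$ is $$\mu=\mu_A+\mu_B+\nu,$$ where $\mu_A$ and $\mu_B$ are the Morse indices of the cyclic polygons $AW$ and $BW$ obtained by adding the diagonal $W=IT$ to $A$ and $B$ respectively, and $$\nu=\begin{cases} f-1, & \text{if the pair of vectors } (\overrightarrow{W},\overrightarrow{O_AO_B}) \text{ is positively oriented},\\ r-f, & \text{otherwise,}\end{cases}$$ where $r$ is the number of edges of the chain $Z$, $f$ is the number of forward edges of $Z$, and $O_A$, $O_B$ are the centers of the circles circumscribed about $A$ and $B$ (equivalently, about the polygons $AW$ and $BW$) respectively.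
   Context: A linkage is a graph together with an assignment of (positive) lengths to its edges. A configuration is a realization of the linkage in the Euclidean plane (self-intersections allowed); the reduced configuration space is the space of configurations modulo orientation-preserving isometries of the plane. Edge lengths are assumed realizable (non-empty configuration space). A configuration (of a linkage or of a sublinkage) is aligned if all its vertices lie on one straight line. An open chain is a linkage whose underlying graph is a path, oriented from its initial to its terminal vertex; a polygonal linkage is one whose underlying graph is a single cycle. A three-chain linkage is obtained from three oriented open chains $A$, $B$, $Z$ by gluing their initial points into one vertex $I$ and their terminal points into one vertex $T$. The distinguished oriented cycle $\Gamma=AB$ runs along $A$ from $I$ to $T$ and then along $B$ backwards from $T$ to $I$. When none of the three cycles has an aligned configuration, the reduced configuration space of the three-chain is a smooth manifold. The oriented area of a polygon with consecutive vertices $p_i=(x_i,y_i)$, $i=1,\dots,n$, is defined by $2S=(x_1y_2-x_2y_1)+\dots+(x_ny_1-x_1y_n)$; for the three-chain, $S$ is the oriented area of $\Gamma$, viewed as a function on the reduced configuration space. A polygon or chain is cyclic if all its vertices lie on a circle. "Generic" means: outside a suitable finite union of submanifolds of codimension at least one in the parameter space of edge lengths; in particular one may assume that no configuration has simultaneously $\Gamma$ cyclic and $Z$ aligned (so $O_A\ne O_B$ at aligned critical configurations), and that the cyclic polygons occurring ($AW$ and $BW$) are non-degenerate critical points of the oriented area on the reduced configuration spaces of the corresponding polygonal linkages. At $P$, the oriented cycle $\Gamma$ splits, by cutting along the diagonal $W=IT$, into the homological sum of two oriented cycles $AW$ (traverse $A$ from $I$ to $T$, then the segment from $T$ to $I$)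 and $BW$ (traverse the segment from $I$ to $T$, then $B$ backwards from $T$ to $I$). These are cyclic polygons, and each is a critical point of the oriented area function on the reduced configuration space of the polygonal linkage having the same edge lengths as it (the length of the edge $W$ being $|IT|$ at $P$); $\mu_A$, $\mu_B$ are the Morse indices there. An edge of $Z$, directed according to the orientation of $Z$ from $I$ to $T$, is forward if it has the same direction as the vector $\overrightarrow{W}$. The Morse index is the number of negative eigenvalues of the Hessian. Known formula for the Morse index of a (generic) cyclic configuration $P=(p_1,\dots,p_n)$ of a polygonal linkage: let $O$ be the center of the circumscribed circle, $\omega_P$ the winding number of $P$ with respect to $O$, $\alpha_i>0$ half of the (unoriented) angle between $\overrightarrow{Op_i}$ and $\overrightarrow{Op_{i+1}}$, $\varepsilon_i=1$ if $O$ lies to the left of the directed edge $p_ip_{i+1}$ and $\varepsilon_i=-1$ if it lies to the right, and $e(P)$ the number of positive entries among $\varepsilon_1,\dots,\varepsilon_n$. Then the Morse index is $e(P)-1-2\omega_P$ if $\sum_i\varepsilon_i\tan\alpha_i>0$ and $e(P)-2-2\omega_P$ otherwise. *)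

theory Defs
  imports "HOL-Analysis.Analysis" "Jordan_Normal_Form.Char_Poly"
begin

section \<open>Smooth functions on open subsets of R^n\<close>

text \<open>Since dimensions vary inside the statements below, R^n is the library's
  \<^const>\<open>Euclidean_space\<close> \<open>n\<close>: functions \<open>nat \<Rightarrow> real\<close> vanishing from index \<open>n\<close> on.\<close>

definition pderiv_at :: "nat \<Rightarrow> ((nat \<Rightarrow> real) \<Rightarrow> real) \<Rightarrow> (nat \<Rightarrow> real) \<Rightarrow> real" where
  "pderiv_at i f x = deriv (\<lambda>t. f (x(i := t))) (x i)"

primrec C_on :: "nat \<Rightarrow> nat \<Rightarrow> (nat \<Rightarrow> real) set \<Rightarrow> ((nat \<Rightarrow> real) \<Rightarrow> real) \<Rightarrow> bool" where
  "C_on 0 n U f \<longleftrightarrow> continuous_map (subtopology (Euclidean_space n) U) euclideanreal f"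
| "C_on (Suc k) n U f \<longleftrightarrow>
     continuous_map (subtopology (Euclidean_space n) U) euclideanreal f \<and>
     (\<forall>i<n. (\<forall>x\<in>U. (\<lambda>t. f (x(i := t))) differentiable at (x i)) \<and> C_on k n U (pderiv_at i f))"

definition smooth_fun_on :: "nat \<Rightarrow> (nat \<Rightarrow> real) set \<Rightarrow> ((nat \<Rightarrow> real) \<Rightarrow> real) \<Rightarrow> bool" where
  "smooth_fun_on n U f \<longleftrightarrow> (\<forall>k. C_on k n U f)"

definition hessian :: "nat \<Rightarrow> ((nat \<Rightarrow> real) \<Rightarrow> real) \<Rightarrow> (nat \<Rightarrow> real) \<Rightarrow> real Matrix.mat" where
  "hessian d f x = Matrix.mat d d (\<lambda>(i, j). pderiv_at i (pderiv_at j f) x)"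

text \<open>Eigenvalues are counted with multiplicity.\<close>

definition num_neg_eigenvalues :: "real Matrix.mat \<Rightarrow> nat" where
  "num_neg_eigenvalues H = (\<Sum>t | eigenvalue H t \<and> t < 0. Polynomial.order t (char_poly H))"


section \<open>Generic edge lengths\<close>

definition submanifold_codim :: "nat \<Rightarrow> nat \<Rightarrow> (nat \<Rightarrow> real) set \<Rightarrow> bool" where
  "submanifold_codim n k M \<longleftrightarrow> k \<le> n \<and> M \<subseteq> topspace (Euclidean_space n) \<and>
     (\<forall>x\<in>M. \<exists>U g. openin (Euclidean_space n) U \<and> x \<in> U \<and>
        (\<forall>j<k. smooth_fun_on n U (g j)) \<and>
        M \<inter> U = {y \<in> U. \<forall>j<k. g j y = 0} \<and>
        (\<forall>y\<in>U. \<forall>c :: nat \<Rightarrow> real. (\<forall>i<n. (\<Sum>j<k. c j * pderiv_at i (g j) y) = 0) \<longrightarrow> (\<forall>j<k. c j = 0)))"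

definition vec_of :: "real list \<Rightarrow> nat \<Rightarrow> real" where
  "vec_of xs = (\<lambda>i. if i < length xs then xs ! i else 0)"

text \<open>\<open>Q a b z\<close> holds for generic positive edge lengths of three chains with \<open>nA\<close>, \<open>nB\<close>, \<open>r\<close> edges.
  The exceptional set depends on \<open>nA\<close>, \<open>nB\<close>, \<open>r\<close> only.\<close>

definition for_generic_lengths ::
    "nat \<Rightarrow> nat \<Rightarrow> nat \<Rightarrow> (real list \<Rightarrow> real list \<Rightarrow> real list \<Rightarrow> bool) \<Rightarrow> bool" where
  "for_generic_lengths nA nB r Q \<longleftrightarrow>
     (\<exists>\<M>. finite \<M> \<and> (\<forall>M\<in>\<M>. \<exists>k\<ge>1. submanifold_codim (nA + nB + r) k M) \<and>
        (\<forall>a b z. length a = nA \<and> length b = nB \<and> length z = r \<and>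
           (\<forall>l \<in> set (a @ b @ z). 0 < l) \<and> vec_of (a @ b @ z) \<notin> \<Union>\<M> \<longrightarrow> Q a b z))"


section \<open>Linkages and their reduced configuration spaces\<close>

text \<open>A linkage consists of its vertices and its edges \<open>(u, v, l)\<close> of length \<open>l\<close>. The Euclidean
  plane is the complex plane. Configurations are extensional functions on the vertex set.\<close>

type_synonym 'v linkage = "'v set \<times> ('v \<times> 'v \<times> real) set"

definition configs :: "'v linkage \<Rightarrow> ('v \<Rightarrow> complex) set" where
  "configs L = {p \<in> fst L \<rightarrow>\<^sub>E UNIV. \<forall>(u, v, l) \<in> snd L. dist (p u) (p v) = l}"

definition config_space :: "'v linkage \<Rightarrow> ('v \<Rightarrow> complex) topology" where
  "config_space L = subtopology (product_topology (\<lambda>_. euclidean) (fst L)) (configs L)"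

text \<open>The orientation-preserving isometries are the maps \<open>x \<mapsto> c * x + b\<close> with \<open>norm c = 1\<close>.\<close>

definition config_class :: "'v linkage \<Rightarrow> ('v \<Rightarrow> complex) \<Rightarrow> ('v \<Rightarrow> complex) set" where
  "config_class L p = {q \<in> configs L. \<exists>c b. norm c = 1 \<and> (\<forall>v \<in> fst L. q v = c * p v + b)}"

text \<open>The quotient topology on the set of congruence classes.\<close>

definition reduced_space :: "'v linkage \<Rightarrow> ('v \<Rightarrow> complex) set topology" where
  "reduced_space L = topology (\<lambda>\<U>. \<U> \<subseteq> config_class L ` configs L \<and>
     openin (config_space L) {p \<in> configs L. config_class L p \<in> \<U>})"

lemma topspace_config_space: "topspace (config_space L) = configs L"
  by (auto simp: config_space_def configs_def)

lemma openin_reduced_space: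
  "openin (reduced_space L) \<U> \<longleftrightarrow> \<U> \<subseteq> config_class L ` configs L \<and>
     openin (config_space L) {p \<in> configs L. config_class L p \<in> \<U>}"
proof -
  let ?o = "\<lambda>\<U>. \<U> \<subseteq> config_class L ` configs L \<and>
     openin (config_space L) {p \<in> configs L. config_class L p \<in> \<U>}"
  have "istopology ?o"
    unfolding istopology_def
  proof (intro conjI allI impI)
    fix S T assume "?o S" "?o T"
    then show "S \<inter> T \<subseteq> config_class L ` configs L" by blast
    have "{p \<in> configs L. config_class L p \<in> S \<inter> T}
        = {p \<in> configs L. config_class L p \<in> S} \<inter> {p \<in> configs L. config_class L p \<in> T}" by auto
    then show "openin (config_space L) {p \<in> configs L. config_class L p \<in> S \<inter> T}"
      using \<open>?o S\<close> \<open>?o T\<close> by (metis (no_types, lifting) openin_Int)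
  next
    fix \<K> assume K: "\<forall>K\<in>\<K>. ?o K"
    then show "\<Union>\<K> \<subseteq> config_class L ` configs L" by blast
    have "{p \<in> configs L. config_class L p \<in> \<Union>\<K>}
        = (\<Union>K\<in>\<K>. {p \<in> configs L. config_class L p \<in> K})" by auto
    moreover have "openin (config_space L) (\<Union>K\<in>\<K>. {p \<in> configs L. config_class L p \<in> K})"
      by (rule openin_Union) (use K in auto)
    ultimately show "openin (config_space L) {p \<in> configs L. config_class L p \<in> \<Union>\<K>}" by simp
  qed
  then show ?thesis by (simp add: reduced_space_def topology_inverse')
qed

lemma topspace_reduced_space: "topspace (reduced_space L) = config_class L ` configs L"
proof
  show "topspace (reduced_space L) \<subseteq> config_class L ` configs L"
    by (metis openin_reduced_space openin_topspace)
  have "{p \<in> configs L. config_class L p \<in> config_class L ` configs L} = topspace (config_space L)"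
    by (auto simp: topspace_config_space)
  then have "openin (reduced_space L) (config_class L ` configs L)"
    unfolding openin_reduced_space by (metis openin_topspace order_refl)
  then show "config_class L ` configs L \<subseteq> topspace (reduced_space L)"
    by (rule openin_subset)
qed

lemma quotient_map_config_class: "quotient_map (config_space L) (reduced_space L) (config_class L)"
  by (auto simp: quotient_map_def topspace_config_space topspace_reduced_space openin_reduced_space)

text \<open>A smooth local parametrization of the reduced configuration space, given by a lift
  \<open>\<phi>\<close> to configurations: \<open>\<phi>\<close> is smooth, its composition with the quotient map is a homeomorphism
  from \<open>U\<close> onto an open set, and no nonzero directional derivative of \<open>\<phi>\<close> is an
  infinitesimal rigid motion \<open>v \<mapsto> \<i> * s * \<phi> x v + b\<close>, so that the induced map into the
  quotient is an immersion.\<close>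

definition reduced_chart ::
    "'v linkage \<Rightarrow> nat \<Rightarrow> (nat \<Rightarrow> real) set \<Rightarrow> ((nat \<Rightarrow> real) \<Rightarrow> 'v \<Rightarrow> complex) \<Rightarrow> bool" where
  "reduced_chart L d U \<phi> \<longleftrightarrow>
     openin (Euclidean_space d) U \<and> \<phi> ` U \<subseteq> configs L \<and>
     (\<forall>v \<in> fst L. smooth_fun_on d U (\<lambda>x. Re (\<phi> x v)) \<and> smooth_fun_on d U (\<lambda>x. Im (\<phi> x v))) \<and>
     embedding_map (subtopology (Euclidean_space d) U) (reduced_space L) (config_class L \<circ> \<phi>) \<and>
     openin (reduced_space L) ((config_class L \<circ> \<phi>) ` U) \<and>
     (\<forall>x\<in>U. \<forall>(h :: nat \<Rightarrow> real) (s :: real) b.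
        (\<forall>v \<in> fst L. (\<Sum>i<d. complex_of_real (h i) *
             Complex (pderiv_at i (\<lambda>y. Re (\<phi> y v)) x) (pderiv_at i (\<lambda>y. Im (\<phi> y v)) x))
           = \<i> * complex_of_real s * \<phi> x v + b)
        \<longrightarrow> (\<forall>i<d. h i = 0))"

text \<open>In the next two definitions \<open>F\<close> is a function on configurations that is invariant under
  orientation-preserving isometries, i.e. a function on the reduced configuration space.\<close>

definition critical_config :: "'v linkage \<Rightarrow> (('v \<Rightarrow> complex) \<Rightarrow> real) \<Rightarrow> ('v \<Rightarrow> complex) \<Rightarrow> bool" where
  "critical_config L F P \<longleftrightarrow> P \<in> configs L \<and>
     (\<exists>d U \<phi> x. reduced_chart L d U \<phi> \<and> x \<in> U \<and> config_class L (\<phi> x) = config_class L P \<and>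
        (\<forall>i<d. pderiv_at i (F \<circ> \<phi>) x = 0))"

text \<open>At a critical point the number below does not depend on the chart.\<close>

definition morse_index :: "'v linkage \<Rightarrow> (('v \<Rightarrow> complex) \<Rightarrow> real) \<Rightarrow> ('v \<Rightarrow> complex) \<Rightarrow> nat" where
  "morse_index L F P = (THE m. \<exists>d U \<phi> x. reduced_chart L d U \<phi> \<and> x \<in> U \<and>
     config_class L (\<phi> x) = config_class L P \<and> m = num_neg_eigenvalues (hessian d (F \<circ> \<phi>) x))"

definition has_aligned_config :: "'v linkage \<Rightarrow> bool" where
  "has_aligned_config L \<longleftrightarrow> (\<exists>p \<in> configs L. collinear (p ` fst L))"


section \<open>Polygons\<close>

definition polygon_linkage :: "real list \<Rightarrow> nat linkage" where
  "polygon_linkage ls = ({..<length ls}, {(i, Suc i mod length ls, ls ! i) | i. i < length ls})"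

definition oriented_area :: "complex list \<Rightarrow> real" where
  "oriented_area ps = (\<Sum>i<length ps. let p = ps ! i; q = ps ! (Suc i mod length ps)
     in Re p * Im q - Re q * Im p) / 2"

definition side_lengths :: "complex list \<Rightarrow> real list" where
  "side_lengths ps = map (\<lambda>i. dist (ps ! i) (ps ! (Suc i mod length ps))) [0..<length ps]"

definition polygon_morse_index :: "complex list \<Rightarrow> nat" where
  "polygon_morse_index ps = morse_index (polygon_linkage (side_lengths ps))
     (\<lambda>p. oriented_area (map p [0..<length ps])) (\<lambda>i\<in>{..<length ps}. ps ! i)"

definition circumcenter :: "complex \<Rightarrow> complex set \<Rightarrow> bool" where
  "circumcenter c X \<longleftrightarrow> (\<exists>R>0. \<forall>p\<in>X. dist c p = R)"

definition positively_oriented :: "complex \<Rightarrow> complex \<Rightarrow> bool" where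
  "positively_oriented u v \<longleftrightarrow> Re u * Im v - Im u * Re v > 0"


section \<open>Three-chain linkages\<close>

datatype vertex = Init | Term | VA nat | VB nat | VZ nat

text \<open>The vertices, from \<open>Init\<close> to \<open>Term\<close>, of a chain with \<open>n\<close> edges and inner vertices
  \<open>K 1, \<dots>, K (n - 1)\<close>.\<close>

definition chain_vertices :: "(nat \<Rightarrow> vertex) \<Rightarrow> nat \<Rightarrow> vertex list" where
  "chain_vertices K n = Init # map K [1..<n] @ [Term]"

definition chain_edges :: "(nat \<Rightarrow> vertex) \<Rightarrow> real list \<Rightarrow> (vertex \<times> vertex \<times> real) set" where
  "chain_edges K ls = (let vs = chain_vertices K (length ls)
     in {(vs ! i, vs ! Suc i, ls ! i) | i. i < length ls})"

definition three_chain :: "real list \<Rightarrow> real list \<Rightarrow> real list \<Rightarrow> vertex linkage" where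
  "three_chain a b z =
     (set (chain_vertices VA (length a)) \<union> set (chain_vertices VB (length b)) \<union>
        set (chain_vertices VZ (length z)),
      chain_edges VA a \<union> chain_edges VB b \<union> chain_edges VZ z)"

text \<open>Along \<open>A\<close> from \<open>Init\<close> to \<open>Term\<close>, then along \<open>B\<close> backwards.\<close>

definition Gamma_vertices :: "nat \<Rightarrow> nat \<Rightarrow> vertex list" where
  "Gamma_vertices nA nB = chain_vertices VA nA @ rev (map VB [1..<nB])"

definition Gamma_area :: "nat \<Rightarrow> nat \<Rightarrow> (vertex \<Rightarrow> complex) \<Rightarrow> real" where
  "Gamma_area nA nB P = oriented_area (map P (Gamma_vertices nA nB))"

text \<open>The cycle \<open>AW\<close> runs along \<open>A\<close> and closes up by the segment from \<open>Term\<close> to \<open>Init\<close>;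
  \<open>BW\<close> runs along the segment from \<open>Init\<close> to \<open>Term\<close> and then backwards along \<open>B\<close>.\<close>

definition AW_vertices :: "nat \<Rightarrow> vertex list" where
  "AW_vertices nA = chain_vertices VA nA"

definition BW_vertices :: "nat \<Rightarrow> vertex list" where
  "BW_vertices nB = [Init, Term] @ rev (map VB [1..<nB])"

definition num_forward :: "nat \<Rightarrow> (vertex \<Rightarrow> complex) \<Rightarrow> nat" where
  "num_forward r P = (let zs = map P (chain_vertices VZ r)
     in card {i. i < r \<and> (\<exists>t>0. zs ! Suc i - zs ! i = t *\<^sub>R (P Term - P Init))})"

end

theory Submission
  imports Defs "Jordan_Normal_Form.Schur_Decomposition"
begin

text \<open>
  Up to the Lagrange multipliers of the squared edge lengths, which are constant on the configuration
  space, the oriented area is a quadratic function with associated bilinear form \<open>B\<close>, and \<open>P\<close> is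
  critical iff \<open>B P\<close> vanishes for suitable multipliers. Then the Hessian in any chart is the Gram
  matrix of \<open>B\<close> on infinitesimal motions, so the Morse index is the index of \<open>B\<close> on tangent vectors
  modulo its radical. For a cyclic polygon the multipliers are read off the
  circumcenter. At an aligned critical configuration the forms of the polygons \<open>AW\<close> and \<open>BW\<close> add up
  to the area form, except that the multipliers of \<open>W\<close> sum to \<open>Im ((O\<^sub>B - O\<^sub>A) / W)\<close>, and this defect is
  made up by the multipliers of the edges of \<open>Z\<close>. Each tangent vector splits into motions of \<open>A\<close>,
  \<open>B\<close> and \<open>Z\<close> modulo rigid motions, and \<open>B\<close> is the orthogonal sum of the polygon forms and of a form
  in the rotation speeds of the edges of \<open>Z\<close>, a rank one modification of a diagonal form that has
  index \<open>f - 1\<close> or \<open>r - f\<close> depending on the sign of that sum.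

  The genericity that is needed is \<open>O\<^sub>A \<noteq> O\<^sub>B\<close> and \<open>W \<noteq> 0\<close>. If it fails, then the \<open>n\<close> edge lengths
  are Laurent polynomials in \<open>n - 1\<close> parameters and hence algebraically dependent. The
  zeros of a nonzero polynomial lie in finitely many hypersurfaces.
\<close>

section \<open>Signatures of real symmetric matrices\<close>

text \<open>\<open>tangent_vectors\<close> is only the linearized solution space, while a chart sees
  velocities of actual configurations. The main geometric work is to realize every infinitesimal
  motion. This is where non-alignment enters: a chain not contained in a line has a bent vertex, so
  its other edges can be rotated at will while this vertex absorbs the change of the distance of the
  ends. In the three-chain the edges of Z are rotated, and A and B follow by bending.

  The splitting works because all edges of an aligned Z move perpendicularly to W. Hence the length
  of W is stationary, and a tangent vector restricts to tangent vectors of the polygons, in which W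
  is rigid.

  \<open>morse_index\<close> is a definite description, so at least one chart is needed and all
  charts must agree. A critical configuration of the three-chain brings a chart with it; for the
  polygons one is constructed from the bent vertex. Agreement is Sylvester's law of inertia for a
  form modulo its radical.\<close>

lemma underdetermined_system:
  fixes M :: "'a \<Rightarrow> 'b \<Rightarrow> 'c::field"
  assumes "finite K" "finite A" "card K < card A"
  shows "\<exists>c. (\<exists>a\<in>A. c a \<noteq> 0) \<and> (\<forall>k\<in>K. (\<Sum>a\<in>A. c a * M a k) = 0)"
  using assms
proof (induction K arbitrary: A M rule: finite_induct)
  case empty
  then have "A \<noteq> {}" by auto
  then show ?case by (intro exI[of _ "\<lambda>_. 1"]) auto
next
  case (insert k K)
  show ?case
  proof (cases "\<forall>a\<in>A. M a k = 0")
    case True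
    obtain c where "\<exists>a\<in>A. c a \<noteq> 0" "\<forall>k\<in>K. (\<Sum>a\<in>A. c a * M a k) = 0"
      using insert.IH[of A M] insert.prems insert.hyps by auto
    then show ?thesis using True by (intro exI[of _ c]) auto
  next
    case False
    then obtain a0 where a0: "a0 \<in> A" "M a0 k \<noteq> 0" by blast
    \<comment> \<open>Gaussian elimination: subtracting multiples of the pivot \<open>a0\<close>
      removes equation \<open>k\<close>, which leaves one unknown and one equation fewer.\<close>
    define M' where "M' a l = M a l - M a k / M a0 k * M a0 l" for a l
    have "card K < card (A - {a0})" using insert.prems insert.hyps a0 by simp
    then obtain c where c: "\<exists>a\<in>A - {a0}. c a \<noteq> 0"
        "\<And>l. l \<in> K \<Longrightarrow> (\<Sum>a\<in>A - {a0}. c a * M' a l) = 0"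
      using insert.IH[of "A - {a0}" M'] insert.prems by auto
    define s where "s = (\<Sum>a\<in>A - {a0}. c a * M a k)"
    \<comment> \<open>The coefficient of the pivot is forced by equation \<open>k\<close>.\<close>
    define c' where "c' = c(a0 := - s / M a0 k)"
    have eq: "(\<Sum>a\<in>A. c' a * M a l) = (\<Sum>a\<in>A - {a0}. c a * M a l) - s / M a0 k * M a0 l" for l
    proof -
      have "(\<Sum>a\<in>A. c' a * M a l) = c' a0 * M a0 l + (\<Sum>a\<in>A - {a0}. c' a * M a l)"
        using a0 insert.prems by (simp add: sum.remove)
      also have "(\<Sum>a\<in>A - {a0}. c' a * M a l) = (\<Sum>a\<in>A - {a0}. c a * M a l)"
        by (rule sum.cong) (auto simp: c'_def)
      finally show ?thesis by (simp add: c'_def)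
    qed
    have "(\<Sum>a\<in>A. c' a * M a l) = 0" if "l \<in> insert k K" for l
    proof (cases "l = k")
      case True
      then show ?thesis using a0 by (simp add: eq s_def)
    next
      case False
      then have l: "l \<in> K" using that by simp
      have "s / M a0 k * M a0 l = (\<Sum>a\<in>A - {a0}. c a * (M a k / M a0 k * M a0 l))"
        by (simp add: s_def sum_distrib_right sum_divide_distrib mult.assoc)
      then show ?thesis using c(2)[OF l]
        by (simp add: eq M'_def right_diff_distrib sum_subtractf)
    qed
    moreover have "\<exists>a\<in>A. c' a \<noteq> 0" using c(1) by (auto simp: c'_def)
    ultimately show ?thesis by blast
  qed
qed

lemma order_prod_linear:
  "Polynomial.order (t::real) (\<Prod>a\<leftarrow>es. [:- a, 1:]) = length (filter ((=) t) es)"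
proof (induction es)
  case (Cons a es)
  have nz: "[:- a, 1:] * (\<Prod>a\<leftarrow>es. [:- a, 1:]) \<noteq> 0"
  proof -
    have "monic (\<Prod>a\<leftarrow>es. [:- a, 1:])" by (rule monic_prod_list) auto
    then have "(\<Prod>a\<leftarrow>es. [:- a, 1:]) \<noteq> 0" by auto
    then show ?thesis by (simp only: mult_eq_0_iff) simp
  qed
  have "Polynomial.order t [:- a, 1:] = (if t = a then 1 else 0)"
    using order_power_n_n[of a 1] by (auto simp: order_0I)
  then show ?case using Cons nz by (simp add: order_mult del: mult_pCons_left)
qed simp

lemma num_neg_eigenvalues_prod_linear:
  assumes H: "H \<in> carrier_mat n n" and c: "char_poly H = (\<Prod>a\<leftarrow>es. [:- a, 1:])"
  shows "num_neg_eigenvalues H = length (filter (\<lambda>t. t < 0) es)"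
proof -
  have ev: "eigenvalue H t \<longleftrightarrow> t \<in> set es" for t
  proof -
    have "poly (\<Prod>a\<leftarrow>es. [:- a, 1:]) t = 0 \<longleftrightarrow> t \<in> set es"
      by (induction es) auto
    then show ?thesis using eigenvalue_root_char_poly[OF H] c by simp
  qed
  have "num_neg_eigenvalues H = (\<Sum>t | t \<in> set es \<and> t < 0. length (filter ((=) t) es))"
    unfolding num_neg_eigenvalues_def c order_prod_linear ev ..
  also have "\<dots> = (\<Sum>t\<in>set (filter (\<lambda>t. t < 0) es). count_list (filter (\<lambda>t. t < 0) es) t)"
  proof (rule sum.cong)
    fix t assume t: "t \<in> set (filter (\<lambda>t. t < 0) es)"
    then have "t < 0" by simp
    have "length (filter ((=) t) xs) = count_list (filter (\<lambda>t. t < 0) xs) t" for xs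
      using \<open>t < 0\<close> by (induction xs) auto
    then show "length (filter ((=) t) es) = count_list (filter (\<lambda>t. t < 0) es) t" by simp
  qed auto
  also have "\<dots> = length (filter (\<lambda>t. t < 0) es)"
    by (rule sum_count_set) auto
  finally show ?thesis .
qed

section \<open>The spectral theorem for real symmetric matrices and comparison of their
  indices\<close>

definition symmetric_on :: "nat \<Rightarrow> real mat \<Rightarrow> bool" where
  "symmetric_on n H \<longleftrightarrow> H \<in> carrier_mat n n \<and> (\<forall>i<n. \<forall>j<n. H $$ (i, j) = H $$ (j, i))"

text \<open>Over the complex numbers the Hermitian form of an eigenvector equals its own conjugate,
  so every eigenvalue is real. The complex linear factors therefore come from real ones, and the
  factorization descends because the coefficient embedding is injective.\<close>

lemma char_poly_symmetric_splits:
  assumes "symmetric_on n H"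
  shows "\<exists>es. char_poly H = (\<Prod>a\<leftarrow>es. [:- a, 1:]) \<and> length es = n"
proof -
  have H: "H \<in> carrier_mat n n" and sym: "\<And>i j. i < n \<Longrightarrow> j < n \<Longrightarrow> H $$ (i, j) = H $$ (j, i)"
    using assms by (auto simp: symmetric_on_def)
  define C where "C = map_mat complex_of_real H"
  have C: "C \<in> carrier_mat n n" using H by (simp add: C_def)
  obtain as where as: "char_poly C = (\<Prod>a\<leftarrow>as. [:- a, 1:])" "length as = n"
    using char_poly_factorized[OF C] by blast
  have real: "Im a = 0" if "a \<in> set as" for a
  proof -
    have "poly (char_poly C) a = 0" unfolding as using that by (induction as) auto
    then have "eigenvalue C a" using eigenvalue_root_char_poly[OF C] by simp
    then obtain v where v: "v \<in> carrier_vec n" "v \<noteq> 0\<^sub>v n" "C *\<^sub>v v = a \<cdot>\<^sub>v v"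
      using C unfolding eigenvalue_def eigenvector_def by auto
    have row: "(\<Sum>j<n. of_real (H $$ (i, j)) * v $ j) = a * v $ i" if "i < n" for i
    proof -
      have "(C *\<^sub>v v) $ i = (\<Sum>j<n. of_real (H $$ (i, j)) * v $ j)"
        using that C v(1) H by (simp add: scalar_prod_def C_def atLeast0LessThan)
      then show ?thesis using v(3) that v(1) by simp
    qed
    let ?s = "\<Sum>i<n. \<Sum>j<n. of_real (H $$ (i, j)) * v $ j * cnj (v $ i)"
    let ?N = "\<Sum>i<n. (cmod (v $ i))\<^sup>2"
    have "?s = (\<Sum>i<n. a * (v $ i * cnj (v $ i)))"
      by (rule sum.cong[OF refl]) (simp add: sum_distrib_right[symmetric] row flip: mult.assoc)
    then have s: "?s = a * of_real ?N"
      by (simp add: sum_distrib_left complex_norm_square[symmetric])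
    have "cnj ?s = (\<Sum>i<n. \<Sum>j<n. of_real (H $$ (i, j)) * cnj (v $ j) * v $ i)"
      by simp
    also have "\<dots> = (\<Sum>j<n. \<Sum>i<n. of_real (H $$ (i, j)) * cnj (v $ j) * v $ i)"
      by (rule sum.swap)
    also have "\<dots> = ?s"
      by (intro sum.cong refl) (simp add: sym mult_ac)
    finally have "cnj ?s = ?s" .
    then have "?s \<in> \<real>" by (simp only: Reals_cnj_iff)
    then have "Im ?s = 0" by (simp only: complex_is_Real_iff)
    then have "Im a * ?N = 0" unfolding s by simp
    moreover have "?N \<noteq> 0"
    proof
      assume "?N = 0"
      then have "\<forall>i<n. v $ i = 0" by (subst (asm) sum_nonneg_eq_0_iff) auto
      then show False using v by (auto intro: eq_vecI)
    qed
    ultimately show ?thesis by simp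
  qed
  define es where "es = map Re as"
  interpret map_poly_inj_idom_hom complex_of_real ..
  have "char_poly C = map_poly of_real (char_poly H)"
    unfolding C_def using H by (simp add: of_real_hom.char_poly_hom)
  moreover have "(\<Prod>a\<leftarrow>as. [:- a, 1:]) = map_poly of_real (\<Prod>a\<leftarrow>es. [:- a, 1:])"
    using real unfolding es_def
  proof (induction as)
    case (Cons a as)
    have "of_real (Re a) = a" using Cons.prems by (simp add: complex_eq_iff)
    then show ?case using Cons by (simp add: hom_mult del: mult_pCons_left)
  qed simp
  ultimately have "map_poly complex_of_real (char_poly H) = map_poly of_real (\<Prod>a\<leftarrow>es. [:- a, 1:])"
    using as by simp
  then have "char_poly H = (\<Prod>a\<leftarrow>es. [:- a, 1:])" by (rule injectivity)
  moreover have "length es = n" using as by (simp add: es_def)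
  ultimately show ?thesis by blast
qed

text \<open>Gram-Schmidt for a basis that starts with \<open>v\<close>, then normalization. The
  leading column stays proportional to \<open>v\<close>, which lets the spectral theorem split off
  one eigenvector.\<close>

lemma orthonormal_completion:
  fixes v :: "real vec"
  assumes v: "v \<in> carrier_vec n" "v \<noteq> 0\<^sub>v n"
  shows "\<exists>W\<in>carrier_mat n n. \<exists>k. W\<^sup>T * W = 1\<^sub>m n \<and> v = k \<cdot>\<^sub>v col W 0"
proof -
  have n: "n \<noteq> 0" using v by auto
  interpret cof_vec_space n "TYPE(real)" .
  define b where "b = basis_completion v"
  define ws where "ws = gram_schmidt n b"
  note b = basis_completion[OF v, folded b_def]
  obtain vs where bv: "b = v # vs" using b(6,7) n by (cases b) auto
  from gram_schmidt_result[OF b(2,4,5) refl, folded ws_def]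
  have ws: "set ws \<subseteq> carrier_vec n" "corthogonal ws" "length ws = n" using b(6) by auto
  have hd: "hd ws = v" unfolding ws_def bv by (rule gram_schmidt_hd[OF v(1)])
  \<comment> \<open>\<open>corthogonal\<close> refers to the conjugate inner product; over the reals
    conjugation is trivial.\<close>
  have dot: "ws ! i \<bullet> ws ! j = 0 \<longleftrightarrow> i \<noteq> j" if "i < n" "j < n" for i j
  proof -
    have "conjugate (ws ! j) = ws ! j" by (auto intro!: eq_vecI)
    then show ?thesis using corthogonalD[OF ws(2), of i j] that ws(3) by simp
  qed
  have wsc: "ws ! i \<in> carrier_vec n" if "i < n" for i using ws that by auto
  have pos: "ws ! i \<bullet> ws ! i > 0" if "i < n" for i
  proof -
    have "ws ! i \<bullet> ws ! i \<ge> 0" by (simp add: scalar_prod_def sum_nonneg)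
    then show ?thesis using dot[OF that that] by linarith
  qed
  define r where "r i = 1 / sqrt (ws ! i \<bullet> ws ! i)" for i
  define W where "W = mat_of_cols n (map (\<lambda>i. r i \<cdot>\<^sub>v ws ! i) [0..<n])"
  have W: "W \<in> carrier_mat n n" unfolding W_def by (auto simp: mat_of_cols_def)
  have colW: "col W i = r i \<cdot>\<^sub>v ws ! i" if "i < n" for i
    unfolding W_def using that wsc by (subst col_mat_of_cols) auto
  have "(W\<^sup>T * W) $$ (i, j) = 1\<^sub>m n $$ (i, j)" if "i < n" "j < n" for i j
  proof -
    have "(W\<^sup>T * W) $$ (i, j) = col W i \<bullet> col W j" using W that by simp
    also have "\<dots> = r i * r j * (ws ! i \<bullet> ws ! j)"
      using wsc[OF that(1)] wsc[OF that(2)] by (simp add: colW[OF that(1)] colW[OF that(2)])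
    also have "\<dots> = (if i = j then 1 else 0)"
      using dot[OF that] pos[OF that(1)] by (auto simp: r_def)
    finally show ?thesis using that by simp
  qed
  then have "W\<^sup>T * W = 1\<^sub>m n" using W by (intro eq_matI) auto
  moreover have "v = sqrt (v \<bullet> v) \<cdot>\<^sub>v col W 0"
  proof -
    have ws0: "ws ! 0 = v" using hd ws n by (metis hd_conv_nth length_0_conv)
    have "sqrt (v \<bullet> v) * r 0 = 1" using pos[of 0] n by (simp add: r_def ws0)
    then show ?thesis using n colW[of 0] v by (simp add: ws0 smult_smult_assoc)
  qed
  ultimately show ?thesis using W by blast
qed

text \<open>Deflation: in an orthonormal basis that starts with an eigenvector, symmetry clears the
  rest of the first row and column. The remaining block is symmetric and carries the remaining
  eigenvalues.\<close>

lemma spectral_decomposition: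
  assumes "symmetric_on n H" "char_poly H = (\<Prod>a\<leftarrow>es. [:- a, 1:])" "length es = n"
  shows "\<exists>P\<in>carrier_mat n n. P\<^sup>T * P = 1\<^sub>m n \<and>
    P\<^sup>T * H * P = Matrix.mat n n (\<lambda>(i, j). if i = j then es ! i else 0)"
  using assms
proof (induction es arbitrary: n H)
  case Nil
  then show ?case by (intro bexI[of _ "1\<^sub>m 0"]) (auto simp: symmetric_on_def)
next
  case (Cons e es)
  define m where "m = n - 1"
  have n: "n = Suc m" using Cons.prems by (simp add: m_def)
  have H: "H \<in> carrier_mat n n" and sym: "H\<^sup>T = H"
    using Cons.prems by (auto simp: symmetric_on_def)
  have "poly (char_poly H) e = 0" unfolding Cons.prems(2) by simp
  then have "eigenvalue H e" using eigenvalue_root_char_poly[OF H] by simp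
  then obtain v where v: "v \<in> carrier_vec n" "v \<noteq> 0\<^sub>v n" "H *\<^sub>v v = e \<cdot>\<^sub>v v"
    using H unfolding eigenvalue_def eigenvector_def by auto
  obtain W k where W: "W \<in> carrier_mat n n" "W\<^sup>T * W = 1\<^sub>m n" "v = k \<cdot>\<^sub>v col W 0"
    using orthonormal_completion[OF v(1,2)] by blast
  have W2: "W * W\<^sup>T = 1\<^sub>m n"
    using mat_mult_left_right_inverse[of "W\<^sup>T" n W] W by auto
  have k: "k \<noteq> 0"
  proof
    assume "k = 0"
    then have "v = 0\<^sub>v n" using W by (auto intro!: eq_vecI)
    then show False using v by simp
  qed
  have evW: "H *\<^sub>v col W 0 = e \<cdot>\<^sub>v col W 0"
  proof -
    have c: "col W 0 \<in> carrier_vec n" using W(1) n by (intro carrier_vecI) simp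
    have "k \<cdot>\<^sub>v (H *\<^sub>v col W 0) = k \<cdot>\<^sub>v (e \<cdot>\<^sub>v col W 0)"
      using v(3) c H unfolding W(3) by (simp add: mult_mat_vec smult_smult_assoc mult.commute)
    then have "inverse k \<cdot>\<^sub>v (k \<cdot>\<^sub>v (H *\<^sub>v col W 0)) = inverse k \<cdot>\<^sub>v (k \<cdot>\<^sub>v (e \<cdot>\<^sub>v col W 0))"
      by simp
    then show ?thesis using k by (simp add: smult_smult_assoc mult.assoc[symmetric])
  qed
  define A where "A = W\<^sup>T * H * W"
  have A: "A \<in> carrier_mat n n" using W H by (simp add: A_def)
  have "A\<^sup>T = W\<^sup>T * (W\<^sup>T * H)\<^sup>T" unfolding A_def using W H by (subst transpose_mult) auto
  also have "(W\<^sup>T * H)\<^sup>T = H * W" using W H sym by (subst transpose_mult) auto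
  finally have AT: "A\<^sup>T = A" unfolding A_def using W H by (simp add: assoc_mult_mat[of _ n n _ n _ n])
  have Asym: "A $$ (i, j) = A $$ (j, i)" if "i < n" "j < n" for i j
    using arg_cong[OF AT, of "\<lambda>M. M $$ (j, i)"] that A by simp
  have A0: "A $$ (i, 0) = (if i = 0 then e else 0)" if "i < n" for i
  proof -
    have "A $$ (i, 0) = (W\<^sup>T * (H * W)) $$ (i, 0)"
      unfolding A_def using W H by (simp add: assoc_mult_mat[of _ n n _ n _ n])
    also have "\<dots> = col W i \<bullet> (H *\<^sub>v col W 0)"
      using W(1) H that n by (simp add: col_mult2[of _ n n _ n] mult_mat_vec_def)
    also have "\<dots> = e * (col W i \<bullet> col W 0)"
      unfolding evW using W(1) that n by (intro scalar_prod_smult_distrib[of _ n]) (auto intro!: carrier_vecI)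
    also have "col W i \<bullet> col W 0 = (W\<^sup>T * W) $$ (i, 0)"
      using W(1) that n by simp
    finally show ?thesis using W(2) that n by simp
  qed
  define A3 where "A3 = Matrix.mat m m (\<lambda>(i, j). A $$ (Suc i, Suc j))"
  have A3: "A3 \<in> carrier_mat m m" by (simp add: A3_def)
  define E where "E = Matrix.mat 1 1 (\<lambda>_. e)"
  have E: "E \<in> carrier_mat 1 1" by (simp add: E_def)
  have block: "A = four_block_mat E (0\<^sub>m 1 m) (0\<^sub>m m 1) A3"
  proof (rule eq_matI)
    fix i j assume ij: "i < dim_row (four_block_mat E (0\<^sub>m 1 m) (0\<^sub>m m 1) A3)"
      "j < dim_col (four_block_mat E (0\<^sub>m 1 m) (0\<^sub>m m 1) A3)"
    then have "i < n" "j < n" using n by (auto simp: E_def A3_def)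
    then show "A $$ (i, j) = four_block_mat E (0\<^sub>m 1 m) (0\<^sub>m m 1) A3 $$ (i, j)"
      using A0[of i] A0[of j] Asym[of i j] n by (auto simp: E_def A3_def)
  qed (use A n in \<open>auto simp: E_def A3_def\<close>)
  have "similar_mat A H"
    unfolding similar_mat_def similar_mat_wit_def Let_def
    using W W2 A H by (intro exI[of _ "W\<^sup>T"] exI[of _ W]) (auto simp: A_def)
  then have "char_poly A = [:- e, 1:] * (\<Prod>a\<leftarrow>es. [:- a, 1:])"
    using Cons.prems(2) by (subst char_poly_similar) (auto simp del: mult_pCons_left)
  moreover have "char_poly A = char_poly E * char_poly A3"
    unfolding block by (rule char_poly_four_block_zeros_col[OF E _ A3]) simp
  moreover have "char_poly E = [:- e, 1:]"
    by (simp add: E_def char_poly_defs det_def sign_def)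
  ultimately have "char_poly A3 = (\<Prod>a\<leftarrow>es. [:- a, 1:])"
    by (metis mult_cancel_left pCons_eq_0_iff zero_neq_one)
  moreover have "symmetric_on m A3" using Asym n by (auto simp: symmetric_on_def A3_def)
  ultimately obtain Q where Q: "Q \<in> carrier_mat m m" "Q\<^sup>T * Q = 1\<^sub>m m"
      "Q\<^sup>T * A3 * Q = Matrix.mat m m (\<lambda>(i, j). if i = j then es ! i else 0)"
    using Cons.IH[of m A3] Cons.prems n by auto
  define R where "R = four_block_mat (1\<^sub>m 1) (0\<^sub>m 1 m) (0\<^sub>m m 1) Q"
  have R: "R \<in> carrier_mat n n" using Q n by (auto simp: R_def)
  have RT: "R\<^sup>T = four_block_mat (1\<^sub>m 1) (0\<^sub>m 1 m) (0\<^sub>m m 1) (Q\<^sup>T)"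
    unfolding R_def using Q by (subst transpose_four_block_mat[of _ 1 1 _ m _ m]) auto
  have RR: "R\<^sup>T * R = 1\<^sub>m n"
    unfolding RT unfolding R_def
    by (subst mult_four_block_mat[of _ 1 1 _ m _ m _ _ 1 _ m]) (use Q n in \<open>auto simp: four_block_one_mat\<close>)
  have "R\<^sup>T * A = four_block_mat E (0\<^sub>m 1 m) (0\<^sub>m m 1) (Q\<^sup>T * A3)"
    unfolding RT block
    by (subst mult_four_block_mat[of _ 1 1 _ m _ m _ _ 1 _ m]) (use Q E A3 in auto)
  then have "R\<^sup>T * A * R = four_block_mat E (0\<^sub>m 1 m) (0\<^sub>m m 1) (Q\<^sup>T * A3 * Q)"
    unfolding R_def
    by simp (subst mult_four_block_mat[of _ 1 1 _ m _ m _ _ 1 _ m], use Q E A3 in auto)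
  also have "\<dots> = Matrix.mat n n (\<lambda>(i, j). if i = j then (e # es) ! i else 0)"
    unfolding Q(3) by (rule eq_matI) (use n in \<open>auto simp: E_def nth_Cons'\<close>)
  finally have RAR: "R\<^sup>T * A * R = Matrix.mat n n (\<lambda>(i, j). if i = j then (e # es) ! i else 0)" .
  have tr: "(W * R)\<^sup>T = R\<^sup>T * W\<^sup>T" using W R by (subst transpose_mult) auto
  have "(W * R)\<^sup>T * (W * R) = R\<^sup>T * (W\<^sup>T * W) * R"
    unfolding tr using W(1) R by (simp add: assoc_mult_mat[of _ n n _ n _ n])
  also have "\<dots> = 1\<^sub>m n" using W R RR by simp
  finally have 1: "(W * R)\<^sup>T * (W * R) = 1\<^sub>m n" .
  have "(W * R)\<^sup>T * H * (W * R) = R\<^sup>T * A * R"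
    unfolding tr A_def using W(1) R H by (simp add: assoc_mult_mat[of _ n n _ n _ n])
  then show ?case using 1 RAR W R by (intro bexI[of _ "W * R"]) auto
qed

text \<open>Column \<open>k\<close> of \<open>P\<close> is a unit eigenvector for
  \<open>e k\<close>. Plain functions of indices reduce the later estimates to finite sums.\<close>

lemma symmetric_diagonalization:
  assumes H: "symmetric_on n H"
  obtains P :: "nat \<Rightarrow> nat \<Rightarrow> real" and e :: "nat \<Rightarrow> real" where
    "\<And>i j. i < n \<Longrightarrow> j < n \<Longrightarrow> (\<Sum>k<n. P k i * P k j) = (if i = j then 1 else 0)"
    "\<And>i j. i < n \<Longrightarrow> j < n \<Longrightarrow> H $$ (i, j) = (\<Sum>k<n. e k * P i k * P j k)"
    "num_neg_eigenvalues H = card {i. i < n \<and> e i < 0}"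
proof -
  have Hc: "H \<in> carrier_mat n n" using H by (simp add: symmetric_on_def)
  obtain es where es: "char_poly H = (\<Prod>a\<leftarrow>es. [:- a, 1:])" "length es = n"
    using char_poly_symmetric_splits[OF H] by blast
  obtain P where P: "P \<in> carrier_mat n n" "P\<^sup>T * P = 1\<^sub>m n"
      "P\<^sup>T * H * P = Matrix.mat n n (\<lambda>(i, j). if i = j then es ! i else 0)" (is "_ = ?D")
    using spectral_decomposition[OF H es] by blast
  have P2: "P * P\<^sup>T = 1\<^sub>m n" using mat_mult_left_right_inverse[of "P\<^sup>T" n P] P by auto
  have "P * ?D * P\<^sup>T = (P * P\<^sup>T) * H * (P * P\<^sup>T)"
    unfolding P(3)[symmetric] using P(1) Hc by (simp add: assoc_mult_mat[of _ n n _ n _ n])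
  then have HD: "H = P * ?D * P\<^sup>T" using P2 Hc by simp
  have "H $$ (i, j) = (\<Sum>k<n. es ! k * P $$ (i, k) * P $$ (j, k))" if "i < n" "j < n" for i j
  proof -
    have PD: "(P * ?D) $$ (i, k) = P $$ (i, k) * es ! k" if "k < n" for k
      using P(1) that \<open>i < n\<close> by (simp add: scalar_prod_def sum.delta if_distrib cong: if_cong)
    have "H $$ (i, j) = (\<Sum>k<n. (P * ?D) $$ (i, k) * P $$ (j, k))"
      by (subst HD) (use P(1) that in \<open>simp add: scalar_prod_def atLeast0LessThan\<close>)
    then show ?thesis by (simp add: PD mult_ac)
  qed
  moreover have "(\<Sum>k<n. P $$ (k, i) * P $$ (k, j)) = (if i = j then 1 else 0)" if "i < n" "j < n" for i j
    using arg_cong[OF P(2), of "\<lambda>M. M $$ (i, j)"] P(1) that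
    by (simp add: scalar_prod_def atLeast0LessThan)
  moreover have "num_neg_eigenvalues H = card {i. i < n \<and> es ! i < 0}"
    using num_neg_eigenvalues_prod_linear[OF Hc es(1)] es(2) by (simp add: length_filter_conv_card)
  ultimately show thesis using that[of "\<lambda>i j. P $$ (i, j)" "\<lambda>k. es ! k"] by simp
qed

text \<open>Sylvester's argument. If \<open>G\<close> had more negative eigenvalues, a nonzero
  combination of their eigenvectors would be mapped by \<open>C\<close> to a vector orthogonal to
  all negative eigenvectors of \<open>G'\<close>. The form is negative at the former and nonnegative
  at the latter, yet the two values agree.\<close>

lemma num_neg_eigenvalues_pullback:
  assumes G: "symmetric_on n G" and G': "symmetric_on n' G'"
    and C: "\<And>i j. i < n \<Longrightarrow> j < n \<Longrightarrow> G $$ (i, j) = (\<Sum>k<n'. \<Sum>l<n'. C i k * C j l * G' $$ (k, l))"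
  shows "num_neg_eigenvalues G \<le> num_neg_eigenvalues G'"
proof (rule ccontr)
  obtain P e where P: "\<And>i j. i < n \<Longrightarrow> j < n \<Longrightarrow> (\<Sum>k<n. P k i * P k j) = (if i = j then 1 else 0)"
    and e: "\<And>i j. i < n \<Longrightarrow> j < n \<Longrightarrow> G $$ (i, j) = (\<Sum>k<n. e k * P i k * P j k)"
    and ne: "num_neg_eigenvalues G = card {i. i < n \<and> e i < 0}"
    by (rule symmetric_diagonalization[OF G]) (rule that, assumption+)
  obtain P' e' where
        "\<And>i j. i < n' \<Longrightarrow> j < n' \<Longrightarrow> (\<Sum>k<n'. P' k i * P' k j) = (if i = j then 1 else 0)"
    and e': "\<And>i j. i < n' \<Longrightarrow> j < n' \<Longrightarrow> G' $$ (i, j) = (\<Sum>k<n'. e' k * P' i k * P' j k)"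
    and ne': "num_neg_eigenvalues G' = card {i. i < n' \<and> e' i < 0}"
    by (rule symmetric_diagonalization[OF G']) (rule that, assumption+)
  let ?N = "{i. i < n \<and> e i < 0}" and ?N' = "{i. i < n' \<and> e' i < 0}"
  \<comment> \<open>\<open>M m l\<close> is the component, along eigenvector \<open>l\<close> of
    \<open>G'\<close>, of the image of eigenvector \<open>m\<close> of \<open>G\<close>.\<close>
  define M where "M m l = (\<Sum>k<n'. P' k l * (\<Sum>i<n. C i k * P i m))" for m l
  assume "\<not> num_neg_eigenvalues G \<le> num_neg_eigenvalues G'"
  then have "card ?N' < card ?N" using ne ne' by simp
  then obtain a where a: "\<exists>m\<in>?N. a m \<noteq> 0" "\<And>l. l \<in> ?N' \<Longrightarrow> (\<Sum>m\<in>?N. a m * M m l) = 0"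
    using underdetermined_system[of ?N' ?N M] by auto
  define x where "x i = (\<Sum>m\<in>?N. P i m * a m)" for i
  define y where "y k = (\<Sum>i<n. C i k * x i)" for k
  \<comment> \<open>The quadratic form in the coordinates of an eigenbasis.\<close>
  have quad: "(\<Sum>i<d. \<Sum>j<d. (\<Sum>k<d. f k * Q i k * Q j k) * z i * z j)
      = (\<Sum>k<d. f k * (\<Sum>i<d. Q i k * z i)\<^sup>2)" for d f z and Q :: "nat \<Rightarrow> nat \<Rightarrow> real"
  proof -
    have "(\<Sum>i<d. \<Sum>j<d. (\<Sum>k<d. f k * Q i k * Q j k) * z i * z j)
        = (\<Sum>i<d. \<Sum>j<d. \<Sum>k<d. f k * Q i k * Q j k * z i * z j)"
      by (simp add: sum_distrib_right)
    also have "\<dots> = (\<Sum>i<d. \<Sum>k<d. \<Sum>j<d. f k * Q i k * Q j k * z i * z j)"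
      by (intro sum.cong refl sum.swap)
    also have "\<dots> = (\<Sum>k<d. \<Sum>i<d. \<Sum>j<d. f k * Q i k * Q j k * z i * z j)"
      by (rule sum.swap)
    also have "\<dots> = (\<Sum>k<d. f k * (\<Sum>i<d. Q i k * z i)\<^sup>2)"
      by (simp add: power2_eq_square sum_product sum_distrib_left mult_ac)
    finally show ?thesis .
  qed
  let ?q = "\<Sum>i<n. \<Sum>j<n. G $$ (i, j) * x i * x j"
  have "?q = (\<Sum>i<n. \<Sum>j<n. (\<Sum>k<n. e k * P i k * P j k) * x i * x j)"
    by (intro sum.cong refl) (simp add: e)
  also have "\<dots> = (\<Sum>k<n. e k * (\<Sum>i<n. P i k * x i)\<^sup>2)" by (rule quad)
  also have "\<dots> = (\<Sum>k<n. if e k < 0 then e k * (a k)\<^sup>2 else 0)"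
  proof (rule sum.cong[OF refl])
    fix k assume k: "k \<in> {..<n}"
    have "(\<Sum>i<n. P i k * x i) = (\<Sum>i<n. \<Sum>m\<in>?N. P i k * P i m * a m)"
      by (simp add: x_def sum_distrib_left mult.assoc)
    also have "\<dots> = (\<Sum>m\<in>?N. \<Sum>i<n. P i k * P i m * a m)" by (rule sum.swap)
    also have "\<dots> = (\<Sum>m\<in>?N. (if k = m then 1 else 0) * a m)"
      by (intro sum.cong refl) (use k in \<open>simp add: sum_distrib_right[symmetric] P\<close>)
    also have "\<dots> = (\<Sum>m\<in>?N. if m = k then a m else 0)"
      by (intro sum.cong) auto
    also have "\<dots> = (if e k < 0 then a k else 0)"
      using k by (subst sum.delta) auto
    finally show "e k * (\<Sum>i<n. P i k * x i)\<^sup>2 = (if e k < 0 then e k * (a k)\<^sup>2 else 0)" by simp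
  qed
  also have "\<dots> < 0"
  proof -
    obtain m where m: "m < n" "e m < 0" "a m \<noteq> 0" using a(1) by auto
    have "(\<Sum>k<n. if e k < 0 then e k * (a k)\<^sup>2 else 0) < (\<Sum>k<n. 0)"
    proof (rule sum_strict_mono_ex1)
      show "\<forall>k\<in>{..<n}. (if e k < 0 then e k * (a k)\<^sup>2 else 0) \<le> 0"
        by (auto simp: mult_nonpos_nonneg)
      show "\<exists>k\<in>{..<n}. (if e k < 0 then e k * (a k)\<^sup>2 else 0) < 0"
        using m by (intro bexI[of _ m]) (auto simp: mult_neg_pos)
    qed simp
    then show ?thesis by simp
  qed
  finally have neg: "?q < 0" .
  have "?q = (\<Sum>i<n. \<Sum>j<n. \<Sum>k<n'. \<Sum>l<n'. C i k * C j l * G' $$ (k, l) * x i * x j)"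
    by (intro sum.cong refl) (simp add: C sum_distrib_right)
  also have "\<dots> = (\<Sum>i<n. \<Sum>k<n'. \<Sum>j<n. \<Sum>l<n'. C i k * C j l * G' $$ (k, l) * x i * x j)"
    by (intro sum.cong refl sum.swap)
  also have "\<dots> = (\<Sum>k<n'. \<Sum>i<n. \<Sum>j<n. \<Sum>l<n'. C i k * C j l * G' $$ (k, l) * x i * x j)"
    by (rule sum.swap)
  also have "\<dots> = (\<Sum>k<n'. \<Sum>i<n. \<Sum>l<n'. \<Sum>j<n. C i k * C j l * G' $$ (k, l) * x i * x j)"
    by (intro sum.cong refl sum.swap)
  also have "\<dots> = (\<Sum>k<n'. \<Sum>l<n'. \<Sum>i<n. \<Sum>j<n. C i k * C j l * G' $$ (k, l) * x i * x j)"
    by (intro sum.cong refl sum.swap)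
  also have "\<dots> = (\<Sum>k<n'. \<Sum>l<n'. G' $$ (k, l) * y k * y l)"
    by (intro sum.cong refl) (simp add: y_def sum_product sum_distrib_left mult_ac)
  also have "\<dots> = (\<Sum>i<n'. \<Sum>j<n'. (\<Sum>k<n'. e' k * P' i k * P' j k) * y i * y j)"
    by (intro sum.cong refl) (simp add: e')
  also have "\<dots> = (\<Sum>k<n'. e' k * (\<Sum>i<n'. P' i k * y i)\<^sup>2)" by (rule quad)
  also have "\<dots> \<ge> 0"
  proof (rule sum_nonneg)
    fix l assume l: "l \<in> {..<n'}"
    show "0 \<le> e' l * (\<Sum>i<n'. P' i l * y i)\<^sup>2"
    proof (cases "e' l < 0")
      case True
      have "(\<Sum>m\<in>?N. a m * M m l) = (\<Sum>m\<in>?N. \<Sum>k<n'. \<Sum>i<n. P' k l * C i k * P i m * a m)"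
        unfolding M_def by (simp add: sum_distrib_left mult_ac)
      also have "\<dots> = (\<Sum>k<n'. \<Sum>m\<in>?N. \<Sum>i<n. P' k l * C i k * P i m * a m)" by (rule sum.swap)
      also have "\<dots> = (\<Sum>k<n'. \<Sum>i<n. \<Sum>m\<in>?N. P' k l * C i k * P i m * a m)"
        by (intro sum.cong refl sum.swap)
      also have "\<dots> = (\<Sum>i<n'. P' i l * y i)"
        by (simp add: y_def x_def sum_distrib_left mult_ac)
      finally show ?thesis using a(2)[of l] l True by simp
    qed simp
  qed
  finally show False using neg by simp
qed

lemma num_neg_eigenvalues_diag:
  "num_neg_eigenvalues (Matrix.mat n n (\<lambda>(i, j). if i = j then f i else 0)) = card {i. i < n \<and> f i < 0}"
    (is "num_neg_eigenvalues ?D = _")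
proof -
  have "char_poly ?D = (\<Prod>a\<leftarrow>diag_mat ?D. [:- a, 1:])"
    by (rule char_poly_upper_triangular[of _ n]) auto
  moreover have "diag_mat ?D = map f [0..<n]" by (auto simp: diag_mat_def)
  ultimately have "num_neg_eigenvalues ?D = length (filter (\<lambda>t. t < 0) (map f [0..<n]))"
    by (intro num_neg_eigenvalues_prod_linear[of _ n]) auto
  also have "\<dots> = card {i. i < n \<and> f i < 0}"
    by (simp add: length_filter_conv_card) (rule arg_cong[where f = card], auto)
  finally show ?thesis .
qed

lemma num_neg_eigenvalues_block:
  assumes G: "symmetric_on n G" and H: "symmetric_on m H"
  shows "num_neg_eigenvalues (four_block_mat G (0\<^sub>m n m) (0\<^sub>m m n) H)
    = num_neg_eigenvalues G + num_neg_eigenvalues H" (is "num_neg_eigenvalues ?B = _")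
proof -
  have Gc: "G \<in> carrier_mat n n" and Hc: "H \<in> carrier_mat m m" using G H by (auto simp: symmetric_on_def)
  obtain es where es: "char_poly G = (\<Prod>a\<leftarrow>es. [:- a, 1:])"
    using char_poly_symmetric_splits[OF G] by blast
  obtain fs where fs: "char_poly H = (\<Prod>a\<leftarrow>fs. [:- a, 1:])"
    using char_poly_symmetric_splits[OF H] by blast
  have "char_poly ?B = char_poly G * char_poly H"
    by (rule char_poly_0_block[OF refl]) (use es fs Gc Hc in auto)
  then have "char_poly ?B = (\<Prod>a\<leftarrow>es @ fs. [:- a, 1:])" by (simp add: es fs)
  then have "num_neg_eigenvalues ?B = length (filter (\<lambda>t. t < 0) (es @ fs))"
    by (rule num_neg_eigenvalues_prod_linear[rotated]) (use Gc Hc in auto)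
  then show ?thesis
    using num_neg_eigenvalues_prod_linear[OF Gc es] num_neg_eigenvalues_prod_linear[OF Hc fs] by simp
qed

section \<open>The index of a symmetric form on a set of vectors\<close>

text \<open>Only the values of the form matter below: the vectors of \<open>T\<close> are combined modulo
  the radical, so no vector space structure on \<open>T\<close> is needed.\<close>

definition gram :: "('a \<Rightarrow> 'a \<Rightarrow> real) \<Rightarrow> nat \<Rightarrow> (nat \<Rightarrow> 'a) \<Rightarrow> real mat" where
  "gram B d u = Matrix.mat d d (\<lambda>(i, j). B (u i) (u j))"

definition spans_form :: "('a \<Rightarrow> 'a \<Rightarrow> real) \<Rightarrow> 'a set \<Rightarrow> nat \<Rightarrow> (nat \<Rightarrow> 'a) \<Rightarrow> bool" where
  "spans_form B T d u \<longleftrightarrow>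
     (\<forall>i<d. u i \<in> T) \<and> (\<forall>v\<in>T. \<exists>c. \<forall>w\<in>T. B v w = (\<Sum>i<d. c i * B (u i) w))"

text \<open>A relation instead of a function: existence comes from a chart or a basis, uniqueness
  from \<open>has_index_unique\<close>, and the two are obtained in different places.\<close>

definition has_index :: "('a \<Rightarrow> 'a \<Rightarrow> real) \<Rightarrow> 'a set \<Rightarrow> nat \<Rightarrow> bool" where
  "has_index B T m \<longleftrightarrow> (\<exists>d u. spans_form B T d u \<and> m = num_neg_eigenvalues (gram B d u))"

lemma symmetric_on_gram:
  assumes "\<And>v w. v \<in> T \<Longrightarrow> w \<in> T \<Longrightarrow> B v w = B w v" "spans_form B T d u"
  shows "symmetric_on d (gram B d u)"
  using assms(2) by (auto simp: symmetric_on_def gram_def spans_form_def intro: assms(1))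

text \<open>The coefficients that express \<open>u\<close> through \<open>u'\<close> form a pullback
  matrix between the Gram matrices. The expansion is tested only against elements of
  \<open>T\<close>, so relations modulo the radical suffice.\<close>

lemma num_neg_eigenvalues_gram_le:
  assumes sym: "\<And>v w. v \<in> T \<Longrightarrow> w \<in> T \<Longrightarrow> B v w = B w v"
    and u: "spans_form B T d u" and u': "spans_form B T d' u'"
  shows "num_neg_eigenvalues (gram B d u) \<le> num_neg_eigenvalues (gram B d' u')"
proof -
  have uT: "u i \<in> T" if "i < d" for i using u that by (auto simp: spans_form_def)
  have u'T: "u' i \<in> T" if "i < d'" for i using u' that by (auto simp: spans_form_def)
  have "\<forall>i. \<exists>c. i < d \<longrightarrow> (\<forall>w\<in>T. B (u i) w = (\<Sum>k<d'. c k * B (u' k) w))"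
    using uT u' by (auto simp: spans_form_def)
  then obtain C where "\<forall>i. i < d \<longrightarrow> (\<forall>w\<in>T. B (u i) w = (\<Sum>k<d'. C i k * B (u' k) w))"
    by (metis (no_types))
  then have C: "B (u i) w = (\<Sum>k<d'. C i k * B (u' k) w)" if "i < d" "w \<in> T" for i w
    using that by blast
  show ?thesis
  proof (rule num_neg_eigenvalues_pullback[where C = C])
    fix i j assume ij: "i < d" "j < d"
    have "gram B d u $$ (i, j) = (\<Sum>k<d'. C i k * B (u' k) (u j))"
      using ij by (simp add: gram_def C uT)
    also have "\<dots> = (\<Sum>k<d'. C i k * (\<Sum>l<d'. C j l * B (u' k) (u' l)))"
    proof (intro sum.cong refl)
      fix k assume k: "k \<in> {..<d'}"
      have "B (u' k) (u j) = (\<Sum>l<d'. C j l * B (u' l) (u' k))"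
        using k ij by (subst sym) (auto simp: uT u'T C)
      also have "\<dots> = (\<Sum>l<d'. C j l * B (u' k) (u' l))"
        by (intro sum.cong refl arg_cong2[where f = "(*)"] sym u'T) (use k in auto)
      finally show "C i k * B (u' k) (u j) = C i k * (\<Sum>l<d'. C j l * B (u' k) (u' l))" by simp
    qed
    also have "\<dots> = (\<Sum>k<d'. \<Sum>l<d'. C i k * C j l * gram B d' u' $$ (k, l))"
      by (simp add: gram_def sum_distrib_left mult.assoc)
    finally show "gram B d u $$ (i, j) = (\<Sum>k<d'. \<Sum>l<d'. C i k * C j l * gram B d' u' $$ (k, l))" .
  qed (use symmetric_on_gram[OF sym u] symmetric_on_gram[OF sym u'] in auto)
qed

lemma has_index_unique:
  assumes sym: "\<And>v w. v \<in> T \<Longrightarrow> w \<in> T \<Longrightarrow> B v w = B w v"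
    and "has_index B T m" "has_index B T m'"
  shows "m = m'"
proof -
  obtain d u where u: "spans_form B T d u" "m = num_neg_eigenvalues (gram B d u)"
    using assms(2) by (auto simp: has_index_def)
  obtain d' u' where u': "spans_form B T d' u'" "m' = num_neg_eigenvalues (gram B d' u')"
    using assms(3) by (auto simp: has_index_def)
  have "m \<le> m'" unfolding u(2) u'(2) by (rule num_neg_eigenvalues_gram_le[OF sym u(1) u'(1)])
  moreover have "m' \<le> m" unfolding u(2) u'(2) by (rule num_neg_eigenvalues_gram_le[OF sym u'(1) u(1)])
  ultimately show ?thesis by simp
qed

text \<open>\<open>p1\<close>, \<open>p2\<close> act as projections and \<open>s1\<close>,
  \<open>s2\<close> as sections, with all identities required only up to the radicals of
  \<open>B1\<close> and \<open>B2\<close>. The sections of two spanning families, concatenated, have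
  a block diagonal Gram matrix.\<close>

lemma has_index_sum:
  assumes sym1: "\<And>v w. v \<in> T1 \<Longrightarrow> w \<in> T1 \<Longrightarrow> B1 v w = B1 w v"
    and sym2: "\<And>v w. v \<in> T2 \<Longrightarrow> w \<in> T2 \<Longrightarrow> B2 v w = B2 w v"
    and B: "\<And>v w. v \<in> T \<Longrightarrow> w \<in> T \<Longrightarrow> B v w = B1 (p1 v) (p1 w) + B2 (p2 v) (p2 w)"
    and p1: "\<And>v. v \<in> T \<Longrightarrow> p1 v \<in> T1" and p2: "\<And>v. v \<in> T \<Longrightarrow> p2 v \<in> T2"
    and s1: "\<And>v. v \<in> T1 \<Longrightarrow> s1 v \<in> T" and s2: "\<And>v. v \<in> T2 \<Longrightarrow> s2 v \<in> T"
    and s11: "\<And>v w. v \<in> T1 \<Longrightarrow> w \<in> T1 \<Longrightarrow> B1 (p1 (s1 v)) w = B1 v w"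
    and s12: "\<And>v w. v \<in> T1 \<Longrightarrow> w \<in> T2 \<Longrightarrow> B2 (p2 (s1 v)) w = 0"
    and s22: "\<And>v w. v \<in> T2 \<Longrightarrow> w \<in> T2 \<Longrightarrow> B2 (p2 (s2 v)) w = B2 v w"
    and s21: "\<And>v w. v \<in> T2 \<Longrightarrow> w \<in> T1 \<Longrightarrow> B1 (p1 (s2 v)) w = 0"
    and i1: "has_index B1 T1 m1" and i2: "has_index B2 T2 m2"
  shows "has_index B T (m1 + m2)"
proof -
  obtain d1 u1 where u1: "spans_form B1 T1 d1 u1" and m1: "m1 = num_neg_eigenvalues (gram B1 d1 u1)"
    using i1 by (auto simp: has_index_def)
  obtain d2 u2 where u2: "spans_form B2 T2 d2 u2" and m2: "m2 = num_neg_eigenvalues (gram B2 d2 u2)"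
    using i2 by (auto simp: has_index_def)
  have u1T: "u1 i \<in> T1" if "i < d1" for i using u1 that by (auto simp: spans_form_def)
  have u2T: "u2 i \<in> T2" if "i < d2" for i using u2 that by (auto simp: spans_form_def)
  define u where "u i = (if i < d1 then s1 (u1 i) else s2 (u2 (i - d1)))" for i
  have uT: "u i \<in> T" if "i < d1 + d2" for i using that by (cases "i < d1") (auto simp: u_def intro!: s1 s2 u1T u2T)
  have Bu1: "B (s1 v) w = B1 v (p1 w)" if "v \<in> T1" "w \<in> T" for v w
    using that by (simp add: B s1 s11 s12 p1 p2)
  have Bu2: "B (s2 v) w = B2 v (p2 w)" if "v \<in> T2" "w \<in> T" for v w
    using that by (simp add: B s2 s22 s21 p1 p2)
  have split: "(\<Sum>i<d1 + d2. f i) = (\<Sum>i<d1. f i) + (\<Sum>i<d2. f (d1 + i))" for f :: "nat \<Rightarrow> real"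
    using sum.atLeastLessThan_concat[of 0 d1 "d1 + d2" f] sum.shift_bounds_nat_ivl[of f 0 d1 d2]
    by (simp add: atLeast0LessThan add.commute)
  have "spans_form B T (d1 + d2) u"
    unfolding spans_form_def
  proof (intro conjI allI impI ballI uT)
    fix v assume v: "v \<in> T"
    obtain c1 where c1: "\<forall>w\<in>T1. B1 (p1 v) w = (\<Sum>i<d1. c1 i * B1 (u1 i) w)"
      using u1 p1[OF v] unfolding spans_form_def by blast
    obtain c2 where c2: "\<forall>w\<in>T2. B2 (p2 v) w = (\<Sum>i<d2. c2 i * B2 (u2 i) w)"
      using u2 p2[OF v] unfolding spans_form_def by blast
    show "\<exists>c. \<forall>w\<in>T. B v w = (\<Sum>i<d1 + d2. c i * B (u i) w)"
    proof (intro exI ballI)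
      fix w assume w: "w \<in> T"
      show "B v w = (\<Sum>i<d1 + d2. (if i < d1 then c1 i else c2 (i - d1)) * B (u i) w)"
        unfolding split using v w c1 c2 by (simp add: B[OF v w] u_def Bu1 Bu2 u1T u2T p1 p2)
    qed
  qed
  moreover have "gram B (d1 + d2) u
      = four_block_mat (gram B1 d1 u1) (0\<^sub>m d1 d2) (0\<^sub>m d2 d1) (gram B2 d2 u2)"
  proof (rule eq_matI)
    fix i j assume "i < dim_row (four_block_mat (gram B1 d1 u1) (0\<^sub>m d1 d2) (0\<^sub>m d2 d1) (gram B2 d2 u2))"
      "j < dim_col (four_block_mat (gram B1 d1 u1) (0\<^sub>m d1 d2) (0\<^sub>m d2 d1) (gram B2 d2 u2))"
    then have ij: "i < d1 + d2" "j < d1 + d2" by (auto simp: gram_def)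
    have 11: "B (s1 v) (s1 w) = B1 v w" if "v \<in> T1" "w \<in> T1" for v w
      using that by (simp add: Bu1 s1 sym1[of v] p1 s11)
    have 22: "B (s2 v) (s2 w) = B2 v w" if "v \<in> T2" "w \<in> T2" for v w
      using that by (simp add: Bu2 s2 sym2[of v] p2 s22)
    have 12: "B (s1 v) (s2 w) = 0" if "v \<in> T1" "w \<in> T2" for v w
      using that by (simp add: Bu1 s2 sym1[of v] p1 s21)
    have 21: "B (s2 v) (s1 w) = 0" if "v \<in> T2" "w \<in> T1" for v w
      using that by (simp add: Bu2 s1 sym2[of v] p2 s12)
    show "gram B (d1 + d2) u $$ (i, j)
        = four_block_mat (gram B1 d1 u1) (0\<^sub>m d1 d2) (0\<^sub>m d2 d1) (gram B2 d2 u2) $$ (i, j)"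
      using ij by (auto simp: gram_def u_def 11 22 12 21 u1T u2T)
  qed (auto simp: gram_def)
  moreover have "num_neg_eigenvalues (four_block_mat (gram B1 d1 u1) (0\<^sub>m d1 d2) (0\<^sub>m d2 d1) (gram B2 d2 u2))
      = m1 + m2"
    unfolding m1 m2 by (rule num_neg_eigenvalues_block) (auto intro: symmetric_on_gram sym1 sym2 u1 u2)
  ultimately show ?thesis unfolding has_index_def
    by (intro exI[of _ "d1 + d2"] exI[of _ u] conjI) simp_all
qed

lemma has_index_diagonal:
  fixes f :: "nat \<Rightarrow> real"
  shows "has_index (\<lambda>y y'. \<Sum>e<r. f e * y e * y' e) UNIV (card {e. e < r \<and> f e < 0})"
proof -
  let ?B = "\<lambda>y y'. \<Sum>e<r. f e * y e * y' e" and ?u = "\<lambda>i e. if e = i then 1 else (0::real)"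
  have Bu: "?B (?u i) w = f i * w i" if "i < r" for i w
  proof -
    have "?B (?u i) w = (\<Sum>e<r. if e = i then f e * w e else 0)" by (intro sum.cong) auto
    then show ?thesis using that by simp
  qed
  have "spans_form ?B UNIV r ?u"
    unfolding spans_form_def
  proof (intro conjI ballI)
    fix v :: "nat \<Rightarrow> real"
    show "\<exists>c. \<forall>w\<in>UNIV. ?B v w = (\<Sum>i<r. c i * ?B (?u i) w)"
      by (intro exI[of _ v] ballI sum.cong refl) (subst Bu, auto)
  qed simp
  moreover have "gram ?B r ?u = Matrix.mat r r (\<lambda>(i, j). if i = j then f i else 0)"
    unfolding gram_def by (rule cong_mat) (auto simp: Bu)
  ultimately show ?thesis unfolding has_index_def
    by (intro exI[of _ r] exI[of _ ?u] conjI) (simp_all add: num_neg_eigenvalues_diag)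
qed

section \<open>Euclidean spaces of functions on the naturals\<close>

lemma Euclidean_space_top_of_set: "Euclidean_space n = top_of_set {x. \<forall>i\<ge>n. x i = 0}"
  by (simp add: Euclidean_space_def euclidean_product_topology)

lemma continuous_map_Euclidean_subspace:
  "U \<subseteq> topspace (Euclidean_space n) \<Longrightarrow>
     continuous_map (subtopology (Euclidean_space n) U) euclidean f \<longleftrightarrow> continuous_on U f"
  by (simp add: Euclidean_space_top_of_set subtopology_subtopology inf.absorb2)

text \<open>A basic open set of the product topology leaves room around each coordinate of
  \<open>x\<close>. The coordinates from \<open>d\<close> on are 0 anyway, so the least of finitely
  many radii works.\<close>

lemma openin_Euclidean_box:
  assumes "openin (Euclidean_space d) U" "x \<in> U"
  shows "\<exists>\<delta>>0. \<forall>y. (\<forall>i<d. \<bar>y i - x i\<bar> < \<delta>) \<and> (\<forall>i\<ge>d. y i = 0) \<longrightarrow> y \<in> U"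
proof -
  obtain V where V: "open V" "U = {x. \<forall>i\<ge>d. x i = 0} \<inter> V"
    using assms(1) unfolding Euclidean_space_top_of_set openin_open by auto
  have "openin (product_topology (\<lambda>_. euclideanreal) UNIV) V"
    using V(1) by (simp add: euclidean_product_topology)
  then obtain X where X: "finite {i. X i \<noteq> UNIV}" "\<And>i. open (X i)" "x \<in> Pi\<^sub>E UNIV X" "Pi\<^sub>E UNIV X \<subseteq> V"
    using assms(2) V(2) unfolding openin_product_topology_alt by auto
  have "\<forall>i. \<exists>e>0. \<forall>t. \<bar>t - x i\<bar> < e \<longrightarrow> t \<in> X i"
    using X(2,3) by (auto simp: open_real PiE_iff)
  then obtain e where e: "\<And>i. e i > 0" "\<And>i t. \<bar>t - x i\<bar> < e i \<Longrightarrow> t \<in> X i" by metis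
  \<comment> \<open>Inserting 1 keeps the minimum meaningful for \<open>d = 0\<close>.\<close>
  define \<delta> where "\<delta> = Min (insert 1 (e ` {..<d}))"
  have "\<delta> > 0" unfolding \<delta>_def using e(1) by (subst Min_gr_iff) auto
  moreover have "y \<in> U" if "\<forall>i<d. \<bar>y i - x i\<bar> < \<delta>" "\<forall>i\<ge>d. y i = 0" for y
  proof -
    have "y i \<in> X i" for i
    proof (cases "i < d")
      case True
      then have "\<delta> \<le> e i" unfolding \<delta>_def by (intro Min_le) auto
      then show ?thesis using e(2) that(1) True by fastforce
    next
      case False
      then have "y i = x i" using that(2) assms(2) V(2) by auto
      then show ?thesis using X(3) by (auto simp: PiE_iff)
    qed
    then show ?thesis using X(4) V(2) that(2) by (auto simp: PiE_iff)
  qed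
  ultimately show ?thesis by blast
qed

lemma eventually_fun_upd_in_open:
  assumes "openin (Euclidean_space d) U" "x \<in> U" "i < d"
  shows "\<forall>\<^sub>F t in nhds (x i). x(i := t) \<in> U"
proof -
  obtain \<delta> where \<delta>: "\<delta> > 0" "\<And>y. (\<forall>i<d. \<bar>y i - x i\<bar> < \<delta>) \<and> (\<forall>i\<ge>d. y i = 0) \<Longrightarrow> y \<in> U"
    using openin_Euclidean_box[OF assms(1,2)] by blast
  have "x \<in> topspace (Euclidean_space d)" using assms openin_subset by blast
  then have "x(i := t) \<in> U" if "\<bar>t - x i\<bar> < \<delta>" for t
    using that \<delta> assms(3) by (intro \<delta>(2)) (auto simp: topspace_Euclidean_space)
  then show ?thesis using \<delta>(1) by (auto simp: eventually_nhds_metric dist_real_def)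
qed

lemma continuous_map_Euclidean_box:
  assumes "continuous_map (subtopology (Euclidean_space d) U) euclideanreal f"
    "openin (Euclidean_space d) U" "x \<in> U" "e > 0"
  shows "\<exists>\<delta>>0. \<forall>y. (\<forall>i<d. \<bar>y i - x i\<bar> < \<delta>) \<and> (\<forall>i\<ge>d. y i = 0) \<longrightarrow> y \<in> U \<and> \<bar>f y - f x\<bar> < e"
proof -
  have sub: "U \<subseteq> topspace (Euclidean_space d)" using assms(2) openin_subset by blast
  have "openin (subtopology (Euclidean_space d) U) {y \<in> U. f y \<in> ball (f x) e}"
    using openin_continuous_map_preimage[OF assms(1), of "ball (f x) e"] sub
    by (simp add: inf.absorb2)
  then have "openin (Euclidean_space d) {y \<in> U. f y \<in> ball (f x) e}"
    using assms(2) openin_trans_full by blast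
  from openin_Euclidean_box[OF this, of x] show ?thesis
    using assms(3,4) by (auto simp: dist_real_def abs_minus_commute)
qed

text \<open>\<open>C_on\<close> supplies continuous partial derivatives only. A path that moves one
  coordinate at a time, with the mean value theorem on each piece, turns them into a first-order
  expansion.\<close>

lemma C1_first_order:
  assumes f: "C_on 1 d U f" and U: "openin (Euclidean_space d) U" "x \<in> U" and e: "e > 0"
  shows "\<exists>\<delta>>0. \<forall>y. (\<forall>i<d. \<bar>y i - x i\<bar> < \<delta>) \<and> (\<forall>i\<ge>d. y i = 0) \<longrightarrow>
    \<bar>f y - f x - (\<Sum>i<d. (y i - x i) * pderiv_at i f x)\<bar> \<le> e * (\<Sum>i<d. \<bar>y i - x i\<bar>)"
proof -
  have diff: "\<And>i y. i < d \<Longrightarrow> y \<in> U \<Longrightarrow> (\<lambda>t. f (y(i := t))) differentiable at (y i)"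
    and cont: "\<And>i. i < d \<Longrightarrow> continuous_map (subtopology (Euclidean_space d) U) euclideanreal (pderiv_at i f)"
    using f by (auto simp: One_nat_def)
  have "\<forall>i. \<exists>\<delta>>0. i < d \<longrightarrow> (\<forall>y. (\<forall>j<d. \<bar>y j - x j\<bar> < \<delta>) \<and> (\<forall>j\<ge>d. y j = 0) \<longrightarrow>
      y \<in> U \<and> \<bar>pderiv_at i f y - pderiv_at i f x\<bar> < e)"
  proof
    fix i
    show "\<exists>\<delta>>0. i < d \<longrightarrow> (\<forall>y. (\<forall>j<d. \<bar>y j - x j\<bar> < \<delta>) \<and> (\<forall>j\<ge>d. y j = 0) \<longrightarrow>
      y \<in> U \<and> \<bar>pderiv_at i f y - pderiv_at i f x\<bar> < e)"
    proof (cases "i < d")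
      case True
      show ?thesis using continuous_map_Euclidean_box[OF cont[OF True] U e] by blast
    qed (auto intro: exI[of _ 1])
  qed
  then obtain D where D: "\<And>i. D i > 0"
     "\<And>i y. i < d \<Longrightarrow> (\<forall>j<d. \<bar>y j - x j\<bar> < D i) \<Longrightarrow> (\<forall>j\<ge>d. y j = 0) \<Longrightarrow>
      y \<in> U \<and> \<bar>pderiv_at i f y - pderiv_at i f x\<bar> < e" by metis
  define \<delta> where "\<delta> = Min (insert 1 (D ` {..<d}))"
  have \<delta>: "\<delta> > 0" unfolding \<delta>_def using D(1) by (subst Min_gr_iff) auto
  have \<delta>D: "\<delta> \<le> D i" if "i < d" for i unfolding \<delta>_def using that by (intro Min_le) auto
  have x0: "x j = 0" if "j \<ge> d" for j
    using U openin_subset that by (fastforce simp: topspace_Euclidean_space)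
  have "\<bar>f y - f x - (\<Sum>i<d. (y i - x i) * pderiv_at i f x)\<bar> \<le> e * (\<Sum>i<d. \<bar>y i - x i\<bar>)"
    if y: "\<forall>i<d. \<bar>y i - x i\<bar> < \<delta>" "\<forall>i\<ge>d. y i = 0" for y
  proof -
    \<comment> \<open>The corners of the path: the first \<open>k\<close> coordinates already have
      their new values.\<close>
    define Y where "Y k = (\<lambda>i. if i < k then y i else x i)" for k
    have Y0: "Y 0 = x" and Yd: "Y d = y" using y x0 by (auto simp: Y_def fun_eq_iff)
    have step: "\<bar>f (Y (Suc k)) - f (Y k) - (y k - x k) * pderiv_at k f x\<bar> \<le> e * \<bar>y k - x k\<bar>"
      if k: "k < d" for k
    proof -
      have box: "(Y k)(k := t) \<in> U \<and> \<bar>pderiv_at k f ((Y k)(k := t)) - pderiv_at k f x\<bar> < e"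
        if t: "\<bar>t - x k\<bar> < \<delta>" for t
      proof (rule D(2)[OF k]; intro allI impI)
        fix j assume j: "j < d"
        have "\<bar>((Y k)(k := t)) j - x j\<bar> < \<delta>"
          using t y(1) j \<delta> by (simp add: Y_def)
        then show "\<bar>((Y k)(k := t)) j - x j\<bar> < D k" using \<delta>D[OF k] by simp
      next
        fix j assume "j \<ge> d"
        then show "((Y k)(k := t)) j = 0" using k x0 by (simp add: Y_def)
      qed
      have der: "((\<lambda>t. f ((Y k)(k := t))) has_real_derivative pderiv_at k f ((Y k)(k := t))) (at t)"
        if "\<bar>t - x k\<bar> < \<delta>" for t
        using diff[OF k, of "(Y k)(k := t)"] box[OF that]
        by (simp add: pderiv_at_def DERIV_deriv_iff_real_differentiable)
      have Ys: "Y (Suc k) = (Y k)(k := y k)" and Yk: "(Y k)(k := x k) = Y k"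
        by (auto simp: Y_def fun_eq_iff less_Suc_eq)
      have "\<exists>t. \<bar>t - x k\<bar> < \<delta> \<and> f (Y (Suc k)) - f (Y k) = (y k - x k) * pderiv_at k f ((Y k)(k := t))"
      proof (cases "x k" "y k" rule: linorder_cases)
        case less
        obtain t where t: "x k < t" "t < y k"
          "f ((Y k)(k := y k)) - f ((Y k)(k := x k)) = (y k - x k) * pderiv_at k f ((Y k)(k := t))"
          using MVT2[OF less, of "\<lambda>t. f ((Y k)(k := t))" "\<lambda>t. pderiv_at k f ((Y k)(k := t))"] der y k
          by (smt (verit, best))
        then show ?thesis using y k unfolding Ys Yk by (intro exI[of _ t]) (auto simp: abs_if split: if_splits)
      next
        case equal
        then show ?thesis using \<delta> by (intro exI[of _ "x k"]) (auto simp: Ys Yk simp flip: equal)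
      next
        case greater
        obtain t where t: "y k < t" "t < x k"
          "f ((Y k)(k := x k)) - f ((Y k)(k := y k)) = (x k - y k) * pderiv_at k f ((Y k)(k := t))"
          using MVT2[OF greater, of "\<lambda>t. f ((Y k)(k := t))" "\<lambda>t. pderiv_at k f ((Y k)(k := t))"] der y k
          by (smt (verit, best))
        have "\<bar>t - x k\<bar> < \<delta>" using t(1,2) y k by force
        then show ?thesis using t(3) unfolding Ys Yk by (intro exI[of _ t]) (simp add: algebra_simps)
      qed
      then obtain t where t: "\<bar>t - x k\<bar> < \<delta>"
        "f (Y (Suc k)) - f (Y k) = (y k - x k) * pderiv_at k f ((Y k)(k := t))" by blast
      have "\<bar>f (Y (Suc k)) - f (Y k) - (y k - x k) * pderiv_at k f x\<bar>
          = \<bar>pderiv_at k f ((Y k)(k := t)) - pderiv_at k f x\<bar> * \<bar>y k - x k\<bar>"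
        unfolding t(2) by (simp add: abs_mult[symmetric] algebra_simps)
      also have "\<dots> \<le> e * \<bar>y k - x k\<bar>" using box[OF t(1)] by (intro mult_right_mono) auto
      finally show ?thesis .
    qed
    have "f y - f x = (\<Sum>k<d. f (Y (Suc k)) - f (Y k))"
      by (subst sum_lessThan_telescope) (simp add: Y0 Yd)
    then have "\<bar>f y - f x - (\<Sum>i<d. (y i - x i) * pderiv_at i f x)\<bar>
        = \<bar>\<Sum>k<d. f (Y (Suc k)) - f (Y k) - (y k - x k) * pderiv_at k f x\<bar>"
      by (simp add: sum_subtractf)
    also have "\<dots> \<le> (\<Sum>k<d. e * \<bar>y k - x k\<bar>)"
      by (rule order_trans[OF sum_abs sum_mono]) (use step in auto)
    finally show ?thesis by (simp add: sum_distrib_left)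
  qed
  then show ?thesis using \<delta> by blast
qed

text \<open>Bolzano-Weierstrass, with one refinement per index.\<close>

lemma common_convergent_subsequence:
  fixes f :: "'i \<Rightarrow> nat \<Rightarrow> complex"
  assumes "finite I" "\<And>i. i \<in> I \<Longrightarrow> bounded (range (f i))"
  shows "\<exists>r l. strict_mono (r :: nat \<Rightarrow> nat) \<and> (\<forall>i\<in>I. (f i \<circ> r) \<longlonglongrightarrow> l i)"
  using assms
proof (induction I rule: finite_induct)
  case empty
  show ?case by (intro exI[of _ id]) (simp add: strict_mono_def)
next
  case (insert a I)
  obtain r l where r: "strict_mono r" "\<And>i. i \<in> I \<Longrightarrow> (f i \<circ> r) \<longlonglongrightarrow> l i"
    using insert.IH insert.prems by (metis insertCI)
  have "bounded (range (f a \<circ> r))"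
    by (rule bounded_subset[OF insert.prems[of a]]) auto
  then obtain q k where q: "strict_mono q" "((f a \<circ> r) \<circ> q) \<longlonglongrightarrow> k"
    using bounded_imp_convergent_subsequence by blast
  have "(f i \<circ> (r \<circ> q)) \<longlonglongrightarrow> (l(a := k)) i" if "i \<in> insert a I" for i
  proof (cases "i = a")
    case True
    then show ?thesis using q(2) by (simp add: comp_assoc)
  next
    case False
    then have "i \<in> I" using that by simp
    from LIMSEQ_subseq_LIMSEQ[OF r(2)[OF this] q(1)] False show ?thesis by (simp add: comp_assoc)
  qed
  then show ?case using strict_mono_o[OF r(1) q(1)] by blast
qed

section \<open>Invariant quadratic functions on configurations\<close>

text \<open>What the Hessian computation needs to know about a quadratic form. The Leibniz rule is
  demanded along vertexwise differentiable curves, so no topology on the space of motions is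
  involved. Linearity in the second argument follows by symmetry.\<close>

definition plane_form :: "'v set \<Rightarrow> (('v \<Rightarrow> complex) \<Rightarrow> ('v \<Rightarrow> complex) \<Rightarrow> real) \<Rightarrow> bool" where
  "plane_form V B \<longleftrightarrow>
     (\<forall>v w. B v w = B w v) \<and>
     (\<forall>v v' w. (\<forall>a\<in>V. v a = v' a) \<longrightarrow> B v w = B v' w) \<and>
     (\<forall>x v v' w. B (\<lambda>a. of_real x * v a + v' a) w = x * B v w + B v' w) \<and>
     (\<forall>b w. B (\<lambda>_. b) w = 0) \<and>
     (\<forall>c v w. norm c = 1 \<longrightarrow> B (\<lambda>a. c * v a) (\<lambda>a. c * w a) = B v w) \<and>
     (\<forall>f g f' g' t. (\<forall>a\<in>V. ((\<lambda>s. f s a) has_vector_derivative f' a) (at t)) \<longrightarrow>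
        (\<forall>a\<in>V. ((\<lambda>s. g s a) has_vector_derivative g' a) (at t)) \<longrightarrow>
        ((\<lambda>s. B (f s) (g s)) has_real_derivative B f' (g t) + B (f t) g') (at t))"

lemma plane_formD:
  assumes "plane_form V B"
  shows plane_form_sym: "B v w = B w v"
    and plane_form_cong: "(\<And>a. a \<in> V \<Longrightarrow> v a = v' a) \<Longrightarrow> B v w = B v' w"
    and plane_form_lin: "B (\<lambda>a. of_real x * v a + v' a) w = x * B v w + B v' w"
    and plane_form_const: "B (\<lambda>_. b) w = 0"
    and plane_form_rot: "norm c = 1 \<Longrightarrow> B (\<lambda>a. c * v a) (\<lambda>a. c * w a) = B v w"
    and plane_form_deriv: "(\<And>a. a \<in> V \<Longrightarrow> ((\<lambda>s. f s a) has_vector_derivative f' a) (at t)) \<Longrightarrow>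
        (\<And>a. a \<in> V \<Longrightarrow> ((\<lambda>s. g s a) has_vector_derivative g' a) (at t)) \<Longrightarrow>
        ((\<lambda>s. B (f s) (g s)) has_real_derivative B f' (g t) + B (f t) g') (at t)"
proof -
  note P = assms[unfolded plane_form_def]
  note P1 = P[THEN conjunct2] note P2 = P1[THEN conjunct2] note P3 = P2[THEN conjunct2]
  note P4 = P3[THEN conjunct2]
  show "B v w = B w v" by (rule P[THEN conjunct1, rule_format])
  show "B v w = B v' w" if "\<And>a. a \<in> V \<Longrightarrow> v a = v' a"
    by (rule P1[THEN conjunct1, rule_format]) (rule that)
  show "B (\<lambda>a. of_real x * v a + v' a) w = x * B v w + B v' w"
    by (rule P2[THEN conjunct1, rule_format])
  show "B (\<lambda>_. b) w = 0" by (rule P3[THEN conjunct1, rule_format])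
  show "B (\<lambda>a. c * v a) (\<lambda>a. c * w a) = B v w" if "norm c = 1"
    by (rule P4[THEN conjunct1, rule_format]) (rule that)
  show "((\<lambda>s. B (f s) (g s)) has_real_derivative B f' (g t) + B (f t) g') (at t)"
    if "\<And>a. a \<in> V \<Longrightarrow> ((\<lambda>s. f s a) has_vector_derivative f' a) (at t)"
      "\<And>a. a \<in> V \<Longrightarrow> ((\<lambda>s. g s a) has_vector_derivative g' a) (at t)"
    by (rule P4[THEN conjunct2, rule_format]) (rule that, assumption)+
qed

lemma plane_form_add:
  assumes "plane_form V B" shows "B (\<lambda>a. v a + v' a) w = B v w + B v' w"
  using plane_form_lin[OF assms, of 1 v v' w] by simp

lemma plane_form_lincomb:
  fixes d :: nat
  assumes "plane_form V B"
  shows "B (\<lambda>a. \<Sum>i<d. of_real (h i) * u i a) w = (\<Sum>i<d. h i * B (u i) w)"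
proof (induction d)
  case 0
  then show ?case using plane_form_const[OF assms, of 0] by simp
next
  case (Suc d)
  have "B (\<lambda>a. \<Sum>i<Suc d. of_real (h i) * u i a) w
      = B (\<lambda>a. of_real (h d) * u d a + (\<Sum>i<d. of_real (h i) * u i a)) w"
    by (simp add: add.commute)
  then show ?case by (simp add: plane_form_lin[OF assms] Suc)
qed

text \<open>Rotation invariance moves the factor \<i> to the other argument as -\<i>, where
  criticality of \<open>P\<close> kills it. So infinitesimal rigid motions lie in the
  radical.\<close>

lemma plane_form_rigid:
  assumes B: "plane_form V B" and crit: "\<And>w. B P w = 0"
    and v: "\<And>a. a \<in> V \<Longrightarrow> v a = \<i> * of_real s * P a + b"
  shows "B v w = 0"
proof -
  have "B v w = B (\<lambda>a. of_real s * (\<i> * P a) + b) w"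
    by (rule plane_form_cong[OF B]) (simp add: v mult_ac)
  also have "\<dots> = s * B (\<lambda>a. \<i> * P a) w"
    using plane_form_lin[OF B, of s "\<lambda>a. \<i> * P a" "\<lambda>_. b" w] plane_form_const[OF B, of b w] by simp
  also have "B (\<lambda>a. \<i> * P a) w = B (\<lambda>a. \<i> * P a) (\<lambda>a. \<i> * (- \<i> * w a))"
    by (simp add: mult.assoc[symmetric])
  also have "\<dots> = 0" by (subst plane_form_rot[OF B]) (simp_all add: crit)
  finally show ?thesis by simp
qed

text \<open>The building block of all forms below: \<open>k = - \<i> / 2\<close> yields a
  symmetrized cross product and \<open>k = 1 / 2\<close> an inner product. Differences of vertices
  give translation invariance, and the conjugate in one factor gives rotation invariance.\<close>

lemma plane_form_basic:
  assumes "a \<in> V" "b \<in> V" "c \<in> V" "d \<in> V"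
  shows "plane_form V (\<lambda>v w. Re (k * cnj (v a - v b) * (w c - w d)) + Re (k * cnj (w a - w b) * (v c - v d)))"
  unfolding plane_form_def
proof (intro conjI allI impI)
  fix v v' w :: "'a \<Rightarrow> complex" assume "\<forall>a\<in>V. v a = v' a"
  then show "Re (k * cnj (v a - v b) * (w c - w d)) + Re (k * cnj (w a - w b) * (v c - v d))
    = Re (k * cnj (v' a - v' b) * (w c - w d)) + Re (k * cnj (w a - w b) * (v' c - v' d))"
    using assms by simp
next
  fix z :: complex and v w :: "'a \<Rightarrow> complex" assume z: "norm z = 1"
  have "cnj z * z = 1" using z by (simp add: complex_norm_square[symmetric] mult.commute)
  then have *: "k * cnj (z * p - z * q) * (z * r - z * s) = k * cnj (p - q) * (r - s)" for p q r s
  proof -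
    have "k * cnj (z * p - z * q) * (z * r - z * s) = k * (cnj z * z) * cnj (p - q) * (r - s)"
      by (simp add: algebra_simps)
    then show ?thesis using \<open>cnj z * z = 1\<close> by simp
  qed
  show "Re (k * cnj (z * v a - z * v b) * (z * w c - z * w d)) + Re (k * cnj (z * w a - z * w b) * (z * v c - z * v d))
    = Re (k * cnj (v a - v b) * (w c - w d)) + Re (k * cnj (w a - w b) * (v c - v d))"
    unfolding * ..
next
  fix f g :: "real \<Rightarrow> 'a \<Rightarrow> complex" and f' g' t
  assume f: "\<forall>a\<in>V. ((\<lambda>s. f s a) has_vector_derivative f' a) (at t)"
    and g: "\<forall>a\<in>V. ((\<lambda>s. g s a) has_vector_derivative g' a) (at t)"
  have der: "((\<lambda>s. Re (k * cnj (p s) * q s)) has_real_derivative Re (k * cnj p' * q t) + Re (k * cnj (p t) * q')) (at t)"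
    if p: "(p has_vector_derivative p') (at t)" and q: "(q has_vector_derivative q') (at t)"
    for p q :: "real \<Rightarrow> complex" and p' q'
  proof -
    have "((\<lambda>s. k * cnj (p s) * q s) has_vector_derivative k * cnj (p t) * q' + k * cnj p' * q t) (at t)"
      by (rule has_vector_derivative_mult[OF _ q])
        (intro has_vector_derivative_mult_right has_vector_derivative_cnj p)
    then have "((\<lambda>s. Re (k * cnj (p s) * q s)) has_vector_derivative Re (k * cnj (p t) * q' + k * cnj p' * q t)) (at t)"
      by (rule bounded_linear.has_vector_derivative[OF bounded_linear_Re])
    then show ?thesis by (simp add: has_real_derivative_iff_has_vector_derivative add.commute)
  qed
  have df: "((\<lambda>s. f s x - f s y) has_vector_derivative f' x - f' y) (at t)" if "x \<in> V" "y \<in> V" for x y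
    using f that by (intro has_vector_derivative_diff) auto
  have dg: "((\<lambda>s. g s x - g s y) has_vector_derivative g' x - g' y) (at t)" if "x \<in> V" "y \<in> V" for x y
    using g that by (intro has_vector_derivative_diff) auto
  show "((\<lambda>s. Re (k * cnj (f s a - f s b) * (g s c - g s d)) + Re (k * cnj (g s a - g s b) * (f s c - f s d)))
     has_real_derivative
       (Re (k * cnj (f' a - f' b) * (g t c - g t d)) + Re (k * cnj (g t a - g t b) * (f' c - f' d))) +
       (Re (k * cnj (f t a - f t b) * (g' c - g' d)) + Re (k * cnj (g' a - g' b) * (f t c - f t d)))) (at t)"
    by (rule DERIV_cong[OF DERIV_add[OF der[OF df dg] der[OF dg df]]]) (use assms in simp_all)
qed (simp_all add: algebra_simps)

lemma plane_form_plus: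
  assumes B: "plane_form V B" and B': "plane_form V B'"
  shows "plane_form V (\<lambda>v w. B v w + B' v w)"
  unfolding plane_form_def
proof (intro conjI allI impI)
  fix v w show "B v w + B' v w = B w v + B' w v"
    by (simp only: plane_form_sym[OF B, of v] plane_form_sym[OF B', of v])
next
  fix v v' w :: "'a \<Rightarrow> complex" assume "\<forall>a\<in>V. v a = v' a"
  then show "B v w + B' v w = B v' w + B' v' w"
    using plane_form_cong[OF B, of v v' w] plane_form_cong[OF B', of v v' w] by simp
next
  fix f g :: "real \<Rightarrow> 'a \<Rightarrow> complex" and f' g' t
  assume f: "\<forall>a\<in>V. ((\<lambda>s. f s a) has_vector_derivative f' a) (at t)"
    and g: "\<forall>a\<in>V. ((\<lambda>s. g s a) has_vector_derivative g' a) (at t)"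
  show "((\<lambda>s. B (f s) (g s) + B' (f s) (g s)) has_real_derivative
      B f' (g t) + B' f' (g t) + (B (f t) g' + B' (f t) g')) (at t)"
    by (rule DERIV_cong[OF DERIV_add[OF plane_form_deriv[OF B, of f f' t g g'] plane_form_deriv[OF B', of f f' t g g']]])
      (use f g in auto)
qed (simp_all add: plane_form_lin[OF B] plane_form_lin[OF B'] plane_form_const[OF B] plane_form_const[OF B']
      plane_form_rot[OF B] plane_form_rot[OF B'] distrib_left)

lemma plane_form_mult:
  assumes B: "plane_form V B"
  shows "plane_form V (\<lambda>v w. k * B v w)"
  unfolding plane_form_def
proof (intro conjI allI impI)
  fix v w show "k * B v w = k * B w v" by (simp only: plane_form_sym[OF B, of v])
next
  fix v v' w :: "'a \<Rightarrow> complex" assume "\<forall>a\<in>V. v a = v' a"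
  then show "k * B v w = k * B v' w" using plane_form_cong[OF B, of v v' w] by simp
next
  fix f g :: "real \<Rightarrow> 'a \<Rightarrow> complex" and f' g' t
  assume f: "\<forall>a\<in>V. ((\<lambda>s. f s a) has_vector_derivative f' a) (at t)"
    and g: "\<forall>a\<in>V. ((\<lambda>s. g s a) has_vector_derivative g' a) (at t)"
  show "((\<lambda>s. k * B (f s) (g s)) has_real_derivative k * B f' (g t) + k * B (f t) g') (at t)"
    by (rule DERIV_cong[OF DERIV_cmult[OF plane_form_deriv[OF B, of f f' t g g']]])
      (use f g in \<open>auto simp: algebra_simps\<close>)
qed (simp_all add: plane_form_lin[OF B] plane_form_const[OF B] plane_form_rot[OF B] distrib_left mult.left_commute)

lemma plane_form_zero: "plane_form V (\<lambda>v w. 0)"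
  by (simp add: plane_form_def)

lemma plane_form_sum:
  assumes "finite I" "\<And>i. i \<in> I \<Longrightarrow> plane_form V (B i)"
  shows "plane_form V (\<lambda>v w. \<Sum>i\<in>I. B i v w)"
  using assms by (induction I rule: finite_induct) (auto intro: plane_form_zero plane_form_plus)

lemma plane_form_reindex:
  assumes B: "plane_form V B" and g: "g ` V \<subseteq> V'"
  shows "plane_form V' (\<lambda>v w. B (\<lambda>i. v (g i)) (\<lambda>i. w (g i)))"
  unfolding plane_form_def
proof (intro conjI allI impI)
  fix v w show "B (\<lambda>i. v (g i)) (\<lambda>i. w (g i)) = B (\<lambda>i. w (g i)) (\<lambda>i. v (g i))"
    by (rule plane_form_sym[OF B])
next
  fix v v' w :: "'b \<Rightarrow> complex" assume "\<forall>a\<in>V'. v a = v' a"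
  then show "B (\<lambda>i. v (g i)) (\<lambda>i. w (g i)) = B (\<lambda>i. v' (g i)) (\<lambda>i. w (g i))"
    using g by (intro plane_form_cong[OF B]) auto
next
  fix f h :: "real \<Rightarrow> 'b \<Rightarrow> complex" and f' h' t
  assume "\<forall>a\<in>V'. ((\<lambda>s. f s a) has_vector_derivative f' a) (at t)"
    "\<forall>a\<in>V'. ((\<lambda>s. h s a) has_vector_derivative h' a) (at t)"
  then show "((\<lambda>s. B (\<lambda>i. f s (g i)) (\<lambda>i. h s (g i))) has_real_derivative
      B (\<lambda>i. f' (g i)) (\<lambda>i. h t (g i)) + B (\<lambda>i. f t (g i)) (\<lambda>i. h' (g i))) (at t)"
    using g by (intro plane_form_deriv[OF B]) auto
qed (simp_all add: plane_form_lin[OF B] plane_form_const[OF B] plane_form_rot[OF B])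

section \<open>Charts of reduced configuration spaces\<close>

definition chart_deriv ::
    "((nat \<Rightarrow> real) \<Rightarrow> 'v \<Rightarrow> complex) \<Rightarrow> nat \<Rightarrow> (nat \<Rightarrow> real) \<Rightarrow> 'v \<Rightarrow> complex" where
  "chart_deriv \<phi> i x v = Complex (pderiv_at i (\<lambda>y. Re (\<phi> y v)) x) (pderiv_at i (\<lambda>y. Im (\<phi> y v)) x)"

lemma reduced_chartD:
  assumes "reduced_chart L d U \<phi>"
  shows reduced_chart_open: "openin (Euclidean_space d) U"
    and reduced_chart_configs: "x \<in> U \<Longrightarrow> \<phi> x \<in> configs L"
    and reduced_chart_smooth: "v \<in> fst L \<Longrightarrow> smooth_fun_on d U (\<lambda>x. Re (\<phi> x v))"
      "v \<in> fst L \<Longrightarrow> smooth_fun_on d U (\<lambda>x. Im (\<phi> x v))"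
    and reduced_chart_embedding:
      "embedding_map (subtopology (Euclidean_space d) U) (reduced_space L) (config_class L \<circ> \<phi>)"
    and reduced_chart_open_image: "openin (reduced_space L) ((config_class L \<circ> \<phi>) ` U)"
    and reduced_chart_immersion: "x \<in> U \<Longrightarrow>
      (\<And>v. v \<in> fst L \<Longrightarrow> (\<Sum>i<d. of_real (h i) * chart_deriv \<phi> i x v) = \<i> * of_real s * \<phi> x v + b) \<Longrightarrow>
      i < d \<Longrightarrow> h i = 0"
  using assms unfolding reduced_chart_def chart_deriv_def by (simp_all add: image_subset_iff) blast

lemma has_vector_derivative_complexI:
  assumes "((\<lambda>t. Re (f t)) has_real_derivative a) F" "((\<lambda>t. Im (f t)) has_real_derivative b) F"
  shows "(f has_vector_derivative Complex a b) F"
  using assms by (simp add: has_vector_derivative_complex_iff)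

lemma smooth_fun_on_partial:
  assumes "smooth_fun_on d U f" "i < d" "x \<in> U"
  shows "((\<lambda>t. f (x(i := t))) has_real_derivative pderiv_at i f x) (at (x i))"
    and "smooth_fun_on d U (pderiv_at i f)"
proof -
  have "C_on (Suc k) d U f" for k using assms(1) by (simp add: smooth_fun_on_def)
  then have "C_on k d U (pderiv_at i f)" "(\<lambda>t. f (x(i := t))) differentiable at (x i)" for k
    using assms(2,3) by auto
  then show "smooth_fun_on d U (pderiv_at i f)"
    "((\<lambda>t. f (x(i := t))) has_real_derivative pderiv_at i f x) (at (x i))"
    by (simp_all add: smooth_fun_on_def pderiv_at_def DERIV_deriv_iff_real_differentiable)
qed

lemma chart_has_vector_derivative:
  assumes "reduced_chart L d U \<phi>" "x \<in> U" "i < d" "v \<in> fst L"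
  shows "((\<lambda>t. \<phi> (x(i := t)) v) has_vector_derivative chart_deriv \<phi> i x v) (at (x i))"
  unfolding chart_deriv_def
  using reduced_chart_smooth[OF assms(1,4)] assms(2,3)
  by (intro has_vector_derivative_complexI smooth_fun_on_partial)

lemma chart_deriv_has_vector_derivative:
  assumes "reduced_chart L d U \<phi>" "x \<in> U" "i < d" "j < d" "v \<in> fst L"
  shows "\<exists>D. ((\<lambda>t. chart_deriv \<phi> j (x(i := t)) v) has_vector_derivative D) (at (x i))"
proof -
  note s = reduced_chart_smooth[OF assms(1,5)]
  have "((\<lambda>t. chart_deriv \<phi> j (x(i := t)) v) has_vector_derivative
     Complex (pderiv_at i (pderiv_at j (\<lambda>y. Re (\<phi> y v))) x) (pderiv_at i (pderiv_at j (\<lambda>y. Im (\<phi> y v))) x))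
     (at (x i))"
    using s[THEN smooth_fun_on_partial(2), OF assms(4,2)] assms(2,3)
    by (intro has_vector_derivative_complexI) (simp_all add: chart_deriv_def smooth_fun_on_partial(1))
  then show ?thesis by blast
qed

text \<open>Differentiating B(\<phi>, \<phi>) / 2 twice gives B of two coordinate vectors plus B of
  \<phi> with a second derivative of \<phi>. The latter vanishes at \<open>x\<close> by
  \<open>crit\<close>.\<close>

lemma chart_hessian:
  assumes chart: "reduced_chart L d U \<phi>" and x: "x \<in> U" and B: "plane_form (fst L) B"
    and F: "\<And>p. p \<in> configs L \<Longrightarrow> F p = B p p / 2 + k"
    and crit: "\<And>w. B (\<phi> x) w = 0"
  shows "hessian d (F \<circ> \<phi>) x = gram B d (\<lambda>i. chart_deriv \<phi> i x)"
  unfolding hessian_def gram_def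
proof (rule cong_mat[OF refl refl], clarify)
  fix i j assume i: "i < d" and j: "j < d"
  note U = reduced_chart_open[OF chart]
  \<comment> \<open>Needed on all of \<open>U\<close>, since it is differentiated once more.\<close>
  have first: "pderiv_at j (F \<circ> \<phi>) y = B (\<phi> y) (chart_deriv \<phi> j y)" if y: "y \<in> U" for y
  proof -
    have "((\<lambda>t. B (\<phi> (y(j := t))) (\<phi> (y(j := t)))) has_real_derivative
        B (chart_deriv \<phi> j y) (\<phi> (y(j := y j))) + B (\<phi> (y(j := y j))) (chart_deriv \<phi> j y)) (at (y j))"
      by (rule plane_form_deriv[OF B]) (rule chart_has_vector_derivative[OF chart y j], assumption)+
    then have "((\<lambda>t. B (\<phi> (y(j := t))) (\<phi> (y(j := t))) / 2 + k) has_real_derivative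
        (B (chart_deriv \<phi> j y) (\<phi> y) + B (\<phi> y) (chart_deriv \<phi> j y)) / 2) (at (y j))"
      by (auto intro!: derivative_eq_intros)
    then have "((\<lambda>t. B (\<phi> (y(j := t))) (\<phi> (y(j := t))) / 2 + k) has_real_derivative
        B (\<phi> y) (chart_deriv \<phi> j y)) (at (y j))"
      by (simp add: plane_form_sym[OF B, of "chart_deriv \<phi> j y"])
    moreover have "\<forall>\<^sub>F t in nhds (y j). B (\<phi> (y(j := t))) (\<phi> (y(j := t))) / 2 + k = (F \<circ> \<phi>) (y(j := t))"
      using eventually_fun_upd_in_open[OF U y j]
      by eventually_elim (simp add: F reduced_chart_configs[OF chart])
    ultimately have "((\<lambda>t. (F \<circ> \<phi>) (y(j := t))) has_real_derivative B (\<phi> y) (chart_deriv \<phi> j y)) (at (y j))"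
      by (subst (asm) DERIV_cong_ev[OF refl _ refl]) auto
    then show ?thesis unfolding pderiv_at_def by (rule DERIV_imp_deriv)
  qed
  have "\<forall>v\<in>fst L. \<exists>D. ((\<lambda>t. chart_deriv \<phi> j (x(i := t)) v) has_vector_derivative D) (at (x i))"
    using chart_deriv_has_vector_derivative[OF chart x i j] by blast
  then obtain D where D: "\<And>v. v \<in> fst L \<Longrightarrow>
      ((\<lambda>t. chart_deriv \<phi> j (x(i := t)) v) has_vector_derivative D v) (at (x i))" by metis
  have "((\<lambda>t. B (\<phi> (x(i := t))) (chart_deriv \<phi> j (x(i := t)))) has_real_derivative
      B (chart_deriv \<phi> i x) (chart_deriv \<phi> j (x(i := x i))) + B (\<phi> (x(i := x i))) D) (at (x i))"
    by (rule plane_form_deriv[OF B]) (rule chart_has_vector_derivative[OF chart x i] D, assumption)+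
  then have "((\<lambda>t. B (\<phi> (x(i := t))) (chart_deriv \<phi> j (x(i := t)))) has_real_derivative
      B (chart_deriv \<phi> i x) (chart_deriv \<phi> j x)) (at (x i))"
    by (simp add: crit)
  moreover have "\<forall>\<^sub>F t in nhds (x i). B (\<phi> (x(i := t))) (chart_deriv \<phi> j (x(i := t)))
      = pderiv_at j (F \<circ> \<phi>) (x(i := t))"
    using eventually_fun_upd_in_open[OF U x i] by eventually_elim (simp add: first)
  ultimately have "((\<lambda>t. pderiv_at j (F \<circ> \<phi>) (x(i := t))) has_real_derivative
      B (chart_deriv \<phi> i x) (chart_deriv \<phi> j x)) (at (x i))"
    by (subst (asm) DERIV_cong_ev[OF refl _ refl]) auto
  then show "pderiv_at i (pderiv_at j (F \<circ> \<phi>)) x = B (chart_deriv \<phi> i x) (chart_deriv \<phi> j x)"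
    unfolding pderiv_at_def[of i] by (rule DERIV_imp_deriv)
qed

text \<open>\<open>m\<close> may be any positive bound for the displacement. It is chosen later so
  as to dominate the accompanying rotations and translations as well.\<close>

lemma chart_first_order:
  assumes chart: "reduced_chart L d U \<phi>" and x: "x \<in> U" and v: "v \<in> fst L"
    and y: "\<And>n. y n \<in> U" "\<And>i. i < d \<Longrightarrow> (\<lambda>n. y n i) \<longlonglongrightarrow> x i"
    and m: "\<And>n. m n > 0" "\<And>n. (\<Sum>i<d. \<bar>y n i - x i\<bar>) \<le> m n"
  shows "(\<lambda>n. (\<phi> (y n) v - \<phi> x v - (\<Sum>i<d. of_real (y n i - x i) * chart_deriv \<phi> i x v)) / of_real (m n)) \<longlonglongrightarrow> 0"
proof -
  have real: "(\<lambda>n. (f (y n) - f x - (\<Sum>i<d. (y n i - x i) * pderiv_at i f x)) / m n) \<longlonglongrightarrow> 0"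
    if f: "smooth_fun_on d U f" for f
  proof (rule LIMSEQ_I)
    fix e :: real assume e: "e > 0"
    have "C_on 1 d U f" using f unfolding smooth_fun_on_def by blast
    from C1_first_order[OF this reduced_chart_open[OF chart] x, of "e / 2"] e
    obtain \<delta> where \<delta>: "\<delta> > 0" "\<And>y. (\<forall>i<d. \<bar>y i - x i\<bar> < \<delta>) \<Longrightarrow> (\<forall>i\<ge>d. y i = 0) \<Longrightarrow>
      \<bar>f y - f x - (\<Sum>i<d. (y i - x i) * pderiv_at i f x)\<bar> \<le> e / 2 * (\<Sum>i<d. \<bar>y i - x i\<bar>)"
      by auto
    have "\<forall>\<^sub>F n in sequentially. \<forall>i\<in>{..<d}. \<bar>y n i - x i\<bar> < \<delta>"
    proof (rule eventually_ball_finite)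
      show "\<forall>i\<in>{..<d}. \<forall>\<^sub>F n in sequentially. \<bar>y n i - x i\<bar> < \<delta>"
        using y(2) \<delta>(1) by (auto simp: tendsto_iff dist_real_def)
    qed simp
    then obtain N where N: "\<And>n. n \<ge> N \<Longrightarrow> \<forall>i<d. \<bar>y n i - x i\<bar> < \<delta>"
      by (auto simp: eventually_sequentially)
    have "norm ((f (y n) - f x - (\<Sum>i<d. (y n i - x i) * pderiv_at i f x)) / m n - 0) < e" if "n \<ge> N" for n
    proof -
      have "\<forall>i\<ge>d. y n i = 0"
        using y(1)[of n] openin_subset[OF reduced_chart_open[OF chart]] by (auto simp: topspace_Euclidean_space)
      then have "\<bar>f (y n) - f x - (\<Sum>i<d. (y n i - x i) * pderiv_at i f x)\<bar> \<le> e / 2 * (\<Sum>i<d. \<bar>y n i - x i\<bar>)"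
        using \<delta>(2) N[OF that] by blast
      also have "\<dots> \<le> e / 2 * m n" using m(2) e by (intro mult_left_mono) auto
      also have "\<dots> < e * m n" using e m(1)[of n] by simp
      finally show ?thesis using m(1)[of n] by (simp add: divide_less_eq)
    qed
    then show "\<exists>N. \<forall>n\<ge>N. norm ((f (y n) - f x - (\<Sum>i<d. (y n i - x i) * pderiv_at i f x)) / m n - 0) < e"
      by blast
  qed
  show ?thesis
    using real[OF reduced_chart_smooth(1)[OF chart v]] real[OF reduced_chart_smooth(2)[OF chart v]]
    by (simp add: tendsto_complex_iff chart_deriv_def Re_divide_of_real Im_divide_of_real)
qed

text \<open>The tangent cone, described by sequences of configurations and step sizes. Sequences can
  be pulled back through a chart and refined, without any regularity of a curve.\<close>

definition config_velocity :: "'v linkage \<Rightarrow> ('v \<Rightarrow> complex) \<Rightarrow> ('v \<Rightarrow> complex) \<Rightarrow> bool" where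
  "config_velocity L P v \<longleftrightarrow> (\<exists>t \<gamma>. (\<forall>n. 0 < t n \<and> \<gamma> n \<in> configs L) \<and> t \<longlonglongrightarrow> 0 \<and>
     (\<forall>a\<in>fst L. (\<lambda>n. (\<gamma> n a - P a) / of_real (t n)) \<longlonglongrightarrow> v a))"

text \<open>The kernel of the rigidity matrix. In general it may contain more than velocities of
  configurations; that its elements are velocities is proved separately, for bent polygons and for
  aligned three-chains.\<close>

definition tangent_vectors :: "'v linkage \<Rightarrow> ('v \<Rightarrow> complex) \<Rightarrow> ('v \<Rightarrow> complex) set" where
  "tangent_vectors L P = {v. \<forall>(a, b, l)\<in>snd L. Re (cnj (P a - P b) * (v a - v b)) = 0}"

lemma config_class_eqD:
  assumes "P \<in> configs L" "config_class L P = config_class L Q"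
  shows "\<exists>c b. norm c = 1 \<and> (\<forall>v\<in>fst L. P v = c * Q v + b)"
proof -
  have "P \<in> config_class L P"
    using assms(1) by (simp add: config_class_def) (rule exI[of _ 1], simp)
  then show ?thesis unfolding assms(2) by (auto simp: config_class_def)
qed

lemma configs_dist: "p \<in> configs L \<Longrightarrow> (u, v, l) \<in> snd L \<Longrightarrow> dist (p u) (p v) = l"
  by (auto simp: configs_def)

lemma limitin_config_space:
  assumes "\<And>n. \<gamma> n \<in> configs L" "P \<in> configs L" "\<And>a. a \<in> fst L \<Longrightarrow> (\<lambda>n. \<gamma> n a) \<longlonglongrightarrow> P a"
  shows "limitin (config_space L) \<gamma> P sequentially"
  using assms unfolding config_space_def limitin_subtopology limitin_componentwise
  by (auto simp: configs_def PiE_def)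

lemma velocity_limit:
  assumes "\<And>n::nat. 0 < t n" "t \<longlonglongrightarrow> 0" "(\<lambda>n. (g n - p) / complex_of_real (t n)) \<longlonglongrightarrow> v"
  shows "g \<longlonglongrightarrow> p"
proof -
  have "(\<lambda>n. of_real (t n) * ((g n - p) / of_real (t n)) + p) \<longlonglongrightarrow> of_real 0 * v + p"
    by (intro tendsto_intros assms)
  moreover have "of_real (t n) * ((g n - p) / of_real (t n)) + p = g n" for n
    using assms(1)[of n] by simp
  ultimately show ?thesis by simp
qed

text \<open>The classes of the configurations converge to a point of the open image of the chart, on
  which the chart has a continuous inverse. The shift \<open>N\<close> discards the initial terms
  that may lie outside.\<close>

lemma chart_pullback_sequence:
  assumes chart: "reduced_chart L d U \<phi>" and x: "x \<in> U"
    and \<gamma>: "\<And>n. \<gamma> n \<in> configs L" "\<And>a. a \<in> fst L \<Longrightarrow> (\<lambda>n. \<gamma> n a) \<longlonglongrightarrow> \<phi> x a"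
  shows "\<exists>N y. (\<forall>n. y n \<in> U \<and> config_class L (\<phi> (y n)) = config_class L (\<gamma> (n + N))) \<and>
    limitin (subtopology (Euclidean_space d) U) y x sequentially"
proof -
  let ?e = "config_class L \<circ> \<phi>" and ?E = "subtopology (Euclidean_space d) U"
  let ?W = "?e ` U"
  have tU: "topspace ?E = U"
    using openin_subset[OF reduced_chart_open[OF chart]] by auto
  then have sub: "topspace (Euclidean_space d) \<inter> U = U" by simp
  have "limitin (config_space L) \<gamma> (\<phi> x) sequentially"
    by (rule limitin_config_space[OF \<gamma>(1) reduced_chart_configs[OF chart x] \<gamma>(2)])
  then have lim: "limitin (reduced_space L) (config_class L \<circ> \<gamma>) (?e x) sequentially"
    using continuous_map_limit[OF quotient_imp_continuous_map[OF quotient_map_config_class]] by fastforce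
  have "homeomorphic_map ?E (subtopology (reduced_space L) ?W) ?e"
    using reduced_chart_embedding[OF chart] unfolding embedding_map_def tU .
  then obtain g where g: "homeomorphic_maps ?E (subtopology (reduced_space L) ?W) ?e g"
    using homeomorphic_map_maps by blast
  have W: "?W \<subseteq> topspace (reduced_space L)"
    using openin_subset[OF reduced_chart_open_image[OF chart]] .
  have gcont: "continuous_map (subtopology (reduced_space L) ?W) ?E g"
    and ge: "\<And>y. y \<in> U \<Longrightarrow> g (?e y) = y" and eg: "\<And>w. w \<in> ?W \<Longrightarrow> ?e (g w) = w"
    using g W by (auto simp: homeomorphic_maps_def sub)
  have ev: "\<forall>\<^sub>F n in sequentially. (config_class L \<circ> \<gamma>) n \<in> ?W"
    using lim reduced_chart_open_image[OF chart] x unfolding limitin_def by blast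
  then obtain N where N: "\<And>n. n \<ge> N \<Longrightarrow> config_class L (\<gamma> n) \<in> ?W"
    by (auto simp: eventually_sequentially)
  have "limitin (subtopology (reduced_space L) ?W) (config_class L \<circ> \<gamma>) (?e x) sequentially"
    using lim ev x unfolding limitin_subtopology by blast
  then have "limitin ?E (g \<circ> (config_class L \<circ> \<gamma>)) (g (?e x)) sequentially"
    by (rule continuous_map_limit[OF gcont])
  then have "limitin ?E (g \<circ> (config_class L \<circ> \<gamma>)) x sequentially" using ge[OF x] by simp
  then have l: "limitin ?E (\<lambda>n. (g \<circ> (config_class L \<circ> \<gamma>)) (n + N)) x sequentially"
    unfolding limitin_def
  proof (elim conjE, intro conjI allI impI)
    fix X assume "openin ?E X \<and> x \<in> X"
      and "\<forall>X. openin ?E X \<and> x \<in> X \<longrightarrow> (\<forall>\<^sub>F n in sequentially. (g \<circ> (config_class L \<circ> \<gamma>)) n \<in> X)"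
    then have "\<forall>\<^sub>F n in sequentially. (g \<circ> (config_class L \<circ> \<gamma>)) n \<in> X" by blast
    then show "\<forall>\<^sub>F n in sequentially. (g \<circ> (config_class L \<circ> \<gamma>)) (n + N) \<in> X"
      by (rule eventually_sequentially_seg[THEN iffD2])
  qed
  have "(g \<circ> (config_class L \<circ> \<gamma>)) (n + N) \<in> U \<and>
      config_class L (\<phi> ((g \<circ> (config_class L \<circ> \<gamma>)) (n + N))) = config_class L (\<gamma> (n + N))" for n
  proof -
    have w: "config_class L (\<gamma> (n + N)) \<in> ?W" by (rule N) simp
    then have "g (config_class L (\<gamma> (n + N))) \<in> U" using ge by auto
    then show ?thesis using eg[OF w] by simp
  qed
  note Y = this
  show ?thesis
    by (rule exI[of _ N], rule exI[of _ "\<lambda>n. (g \<circ> (config_class L \<circ> \<gamma>)) (n + N)"]) (intro conjI allI Y l)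
qed

text \<open>A unit complex number near 1 deviates from 1 to first order only in its imaginary part;
  the real part contributes at second order.\<close>

lemma one_minus_Re_le:
  assumes "norm c = 1" "Re c \<ge> 0" shows "\<bar>Re c - 1\<bar> \<le> \<bar>Im c\<bar> * \<bar>Im c\<bar>"
proof -
  have 1: "(Re c)\<^sup>2 + (Im c)\<^sup>2 = 1" using assms(1) by (metis cmod_power2 one_power2)
  then have "(1 - Re c) * (1 + Re c) = (Im c)\<^sup>2" by (simp add: power2_eq_square algebra_simps)
  moreover have "Re c \<le> 1" using complex_Re_le_cmod[of c] assms(1) by simp
  ultimately have "1 - Re c \<le> (Im c)\<^sup>2" using assms(2)
    by (metis add_increasing2 diff_ge_0_iff_ge mult_left_mono mult.right_neutral order_refl)
  then show ?thesis using \<open>Re c \<le> 1\<close> by (simp add: power2_eq_square)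
qed

text \<open>The relation between \<open>\<phi> (y n)\<close> and \<open>\<gamma> n\<close> is divided by the size \<open>m n\<close> of all its
  first-order data and passed to the limit along a subsequence; since \<open>\<phi>\<close> is an immersion modulo
  rigid motions, the limiting relation involves the velocity nontrivially.\<close>

lemma velocity_in_chart:
  assumes chart: "reduced_chart L d U \<phi>" and x: "x \<in> U"
    and edge: "(a0, a1, len) \<in> snd L" "len > 0" "a0 \<in> fst L" "a1 \<in> fst L"
    and v: "config_velocity L (\<phi> x) v"
  shows "\<exists>h s b. \<forall>a\<in>fst L. v a = (\<Sum>i<d. of_real (h i) * chart_deriv \<phi> i x a) + \<i> * of_real s * \<phi> x a + b"
proof -
  let ?P = "\<phi> x"
  obtain t0 \<gamma>0 where t0: "\<And>n. 0 < t0 n" "t0 \<longlonglongrightarrow> 0" and \<gamma>0: "\<And>n. \<gamma>0 n \<in> configs L"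
    and vel0: "\<And>a. a \<in> fst L \<Longrightarrow> (\<lambda>n. (\<gamma>0 n a - ?P a) / of_real (t0 n)) \<longlonglongrightarrow> v a"
    using v unfolding config_velocity_def by blast
  have lim0: "(\<lambda>n. \<gamma>0 n a) \<longlonglongrightarrow> ?P a" if "a \<in> fst L" for a
    by (rule velocity_limit[OF t0 vel0[OF that]])
  obtain N y where y: "\<And>n. y n \<in> U" "\<And>n. config_class L (\<phi> (y n)) = config_class L (\<gamma>0 (n + N))"
    and ylim: "limitin (subtopology (Euclidean_space d) U) y x sequentially"
    using chart_pullback_sequence[OF chart x \<gamma>0 lim0] by blast
  define t where "t n = t0 (n + N)" for n
  define \<gamma> where "\<gamma> n = \<gamma>0 (n + N)" for n
  have t: "\<And>n. 0 < t n" "t \<longlonglongrightarrow> 0" using t0 unfolding t_def by (auto intro: LIMSEQ_ignore_initial_segment)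
  have \<gamma>: "\<gamma> n \<in> configs L" for n by (simp add: \<gamma>_def \<gamma>0)
  have vel: "(\<lambda>n. (\<gamma> n a - ?P a) / of_real (t n)) \<longlonglongrightarrow> v a" if "a \<in> fst L" for a
    unfolding \<gamma>_def t_def by (rule LIMSEQ_ignore_initial_segment[OF vel0[OF that]])
  have lim: "(\<lambda>n. \<gamma> n a) \<longlonglongrightarrow> ?P a" if "a \<in> fst L" for a
    by (rule velocity_limit[OF t vel[OF that]])
  have sub: "U \<subseteq> topspace (Euclidean_space d)"
    using openin_subset[OF reduced_chart_open[OF chart]] .
  have ycoord: "(\<lambda>n. y n i) \<longlonglongrightarrow> x i" for i
  proof -
    have "continuous_map (subtopology (Euclidean_space d) U) euclideanreal (\<lambda>y. y i)"
      unfolding continuous_map_Euclidean_subspace[OF sub]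
      by (rule continuous_on_product_coordinates[THEN continuous_on_subset]) simp
    from continuous_map_limit[OF this ylim] show ?thesis by (simp add: o_def)
  qed
  have \<phi>lim: "(\<lambda>n. \<phi> (y n) a) \<longlonglongrightarrow> ?P a" if a: "a \<in> fst L" for a
  proof -
    have "continuous_map (subtopology (Euclidean_space d) U) euclideanreal f" if "smooth_fun_on d U f" for f
      using that[unfolded smooth_fun_on_def, rule_format, of 0] by simp
    from continuous_map_limit[OF this[OF reduced_chart_smooth(1)[OF chart a]] ylim]
      continuous_map_limit[OF this[OF reduced_chart_smooth(2)[OF chart a]] ylim]
    show ?thesis by (simp add: o_def tendsto_complex_iff)
  qed
  have "\<forall>n. \<exists>c b. norm c = 1 \<and> (\<forall>v\<in>fst L. \<phi> (y n) v = c * \<gamma> n v + b)"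
    using config_class_eqD[OF reduced_chart_configs[OF chart y(1)] y(2)] by (simp add: \<gamma>_def)
  then obtain c b where cn: "\<And>n. norm (c n) = 1"
    and cb: "\<And>n a. a \<in> fst L \<Longrightarrow> \<phi> (y n) a = c n * \<gamma> n a + b n" by metis
  \<comment> \<open>An edge of positive length determines the rotation \<open>c n\<close>, so
    convergence of its ends forces \<open>c n\<close> to tend to 1.\<close>
  have clim: "c \<longlonglongrightarrow> 1"
  proof -
    have nz: "\<gamma> n a0 - \<gamma> n a1 \<noteq> 0" for n using configs_dist[OF \<gamma>[of n] edge(1)] edge(2) by auto
    have Pnz: "?P a0 - ?P a1 \<noteq> 0"
      using configs_dist[OF reduced_chart_configs[OF chart x] edge(1)] edge(2) by auto
    have "c = (\<lambda>n. (\<phi> (y n) a0 - \<phi> (y n) a1) / (\<gamma> n a0 - \<gamma> n a1))"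
      using nz by (simp add: fun_eq_iff cb edge field_simps)
    moreover have "(\<lambda>n. (\<phi> (y n) a0 - \<phi> (y n) a1) / (\<gamma> n a0 - \<gamma> n a1)) \<longlonglongrightarrow> (?P a0 - ?P a1) / (?P a0 - ?P a1)"
      by (intro tendsto_intros \<phi>lim lim edge Pnz)
    ultimately show ?thesis using Pnz by simp
  qed
  define m where "m n = (\<Sum>i<d. \<bar>y n i - x i\<bar>) + t n + \<bar>Im (c n)\<bar> + norm (b n)" for n
  have m: "m n > 0" for n unfolding m_def using t(1)[of n] by (simp add: add_nonneg_pos add_pos_nonneg sum_nonneg)
  have m1: "(\<Sum>i<d. \<bar>y n i - x i\<bar>) \<le> m n" "t n \<le> m n" "\<bar>Im (c n)\<bar> \<le> m n" "norm (b n) \<le> m n" for n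
    unfolding m_def using t(1)[of n] by (simp_all add: sum_nonneg add_increasing add_increasing2)
  have m2: "\<bar>y n i - x i\<bar> \<le> m n" if "i < d" for n i
    using m1(1)[of n] member_le_sum[of i "{..<d}" "\<lambda>i. \<bar>y n i - x i\<bar>"] that by simp
  define f where "f k n = (if k < d then of_real ((y n k - x k) / m n)
      else if k = d then of_real (t n / m n) else if k = d + 1 then of_real (Im (c n) / m n)
      else b n / of_real (m n))" for k n
  have fb: "norm (f k n) \<le> 1" for k n
    using m[of n] m1[of n] m2[of k n] t(1)[of n] by (auto simp: f_def norm_divide simp del: of_real_divide of_real_diff)
  have "\<exists>r l. strict_mono (r :: nat \<Rightarrow> nat) \<and> (\<forall>k\<in>{..<d + 3}. (f k \<circ> r) \<longlonglongrightarrow> l k)"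
    by (rule common_convergent_subsequence) (auto intro!: boundedI[of _ 1] fb)
  then obtain r l where r: "strict_mono (r :: nat \<Rightarrow> nat)" and l: "\<And>k. k < d + 3 \<Longrightarrow> (f k \<circ> r) \<longlonglongrightarrow> l k"
    by auto
  note sub' = LIMSEQ_subseq_LIMSEQ[OF _ r]
  have l1: "(\<lambda>n. f i (r n)) \<longlonglongrightarrow> l i" if "i < d" for i using l[of i] that by (simp add: o_def)
  have ld: "(\<lambda>n. f d (r n)) \<longlonglongrightarrow> l d" "(\<lambda>n. f (d+1) (r n)) \<longlonglongrightarrow> l (d+1)" "(\<lambda>n. f (d+2) (r n)) \<longlonglongrightarrow> l (d+2)"
    using l[of d] l[of "d+1"] l[of "d+2"] by (simp_all add: o_def)
  have real: "l k = of_real (Re (l k))" if "k < d + 2" for k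
  proof -
    have "(\<lambda>n. Im (f k (r n))) \<longlonglongrightarrow> Im (l k)" using l[of k] that by (simp add: o_def tendsto_Im)
    moreover have "Im (f k (r n)) = 0" for n using that by (auto simp: f_def)
    ultimately have "Im (l k) = 0" by (simp add: LIMSEQ_const_iff)
    then show ?thesis by (simp add: complex_eq_iff)
  qed
  \<comment> \<open>The normalized data have total size exactly 1 for every \<open>n\<close>. This
    survives in the limit, so the limits cannot all vanish.\<close>
  have total: "(\<Sum>i<d. norm (l i)) + norm (l d) + norm (l (d+1)) + norm (l (d+2)) = 1"
  proof -
    have "(\<lambda>n. (\<Sum>i<d. norm (f i (r n))) + norm (f d (r n)) + norm (f (d+1) (r n)) + norm (f (d+2) (r n)))
        \<longlonglongrightarrow> (\<Sum>i<d. norm (l i)) + norm (l d) + norm (l (d+1)) + norm (l (d+2))"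
      by (intro tendsto_intros ld) (use l1 in auto)
    moreover have "(\<Sum>i<d. norm (f i n)) + norm (f d n) + norm (f (d+1) n) + norm (f (d+2) n) = 1" for n
    proof -
      have "(\<Sum>i<d. norm (f i n)) = (\<Sum>i<d. \<bar>y n i - x i\<bar>) / m n"
        using m[of n] by (simp add: f_def sum_divide_distrib del: of_real_divide of_real_diff)
      moreover have "norm (f d n) = t n / m n" "norm (f (d+1) n) = \<bar>Im (c n)\<bar> / m n" "norm (f (d+2) n) = norm (b n) / m n"
        using m[of n] t(1)[of n] by (simp_all add: f_def norm_divide del: of_real_divide of_real_diff)
      ultimately have "(\<Sum>i<d. norm (f i n)) + norm (f d n) + norm (f (d+1) n) + norm (f (d+2) n) = m n / m n"
        by (simp only: m_def add_divide_distrib)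
      then show ?thesis using m[of n] by simp
    qed
    ultimately show ?thesis by (simp add: LIMSEQ_const_iff)
  qed
  have Re0: "(\<lambda>n. complex_of_real ((Re (c n) - 1) / m n)) \<longlonglongrightarrow> 0"
  proof (rule Lim_null_comparison)
    have "(\<lambda>n. Re (c n)) \<longlonglongrightarrow> 1" using tendsto_Re[OF clim] by simp
    then have "\<forall>\<^sub>F n in sequentially. Re (c n) > 0" by (rule order_tendstoD) simp
    then show "\<forall>\<^sub>F n in sequentially. norm (complex_of_real ((Re (c n) - 1) / m n)) \<le> \<bar>Im (c n)\<bar>"
    proof eventually_elim
      case (elim n)
      have "\<bar>Re (c n) - 1\<bar> \<le> \<bar>Im (c n)\<bar> * \<bar>Im (c n)\<bar>" using one_minus_Re_le[OF cn] elim by simp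
      also have "\<dots> \<le> \<bar>Im (c n)\<bar> * m n" using m1(3) by (intro mult_left_mono) auto
      finally show ?case using m[of n] by (simp add: divide_le_eq del: of_real_divide of_real_diff)
    qed
    show "(\<lambda>n. \<bar>Im (c n)\<bar>) \<longlonglongrightarrow> 0" using tendsto_rabs[OF tendsto_Im[OF clim]] by simp
  qed
  have eq: "(\<Sum>i<d. l i * chart_deriv \<phi> i x a) = l d * v a + \<i> * l (d+1) * ?P a + l (d+2)" if a: "a \<in> fst L" for a
  proof -
    let ?A = "\<lambda>n. (\<phi> (y n) a - ?P a - (\<Sum>i<d. of_real (y n i - x i) * chart_deriv \<phi> i x a)) / of_real (m n)"
    have "?A \<longlonglongrightarrow> 0"
      by (rule chart_first_order[where y = y and m = m, OF chart x a y(1) ycoord m m1(1)])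
    then have A: "(\<lambda>n. ?A (r n)) \<longlonglongrightarrow> 0" using sub'[of ?A] by (simp add: o_def)
    have "?A n = c n * f d n * ((\<gamma> n a - ?P a) / of_real (t n)) + (\<i> * f (d+1) n + of_real ((Re (c n) - 1) / m n)) * ?P a
       + f (d+2) n - (\<Sum>i<d. f i n * chart_deriv \<phi> i x a)" for n
    proof -
      have s: "(\<Sum>i<d. f i n * chart_deriv \<phi> i x a) = (\<Sum>i<d. of_real (y n i - x i) * chart_deriv \<phi> i x a) / of_real (m n)"
        by (simp add: f_def sum_divide_distrib)
      have c1: "\<i> * f (d+1) n + of_real ((Re (c n) - 1) / m n) = (c n - 1) / of_real (m n)"
        by (simp add: f_def complex_eq_iff Re_divide_of_real Im_divide_of_real)
      have "\<phi> (y n) a - ?P a = c n * (\<gamma> n a - ?P a) + (c n - 1) * ?P a + b n"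
        by (simp add: cb[OF a] algebra_simps)
      then have "(\<phi> (y n) a - ?P a) / of_real (m n)
         = c n * (\<gamma> n a - ?P a) / of_real (m n) + (c n - 1) / of_real (m n) * ?P a + b n / of_real (m n)"
        by (simp add: add_divide_distrib)
      moreover have "c n * f d n * ((\<gamma> n a - ?P a) / of_real (t n)) = c n * (\<gamma> n a - ?P a) / of_real (m n)"
        using t(1)[of n] m[of n] by (simp add: f_def field_simps)
      moreover have "f (d+2) n = b n / of_real (m n)" by (simp add: f_def)
      ultimately show ?thesis unfolding s c1 by (simp add: diff_divide_distrib)
    qed
    note Aeq = this
    have "(\<lambda>n. c (r n) * f d (r n) * ((\<gamma> (r n) a - ?P a) / of_real (t (r n)))
        + (\<i> * f (d+1) (r n) + of_real ((Re (c (r n)) - 1) / m (r n))) * ?P a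
        + f (d+2) (r n) - (\<Sum>i<d. f i (r n) * chart_deriv \<phi> i x a))
      \<longlonglongrightarrow> 1 * l d * v a + (\<i> * l (d+1) + 0) * ?P a + l (d+2) - (\<Sum>i<d. l i * chart_deriv \<phi> i x a)"
      using sub'[OF clim] sub'[OF vel[OF a]] sub'[OF Re0] l1
      by (intro tendsto_intros ld) (auto simp: o_def)
    then have "(\<lambda>n. ?A (r n)) \<longlonglongrightarrow> 1 * l d * v a + (\<i> * l (d+1) + 0) * ?P a + l (d+2) - (\<Sum>i<d. l i * chart_deriv \<phi> i x a)"
      unfolding Aeq .
    from LIMSEQ_unique[OF this A] show ?thesis by simp
  qed
  define h where "h i = Re (l i)" for i
  define T where "T = Re (l d)"
  define S where "S = Re (l (d+1))"
  have lh: "l i = of_real (h i)" if "i < d" for i using real[of i] that by (simp add: h_def)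
  have lT: "l d = of_real T" and lS: "l (d+1) = of_real S" using real[of d] real[of "d+1"] by (simp_all add: T_def S_def)
  have eq': "(\<Sum>i<d. of_real (h i) * chart_deriv \<phi> i x a) = of_real T * v a + \<i> * of_real S * ?P a + l (d+2)"
    if "a \<in> fst L" for a using eq[OF that] by (simp add: lh lT lS[simplified])
  \<comment> \<open>If the velocity dropped out, the immersion property would give
    \<open>h = 0\<close>. Comparing the two ends of the edge would then leave neither rotation nor
    translation, which contradicts \<open>total\<close>.\<close>
  have "T \<noteq> 0"
  proof
    assume T0: "T = 0"
    have h0: "h i = 0" if "i < d" for i
      using reduced_chart_immersion[OF chart x, of h S "l (d+2)" i] eq' T0 that by simp
    then have "\<i> * of_real S * ?P a + l (d+2) = 0" if "a \<in> fst L" for a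
      using eq'[OF that] T0 by simp
    from this[OF edge(3)] this[OF edge(4)] have "\<i> * of_real S * (?P a0 - ?P a1) = 0"
      by (metis add_diff_cancel_right cancel_comm_monoid_add_class.diff_cancel right_diff_distrib)
    moreover have "?P a0 \<noteq> ?P a1"
      using configs_dist[OF reduced_chart_configs[OF chart x] edge(1)] edge(2) by auto
    ultimately have S0: "S = 0" by simp
    then have "l (d+2) = 0" using \<open>\<And>a. a \<in> fst L \<Longrightarrow> \<i> * of_real S * ?P a + l (d+2) = 0\<close>[OF edge(3)] by simp
    moreover have "l (d+1) = 0" "l d = 0" using S0 T0 lS lT by simp_all
    ultimately show False using total h0 by (simp add: lh)
  qed
  show ?thesis
  proof (intro exI ballI)
    fix a assume a: "a \<in> fst L"
    have "(\<Sum>i<d. of_real (h i / T) * chart_deriv \<phi> i x a) = (\<Sum>i<d. of_real (h i) * chart_deriv \<phi> i x a) / of_real T"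
      by (simp add: sum_divide_distrib)
    also have "\<dots> = v a + \<i> * of_real (S / T) * ?P a + l (d+2) / of_real T"
      using \<open>T \<noteq> 0\<close> unfolding eq'[OF a] by (simp add: add_divide_distrib)
    finally show "v a = (\<Sum>i<d. of_real (h i / T) * chart_deriv \<phi> i x a) + \<i> * of_real (- S / T) * ?P a + (- l (d+2) / of_real T)"
      by simp
  qed
qed

lemma chart_deriv_tangent:
  assumes chart: "reduced_chart L d U \<phi>" and x: "x \<in> U" and i: "i < d"
    and wf: "\<And>a b l. (a, b, l) \<in> snd L \<Longrightarrow> a \<in> fst L \<and> b \<in> fst L"
  shows "chart_deriv \<phi> i x \<in> tangent_vectors L (\<phi> x)"
  unfolding tangent_vectors_def
proof (clarify)
  fix a b l assume e: "(a, b, l) \<in> snd L"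
  let ?k = "1 / 2 :: complex"
  have "plane_form (fst L) (\<lambda>v w. Re (?k * cnj (v a - v b) * (w a - w b)) + Re (?k * cnj (w a - w b) * (v a - v b)))"
    using wf[OF e] by (intro plane_form_basic) auto
  note B = this
  have nrm: "(norm z)\<^sup>2 = Re (?k * cnj z * z) + Re (?k * cnj z * z)" for z
    unfolding cmod_power2 by (simp add: power2_eq_square)
  have "((\<lambda>t. (norm (\<phi> (x(i := t)) a - \<phi> (x(i := t)) b))\<^sup>2) has_real_derivative
      2 * Re (cnj (\<phi> x a - \<phi> x b) * (chart_deriv \<phi> i x a - chart_deriv \<phi> i x b))) (at (x i))"
    unfolding nrm
    by (rule DERIV_cong[OF plane_form_deriv[OF B chart_has_vector_derivative[OF chart x i]
        chart_has_vector_derivative[OF chart x i]]]) (simp_all add: algebra_simps)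
  moreover have "\<forall>\<^sub>F t in nhds (x i). (norm (\<phi> (x(i := t)) a - \<phi> (x(i := t)) b))\<^sup>2 = l\<^sup>2"
    using eventually_fun_upd_in_open[OF reduced_chart_open[OF chart] x i]
  proof eventually_elim
    case (elim t)
    from configs_dist[OF reduced_chart_configs[OF chart elim] e] show ?case by (simp add: dist_norm)
  qed
  ultimately have "((\<lambda>t. l\<^sup>2) has_real_derivative
      2 * Re (cnj (\<phi> x a - \<phi> x b) * (chart_deriv \<phi> i x a - chart_deriv \<phi> i x b))) (at (x i))"
    by (subst (asm) DERIV_cong_ev[OF refl _ refl]) auto
  from DERIV_unique[OF this DERIV_const]
  show "Re (cnj (\<phi> x a - \<phi> x b) * (chart_deriv \<phi> i x a - chart_deriv \<phi> i x b)) = 0" by simp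
qed

lemma config_velocity_rigid:
  assumes v: "config_velocity L P v" and c: "norm c = 1"
    and Q: "\<And>a. a \<in> fst L \<Longrightarrow> Q a = c * P a + b"
    and wf: "\<And>a b l. (a, b, l) \<in> snd L \<Longrightarrow> a \<in> fst L \<and> b \<in> fst L"
  shows "config_velocity L Q (\<lambda>a. c * v a)"
proof -
  obtain t \<gamma> where t: "\<And>n. 0 < t n" "t \<longlonglongrightarrow> 0" and \<gamma>: "\<And>n. \<gamma> n \<in> configs L"
    and vel: "\<And>a. a \<in> fst L \<Longrightarrow> (\<lambda>n. (\<gamma> n a - P a) / of_real (t n)) \<longlonglongrightarrow> v a"
    using v unfolding config_velocity_def by blast
  define \<delta> where "\<delta> n = (\<lambda>a\<in>fst L. c * \<gamma> n a + b)" for n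
  have "\<delta> n \<in> configs L" for n
  proof -
    have "dist (\<delta> n u) (\<delta> n w) = l" if e: "(u, w, l) \<in> snd L" for u w l
    proof -
      have "dist (\<delta> n u) (\<delta> n w) = norm (c * (\<gamma> n u - \<gamma> n w))"
        using wf[OF e] by (simp add: \<delta>_def dist_norm right_diff_distrib)
      also have "\<dots> = dist (\<gamma> n u) (\<gamma> n w)" by (simp add: norm_mult c dist_norm)
      finally show ?thesis using configs_dist[OF \<gamma> e] by simp
    qed
    then show ?thesis by (auto simp: configs_def \<delta>_def)
  qed
  moreover have "(\<lambda>n. (\<delta> n a - Q a) / of_real (t n)) \<longlonglongrightarrow> c * v a" if a: "a \<in> fst L" for a
  proof -
    have "(\<delta> n a - Q a) / of_real (t n) = c * ((\<gamma> n a - P a) / of_real (t n))" for n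
      using a by (simp add: \<delta>_def Q right_diff_distrib diff_divide_distrib)
    note eq = this
    show ?thesis unfolding eq by (rule tendsto_mult_left[OF vel[OF a]])
  qed
  ultimately show ?thesis unfolding config_velocity_def using t by blast
qed

text \<open>The chart passes through a configuration congruent to \<open>P\<close>, so its
  coordinate vectors are rotated back by \<open>cnj c\<close>. They span the tangent vectors up to
  rigid motions, which lie in the radical of \<open>B\<close>.\<close>

lemma chart_index:
  assumes chart: "reduced_chart L d U \<phi>" and x: "x \<in> U" and cl: "config_class L (\<phi> x) = config_class L P"
    and B: "plane_form (fst L) B" and F: "\<And>p. p \<in> configs L \<Longrightarrow> F p = B p p / 2 + k"
    and crit: "\<And>w. B P w = 0"
    and wf: "\<And>a b l. (a, b, l) \<in> snd L \<Longrightarrow> a \<in> fst L \<and> b \<in> fst L"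
    and edge: "(a0, a1, len) \<in> snd L" "len > 0"
    and vel: "\<And>v. v \<in> tangent_vectors L P \<Longrightarrow> config_velocity L P v"
  shows "has_index B (tangent_vectors L P) (num_neg_eigenvalues (hessian d (F \<circ> \<phi>) x))"
proof -
  obtain c b where c: "norm c = 1" and cb: "\<And>v. v \<in> fst L \<Longrightarrow> \<phi> x v = c * P v + b"
    using config_class_eqD[OF reduced_chart_configs[OF chart x] cl] by blast
  have cc: "cnj c * c = 1" "c * cnj c = 1" using c by (simp_all add: complex_norm_square[symmetric] mult.commute)
  have crit\<phi>: "B (\<phi> x) w = 0" for w
  proof -
    have "B (\<phi> x) w = B (\<lambda>a. c * P a + b) w" by (rule plane_form_cong[OF B]) (simp add: cb)
    also have "\<dots> = B (\<lambda>a. c * P a) w"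
      using plane_form_add[OF B, of "\<lambda>a. c * P a" "\<lambda>_. b" w] plane_form_const[OF B, of b w] by simp
    also have "\<dots> = B (\<lambda>a. c * P a) (\<lambda>a. c * (cnj c * w a))" by (simp add: mult.assoc[symmetric] cc)
    also have "\<dots> = 0" by (simp only: plane_form_rot[OF B c] crit)
    finally show ?thesis .
  qed
  define u where "u i = (\<lambda>a. cnj c * chart_deriv \<phi> i x a)" for i
  have c': "norm (cnj c) = 1" using c by simp
  have rot: "Re (cnj (c * p) * q) = Re (cnj p * (cnj c * q))" for p q by (simp add: algebra_simps)
  have uT: "u i \<in> tangent_vectors L P" if i: "i < d" for i
    unfolding tangent_vectors_def
  proof (clarify)
    fix a a' l assume e: "(a, a', l) \<in> snd L"
    have "Re (cnj (\<phi> x a - \<phi> x a') * (chart_deriv \<phi> i x a - chart_deriv \<phi> i x a')) = 0"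
    proof -
      have "chart_deriv \<phi> i x \<in> tangent_vectors L (\<phi> x)"
        by (rule chart_deriv_tangent[OF chart x i]) (rule wf)
      then show ?thesis using e unfolding tangent_vectors_def by blast
    qed
    moreover have "\<phi> x a - \<phi> x a' = c * (P a - P a')" using wf[OF e] by (simp add: cb right_diff_distrib)
    ultimately have "Re (cnj (c * (P a - P a')) * (chart_deriv \<phi> i x a - chart_deriv \<phi> i x a')) = 0" by simp
    then show "Re (cnj (P a - P a') * (u i a - u i a')) = 0"
      unfolding rot by (simp add: u_def right_diff_distrib)
  qed
  have "spans_form B (tangent_vectors L P) d u"
    unfolding spans_form_def
  proof (intro conjI allI impI ballI uT)
    fix v assume "v \<in> tangent_vectors L P"
    then have "config_velocity L (\<phi> x) (\<lambda>a. c * v a)"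
      by (intro config_velocity_rigid[OF vel c cb wf])
    from velocity_in_chart[OF chart x edge conjunct1[OF wf[OF edge(1)]] conjunct2[OF wf[OF edge(1)]] this]
    obtain h s b' where h: "\<And>a. a \<in> fst L \<Longrightarrow>
       c * v a = (\<Sum>i<d. of_real (h i) * chart_deriv \<phi> i x a) + \<i> * of_real s * \<phi> x a + b'" by blast
    have veq: "v a = (\<Sum>i<d. of_real (h i) * u i a) + (\<i> * of_real s * P a + cnj c * (\<i> * of_real s * b + b'))"
      if a: "a \<in> fst L" for a
    proof -
      have "v a = cnj c * (c * v a)" by (simp add: mult.assoc[symmetric] cc)
      also have "\<dots> = (\<Sum>i<d. of_real (h i) * u i a) + \<i> * of_real s * (cnj c * c) * P a + cnj c * (\<i> * of_real s * b + b')"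
        unfolding h[OF a] cb[OF a] by (simp add: u_def sum_distrib_left algebra_simps)
      finally show ?thesis by (simp add: cc)
    qed
    show "\<exists>c. \<forall>w\<in>tangent_vectors L P. B v w = (\<Sum>i<d. c i * B (u i) w)"
    proof (intro exI ballI)
      fix w
      have "B v w = B (\<lambda>a. (\<Sum>i<d. of_real (h i) * u i a) + (\<i> * of_real s * P a + cnj c * (\<i> * of_real s * b + b'))) w"
        by (rule plane_form_cong[OF B]) (rule veq)
      also have "\<dots> = B (\<lambda>a. \<Sum>i<d. of_real (h i) * u i a) w
          + B (\<lambda>a. \<i> * of_real s * P a + cnj c * (\<i> * of_real s * b + b')) w"
        by (rule plane_form_add[OF B])
      also have "\<dots> = (\<Sum>i<d. h i * B (u i) w)"
        by (simp add: plane_form_lincomb[OF B] plane_form_rigid[where B = B and P = P, OF B crit])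
      finally show "B v w = (\<Sum>i<d. h i * B (u i) w)" .
    qed
  qed
  moreover have "hessian d (F \<circ> \<phi>) x = gram B d u"
  proof -
    have "B (u i) (u j) = B (chart_deriv \<phi> i x) (chart_deriv \<phi> j x)" for i j
      unfolding u_def by (rule plane_form_rot[OF B c'])
    moreover have "hessian d (F \<circ> \<phi>) x = gram B d (\<lambda>i. chart_deriv \<phi> i x)"
      by (rule chart_hessian[where B = B and \<phi> = \<phi> and x = x and k = k and F = F, OF chart x B F crit\<phi>])
    ultimately show ?thesis by (simp only: gram_def)
  qed
  ultimately show ?thesis unfolding has_index_def by metis
qed

text \<open>One chart makes the definite description meaningful, and uniqueness of the index of
  \<open>B\<close> makes all charts agree.\<close>

lemma morse_index_has_index:
  assumes chart: "reduced_chart L d U \<phi>" and x: "x \<in> U" and cl: "config_class L (\<phi> x) = config_class L P"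
    and B: "plane_form (fst L) B" and F: "\<And>p. p \<in> configs L \<Longrightarrow> F p = B p p / 2 + k"
    and crit: "\<And>w. B P w = 0"
    and wf: "\<And>a b l. (a, b, l) \<in> snd L \<Longrightarrow> a \<in> fst L \<and> b \<in> fst L"
    and edge: "(a0, a1, len) \<in> snd L" "len > 0"
    and vel: "\<And>v. v \<in> tangent_vectors L P \<Longrightarrow> config_velocity L P v"
  shows "has_index B (tangent_vectors L P) (morse_index L F P)"
proof -
  note idx = chart_index[where B = B and P = P and F = F and L = L and k = k, OF _ _ _ B F crit wf edge vel]
  let ?m = "num_neg_eigenvalues (hessian d (F \<circ> \<phi>) x)"
  have "morse_index L F P = ?m"
    unfolding morse_index_def
  proof (rule the_equality)
    show "\<exists>d U \<phi>' x. reduced_chart L d U \<phi>' \<and> x \<in> U \<and> config_class L (\<phi>' x) = config_class L P \<and>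
        ?m = num_neg_eigenvalues (hessian d (F \<circ> \<phi>') x)"
      using chart x cl by blast
  next
    fix m' assume "\<exists>d U \<phi> x. reduced_chart L d U \<phi> \<and> x \<in> U \<and> config_class L (\<phi> x) = config_class L P \<and>
        m' = num_neg_eigenvalues (hessian d (F \<circ> \<phi>) x)"
    then obtain d' U' \<phi>' x' where c': "reduced_chart L d' U' \<phi>'" "x' \<in> U'"
      "config_class L (\<phi>' x') = config_class L P" "m' = num_neg_eigenvalues (hessian d' (F \<circ> \<phi>') x')" by blast
    show "m' = ?m"
      unfolding c'(4)
      by (rule has_index_unique[OF plane_form_sym[OF B] idx[OF c'(1-3)] idx[OF chart x cl]])
  qed
  then show ?thesis using idx[OF chart x cl] by simp
qed

section \<open>Closure properties of smooth functions\<close>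

lemma C_on_continuous: "C_on k n U f \<Longrightarrow> continuous_map (subtopology (Euclidean_space n) U) euclideanreal f"
  by (cases k) auto

lemma C_on_SucD: "C_on (Suc k) n U f \<Longrightarrow> C_on k n U f"
proof (induction k arbitrary: f)
  case (Suc k)
  note A = Suc.prems[THEN C_on.simps(2)[THEN iffD1]]
  show ?case by (rule C_on.simps(2)[THEN iffD2]) (use A Suc.IH in blast)
qed simp

text \<open>Partial derivatives look at a neighbourhood of the point along a coordinate line, which
  openness of \<open>U\<close> provides.\<close>

lemma C_on_cong:
  assumes "openin (Euclidean_space n) U" "\<And>x. x \<in> U \<Longrightarrow> f x = g x" "C_on k n U f"
  shows "C_on k n U g"
  using assms(2,3)
proof (induction k arbitrary: f g)
  case (0)
  have "topspace (subtopology (Euclidean_space n) U) \<subseteq> U" by simp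
  then show ?case using 0 by (auto intro: continuous_map_eq)
next
  case (Suc k)
  have ev: "\<forall>\<^sub>F t in nhds (x i). f (x(i := t)) = g (x(i := t))" if "x \<in> U" "i < n" for x i
    using eventually_fun_upd_in_open[OF assms(1) that] by eventually_elim (rule Suc.prems(1))
  have "pderiv_at i f x = pderiv_at i g x" if "x \<in> U" "i < n" for x i
    unfolding pderiv_at_def using ev[OF that] by (intro deriv_cong_ev) auto
  then have "C_on k n U (pderiv_at i g)" if "i < n" for i
    using Suc.IH[of "pderiv_at i f" "pderiv_at i g"] Suc.prems(2) that by simp
  moreover have "(\<lambda>t. g (x(i := t))) differentiable at (x i)" if "x \<in> U" "i < n" for x i
  proof -
    have "(\<lambda>t. f (x(i := t))) differentiable at (x i)" using Suc.prems(2) that by simp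
    then obtain D where "((\<lambda>t. f (x(i := t))) has_real_derivative D) (at (x i))"
      by (auto simp: real_differentiable_def)
    then have "((\<lambda>t. g (x(i := t))) has_real_derivative D) (at (x i))"
      using DERIV_cong_ev[OF refl ev[OF that] refl] by blast
    then show ?thesis by (auto simp: real_differentiable_def)
  qed
  moreover have "continuous_map (subtopology (Euclidean_space n) U) euclideanreal g"
    by (rule continuous_map_eq[of _ _ f]) (use Suc.prems in auto)
  ultimately show ?case by simp
qed

text \<open>Any formula \<open>D\<close> for the partial derivatives will do, which spares the
  closure proofs from handling \<open>pderiv_at\<close> of composite functions.\<close>

lemma C_on_SucI:
  assumes "openin (Euclidean_space n) U"
    and "continuous_map (subtopology (Euclidean_space n) U) euclideanreal f"
    and "\<And>i x. i < n \<Longrightarrow> x \<in> U \<Longrightarrow> ((\<lambda>t. f (x(i := t))) has_real_derivative D i x) (at (x i))"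
    and "\<And>i. i < n \<Longrightarrow> C_on k n U (D i)"
  shows "C_on (Suc k) n U f"
proof -
  have "pderiv_at i f x = D i x" if "i < n" "x \<in> U" for i x
    unfolding pderiv_at_def by (rule DERIV_imp_deriv[OF assms(3)[OF that]])
  then have "C_on k n U (pderiv_at i f)" if "i < n" for i
    by (intro C_on_cong[OF assms(1) _ assms(4)[OF that]]) (use that in simp)
  then show ?thesis using assms(2,3) by (auto simp: real_differentiable_def)
qed

lemma C_on_SucE:
  assumes "C_on (Suc k) n U f" "i < n"
  shows "C_on k n U (pderiv_at i f)"
    and "x \<in> U \<Longrightarrow> ((\<lambda>t. f (x(i := t))) has_real_derivative pderiv_at i f x) (at (x i))"
proof -
  note A = assms(1)[THEN C_on.simps(2)[THEN iffD1], THEN conjunct2, rule_format, OF assms(2)]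
  show "C_on k n U (pderiv_at i f)" using A by blast
  show "((\<lambda>t. f (x(i := t))) has_real_derivative pderiv_at i f x) (at (x i))" if "x \<in> U"
    unfolding pderiv_at_def using A that by (intro DERIV_deriv_iff_real_differentiable[THEN iffD2]) blast
qed

context
  fixes n :: nat and U :: "(nat \<Rightarrow> real) set"
  assumes U: "openin (Euclidean_space n) U"
begin

lemma C_on_const: "C_on k n U (\<lambda>_. c)"
proof (induction k arbitrary: c)
  case (Suc k)
  show ?case by (rule C_on_SucI[OF U, where D = "\<lambda>_ _. 0"]) (simp_all add: Suc)
qed simp

lemma C_on_coord: "C_on k n U (\<lambda>x. x i)"
proof -
  have c: "continuous_map (subtopology (Euclidean_space n) U) euclideanreal (\<lambda>x. x i)"
    unfolding continuous_map_Euclidean_subspace[OF openin_subset[OF U]]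
    by (rule continuous_on_product_coordinates[THEN continuous_on_subset]) simp
  show ?thesis
  proof (cases k)
    case (Suc k)
    show ?thesis unfolding Suc
    proof (rule C_on_SucI[OF U c, where D = "\<lambda>l _. if l = i then 1 else 0"])
      show "((\<lambda>t. (x(l := t)) i) has_real_derivative (if l = i then 1 else 0)) (at (x l))" for l x
        by (cases "l = i") auto
    qed (rule C_on_const)
  qed (use c in simp)
qed

lemma C_on_add: "C_on k n U f \<Longrightarrow> C_on k n U g \<Longrightarrow> C_on k n U (\<lambda>x. f x + g x)"
proof (induction k arbitrary: f g)
  case (Suc k)
  show ?case
  proof (rule C_on_SucI[OF U, where D = "\<lambda>i x. pderiv_at i f x + pderiv_at i g x"])
    fix i x assume i: "i < n" "x \<in> U"
    show "((\<lambda>t. f (x(i := t)) + g (x(i := t))) has_real_derivative pderiv_at i f x + pderiv_at i g x) (at (x i))"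
      by (rule DERIV_add[OF C_on_SucE(2)[OF Suc.prems(1) i] C_on_SucE(2)[OF Suc.prems(2) i]])
  next
    fix i assume i: "i < n"
    show "C_on k n U (\<lambda>x. pderiv_at i f x + pderiv_at i g x)"
      by (intro Suc.IH C_on_SucE(1)[OF Suc.prems(1) i] C_on_SucE(1)[OF Suc.prems(2) i])
  qed (intro continuous_map_add C_on_continuous[OF Suc.prems(1)] C_on_continuous[OF Suc.prems(2)])
qed (auto intro: continuous_map_add)

lemma C_on_mult: "C_on k n U f \<Longrightarrow> C_on k n U g \<Longrightarrow> C_on k n U (\<lambda>x. f x * g x)"
proof (induction k arbitrary: f g)
  case (Suc k)
  show ?case
  proof (rule C_on_SucI[OF U, where D = "\<lambda>i x. pderiv_at i f x * g x + pderiv_at i g x * f x"])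
    fix i x assume i: "i < n" "x \<in> U"
    show "((\<lambda>t. f (x(i := t)) * g (x(i := t))) has_real_derivative
        pderiv_at i f x * g x + pderiv_at i g x * f x) (at (x i))"
      by (rule DERIV_cong[OF DERIV_mult[OF C_on_SucE(2)[OF Suc.prems(1) i] C_on_SucE(2)[OF Suc.prems(2) i]]])
        (simp only: fun_upd_triv)
  next
    fix i assume i: "i < n"
    show "C_on k n U (\<lambda>x. pderiv_at i f x * g x + pderiv_at i g x * f x)"
      by (intro C_on_add Suc.IH C_on_SucE(1)[OF Suc.prems(1) i] C_on_SucE(1)[OF Suc.prems(2) i]
          C_on_SucD[OF Suc.prems(1)] C_on_SucD[OF Suc.prems(2)])
  qed (intro continuous_map_real_mult C_on_continuous[OF Suc.prems(1)] C_on_continuous[OF Suc.prems(2)])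
qed (auto intro: continuous_map_real_mult)

text \<open>\<open>h\<close> lists the successive derivatives of the outer function, so the chain
  rule moves the induction one step along the list.\<close>

lemma C_on_compose:
  fixes h :: "nat \<Rightarrow> real \<Rightarrow> real"
  assumes h: "\<And>j t. t \<in> S \<Longrightarrow> (h j has_real_derivative h (Suc j) t) (at t)"
    and fS: "\<And>x. x \<in> U \<Longrightarrow> f x \<in> S"
  shows "C_on k n U f \<Longrightarrow> C_on k n U (\<lambda>x. h j (f x))"
proof (induction k arbitrary: j)
  have cont: "continuous_map (subtopology (Euclidean_space n) U) euclideanreal (\<lambda>x. h j (f x))"
    if f: "continuous_map (subtopology (Euclidean_space n) U) euclideanreal f" for j
  proof -
    have "continuous_on U f"
      using f unfolding continuous_map_Euclidean_subspace[OF openin_subset[OF U]] .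
    moreover have "continuous_on S (h j)"
      by (intro continuous_at_imp_continuous_on ballI DERIV_isCont[OF h])
    ultimately have "continuous_on U (\<lambda>x. h j (f x))"
      using fS by (intro continuous_on_compose2[of S "h j" U f]) auto
    then show ?thesis unfolding continuous_map_Euclidean_subspace[OF openin_subset[OF U]] .
  qed
  {
    case 0
    then show ?case using cont by simp
  next
    case (Suc k)
    show ?case
    proof (rule C_on_SucI[OF U, where D = "\<lambda>i x. h (Suc j) (f x) * pderiv_at i f x"])
      show "continuous_map (subtopology (Euclidean_space n) U) euclideanreal (\<lambda>x. h j (f x))"
        by (rule cont[OF C_on_continuous[OF Suc.prems]])
    next
      fix i x assume i: "i < n" "x \<in> U"
      show "((\<lambda>t. h j (f (x(i := t)))) has_real_derivative h (Suc j) (f x) * pderiv_at i f x) (at (x i))"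
        by (rule DERIV_chain2[where g = "\<lambda>t. f (x(i := t))", OF _ C_on_SucE(2)[OF Suc.prems i]])
          (simp only: fun_upd_triv h[OF fS[OF i(2)]])
    next
      fix i assume i: "i < n"
      show "C_on k n U (\<lambda>x. h (Suc j) (f x) * pderiv_at i f x)"
        by (intro C_on_mult Suc.IH C_on_SucE(1)[OF Suc.prems i] C_on_SucD[OF Suc.prems])
    qed
  }
qed

lemma smooth_fun_on_const: "smooth_fun_on n U (\<lambda>_. c)"
  by (simp add: smooth_fun_on_def C_on_const)

lemma smooth_fun_on_coord: "smooth_fun_on n U (\<lambda>x. x i)"
  by (simp add: smooth_fun_on_def C_on_coord)

lemma smooth_fun_on_add: "smooth_fun_on n U f \<Longrightarrow> smooth_fun_on n U g \<Longrightarrow> smooth_fun_on n U (\<lambda>x. f x + g x)"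
  by (simp add: smooth_fun_on_def C_on_add)

lemma smooth_fun_on_mult: "smooth_fun_on n U f \<Longrightarrow> smooth_fun_on n U g \<Longrightarrow> smooth_fun_on n U (\<lambda>x. f x * g x)"
  by (simp add: smooth_fun_on_def C_on_mult)

lemma smooth_fun_on_diff:
  assumes "smooth_fun_on n U f" "smooth_fun_on n U g" shows "smooth_fun_on n U (\<lambda>x. f x - g x)"
  using smooth_fun_on_add[OF assms(1) smooth_fun_on_mult[OF smooth_fun_on_const[of "- 1"] assms(2)]] by simp

lemma smooth_fun_on_sum:
  assumes "finite I" "\<And>i. i \<in> I \<Longrightarrow> smooth_fun_on n U (f i)"
  shows "smooth_fun_on n U (\<lambda>x. \<Sum>i\<in>I. f i x)"
  using assms by (induction I rule: finite_induct) (auto intro: smooth_fun_on_const smooth_fun_on_add)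

lemma smooth_fun_on_power: "smooth_fun_on n U f \<Longrightarrow> smooth_fun_on n U (\<lambda>x. f x ^ k)"
  by (induction k) (auto intro: smooth_fun_on_const smooth_fun_on_mult)

lemma smooth_fun_on_prod:
  assumes "finite I" "\<And>i. i \<in> I \<Longrightarrow> smooth_fun_on n U (f i)"
  shows "smooth_fun_on n U (\<lambda>x. \<Prod>i\<in>I. f i x)"
  using assms by (induction I rule: finite_induct) (auto intro: smooth_fun_on_const smooth_fun_on_mult)

lemma smooth_fun_on_sin:
  assumes f: "smooth_fun_on n U f" shows "smooth_fun_on n U (\<lambda>x. sin (f x))"
proof -
  \<comment> \<open>A phase shift by pi / 2 per derivative covers all derivatives of the sine by one
    formula.\<close>
  have d: "((\<lambda>t. sin (t + real j * pi / 2)) has_real_derivative sin (t + real (Suc j) * pi / 2)) (at t)" for j t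
  proof -
    have "t + real (Suc j) * pi / 2 = (t + real j * pi / 2) + pi / 2" by (simp add: algebra_simps add_divide_distrib)
    then have "sin (t + real (Suc j) * pi / 2) = cos (t + real j * pi / 2)" by (simp only: sin_add) simp
    then show ?thesis by (auto intro!: derivative_eq_intros)
  qed
  have "C_on k n U (\<lambda>x. sin (f x))" for k
    using C_on_compose[where S = UNIV and h = "\<lambda>j t. sin (t + real j * pi / 2)" and j = 0 and f = f and k = k]
      d f by (simp add: smooth_fun_on_def)
  then show ?thesis by (simp add: smooth_fun_on_def)
qed

lemma smooth_fun_on_cos:
  assumes f: "smooth_fun_on n U f" shows "smooth_fun_on n U (\<lambda>x. cos (f x))"
proof -
  have "smooth_fun_on n U (\<lambda>x. sin (f x + pi / 2))"
    by (intro smooth_fun_on_sin smooth_fun_on_add f smooth_fun_on_const)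
  then show ?thesis by (simp add: sin_add)
qed

lemma smooth_fun_on_powr:
  assumes f: "smooth_fun_on n U f" and pos: "\<And>x. x \<in> U \<Longrightarrow> f x > 0"
  shows "smooth_fun_on n U (\<lambda>x. f x powr a)"
proof -
  \<comment> \<open>Falling factorials, the factors that repeated differentiation of a power
    produces.\<close>
  define c where "c j = (\<Prod>i<j. a - real i)" for j
  have d: "((\<lambda>t. c j * t powr (a - real j)) has_real_derivative c (Suc j) * t powr (a - real (Suc j))) (at t)"
    if "t \<in> {0<..}" for j t
  proof -
    have "((\<lambda>t. t powr (a - real j)) has_real_derivative (a - real j) * t powr (a - real j - 1)) (at t)"
      using that by (intro has_real_derivative_powr) simp
    from DERIV_cmult[OF this, of "c j"] show ?thesis by (simp add: c_def algebra_simps)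
  qed
  have "C_on k n U (\<lambda>x. f x powr a)" for k
    using C_on_compose[where S = "{0<..}" and h = "\<lambda>j t. c j * t powr (a - real j)" and j = 0 and f = f and k = k]
      d f pos by (simp add: smooth_fun_on_def c_def)
  then show ?thesis by (simp add: smooth_fun_on_def)
qed

lemma smooth_fun_on_cong:
  assumes "smooth_fun_on n U f" "\<And>x. x \<in> U \<Longrightarrow> f x = g x" shows "smooth_fun_on n U g"
  using assms C_on_cong[OF U] unfolding smooth_fun_on_def by blast

lemma smooth_fun_on_sqrt:
  assumes f: "smooth_fun_on n U f" and pos: "\<And>x. x \<in> U \<Longrightarrow> f x > 0"
  shows "smooth_fun_on n U (\<lambda>x. sqrt (f x))"
  by (rule smooth_fun_on_cong[OF smooth_fun_on_powr[OF f pos, of "1 / 2"]])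
    (use pos in \<open>auto simp: powr_half_sqrt less_imp_le\<close>)

lemma smooth_fun_on_inverse:
  assumes f: "smooth_fun_on n U f" and pos: "\<And>x. x \<in> U \<Longrightarrow> f x > 0"
  shows "smooth_fun_on n U (\<lambda>x. inverse (f x))"
  by (rule smooth_fun_on_cong[OF smooth_fun_on_powr[OF f pos, of "- 1"]])
    (use pos in \<open>auto simp: powr_minus less_imp_le\<close>)

definition csmooth_on :: "((nat \<Rightarrow> real) \<Rightarrow> complex) \<Rightarrow> bool" where
  "csmooth_on f \<longleftrightarrow> smooth_fun_on n U (\<lambda>x. Re (f x)) \<and> smooth_fun_on n U (\<lambda>x. Im (f x))"

lemma csmooth_on_const: "csmooth_on (\<lambda>_. c)"
  by (simp add: csmooth_on_def smooth_fun_on_const)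

lemma csmooth_on_add: "csmooth_on f \<Longrightarrow> csmooth_on g \<Longrightarrow> csmooth_on (\<lambda>x. f x + g x)"
  by (simp add: csmooth_on_def smooth_fun_on_add)

lemma csmooth_on_diff: "csmooth_on f \<Longrightarrow> csmooth_on g \<Longrightarrow> csmooth_on (\<lambda>x. f x - g x)"
  by (simp add: csmooth_on_def smooth_fun_on_diff)

lemma csmooth_on_mult: "csmooth_on f \<Longrightarrow> csmooth_on g \<Longrightarrow> csmooth_on (\<lambda>x. f x * g x)"
  by (simp add: csmooth_on_def smooth_fun_on_add smooth_fun_on_diff smooth_fun_on_mult)

lemma csmooth_on_sum:
  assumes "finite I" "\<And>i. i \<in> I \<Longrightarrow> csmooth_on (f i)"
  shows "csmooth_on (\<lambda>x. \<Sum>i\<in>I. f i x)"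
  using assms by (induction I rule: finite_induct) (auto intro: csmooth_on_const csmooth_on_add)

lemma csmooth_on_cis: "smooth_fun_on n U f \<Longrightarrow> csmooth_on (\<lambda>x. cis (f x))"
  by (simp add: csmooth_on_def smooth_fun_on_sin smooth_fun_on_cos)

lemma csmooth_on_Complex: "smooth_fun_on n U f \<Longrightarrow> smooth_fun_on n U g \<Longrightarrow> csmooth_on (\<lambda>x. Complex (f x) (g x))"
  by (simp add: csmooth_on_def)

lemma smooth_fun_on_norm_squared: "csmooth_on f \<Longrightarrow> smooth_fun_on n U (\<lambda>x. (cmod (f x))\<^sup>2)"
  unfolding cmod_power2 csmooth_on_def by (auto intro: smooth_fun_on_add smooth_fun_on_power)

end

section \<open>Chains with rotated edges\<close>

definition heron :: "real \<Rightarrow> real \<Rightarrow> complex \<Rightarrow> complex \<Rightarrow> real" where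
  "heron l1 l2 P Q = 4 * l1\<^sup>2 * (cmod (Q - P))\<^sup>2 - ((cmod (Q - P))\<^sup>2 + l1\<^sup>2 - l2\<^sup>2)\<^sup>2"

text \<open>The third vertex of a triangle on the segment from \<open>P\<close> to \<open>Q\<close> with sides \<open>l1\<close>, \<open>l2\<close>, on the side
  given by the sign \<open>s\<close>; it is meaningful only where \<^const>\<open>heron\<close>, which is 16 times the squared
  area, is positive.\<close>

definition apex :: "real \<Rightarrow> real \<Rightarrow> real \<Rightarrow> complex \<Rightarrow> complex \<Rightarrow> complex" where
  "apex s l1 l2 P Q = P + (Q - P) *
     (Complex ((cmod (Q - P))\<^sup>2 + l1\<^sup>2 - l2\<^sup>2) (s * sqrt (heron l1 l2 P Q)) *
      of_real (inverse (2 * (cmod (Q - P))\<^sup>2)))"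

lemma heron_pos_imp: "heron l1 l2 P Q > 0 \<Longrightarrow> (cmod (Q - P))\<^sup>2 > 0"
proof (rule ccontr)
  assume h: "heron l1 l2 P Q > 0" and "\<not> (cmod (Q - P))\<^sup>2 > 0"
  then have "(cmod (Q - P))\<^sup>2 = 0" by simp
  then have "heron l1 l2 P Q = - ((l1\<^sup>2 - l2\<^sup>2)\<^sup>2)" by (simp add: heron_def)
  then show False using h by (simp add: not_less[symmetric])
qed

lemma cmod_diff_squared: "(cmod (z - D))\<^sup>2 = (cmod z)\<^sup>2 - 2 * Re (cnj D * z) + (cmod D)\<^sup>2"
  unfolding cmod_power2 by (simp add: power2_eq_square algebra_simps)

text \<open>Dividing by the base turns the triangle into a complex number. The law of cosines gives
  its real part, and the square root of \<open>heron\<close> is what remains for the height.\<close>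

lemma apex_dist:
  assumes h: "heron l1 l2 P Q > 0" and s: "s\<^sup>2 = 1" and l: "l1 \<ge> 0" "l2 \<ge> 0"
  shows "cmod (apex s l1 l2 P Q - P) = l1" "cmod (Q - apex s l1 l2 P Q) = l2"
    and "Im (cnj (Q - P) * (apex s l1 l2 P Q - P)) = s * sqrt (heron l1 l2 P Q) / 2"
proof -
  define D where "D = Q - P"
  define N where "N = (cmod D)\<^sup>2"
  define z where "z = apex s l1 l2 P Q - P"
  have N: "N > 0" using heron_pos_imp[OF h] by (simp add: N_def D_def)
  have H: "heron l1 l2 P Q = 4 * l1\<^sup>2 * N - (N + l1\<^sup>2 - l2\<^sup>2)\<^sup>2" by (simp add: heron_def N_def D_def)
  define w where "w = Complex (N + l1\<^sup>2 - l2\<^sup>2) (s * sqrt (heron l1 l2 P Q))"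
  have z: "z = D * (w * of_real (inverse (2 * N)))" by (simp add: z_def apex_def w_def D_def N_def)
  have "(cmod w)\<^sup>2 = (N + l1\<^sup>2 - l2\<^sup>2)\<^sup>2 + heron l1 l2 P Q"
    unfolding cmod_power2 using h s by (simp add: w_def power_mult_distrib)
  then have w2: "(cmod w)\<^sup>2 = 4 * l1\<^sup>2 * N" by (simp add: H)
  have "(cmod z)\<^sup>2 = N * ((cmod w)\<^sup>2 * (inverse (2 * N))\<^sup>2)"
    unfolding z norm_mult power_mult_distrib norm_of_real power2_abs N_def[symmetric] ..
  also have "\<dots> = l1\<^sup>2" unfolding w2 using N by (simp add: field_simps power2_eq_square)
  finally have z2: "(cmod z)\<^sup>2 = l1\<^sup>2" .
  have cD: "cnj D * D = of_real N" by (simp add: N_def complex_norm_square mult.commute del: of_real_power)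
  have "cnj D * z = w * of_real (N * inverse (2 * N))" unfolding z mult.assoc[symmetric] cD by simp
  then have cDz: "cnj D * z = w * of_real (1 / 2)" using N by simp
  show "Im (cnj (Q - P) * (apex s l1 l2 P Q - P)) = s * sqrt (heron l1 l2 P Q) / 2"
    unfolding z_def[symmetric] D_def[symmetric] cDz by (simp add: w_def)
  have "(cmod (z - D))\<^sup>2 = l2\<^sup>2" unfolding cmod_diff_squared z2 cDz by (simp add: w_def N_def[symmetric] field_simps)
  moreover have "z - D = - (Q - apex s l1 l2 P Q)" by (simp add: z_def D_def)
  ultimately have "(cmod (Q - apex s l1 l2 P Q))\<^sup>2 = l2\<^sup>2" by (simp only: norm_minus_cancel)
  then show "cmod (Q - apex s l1 l2 P Q) = l2" using l by (simp add: power2_eq_iff_nonneg)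
  show "cmod (apex s l1 l2 P Q - P) = l1" using z2 l by (simp add: z_def power2_eq_iff_nonneg)
qed

text \<open>Two side lengths fix the third vertex up to reflection in the base. The sign of the
  cross product selects the side and at the same time makes the triangle nondegenerate.\<close>

lemma apex_unique:
  assumes d: "cmod (z - P) = l1" "cmod (Q - z) = l2" and s: "s\<^sup>2 = 1"
    and pos: "s * Im (cnj (Q - P) * (z - P)) > 0"
  shows "heron l1 l2 P Q > 0" "apex s l1 l2 P Q = z"
proof -
  define D where "D = Q - P"
  define N where "N = (cmod D)\<^sup>2"
  define G where "G = cnj D * (z - P)"
  have "(cmod ((z - P) - D))\<^sup>2 = l2\<^sup>2"
    using d(2) by (simp add: D_def norm_minus_commute)
  then have ReG: "2 * Re G = N + l1\<^sup>2 - l2\<^sup>2"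
    unfolding cmod_diff_squared d(1) by (simp add: G_def N_def)
  have "(cmod G)\<^sup>2 = N * l1\<^sup>2" by (simp add: G_def norm_mult power_mult_distrib N_def d(1))
  then have "(2 * Im G)\<^sup>2 = 4 * l1\<^sup>2 * N - (2 * Re G)\<^sup>2"
    unfolding cmod_power2 by (simp add: power_mult_distrib algebra_simps)
  then have H: "heron l1 l2 P Q = (2 * Im G)\<^sup>2" unfolding ReG by (simp add: heron_def N_def D_def)
  have p: "s * Im G > 0" using pos by (simp add: G_def D_def)
  then have "Im G \<noteq> 0" by auto
  then show "heron l1 l2 P Q > 0" unfolding H by simp
  have N: "N > 0" using heron_pos_imp[OF \<open>heron l1 l2 P Q > 0\<close>] by (simp add: N_def D_def)
  have "s = 1 \<or> s = -1" using s by (simp add: power2_eq_1_iff)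
  then have "s * sqrt (heron l1 l2 P Q) = 2 * Im G"
    unfolding H real_sqrt_abs using p by auto
  then have "Complex (N + l1\<^sup>2 - l2\<^sup>2) (s * sqrt (heron l1 l2 P Q)) = 2 * G"
    using ReG by (simp add: complex_eq_iff)
  then have "apex s l1 l2 P Q = P + D * (2 * G * of_real (inverse (2 * N)))"
    unfolding apex_def N_def D_def by simp
  also have "\<dots> = P + (D * cnj D) * (z - P) / of_real N" using N by (simp add: G_def field_simps)
  also have "D * cnj D = of_real N" by (simp add: N_def complex_norm_square del: of_real_power)
  finally show "apex s l1 l2 P Q = z" using N by simp
qed

text \<open>Away from vertex \<open>j\<close> both parts of the chain rotate freely: the lower one
  hangs on \<open>p 0\<close>, the upper one on the prescribed end \<open>q\<close>. Vertex
  \<open>j\<close> closes the gap with its two original edge lengths, on the same side as in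
  \<open>p\<close>.\<close>

definition bend :: "(nat \<Rightarrow> complex) \<Rightarrow> nat \<Rightarrow> nat \<Rightarrow> complex \<Rightarrow> (nat \<Rightarrow> real) \<Rightarrow> nat \<Rightarrow> complex" where
  "bend p m j q \<theta> =
     (let lo = (\<lambda>k. p 0 + (\<Sum>i<k. (p (Suc i) - p i) * cis (\<theta> i)));
          hi = (\<lambda>k. q - (\<Sum>i\<in>{k..<m}. (p (Suc i) - p i) * cis (\<theta> i)))
      in (\<lambda>k. if k < j then lo k else if k > j then hi k
         else apex (sgn (Im (cnj (p (Suc j) - p (j - 1)) * (p j - p (j - 1)))))
           (cmod (p j - p (j - 1))) (cmod (p (Suc j) - p j)) (lo (j - 1)) (hi (Suc j))))"

locale bendable =
  fixes p :: "nat \<Rightarrow> complex" and m j :: nat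
  assumes j: "0 < j" "j < m"
    and bent: "Im (cnj (p (Suc j) - p (j - 1)) * (p j - p (j - 1))) \<noteq> 0"
begin

abbreviation "sn \<equiv> sgn (Im (cnj (p (Suc j) - p (j - 1)) * (p j - p (j - 1))))"
abbreviation "la \<equiv> cmod (p j - p (j - 1))"
abbreviation "lb \<equiv> cmod (p (Suc j) - p j)"

lemma bend_less: "k < j \<Longrightarrow> bend p m j q \<theta> k = p 0 + (\<Sum>i<k. (p (Suc i) - p i) * cis (\<theta> i))"
  by (simp add: bend_def)

lemma bend_greater: "k > j \<Longrightarrow> bend p m j q \<theta> k = q - (\<Sum>i\<in>{k..<m}. (p (Suc i) - p i) * cis (\<theta> i))"
  by (simp add: bend_def)

lemma bend_apex: "bend p m j q \<theta> j = apex sn la lb (bend p m j q \<theta> (j - 1)) (bend p m j q \<theta> (Suc j))"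
proof -
  have "j - 1 < j" "\<not> j < j" "\<not> Suc j < j" "j < Suc j" using j by auto
  then show ?thesis by (simp only: bend_def Let_def if_True if_False)
qed

lemma bend_0: "bend p m j q \<theta> 0 = p 0"
  using j by (simp add: bend_less)

lemma bend_m: "bend p m j q \<theta> m = q"
  using j by (simp add: bend_greater)

lemma bend_edge_less: "Suc i < j \<Longrightarrow> bend p m j q \<theta> (Suc i) - bend p m j q \<theta> i = (p (Suc i) - p i) * cis (\<theta> i)"
  by (simp add: bend_less)

lemma bend_edge_greater:
  "j < i \<Longrightarrow> i < m \<Longrightarrow> bend p m j q \<theta> (Suc i) - bend p m j q \<theta> i = (p (Suc i) - p i) * cis (\<theta> i)"
  using sum.atLeast_Suc_lessThan[of i m "\<lambda>i. (p (Suc i) - p i) * cis (\<theta> i)"]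
  by (simp only: bend_greater less_SucI) simp

lemma sn2: "sn\<^sup>2 = 1"
proof -
  have "(sgn x)\<^sup>2 = 1" if "x \<noteq> 0" for x :: real using that by (simp add: sgn_if)
  then show ?thesis using bent by blast
qed

abbreviation "bend_ok q \<theta> \<equiv> heron la lb (bend p m j q \<theta> (j - 1)) (bend p m j q \<theta> (Suc j)) > 0"

lemma bend_dist:
  assumes "bend_ok q \<theta>" "i < m"
  shows "cmod (bend p m j q \<theta> (Suc i) - bend p m j q \<theta> i) = cmod (p (Suc i) - p i)"
proof -
  note a = apex_dist[OF assms(1) sn2 norm_ge_zero norm_ge_zero, folded bend_apex]
  consider "Suc i < j" | "Suc i = j" | "i = j" | "j < i" by linarith
  then show ?thesis
  proof cases
    case 2
    then show ?thesis using a(1) by (auto simp: norm_minus_commute)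
  next
    case 3
    then show ?thesis using a(2) by simp
  qed (use assms(2) in \<open>simp_all add: bend_edge_less bend_edge_greater norm_mult\<close>)
qed

text \<open>The rotations determine every vertex but \<open>j\<close>, working inwards from both
  ends; two lengths and the orientation then determine vertex \<open>j\<close>.\<close>

lemma bend_eqI:
  assumes q0: "q 0 = p 0" and lo: "\<And>i. Suc i < j \<Longrightarrow> q (Suc i) - q i = (p (Suc i) - p i) * cis (\<theta> i)"
    and hi: "\<And>i. j < i \<Longrightarrow> i < m \<Longrightarrow> q (Suc i) - q i = (p (Suc i) - p i) * cis (\<theta> i)"
    and d: "cmod (q j - q (j - 1)) = la" "cmod (q (Suc j) - q j) = lb"
    and or: "sn * Im (cnj (q (Suc j) - q (j - 1)) * (q j - q (j - 1))) > 0"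
  shows "bend_ok (q m) \<theta>" "k \<le> m \<Longrightarrow> bend p m j (q m) \<theta> k = q k"
proof -
  have less: "bend p m j (q m) \<theta> k = q k" if "k < j" for k
    using that
  proof (induction k)
    case 0
    then show ?case by (simp add: bend_0 q0)
  next
    case (Suc k)
    then show ?case using bend_edge_less[of k "q m" \<theta>] lo[of k] by (simp add: diff_eq_eq)
  qed
  have greater: "bend p m j (q m) \<theta> k = q k" if "j < k" "k \<le> m" for k
    using that(2,1)
  proof (induction k rule: inc_induct)
    case base
    then show ?case by (simp add: bend_m)
  next
    case (step i)
    then show ?case using bend_edge_greater[of i "q m" \<theta>] hi[of i] by (simp add: algebra_simps)
  qed
  have nb: "bend p m j (q m) \<theta> (j - 1) = q (j - 1)" "bend p m j (q m) \<theta> (Suc j) = q (Suc j)"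
    using j by (auto intro: less greater)
  note u = apex_unique[OF d sn2 or]
  show "bend_ok (q m) \<theta>" unfolding nb by (rule u(1))
  show "bend p m j (q m) \<theta> k = q k" if "k \<le> m"
  proof (cases k j rule: linorder_cases)
    case equal
    then show ?thesis by (simp only: bend_apex nb u(2))
  qed (use less greater that in auto)
qed

lemma bend_id: "bend_ok (p m) (\<lambda>_. 0)" "k \<le> m \<Longrightarrow> bend p m j (p m) (\<lambda>_. 0) k = p k"
proof -
  have "sn * Im (cnj (p (Suc j) - p (j - 1)) * (p j - p (j - 1))) > 0"
  proof -
    have "sgn x * x > 0" if "x \<noteq> 0" for x :: real using that by (simp add: sgn_if)
    then show ?thesis using bent by blast
  qed
  note or = this
  show "bend_ok (p m) (\<lambda>_. 0)"
    by (rule bend_eqI(1)[where q = p]; (rule refl | rule or | simp only: cis_zero mult_1_right))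
  show "bend p m j (p m) (\<lambda>_. 0) k = p k" if "k \<le> m"
    by (rule bend_eqI(2)[where q = p]; (rule refl | rule or | rule that | simp only: cis_zero mult_1_right))
qed

end

section \<open>Perpendicular vectors and velocities of curves\<close>

lemma perpendicular_complex:
  fixes a b :: complex
  assumes "Re (cnj a * b) = 0" "a \<noteq> 0"
  shows "b = \<i> * of_real (Im (b / a)) * a"
proof -
  have n: "(cmod a)\<^sup>2 \<noteq> 0" using assms(2) by simp
  have "b / a = cnj a * b / of_real ((cmod a)\<^sup>2)"
    using assms(2) by (simp add: complex_norm_square field_simps del: of_real_power)
  then have "Re (b / a) = 0" using assms(1) by (simp only: Re_divide_of_real div_0)
  then have "b / a = \<i> * of_real (Im (b / a))" by (simp only: complex_eq_iff) simp
  then show ?thesis using assms(2) by (metis nonzero_eq_divide_eq)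
qed

lemma parallel_complex:
  fixes a b :: complex
  assumes "Im (cnj a * b) = 0" "a \<noteq> 0"
  shows "b = of_real (Re (b / a)) * a"
proof -
  have "b / a = cnj a * b / of_real ((cmod a)\<^sup>2)"
    using assms(2) by (simp add: complex_norm_square field_simps del: of_real_power)
  then have "Im (b / a) = 0" using assms(1) by (simp only: Im_divide_of_real div_0)
  then have "b / a = of_real (Re (b / a))" by (simp only: complex_eq_iff) simp
  then show ?thesis using assms(2) by (metis nonzero_eq_divide_eq)
qed

lemma perpendicular_two:
  fixes a b z :: complex
  assumes "Re (cnj a * z) = 0" "Re (cnj b * z) = 0" "Im (cnj a * b) \<noteq> 0"
  shows "z = 0"
proof (rule ccontr)
  assume z: "z \<noteq> 0"
  have "Re (cnj z * a) = 0" "Re (cnj z * b) = 0" using assms(1,2) by (simp_all add: mult.commute)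
  from this[THEN perpendicular_complex[OF _ z]] obtain x y where "a = \<i> * of_real x * z" "b = \<i> * of_real y * z"
    by blast
  then have "cnj a * b = of_real (x * y) * (cnj z * z)" by (simp add: algebra_simps)
  also have "\<dots> = of_real (x * y * (cmod z)\<^sup>2)" by (simp add: complex_norm_square mult.commute del: of_real_power)
  finally show False using assms(3) by (simp only: Im_complex_of_real)
qed

lemma norm_squared_has_real_derivative:
  assumes "(f has_vector_derivative f') (at t)"
  shows "((\<lambda>t. (cmod (f t))\<^sup>2) has_real_derivative 2 * Re (cnj (f t) * f')) (at t)"
proof -
  have "((\<lambda>t. Re (f t)) has_real_derivative Re f') (at t)" "((\<lambda>t. Im (f t)) has_real_derivative Im f') (at t)"
    using assms by (simp_all add: has_vector_derivative_complex_iff)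
  then have "((\<lambda>t. (Re (f t))\<^sup>2 + (Im (f t))\<^sup>2) has_real_derivative 2 * Re (cnj (f t) * f')) (at t)"
    by (intro DERIV_cong[OF DERIV_add[OF DERIV_power DERIV_power]]) (auto simp: algebra_simps)
  then show ?thesis unfolding cmod_power2 .
qed

lemma constant_length_derivative:
  assumes f: "(f has_vector_derivative f') (at 0)" and c: "\<forall>\<^sub>F t in nhds 0. cmod (f t) = l"
  shows "Re (cnj (f 0) * f') = 0"
proof -
  have "\<forall>\<^sub>F t in nhds 0. (cmod (f t))\<^sup>2 = l\<^sup>2" using c by eventually_elim simp
  then have "((\<lambda>t. l\<^sup>2) has_real_derivative 2 * Re (cnj (f 0) * f')) (at 0)"
    using norm_squared_has_real_derivative[OF f] by (subst (asm) DERIV_cong_ev[OF refl _ refl]) auto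
  from DERIV_unique[OF this DERIV_const] show ?thesis by simp
qed

lemma difference_quotient_sequence:
  fixes f :: "real \<Rightarrow> complex"
  assumes f: "(f has_vector_derivative v) (at 0)" and t: "t \<longlonglongrightarrow> 0" "\<And>n. t n \<noteq> 0"
  shows "(\<lambda>n. (f (t n) - f 0) / of_real (t n)) \<longlonglongrightarrow> v"
proof -
  have "((\<lambda>h. norm (f (0 + h) - f 0 - h *\<^sub>R v) / norm h) \<longlongrightarrow> 0) (at 0)"
    using f unfolding has_vector_derivative_def has_derivative_at by blast
  moreover have "filterlim t (at 0) sequentially" using t by (simp add: filterlim_at)
  ultimately have "(\<lambda>n. norm (f (0 + t n) - f 0 - t n *\<^sub>R v) / norm (t n)) \<longlonglongrightarrow> 0"
    by (rule filterlim_compose)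
  moreover have "norm (f (0 + t n) - f 0 - t n *\<^sub>R v) / norm (t n) = norm ((f (t n) - f 0) / of_real (t n) - v)" for n
  proof -
    have "(f (t n) - f 0) / of_real (t n) - v = (f (0 + t n) - f 0 - t n *\<^sub>R v) / of_real (t n)"
      using t(2)[of n] by (simp add: diff_divide_distrib scaleR_conv_of_real)
    then show ?thesis by (simp only: norm_divide norm_of_real real_norm_def)
  qed
  ultimately have "(\<lambda>n. norm ((f (t n) - f 0) / of_real (t n) - v)) \<longlonglongrightarrow> 0" by simp
  then show ?thesis by (simp add: tendsto_norm_zero_iff LIM_zero_iff)
qed

lemma config_velocityI:
  assumes \<gamma>: "\<forall>\<^sub>F t in nhds (0::real). \<gamma> t \<in> configs L" and P: "\<And>a. a \<in> fst L \<Longrightarrow> \<gamma> 0 a = P a"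
    and v: "\<And>a. a \<in> fst L \<Longrightarrow> ((\<lambda>t. \<gamma> t a) has_vector_derivative v a) (at 0)"
  shows "config_velocity L P v"
proof -
  obtain e where e: "e > 0" "\<And>t. \<bar>t\<bar> < e \<Longrightarrow> \<gamma> t \<in> configs L"
    using \<gamma> by (auto simp: eventually_nhds_metric dist_real_def)
  \<comment> \<open>\<open>Suc (Suc n)\<close> keeps every step strictly below
    \<open>e\<close>.\<close>
  define t where "t n = e * inverse (real (Suc (Suc n)))" for n
  have t: "0 < t n" "\<bar>t n\<bar> < e" for n
  proof -
    have "inverse (real (Suc (Suc n))) < 1" by (simp add: inverse_less_1_iff)
    then have "t n < e * 1" unfolding t_def using e(1) by (intro mult_strict_left_mono)
    moreover show "0 < t n" using e(1) by (simp add: t_def)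
    ultimately show "\<bar>t n\<bar> < e" by simp
  qed
  have "(\<lambda>n. e * inverse (real (Suc n))) \<longlonglongrightarrow> e * 0"
    by (intro tendsto_mult_left LIMSEQ_inverse_real_of_nat)
  then have lim: "t \<longlonglongrightarrow> 0" unfolding t_def using LIMSEQ_Suc by fastforce
  have "(\<lambda>n. (\<gamma> (t n) a - P a) / of_real (t n)) \<longlonglongrightarrow> v a" if "a \<in> fst L" for a
    using difference_quotient_sequence[OF v[OF that] lim] t(1) P[OF that] by (simp add: less_imp_neq[symmetric])
  moreover have "\<gamma> (t n) \<in> configs L" for n by (rule e(2)) (rule t(2))
  ultimately show ?thesis
    unfolding config_velocity_def using t(1) lim
    by (intro exI[of _ t] exI[of _ "\<lambda>n. \<gamma> (t n)"] conjI allI ballI) auto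
qed

lemma cis_has_vector_derivative:
  "((\<lambda>t. cis (y * t)) has_vector_derivative \<i> * of_real y) (at 0)"
proof -
  have "((\<lambda>t. cos (y * t)) has_real_derivative 0) (at 0)" "((\<lambda>t. sin (y * t)) has_real_derivative y) (at 0)"
    by (auto intro!: derivative_eq_intros)
  then show ?thesis by (simp add: has_vector_derivative_complex_iff)
qed

text \<open>Along the given sequence, a rotation by \<open>s * t n\<close> and a translation by
  \<open>t n * b\<close> add the infinitesimal rigid motion to the velocity.\<close>

lemma config_velocity_add_rigid:
  assumes v: "config_velocity L P v" and w: "\<And>a. a \<in> fst L \<Longrightarrow> w a = v a + (\<i> * of_real s * P a + b)"
    and wf: "\<And>a b l. (a, b, l) \<in> snd L \<Longrightarrow> a \<in> fst L \<and> b \<in> fst L"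
  shows "config_velocity L P w"
proof -
  obtain t \<gamma> where t: "\<And>n. 0 < t n" "t \<longlonglongrightarrow> 0" and \<gamma>: "\<And>n. \<gamma> n \<in> configs L"
    and vel: "\<And>a. a \<in> fst L \<Longrightarrow> (\<lambda>n. (\<gamma> n a - P a) / of_real (t n)) \<longlonglongrightarrow> v a"
    using v unfolding config_velocity_def by blast
  define \<delta> where "\<delta> n = (\<lambda>a\<in>fst L. cis (s * t n) * \<gamma> n a + of_real (t n) * b)" for n
  have "\<delta> n \<in> configs L" for n
  proof -
    have "dist (\<delta> n u) (\<delta> n u') = l" if e: "(u, u', l) \<in> snd L" for u u' l
    proof -
      have "dist (\<delta> n u) (\<delta> n u') = norm (cis (s * t n) * (\<gamma> n u - \<gamma> n u'))"
        using wf[OF e] by (simp add: \<delta>_def dist_norm right_diff_distrib)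
      also have "\<dots> = dist (\<gamma> n u) (\<gamma> n u')" by (simp add: norm_mult dist_norm)
      finally show ?thesis using configs_dist[OF \<gamma> e] by simp
    qed
    then show ?thesis by (auto simp: configs_def \<delta>_def)
  qed
  moreover have "(\<lambda>n. (\<delta> n a - P a) / of_real (t n)) \<longlonglongrightarrow> w a" if a: "a \<in> fst L" for a
  proof -
    have tn: "t n \<noteq> 0" for n using t(1)[of n] by simp
    have "(\<lambda>n. (cis (s * t n) - cis (s * 0)) / of_real (t n)) \<longlonglongrightarrow> \<i> * of_real s"
      by (rule difference_quotient_sequence[OF cis_has_vector_derivative t(2) tn])
    then have q: "(\<lambda>n. (cis (s * t n) - 1) / of_real (t n)) \<longlonglongrightarrow> \<i> * of_real s" by simp
    have "isCont (\<lambda>t. cis (s * t)) 0"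
      using cis_has_vector_derivative[of s] by (rule has_vector_derivative_continuous)
    from isCont_tendsto_compose[OF this t(2)] have c: "(\<lambda>n. cis (s * t n)) \<longlonglongrightarrow> 1" by simp
    have "(\<delta> n a - P a) / of_real (t n) = cis (s * t n) * ((\<gamma> n a - P a) / of_real (t n))
        + (cis (s * t n) - 1) / of_real (t n) * P a + b" for n
      using a tn[of n] by (simp add: \<delta>_def field_simps)
    moreover have "(\<lambda>n. cis (s * t n) * ((\<gamma> n a - P a) / of_real (t n)) + (cis (s * t n) - 1) / of_real (t n) * P a + b)
        \<longlonglongrightarrow> 1 * v a + \<i> * of_real s * P a + b"
      by (intro tendsto_intros c q vel[OF a])
    ultimately show ?thesis by (simp add: w[OF a] add.assoc)
  qed
  ultimately show ?thesis unfolding config_velocity_def using t by blast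
qed

text \<open>Only differentiability matters here; \<open>bend_velocity\<close> finds the value of the
  derivative from the length constraints.\<close>

lemma apex_has_vector_derivative:
  assumes P: "(P has_vector_derivative P') (at t)" and Q: "(Q has_vector_derivative Q') (at t)"
    and h: "heron l1 l2 (P t) (Q t) > 0"
  shows "\<exists>D. ((\<lambda>t. apex s l1 l2 (P t) (Q t)) has_vector_derivative D) (at t)"
proof -
  have QP: "((\<lambda>t. Q t - P t) has_vector_derivative Q' - P') (at t)"
    by (rule has_vector_derivative_diff[OF Q P])
  note N = norm_squared_has_real_derivative[OF QP]
  obtain H' where H: "((\<lambda>t. heron l1 l2 (P t) (Q t)) has_real_derivative H') (at t)"
    using DERIV_diff[OF DERIV_cmult[OF N, of "4 * l1\<^sup>2"]
        DERIV_power[where n = 2, OF DERIV_diff[OF DERIV_add[OF N DERIV_const[where k = "l1\<^sup>2"]]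
          DERIV_const[where k = "l2\<^sup>2"]]]]
    unfolding heron_def by blast
  obtain S' where S: "((\<lambda>t. sqrt (heron l1 l2 (P t) (Q t))) has_real_derivative S') (at t)"
    using DERIV_chain2[OF DERIV_real_sqrt[OF h] H] by blast
  have n0: "(cmod (Q t - P t))\<^sup>2 \<noteq> 0" using heron_pos_imp[OF h] by simp
  have "2 * (cmod (Q t - P t))\<^sup>2 \<noteq> 0" using n0 by simp
  from DERIV_inverse'[OF DERIV_cmult[OF N, of 2] this]
  obtain I' where I: "((\<lambda>t. inverse (2 * (cmod (Q t - P t))\<^sup>2)) has_real_derivative I') (at t)" by blast
  have A: "((\<lambda>t. (cmod (Q t - P t))\<^sup>2 + l1\<^sup>2 - l2\<^sup>2) has_real_derivative 2 * Re (cnj (Q t - P t) * (Q' - P'))) (at t)"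
    by (rule DERIV_cong[OF DERIV_diff[OF DERIV_add[OF N DERIV_const] DERIV_const]]) simp
  have C: "((\<lambda>t. Complex ((cmod (Q t - P t))\<^sup>2 + l1\<^sup>2 - l2\<^sup>2) (s * sqrt (heron l1 l2 (P t) (Q t))))
      has_vector_derivative Complex (2 * Re (cnj (Q t - P t) * (Q' - P'))) (s * S')) (at t)"
    using A DERIV_cmult[OF S, of s] by (intro has_vector_derivative_complexI) simp_all
  have R: "((\<lambda>t. complex_of_real (inverse (2 * (cmod (Q t - P t))\<^sup>2))) has_vector_derivative of_real I') (at t)"
    using I by (intro has_vector_derivative_of_real) (simp add: has_real_derivative_iff_has_vector_derivative)
  show ?thesis
    unfolding apex_def
    by (rule exI, rule has_vector_derivative_add[OF P has_vector_derivative_mult[OF QP has_vector_derivative_mult[OF C R]]])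
qed

context bendable
begin

text \<open>Rotating edge \<open>i\<close> at speed \<open>y i\<close> reproduces \<open>v\<close>
  away from vertex \<open>j\<close>. The two edges at \<open>j\<close> keep their lengths, so the
  velocity of vertex \<open>j\<close> differs from \<open>v j\<close> by a vector perpendicular to
  two independent edges, that is, by 0.\<close>

lemma bend_velocity:
  assumes q: "(q has_vector_derivative v m) (at 0)" "q 0 = p m" and v0: "v 0 = 0"
    and e: "\<And>i. i < m \<Longrightarrow> p (Suc i) \<noteq> p i"
    and orth: "\<And>i. i < m \<Longrightarrow> Re (cnj (p (Suc i) - p i) * (v (Suc i) - v i)) = 0"
    and y: "\<And>i. i < m \<Longrightarrow> y i = Im ((v (Suc i) - v i) / (p (Suc i) - p i))"
  shows "\<forall>\<^sub>F t in nhds 0. bend_ok (q t) (\<lambda>i. y i * t)"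
    and "k \<le> m \<Longrightarrow> ((\<lambda>t. bend p m j (q t) (\<lambda>i. y i * t) k) has_vector_derivative v k) (at 0)"
proof -
  let ?b = "\<lambda>k t. bend p m j (q t) (\<lambda>i. y i * t) k"
  have b0: "?b k 0 = p k" if "k \<le> m" for k using bend_id(2)[OF that] by (simp add: q(2))
  have step: "(p (Suc i) - p i) * (\<i> * of_real (y i)) = v (Suc i) - v i" if "i < m" for i
  proof -
    have "p (Suc i) - p i \<noteq> 0" using e[OF that] by simp
    from perpendicular_complex[OF orth[OF that] this] show ?thesis by (simp only: y[OF that] mult_ac)
  qed
  have edge: "((\<lambda>t. (p (Suc i) - p i) * cis (y i * t)) has_vector_derivative v (Suc i) - v i) (at 0)" if "i < m" for i
    unfolding step[OF that, symmetric] by (rule has_vector_derivative_mult_right[OF cis_has_vector_derivative])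
  have lo: "(?b k has_vector_derivative v k) (at 0)" if k: "k < j" for k
  proof -
    have "((\<lambda>t. p 0 + (\<Sum>i<k. (p (Suc i) - p i) * cis (y i * t))) has_vector_derivative 0 + (\<Sum>i<k. v (Suc i) - v i)) (at 0)"
      using k j by (intro has_vector_derivative_add has_vector_derivative_const has_vector_derivative_sum edge) auto
    moreover have "(\<Sum>i<k. v (Suc i) - v i) = v k" by (simp only: sum_lessThan_telescope v0 diff_zero)
    ultimately show ?thesis using k by (simp only: bend_less add_0)
  qed
  have hi: "(?b k has_vector_derivative v k) (at 0)" if k: "j < k" "k \<le> m" for k
  proof -
    have "((\<lambda>t. q t - (\<Sum>i\<in>{k..<m}. (p (Suc i) - p i) * cis (y i * t))) has_vector_derivative v m - (\<Sum>i\<in>{k..<m}. v (Suc i) - v i)) (at 0)"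
      by (intro has_vector_derivative_diff q(1) has_vector_derivative_sum edge) auto
    moreover have "(\<Sum>i\<in>{k..<m}. v (Suc i) - v i) = v m - v k" using sum_Suc_diff'[OF k(2)] .
    ultimately show ?thesis using k by (simp only: bend_greater diff_diff_eq2 add_diff_cancel_left')
  qed
  have jl: "j - 1 < j" "j < Suc j" "Suc j \<le> m" "j - 1 \<le> m" "j \<le> m" using j by auto
  have h0: "heron la lb (?b (j - 1) 0) (?b (Suc j) 0) > 0" using bend_id(1) b0[of "j - 1"] b0[of "Suc j"] bend_id(2) jl by simp
  have P: "(?b (j - 1) has_vector_derivative v (j - 1)) (at 0)" and Q: "(?b (Suc j) has_vector_derivative v (Suc j)) (at 0)"
    using lo[OF jl(1)] hi[OF jl(2,3)] .
  show ok: "\<forall>\<^sub>F t in nhds 0. bend_ok (q t) (\<lambda>i. y i * t)"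
  proof -
    have "isCont (\<lambda>t. heron la lb (?b (j - 1) t) (?b (Suc j) t)) 0"
      unfolding heron_def using has_vector_derivative_continuous[OF P] has_vector_derivative_continuous[OF Q]
      by (intro continuous_intros)
    then have "((\<lambda>t. heron la lb (?b (j - 1) t) (?b (Suc j) t)) \<longlongrightarrow> heron la lb (?b (j - 1) 0) (?b (Suc j) 0)) (nhds 0)"
      by (simp only: tendsto_nhds_iff isCont_def)
    then show ?thesis using h0 by (rule order_tendstoD(1))
  qed
  obtain D where "((\<lambda>t. apex sn la lb (?b (j - 1) t) (?b (Suc j) t)) has_vector_derivative D) (at 0)"
    using apex_has_vector_derivative[OF P Q h0] by blast
  then have D: "(?b j has_vector_derivative D) (at 0)" by (simp only: bend_apex[symmetric])
  have "Re (cnj (?b j 0 - ?b (j - 1) 0) * (D - v (j - 1))) = 0"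
  proof (rule constant_length_derivative[OF has_vector_derivative_diff[OF D P]])
    show "\<forall>\<^sub>F t in nhds 0. cmod (?b j t - ?b (j - 1) t) = la"
      using ok by eventually_elim (use bend_dist[of _ _ "j - 1"] j in auto)
  qed
  moreover have "Re (cnj (?b (Suc j) 0 - ?b j 0) * (v (Suc j) - D)) = 0"
  proof (rule constant_length_derivative[OF has_vector_derivative_diff[OF Q D]])
    show "\<forall>\<^sub>F t in nhds 0. cmod (?b (Suc j) t - ?b j t) = lb"
      using ok by eventually_elim (use bend_dist[of _ _ j] j in auto)
  qed
  moreover have "Re (cnj (p j - p (j - 1)) * (v j - v (j - 1))) = 0" "Re (cnj (p (Suc j) - p j) * (v (Suc j) - v j)) = 0"
    using orth[of "j - 1"] orth[of j] j by auto
  ultimately have "Re (cnj (p j - p (j - 1)) * (D - v j)) = 0" "Re (cnj (p (Suc j) - p j) * (D - v j)) = 0"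
    using b0 jl by (simp_all add: algebra_simps)
  moreover have "Im (cnj (p j - p (j - 1)) * (p (Suc j) - p j)) \<noteq> 0"
  proof -
    have "Im (cnj (p j - p (j - 1)) * (p (Suc j) - p j)) = - Im (cnj (p (Suc j) - p (j - 1)) * (p j - p (j - 1)))"
      by (simp add: algebra_simps)
    then show ?thesis using bent by simp
  qed
  ultimately have "D = v j" using perpendicular_two by fastforce
  then show "(?b k has_vector_derivative v k) (at 0)" if "k \<le> m"
    using that lo hi D by (cases k j rule: linorder_cases) auto
qed

end

text \<open>If every inner vertex were straight, each edge would be a real multiple of the one
  before and hence of the first, and all vertices would lie on one line.\<close>

lemma exists_bent_vertex:
  assumes e: "\<And>i. i < m \<Longrightarrow> p (Suc i) \<noteq> p i" and nc: "\<not> collinear (p ` {..m})"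
  shows "\<exists>j. bendable p m j"
proof (rule ccontr)
  assume "\<not> ?thesis"
  then have flat: "Im (cnj (p (Suc j) - p (j - 1)) * (p j - p (j - 1))) = 0" if "0 < j" "j < m" for j
    using that unfolding bendable_def by blast
  define d where "d = p (Suc 0) - p 0"
  have d: "\<exists>r. p (Suc i) - p i = of_real r * d" if "i < m" for i
    using that
  proof (induction i)
    case 0
    then show ?case by (intro exI[of _ 1]) (simp add: d_def)
  next
    case (Suc i)
    then obtain r where r: "p (Suc i) - p i = of_real r * d" by auto
    have "Im (cnj (p (Suc i) - p i) * (p (Suc (Suc i)) - p (Suc i))) = 0"
      using flat[of "Suc i"] Suc.prems by (simp add: algebra_simps)
    from parallel_complex[OF this] e[of i] Suc.prems
    obtain s where "p (Suc (Suc i)) - p (Suc i) = of_real s * (p (Suc i) - p i)" by auto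
    then have "p (Suc (Suc i)) - p (Suc i) = of_real (s * r) * d" by (simp add: r)
    then show ?case by blast
  qed
  have "\<exists>r. p i = p 0 + of_real r * d" if "i \<le> m" for i
    using that
  proof (induction i)
    case 0
    show ?case by (intro exI[of _ 0]) simp
  next
    case (Suc i)
    obtain r where r: "p i = p 0 + of_real r * d" using Suc by auto
    obtain s where "p (Suc i) - p i = of_real s * d" using d[of i] Suc.prems by auto
    with r have "p (Suc i) = p 0 + of_real (r + s) * d" by (simp add: algebra_simps)
    then show ?case by blast
  qed
  then obtain R where R: "\<And>i. i \<le> m \<Longrightarrow> p i = p 0 + of_real (R i) * d" by metis
  have "collinear (p ` {..m})"
    unfolding collinear_def
  proof (rule exI[of _ d], intro ballI)
    fix x y assume "x \<in> p ` {..m}" "y \<in> p ` {..m}"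
    then obtain i k where "x = p i" "i \<le> m" "y = p k" "k \<le> m" by auto
    then have "x - y = (R i - R k) *\<^sub>R d"
      using R[of i] R[of k] by (simp add: scaleR_conv_of_real algebra_simps)
    then show "\<exists>c. x - y = c *\<^sub>R d" by blast
  qed
  then show False using nc by blast
qed

section \<open>Charts of polygon spaces\<close>

lemma csmooth_on_apex:
  assumes U: "openin (Euclidean_space n) U" and P: "csmooth_on n U P" and Q: "csmooth_on n U Q"
    and h: "\<And>x. x \<in> U \<Longrightarrow> heron l1 l2 (P x) (Q x) > 0"
  shows "csmooth_on n U (\<lambda>x. apex s l1 l2 (P x) (Q x))"
proof -
  have N: "smooth_fun_on n U (\<lambda>x. (cmod (Q x - P x))\<^sup>2)"
    by (intro smooth_fun_on_norm_squared[OF U] csmooth_on_diff[OF U] P Q)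
  have H: "smooth_fun_on n U (\<lambda>x. heron l1 l2 (P x) (Q x))"
    unfolding heron_def
    by (intro smooth_fun_on_diff[OF U] smooth_fun_on_mult[OF U] smooth_fun_on_const[OF U]
        smooth_fun_on_power[OF U] smooth_fun_on_add[OF U] N)
  have I: "smooth_fun_on n U (\<lambda>x. inverse (2 * (cmod (Q x - P x))\<^sup>2))"
    using heron_pos_imp[OF h]
    by (intro smooth_fun_on_inverse[OF U] smooth_fun_on_mult[OF U] smooth_fun_on_const[OF U] N) auto
  have C: "csmooth_on n U (\<lambda>x. Complex ((cmod (Q x - P x))\<^sup>2 + l1\<^sup>2 - l2\<^sup>2) (s * sqrt (heron l1 l2 (P x) (Q x))))"
    by (intro csmooth_on_Complex smooth_fun_on_diff[OF U] smooth_fun_on_add[OF U]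
        smooth_fun_on_mult[OF U] smooth_fun_on_const[OF U] smooth_fun_on_sqrt[OF U] N H h U)
  have R: "csmooth_on n U (\<lambda>x. complex_of_real (inverse (2 * (cmod (Q x - P x))\<^sup>2)))"
    using I smooth_fun_on_const[OF U, of 0] by (simp add: csmooth_on_def[OF U] del: of_real_inverse of_real_mult of_real_power)
  show ?thesis
    unfolding apex_def by (intro csmooth_on_add[OF U] csmooth_on_mult[OF U] csmooth_on_diff[OF U] P Q C R)
qed

text \<open>Configurations are constant outside the vertex set, so inclusion into the full function
  space is continuous. This allows \<open>continuous_on\<close> to be used for functions of
  configurations.\<close>

lemma openin_config_space:
  assumes "openin (top_of_set (configs L)) S"
  shows "openin (config_space L) S"
proof -
  have "continuous_map (config_space L) (product_topology (\<lambda>_. euclidean) UNIV) (\<lambda>p. p)"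
    unfolding continuous_map_componentwise_UNIV
  proof
    fix k
    show "continuous_map (config_space L) euclidean (\<lambda>p. p k)"
    proof (cases "k \<in> fst L")
      case True
      then show ?thesis unfolding config_space_def
        by (intro continuous_map_from_subtopology continuous_map_product_coordinates)
    next
      case False
      have "continuous_map (config_space L) euclidean (\<lambda>_. undefined :: complex)" by simp
      then show ?thesis
        by (rule continuous_map_eq) (use False in \<open>auto simp: topspace_config_space configs_def PiE_def extensional_def\<close>)
    qed
  qed
  then have "continuous_map (config_space L) (top_of_set (configs L)) (\<lambda>p. p)"
    by (intro continuous_map_into_subtopology) (auto simp: euclidean_product_topology topspace_config_space)
  from openin_continuous_map_preimage[OF this assms] have "openin (config_space L) {p \<in> configs L. p \<in> S}"
    by (simp add: topspace_config_space)
  moreover have "{p \<in> configs L. p \<in> S} = S" using openin_subset[OF assms] by auto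
  ultimately show ?thesis by simp
qed

lemma config_class_eqI:
  assumes "norm c = 1" and Q: "\<And>v. v \<in> fst L \<Longrightarrow> Q v = c * P v + b"
  shows "config_class L P = config_class L Q"
proof -
  have c: "cnj c * c = 1" "norm (cnj c) = 1" using assms(1) by (simp_all add: complex_norm_square[symmetric] mult.commute)
  have P: "P v = cnj c * Q v + (- cnj c * b)" if "v \<in> fst L" for v
    using c(1) by (simp add: Q[OF that] algebra_simps flip: mult.assoc)
  show ?thesis
  proof (intro equalityI subsetI)
    fix q assume "q \<in> config_class L P"
    then obtain d e where "q \<in> configs L" "norm d = 1" "\<And>v. v \<in> fst L \<Longrightarrow> q v = d * P v + e"
      by (auto simp: config_class_def)
    then show "q \<in> config_class L Q"
      unfolding config_class_def using c(2)
      by (intro CollectI conjI exI[of _ "d * cnj c"] exI[of _ "e - d * cnj c * b"]) (auto simp: norm_mult P algebra_simps)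
  next
    fix q assume "q \<in> config_class L Q"
    then obtain d e where "q \<in> configs L" "norm d = 1" "\<And>v. v \<in> fst L \<Longrightarrow> q v = d * Q v + e"
      by (auto simp: config_class_def)
    then show "q \<in> config_class L P"
      unfolding config_class_def using assms(1)
      by (intro CollectI conjI exI[of _ "d * c"] exI[of _ "e + d * b"]) (auto simp: norm_mult Q algebra_simps)
  qed
qed

definition polygon_lengths :: "nat \<Rightarrow> (nat \<Rightarrow> complex) \<Rightarrow> real list" where
  "polygon_lengths n p = map (\<lambda>i. dist (p i) (p (Suc i mod n))) [0..<n]"

lemma snd_polygon_linkage:
  "(a, b, l) \<in> snd (polygon_linkage (polygon_lengths n p)) \<longleftrightarrow>
     a < n \<and> b = Suc a mod n \<and> l = dist (p a) (p (Suc a mod n))"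
  by (auto simp: polygon_linkage_def polygon_lengths_def)

lemma fst_polygon_linkage: "fst (polygon_linkage (polygon_lengths n p)) = {..<n}"
  by (simp add: polygon_linkage_def polygon_lengths_def)

lemma polygon_configs:
  "q \<in> configs (polygon_linkage (polygon_lengths (Suc m) p)) \<longleftrightarrow>
     q \<in> extensional {..<Suc m} \<and> (\<forall>i<m. cmod (q (Suc i) - q i) = cmod (p (Suc i) - p i)) \<and>
     cmod (q m - q 0) = cmod (p m - p 0)"
proof -
  have "q \<in> configs (polygon_linkage (polygon_lengths (Suc m) p)) \<longleftrightarrow>
     q \<in> extensional {..<Suc m} \<and>
     (\<forall>i<Suc m. dist (q i) (q (Suc i mod Suc m)) = dist (p i) (p (Suc i mod Suc m)))"
    unfolding configs_def
    by (simp add: PiE_def fst_polygon_linkage Ball_def split_paired_All snd_polygon_linkage)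
  also have "\<dots> \<longleftrightarrow> q \<in> extensional {..<Suc m} \<and> (\<forall>i<m. cmod (q (Suc i) - q i) = cmod (p (Suc i) - p i)) \<and>
     cmod (q m - q 0) = cmod (p m - p 0)"
    by (auto simp: All_less_Suc dist_norm norm_minus_commute)
  finally show ?thesis .
qed

lemma polygon_wf: "(a, b, l) \<in> snd (polygon_linkage (polygon_lengths n p)) \<Longrightarrow>
    a \<in> fst (polygon_linkage (polygon_lengths n p)) \<and> b \<in> fst (polygon_linkage (polygon_lengths n p))"
  by (auto simp: fst_polygon_linkage snd_polygon_linkage)

locale bent_polygon = bendable +
  assumes edges: "\<And>i. i < m \<Longrightarrow> p (Suc i) \<noteq> p i" and closing: "p m \<noteq> p 0"
begin

abbreviation "L \<equiv> polygon_linkage (polygon_lengths (Suc m) p)"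
text \<open>A polygon with \<open>m + 1\<close> sides has \<open>m + 1 - 3\<close> degrees of
  freedom modulo isometries. Here they are the rotations of all edges except the closing one and the
  two at vertex \<open>j\<close>.\<close>

abbreviation "d \<equiv> m - 2"

text \<open>\<open>ang\<close> and \<open>idx\<close> renumber between coordinates and edges; the
  two edges \<open>j - 1\<close> and \<open>j\<close> are skipped, hence the shift by 2.\<close>

definition ang :: "(nat \<Rightarrow> real) \<Rightarrow> nat \<Rightarrow> real" where
  "ang x i = (if i < j - 1 then x i else x (i - 2))"

definition idx :: "nat \<Rightarrow> nat" where
  "idx l = (if l < j - 1 then l else l + 2)"

lemma ang_idx: "ang x (idx l) = x l"
  by (auto simp: ang_def idx_def)

lemma idx_cases:
  assumes "i < m" "Suc i < j \<or> j < i"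
  obtains l where "l < d" "idx l = i"
proof (cases "Suc i < j")
  case True
  then show ?thesis using j by (intro that[of i]) (auto simp: idx_def)
next
  case False
  then show ?thesis using assms j by (intro that[of "i - 2"]) (auto simp: idx_def)
qed

lemma idx_bounds: "l < d \<Longrightarrow> idx l < m" "Suc (idx l) < j \<or> j < idx l"
  using j by (auto simp: idx_def)

abbreviation "bd x \<equiv> bend p m j (p m) (ang x)"

text \<open>The bound pi / 2 on the angles lets \<open>arcsin\<close> recover them.\<close>

definition "pdom = {x. (\<forall>i\<ge>d. x i = 0) \<and> (\<forall>l<d. \<bar>x l\<bar> < pi / 2) \<and> bend_ok (p m) (ang x)}"

definition "chart x = (\<lambda>k\<in>{..<Suc m}. bd x k)"

lemma bd_edge: "l < d \<Longrightarrow> bd x (Suc (idx l)) - bd x (idx l) = (p (Suc (idx l)) - p (idx l)) * cis (x l)"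
  using bend_edge_less[of "idx l" "p m" "ang x"] bend_edge_greater[of "idx l" "p m" "ang x"] idx_bounds[of l]
  by (auto simp: ang_idx)

lemma continuous_bd: "k \<noteq> j \<Longrightarrow> continuous_on UNIV (\<lambda>x. bd x k)"
proof -
  have a: "continuous_on UNIV (\<lambda>x. ang x i)" for i
    unfolding ang_def by (cases "i < j - 1") (auto intro: continuous_on_product_coordinates)
  show "continuous_on UNIV (\<lambda>x. bd x k)" if "k \<noteq> j"
    using that by (cases "k < j") (auto simp: bend_less bend_greater not_less intro!: continuous_intros a)
qed

lemma open_dom: "openin (Euclidean_space d) pdom"
proof -
  have "continuous_on UNIV (\<lambda>x. bd x (j - 1))" "continuous_on UNIV (\<lambda>x. bd x (Suc j))"
    using j by (auto intro!: continuous_bd)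
  then have "continuous_on UNIV (\<lambda>x. heron la lb (bd x (j - 1)) (bd x (Suc j)))"
    unfolding heron_def by (intro continuous_intros)
  then have "open {x. bend_ok (p m) (ang x)}" by (intro open_Collect_less continuous_on_const)
  moreover have "open (\<Inter>l\<in>{..<d}. {x :: nat \<Rightarrow> real. \<bar>x l\<bar> < pi / 2})"
    by (intro open_INT finite_lessThan ballI open_Collect_less continuous_intros continuous_on_product_coordinates)
  ultimately have "open ((\<Inter>l\<in>{..<d}. {x :: nat \<Rightarrow> real. \<bar>x l\<bar> < pi / 2}) \<inter> {x. bend_ok (p m) (ang x)})"
    by (rule open_Int[rotated])
  moreover have "pdom = {x. \<forall>i\<ge>d. x i = 0} \<inter>
      ((\<Inter>l\<in>{..<d}. {x :: nat \<Rightarrow> real. \<bar>x l\<bar> < pi / 2}) \<inter> {x. bend_ok (p m) (ang x)})"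
    unfolding pdom_def by blast
  ultimately show ?thesis unfolding Euclidean_space_top_of_set openin_open by blast
qed

lemma smooth_ang: "smooth_fun_on d pdom (\<lambda>x. ang x i)"
  unfolding ang_def by (cases "i < j - 1") (simp_all add: smooth_fun_on_coord[OF open_dom])

lemma smooth_bd: "csmooth_on d pdom (\<lambda>x. bd x k)"
proof -
  have *: "csmooth_on d pdom (\<lambda>x. bd x k)" if "k \<noteq> j" for k
  proof (cases "k < j")
    case True
    then show ?thesis unfolding bend_less[OF True]
      by (intro csmooth_on_add[OF open_dom] csmooth_on_const[OF open_dom] csmooth_on_sum[OF open_dom]
          csmooth_on_mult[OF open_dom] csmooth_on_cis[OF open_dom] smooth_ang) simp
  next
    case False
    then have "j < k" using that by simp
    then show ?thesis unfolding bend_greater[OF \<open>j < k\<close>]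
      by (intro csmooth_on_diff[OF open_dom] csmooth_on_const[OF open_dom] csmooth_on_sum[OF open_dom]
          csmooth_on_mult[OF open_dom] csmooth_on_cis[OF open_dom] smooth_ang) simp
  qed
  show ?thesis
  proof (cases "k = j")
    case True
    have "csmooth_on d pdom (\<lambda>x. apex sn la lb (bd x (j - 1)) (bd x (Suc j)))"
      using j by (intro csmooth_on_apex[OF open_dom] *) (auto simp: pdom_def)
    then show ?thesis unfolding True by (subst bend_apex)
  qed (rule *)
qed

lemma chart_configs: "x \<in> pdom \<Longrightarrow> chart x \<in> configs L"
  unfolding polygon_configs using bend_dist[of "p m" "ang x"]
  by (simp add: chart_def bend_0 bend_m pdom_def)

text \<open>The rotation of edge \<open>i\<close> against its position in \<open>p\<close>, measured
  relative to the closing edge. Isometries cancel, so this is a function on congruence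
  classes.\<close>

definition "ratio i q = (q (Suc i) - q i) / (p (Suc i) - p i) * ((p m - p 0) / (q m - q 0))"

text \<open>A saturated open set of configurations, the preimage of the image of the chart. On it
  \<open>coords\<close> descends to the inverse of the chart.\<close>

definition "region = {q \<in> configs L. (\<forall>l<d. Re (ratio (idx l) q) > 0) \<and>
   sn * Im (cnj (q (Suc j) - q (j - 1)) * (q j - q (j - 1))) > 0}"

definition "coords q l = (if l < d then arcsin (Im (ratio (idx l) q)) else 0)"

lemma sn_mult: "sn * (sn * t) = t"
  using sn2 by (metis power2_eq_square mult.assoc mult_1)

text \<open>The chart keeps the closing edge fixed, so each ratio is \<open>cis\<close> of its
  coordinate, and the sign in \<open>apex\<close> preserves the orientation at vertex
  \<open>j\<close>.\<close>

lemma chart_in_region: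
  assumes x: "x \<in> pdom" shows "chart x \<in> region" "coords (chart x) = x"
proof -
  have r: "ratio (idx l) (chart x) = cis (x l)" if l: "l < d" for l
  proof -
    have "ratio (idx l) (chart x) = (bd x (Suc (idx l)) - bd x (idx l)) / (p (Suc (idx l)) - p (idx l))"
      using idx_bounds(1)[OF l] closing by (simp add: ratio_def chart_def bend_0 bend_m)
    then show ?thesis using edges[OF idx_bounds(1)[OF l]] by (simp add: bd_edge[OF l])
  qed
  have lt: "\<bar>x l\<bar> < pi / 2" if "l < d" for l using x that by (simp add: pdom_def)
  have ok: "bend_ok (p m) (ang x)" using x by (simp add: pdom_def)
  have "Im (cnj (bd x (Suc j) - bd x (j - 1)) * (bd x j - bd x (j - 1)))
      = sn * (sqrt (heron la lb (bd x (j - 1)) (bd x (Suc j))) / 2)"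
    using apex_dist(3)[OF ok sn2, folded bend_apex] by simp
  then have "sn * Im (cnj (bd x (Suc j) - bd x (j - 1)) * (bd x j - bd x (j - 1))) > 0"
    unfolding sn_mult using ok by (simp only: sn_mult) simp
  moreover have "chart x (Suc j) = bd x (Suc j)" "chart x j = bd x j" "chart x (j - 1) = bd x (j - 1)"
    using j by (auto simp: chart_def)
  ultimately have orient: "sn * Im (cnj (chart x (Suc j) - chart x (j - 1)) * (chart x j - chart x (j - 1))) > 0"
    by (simp only:)
  show "chart x \<in> region"
  proof -
    have "cos (x l) > 0" if "l < d" for l using lt[OF that] by (intro cos_gt_zero_pi) auto
    then show ?thesis unfolding region_def using r chart_configs[OF x] orient by auto
  qed
  show "coords (chart x) = x"
  proof
    fix l
    show "coords (chart x) l = x l"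
    proof (cases "l < d")
      case True
      then show ?thesis using lt[OF True] by (simp add: coords_def r arcsin_sin abs_less_iff)
    next
      case False
      then show ?thesis using x by (simp add: coords_def pdom_def)
    qed
  qed
qed

text \<open>An isometry multiplies all differences by one unit, which cancels in the ratios and in
  the cross product at vertex \<open>j\<close>.\<close>

lemma region_invariant:
  assumes q: "q \<in> configs L" "q' \<in> configs L" "config_class L q = config_class L q'" and r: "q' \<in> region"
  shows "q \<in> region" "coords q = coords q'"
proof -
  obtain c b where c: "norm c = 1" and cb: "\<And>v. v < Suc m \<Longrightarrow> q v = c * q' v + b"
    using config_class_eqD[OF q(1,3)] by (auto simp: fst_polygon_linkage)
  have c0: "c \<noteq> 0" using c by auto
  have cc: "cnj c * c = 1" using c by (simp add: complex_norm_square[symmetric] mult.commute)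
  have diff: "q u - q v = c * (q' u - q' v)" if "u < Suc m" "v < Suc m" for u v
    using that by (simp add: cb right_diff_distrib)
  have ratio: "ratio (idx l) q = ratio (idx l) q'" if "l < d" for l
    unfolding ratio_def using idx_bounds(1)[OF that] c0 by (simp add: diff)
  have "cnj (c * z) * (c * w) = cnj z * w" for z w
  proof -
    have "cnj (c * z) * (c * w) = (cnj c * c) * (cnj z * w)" by (simp add: algebra_simps)
    then show ?thesis by (simp add: cc)
  qed
  then have "cnj (q (Suc j) - q (j - 1)) * (q j - q (j - 1)) = cnj (q' (Suc j) - q' (j - 1)) * (q' j - q' (j - 1))"
  proof -
    assume eq: "\<And>z w. cnj (c * z) * (c * w) = cnj z * w"
    have "Suc j < Suc m" "j - 1 < Suc m" "j < Suc m" using j by auto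
    then show ?thesis by (simp only: diff eq)
  qed
  note E = this
  have "sn * Im (cnj (q' (Suc j) - q' (j - 1)) * (q' j - q' (j - 1))) > 0" "\<forall>l<d. Re (ratio (idx l) q') > 0"
    using r unfolding region_def mem_Collect_eq by blast+
  then show "q \<in> region" unfolding region_def mem_Collect_eq E using q(1) ratio by simp
  show "coords q = coords q'" by (auto simp: coords_def ratio)
qed

text \<open>The isometry \<open>q'\<close> puts the closing edge back to its position in
  \<open>p\<close>. The ratios that remain are units with positive real part, hence
  \<open>cis\<close> of an \<open>arcsin\<close>, and \<open>bend_eqI\<close> recognizes the bent
  chain.\<close>

lemma region_chart:
  assumes q: "q \<in> region"
  shows "coords q \<in> pdom" "config_class L (chart (coords q)) = config_class L q"
proof -
  have qc: "q \<in> configs L" using q by (simp add: region_def)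
  have len: "\<And>i. i < m \<Longrightarrow> cmod (q (Suc i) - q i) = cmod (p (Suc i) - p i)" "cmod (q m - q 0) = cmod (p m - p 0)"
    using qc unfolding polygon_configs by auto
  have qm: "q m - q 0 \<noteq> 0" using len(2) closing by auto
  define c where "c = (p m - p 0) / (q m - q 0)"
  have c: "norm c = 1" using len(2) closing by (simp add: c_def norm_divide)
  define q' where "q' k = c * q k + (p 0 - c * q 0)" for k
  have diff: "q' u - q' v = c * (q u - q v)" for u v by (simp add: q'_def right_diff_distrib)
  have q'0: "q' 0 = p 0" by (simp add: q'_def)
  have "q' m = c * (q m - q 0) + p 0" by (simp add: q'_def algebra_simps)
  then have q'm: "q' m = p m" using qm by (simp add: c_def)
  have edge: "q' (Suc i) - q' i = (p (Suc i) - p i) * cis (ang (coords q) i)" if i: "i < m" "Suc i < j \<or> j < i" for i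
  proof -
    obtain l where l: "l < d" "idx l = i" using idx_cases[OF i] .
    have e: "p (Suc i) - p i \<noteq> 0" using edges[OF i(1)] by simp
    define u where "u = ratio i q"
    have "u = (q' (Suc i) - q' i) / (p (Suc i) - p i)" by (simp add: u_def ratio_def diff c_def mult.commute)
    then have qu: "q' (Suc i) - q' i = (p (Suc i) - p i) * u" using e by simp
    have "cmod u = 1" using len(1)[OF i(1)] len(2) e closing by (simp add: u_def ratio_def norm_mult norm_divide)
    moreover have "Re u > 0" using q l by (auto simp: region_def u_def)
    ultimately have sq: "(Re u)\<^sup>2 + (Im u)\<^sup>2 = 1" and Im: "-1 \<le> Im u" "Im u \<le> 1"
      using abs_Im_le_cmod[of u] by (auto simp: cmod_power2[symmetric] abs_le_iff)
    have "cos (arcsin (Im u)) = sqrt (1 - (Im u)\<^sup>2)" by (rule cos_arcsin[OF Im])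
    also have "1 - (Im u)\<^sup>2 = (Re u)\<^sup>2" using sq by simp
    finally have "cos (arcsin (Im u)) = Re u" using \<open>Re u > 0\<close> by simp
    then have "u = cis (arcsin (Im u))" using Im by (simp add: complex_eq_iff)
    moreover have "ang (coords q) i = arcsin (Im u)" using l by (auto simp: ang_idx coords_def u_def)
    ultimately show ?thesis using qu by simp
  qed
  have jm: "j - 1 < m" "j < m" "Suc (j - 1) = j" using j by auto
  have l1: "cmod (q' j - q' (j - 1)) = la" "cmod (q' (Suc j) - q' j) = lb"
    using len(1)[OF jm(1)] len(1)[OF jm(2)] c unfolding jm(3) by (simp_all add: diff norm_mult)
  have cc: "cnj c * c = 1" using c by (simp add: complex_norm_square[symmetric] mult.commute)
  have "cnj (c * z) * (c * w) = cnj z * w" for z w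
  proof -
    have "cnj (c * z) * (c * w) = (cnj c * c) * (cnj z * w)" by (simp add: algebra_simps)
    then show ?thesis by (simp add: cc)
  qed
  then have or: "sn * Im (cnj (q' (Suc j) - q' (j - 1)) * (q' j - q' (j - 1))) > 0"
    using q unfolding diff by (simp only: region_def mem_Collect_eq)
  note B = bend_eqI[where q = q' and \<theta> = "ang (coords q)", OF q'0 _ _ l1 or, unfolded q'm]
  have B1: "bend_ok (p m) (ang (coords q))" by (rule B(1)) (use edge j in auto)
  have B2: "bd (coords q) k = q' k" if "k \<le> m" for k by (rule B(2)) (use edge j that in auto)
  have "\<bar>coords q l\<bar> < pi / 2" if l: "l < d" for l
  proof -
    have "Re (ratio (idx l) q) > 0" using q l by (simp add: region_def)
    moreover have "cmod (ratio (idx l) q) = 1"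
      using len(1)[OF idx_bounds(1)[OF l]] len(2) edges[OF idx_bounds(1)[OF l]] closing
      by (simp add: ratio_def norm_mult norm_divide)
    ultimately have "\<bar>Im (ratio (idx l) q)\<bar> < 1"
      using abs_Im_le_cmod[of "ratio (idx l) q"] cmod_power2[of "ratio (idx l) q"]
      by (metis abs_square_eq_1 add.commute add_cancel_right_right less_eq_real_def less_irrefl one_power2 power2_abs zero_eq_power2)
    then have "- (pi / 2) < arcsin (Im (ratio (idx l) q)) \<and> arcsin (Im (ratio (idx l) q)) < pi / 2"
      by (intro arcsin_lt_bounded) auto
    moreover have "coords q l = arcsin (Im (ratio (idx l) q))" using l by (simp add: coords_def)
    ultimately show ?thesis by linarith
  qed
  then show "coords q \<in> pdom" using B1 by (simp add: pdom_def coords_def)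
  show "config_class L (chart (coords q)) = config_class L q"
    by (rule config_class_eqI[OF c, symmetric]) (simp add: fst_polygon_linkage chart_def B2 q'_def)
qed

lemma continuous_ratio: "i < m \<Longrightarrow> continuous_on (configs L) (ratio i)"
proof -
  have "q m - q 0 \<noteq> 0" if "q \<in> configs L" for q
    using that closing unfolding polygon_configs by auto
  then show "continuous_on (configs L) (ratio i)" if "i < m"
    unfolding ratio_def using edges[OF that]
    by (intro continuous_intros continuous_on_product_coordinates[THEN continuous_on_subset]) auto
qed

text \<open>Openness is shown upstairs, on configurations, where the ratios are continuous; the
  quotient topology then yields openness in the reduced space.\<close>

lemma openin_coords:
  assumes O: "openin (Euclidean_space d) O'"
  shows "openin (config_space L) {q \<in> region. coords q \<in> O'}"
proof (rule openin_config_space)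
  note coord = continuous_on_product_coordinates[THEN continuous_on_subset, OF subset_UNIV]
  define F where "F q = sn * Im (cnj (q (Suc j) - q (j - 1)) * (q j - q (j - 1)))" for q
  have "continuous_on (configs L) F"
    unfolding F_def by (intro continuous_intros coord)
  then have "openin (top_of_set (configs L)) {q \<in> configs L. F q \<in> {0<..}}"
    using continuous_openin_preimage_gen[of "configs L" F "{0<..}"] by (simp add: vimage_def Int_def)
  moreover have "openin (top_of_set (configs L)) (configs L \<inter> (\<Inter>l\<in>{..<d}. {q \<in> configs L. Re (ratio (idx l) q) \<in> {0<..}}))"
  \<comment> \<open>For \<open>d = 0\<close> the intersection runs over an empty family and has to
    be treated apart.\<close>
  proof (cases "d = 0")
    case False
    have "openin (top_of_set (configs L)) {q \<in> configs L. Re (ratio (idx l) q) \<in> {0<..}}" if "l < d" for l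
      using continuous_openin_preimage_gen[of "configs L" "\<lambda>q. Re (ratio (idx l) q)" "{0<..}"]
        continuous_on_Re[OF continuous_ratio[OF idx_bounds(1)[OF that]]] by (simp add: vimage_def Int_def)
    moreover have "0 \<in> {..<d}" using False by simp
    then have "{..<d} \<noteq> {}" by blast
    ultimately show ?thesis by (intro openin_Int openin_INT2) auto
  qed auto
  ultimately have "openin (top_of_set (configs L))
     ({q \<in> configs L. F q \<in> {0<..}} \<inter>
      (configs L \<inter> (\<Inter>l\<in>{..<d}. {q \<in> configs L. Re (ratio (idx l) q) \<in> {0<..}})))"
    by (rule openin_Int)
  also have "\<dots> = region" unfolding region_def F_def[symmetric] by auto
  finally have reg: "openin (top_of_set (configs L)) region" .
  have sub: "region \<subseteq> configs L" by (auto simp: region_def)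
  have "continuous_on region coords"
  proof (rule continuous_on_coordinatewise_then_product)
    fix l
    show "continuous_on region (\<lambda>q. coords q l)"
    proof (cases "l < d")
      case True
      have "-1 \<le> Im (ratio (idx l) q) \<and> Im (ratio (idx l) q) \<le> 1" if "q \<in> region" for q
      proof -
        have "cmod (ratio (idx l) q) = 1"
          using that sub idx_bounds(1)[OF True] edges[OF idx_bounds(1)[OF True]] closing
          unfolding ratio_def norm_mult norm_divide
          by (auto simp: polygon_configs)
        then show ?thesis using abs_Im_le_cmod[of "ratio (idx l) q"] by (auto simp: abs_le_iff)
      qed
      moreover have "continuous_on region (\<lambda>q. Im (ratio (idx l) q))"
        by (intro continuous_on_Im continuous_on_subset[OF continuous_ratio sub] idx_bounds True)
      ultimately have "continuous_on region (\<lambda>q. arcsin (Im (ratio (idx l) q)))"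
        by (intro continuous_on_arcsin) auto
      then show ?thesis using True by (simp add: coords_def)
    qed (simp add: coords_def)
  qed
  moreover obtain W where W: "open W" "O' = {x. \<forall>i\<ge>d. x i = 0} \<inter> W"
    using O unfolding Euclidean_space_top_of_set openin_open by auto
  ultimately have "openin (top_of_set region) (region \<inter> coords -` W)"
    by (intro continuous_openin_preimage_gen)
  then have "openin (top_of_set (configs L)) (region \<inter> coords -` W)"
    using openin_trans[OF _ reg] by blast
  also have "region \<inter> coords -` W = {q \<in> region. coords q \<in> O'}"
    unfolding W(2) by (auto simp: coords_def)
  finally show "openin (top_of_set (configs L)) {q \<in> region. coords q \<in> O'}" .
qed

lemma chart_open_image:
  assumes "openin (Euclidean_space d) O'" "O' \<subseteq> pdom"
  shows "openin (reduced_space L) ((config_class L \<circ> chart) ` O')"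
  unfolding openin_reduced_space
proof
  show "(config_class L \<circ> chart) ` O' \<subseteq> config_class L ` configs L"
    using assms(2) chart_configs by auto
  have "{p \<in> configs L. config_class L p \<in> (config_class L \<circ> chart) ` O'} = {q \<in> region. coords q \<in> O'}"
  proof (intro equalityI subsetI; clarsimp)
    fix q x assume q: "q \<in> configs L" "config_class L q = config_class L (chart x)" "x \<in> O'"
    then have x: "x \<in> pdom" using assms(2) by auto
    show "q \<in> region \<and> coords q \<in> O'"
      using region_invariant[OF q(1) chart_configs[OF x] q(2) chart_in_region(1)[OF x]] chart_in_region(2)[OF x] q(3)
      by simp
  next
    fix q assume q: "q \<in> region" "coords q \<in> O'"
    then have "q \<in> configs L" by (simp add: region_def)
    moreover have "config_class L q = config_class L (chart (coords q))" using region_chart(2)[OF q(1)] by simp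
    ultimately show "q \<in> configs L \<and> config_class L q \<in> (\<lambda>x. config_class L (chart x)) ` O'" using q(2) by blast
  qed
  then show "openin (config_space L) {p \<in> configs L. config_class L p \<in> (config_class L \<circ> chart) ` O'}"
    using openin_coords[OF assms(1)] by simp
qed

lemma chart_embedding:
  "embedding_map (subtopology (Euclidean_space d) pdom) (reduced_space L) (config_class L \<circ> chart)"
proof (rule injective_open_imp_embedding_map)
  have sub: "pdom \<subseteq> topspace (Euclidean_space d)" using openin_subset[OF open_dom] .
  have "continuous_map (subtopology (Euclidean_space d) pdom) (product_topology (\<lambda>_. euclidean) {..<Suc m}) chart"
    unfolding continuous_map_componentwise
  proof (intro conjI ballI)
    fix k assume k: "k \<in> {..<Suc m}"
    have "continuous_on pdom (\<lambda>x. Re (bd x k))" "continuous_on pdom (\<lambda>x. Im (bd x k))"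
      using smooth_bd[of k, unfolded csmooth_on_def[OF open_dom] smooth_fun_on_def, THEN conjunct1, rule_format, of 0]
        smooth_bd[of k, unfolded csmooth_on_def[OF open_dom] smooth_fun_on_def, THEN conjunct2, rule_format, of 0]
      by (simp_all add: continuous_map_Euclidean_subspace[OF sub])
    then have "continuous_on pdom (\<lambda>x. Complex (Re (bd x k)) (Im (bd x k)))" by (rule continuous_on_Complex)
    then show "continuous_map (subtopology (Euclidean_space d) pdom) euclidean (\<lambda>x. chart x k)"
      using k unfolding continuous_map_Euclidean_subspace[OF sub] by (simp add: chart_def)
  qed (auto simp: chart_def)
  then have "continuous_map (subtopology (Euclidean_space d) pdom) (config_space L) chart"
    unfolding config_space_def fst_polygon_linkage
    by (intro continuous_map_into_subtopology) (use chart_configs in auto)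
  then show "continuous_map (subtopology (Euclidean_space d) pdom) (reduced_space L) (config_class L \<circ> chart)"
    using continuous_map_compose quotient_imp_continuous_map[OF quotient_map_config_class] by blast
  show "open_map (subtopology (Euclidean_space d) pdom) (reduced_space L) (config_class L \<circ> chart)"
    unfolding open_map_def
  proof (intro allI impI)
    fix O' assume "openin (subtopology (Euclidean_space d) pdom) O'"
    then have "openin (Euclidean_space d) O'" "O' \<subseteq> pdom"
      using openin_trans_full[OF _ open_dom] openin_subset by fastforce+
    then show "openin (reduced_space L) ((config_class L \<circ> chart) ` O')" by (rule chart_open_image)
  qed
  show "inj_on (config_class L \<circ> chart) (topspace (subtopology (Euclidean_space d) pdom))"
  proof (rule inj_onI)
    fix x y assume "x \<in> topspace (subtopology (Euclidean_space d) pdom)" "y \<in> topspace (subtopology (Euclidean_space d) pdom)"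
      and eq: "(config_class L \<circ> chart) x = (config_class L \<circ> chart) y"
    then have xy: "x \<in> pdom" "y \<in> pdom" by auto
    have "coords (chart x) = coords (chart y)"
      by (rule region_invariant(2)[OF chart_configs chart_configs _ chart_in_region(1)]) (use xy eq in auto)
    then show "x = y" using chart_in_region(2) xy by simp
  qed
qed

text \<open>The chart fixes the distinct vertices \<open>0\<close> and \<open>m\<close>, so the
  rigid motion is trivial. Edge \<open>idx l\<close> depends on coordinate \<open>l\<close> alone,
  which isolates \<open>h l\<close>.\<close>

lemma chart_immersion:
  assumes x: "x \<in> pdom"
    and eq: "\<And>k. k < Suc m \<Longrightarrow> (\<Sum>l<d. of_real (h l) * chart_deriv chart l x k) = \<i> * of_real s * chart x k + b"
    and l: "l < d"
  shows "h l = 0"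
proof -
  have der: "((\<lambda>t. chart (x(l := t)) k) has_vector_derivative chart_deriv chart l x k) (at (x l))"
    if "l < d" "k < Suc m" for l k
  proof -
    have "smooth_fun_on d pdom (\<lambda>y. Re (chart y k))" "smooth_fun_on d pdom (\<lambda>y. Im (chart y k))"
      using smooth_bd[of k] that unfolding csmooth_on_def[OF open_dom] by (simp_all add: chart_def)
    then show ?thesis unfolding chart_deriv_def using that x
      by (intro has_vector_derivative_complexI smooth_fun_on_partial)
  qed
  have unique: "chart_deriv chart l x k = D"
    if "l < d" "k < Suc m" "((\<lambda>t. chart (x(l := t)) k) has_vector_derivative D) (at (x l))" for l k D
    using vector_derivative_unique_at[OF der[OF that(1,2)] that(3)] .
  have "chart_deriv chart l x 0 = 0" "chart_deriv chart l x m = 0" if "l < d" for l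
    by (rule unique[OF that]; simp add: chart_def bend_0 bend_m)+
  with eq[of 0] eq[of m] have "\<i> * of_real s * p 0 + b = 0" "\<i> * of_real s * p m + b = 0"
    by (simp_all add: chart_def bend_0 bend_m)
  then have "\<i> * of_real s * p 0 = - b" "\<i> * of_real s * p m = - b"
    by (simp_all only: eq_neg_iff_add_eq_0)
  then have "\<i> * of_real s * (p m - p 0) = 0" by (simp only: right_diff_distrib) simp
  then have s0: "s = 0" using closing by simp
  with \<open>\<i> * of_real s * p 0 + b = 0\<close> have b0: "b = 0" by simp
  have zero: "(\<Sum>l<d. of_real (h l) * chart_deriv chart l x k) = 0" if "k < Suc m" for k
    using eq[OF that] by (simp add: s0 b0)
  define e where "e = p (Suc (idx l)) - p (idx l)"
  have e: "e \<noteq> 0" using edges[OF idx_bounds(1)[OF l]] by (simp add: e_def)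
  have k: "Suc (idx l) < Suc m" "idx l < Suc m" using idx_bounds(1)[OF l] by auto
  have edge: "chart y (Suc (idx l)) - chart y (idx l) = e * cis (y l)" for y
    using k bd_edge[OF l, of y] by (simp add: chart_def e_def)
  have diff: "chart_deriv chart l' x (Suc (idx l)) - chart_deriv chart l' x (idx l)
      = (if l' = l then e * (\<i> * cis (x l)) else 0)" if l': "l' < d" for l'
  proof -
    have "((\<lambda>t. e * cis ((x(l' := t)) l)) has_vector_derivative
        chart_deriv chart l' x (Suc (idx l)) - chart_deriv chart l' x (idx l)) (at (x l'))"
      using has_vector_derivative_diff[OF der[OF l' k(1)] der[OF l' k(2)]] by (simp only: edge)
    moreover have "((\<lambda>t. e * cis ((x(l' := t)) l)) has_vector_derivative (if l' = l then e * (\<i> * cis (x l)) else 0)) (at (x l'))"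
    proof (cases "l' = l")
      case True
      have "((\<lambda>t. cis t) has_vector_derivative \<i> * cis (x l)) (at (x l))"
        by (simp add: has_vector_derivative_complex_iff)
      then show ?thesis using True by (simp add: has_vector_derivative_mult_right)
    qed simp
    ultimately show ?thesis by (rule vector_derivative_unique_at)
  qed
  have "0 = (\<Sum>l'<d. of_real (h l') * (chart_deriv chart l' x (Suc (idx l)) - chart_deriv chart l' x (idx l)))"
    by (simp add: right_diff_distrib sum_subtractf zero[OF k(1)] zero[OF k(2)])
  also have "\<dots> = (\<Sum>l'<d. if l' = l then of_real (h l') * (e * (\<i> * cis (x l))) else 0)"
    by (intro sum.cong refl) (simp add: diff)
  also have "\<dots> = of_real (h l) * (e * (\<i> * cis (x l)))" using l by simp
  finally show ?thesis using e by simp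
qed

lemma reduced_chart_polygon: "reduced_chart L d pdom chart"
  unfolding reduced_chart_def
proof (intro conjI ballI allI impI)
  fix v assume "v \<in> fst L"
  then have "v < Suc m" by (simp add: fst_polygon_linkage)
  then show "smooth_fun_on d pdom (\<lambda>x. Re (chart x v))" "smooth_fun_on d pdom (\<lambda>x. Im (chart x v))"
    using smooth_bd[of v] unfolding csmooth_on_def[OF open_dom] by (simp_all add: chart_def)
next
  fix x h s b i
  assume "x \<in> pdom" "\<forall>v\<in>fst L. (\<Sum>i<d. complex_of_real (h i) *
      Complex (pderiv_at i (\<lambda>y. Re (chart y v)) x) (pderiv_at i (\<lambda>y. Im (chart y v)) x)) = \<i> * complex_of_real s * chart x v + b"
    "i < d"
  then show "h i = 0"
    using chart_immersion[of x h s b i] by (simp add: fst_polygon_linkage chart_deriv_def)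
qed (use open_dom chart_configs chart_embedding chart_open_image[OF open_dom order_refl] in auto)

lemma chart_at_polygon:
  "(\<lambda>_. 0) \<in> pdom" "chart (\<lambda>_. 0) = (\<lambda>k\<in>{..<Suc m}. p k)"
proof -
  have "ang (\<lambda>_. 0) = (\<lambda>_. 0)" by (auto simp: ang_def)
  then show "(\<lambda>_. 0) \<in> pdom" "chart (\<lambda>_. 0) = (\<lambda>k\<in>{..<Suc m}. p k)"
    using bend_id by (auto simp: pdom_def chart_def)
qed

end

section \<open>The oriented area as an invariant quadratic function\<close>

text \<open>Differences to the vertex \<open>0\<close> do not change the oriented area and make translation
  invariance evident. The \<open>\<mu> i\<close> are the Lagrange multipliers of the squared edge lengths.\<close>

definition poly_form :: "nat \<Rightarrow> (nat \<Rightarrow> real) \<Rightarrow> (nat \<Rightarrow> complex) \<Rightarrow> (nat \<Rightarrow> complex) \<Rightarrow> real" where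
  "poly_form n \<mu> v w = (\<Sum>i<n.
     (Re (- \<i> / 2 * cnj (v i - v 0) * (w (Suc i mod n) - w 0)) +
      Re (- \<i> / 2 * cnj (w i - w 0) * (v (Suc i mod n) - v 0))) +
     - \<mu> i *
     (Re (1 / 2 * cnj (v (Suc i mod n) - v i) * (w (Suc i mod n) - w i)) +
      Re (1 / 2 * cnj (w (Suc i mod n) - w i) * (v (Suc i mod n) - v i))))"

lemma plane_form_poly: "0 < n \<Longrightarrow> plane_form {..<n} (poly_form n \<mu>)"
  unfolding poly_form_def
  by (intro plane_form_sum plane_form_plus plane_form_mult plane_form_basic) auto

lemma sum_cyclic:
  fixes f :: "nat \<Rightarrow> 'a::comm_monoid_add"
  assumes "0 < n" shows "(\<Sum>i<n. f (Suc i mod n)) = (\<Sum>i<n. f i)"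
proof -
  obtain m where n: "n = Suc m" using assms gr0_implies_Suc by blast
  have "(\<Sum>i<n. f (Suc i mod n)) = (\<Sum>i<m. f (Suc i)) + f 0"
    by (simp add: n)
  also have "\<dots> = (\<Sum>i<n. f i)" unfolding n by (subst sum.lessThan_Suc_shift) (simp add: add.commute)
  finally show ?thesis .
qed

lemma sum_cyclic_diff:
  fixes f :: "nat \<Rightarrow> real"
  assumes "0 < n" shows "(\<Sum>i<n. f (Suc i mod n) - f i) = 0"
  by (simp add: sum_subtractf sum_cyclic[OF assms])

lemma oriented_area_cross:
  "oriented_area (map p [0..<n]) = (\<Sum>i<n. Im (cnj (p i) * p (Suc i mod n))) / 2"
proof -
  have "oriented_area (map p [0..<n]) = (\<Sum>i<n. Re (p i) * Im (p (Suc i mod n)) - Re (p (Suc i mod n)) * Im (p i)) / 2"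
    unfolding oriented_area_def by (auto simp: Let_def intro!: sum.cong)
  also have "(\<Sum>i<n. Re (p i) * Im (p (Suc i mod n)) - Re (p (Suc i mod n)) * Im (p i))
      = (\<Sum>i<n. Im (cnj (p i) * p (Suc i mod n)))"
    by (intro sum.cong refl) (simp add: algebra_simps)
  finally show ?thesis .
qed

text \<open>The terms that arise from taking differences to vertex \<open>0\<close> telescope around
  the cycle.\<close>

lemma poly_form_area:
  assumes "0 < n"
  shows "poly_form n \<mu> p p / 2
    = oriented_area (map p [0..<n]) - (\<Sum>i<n. \<mu> i * (cmod (p (Suc i mod n) - p i))\<^sup>2) / 2"
proof -
  have "poly_form n \<mu> p p = (\<Sum>i<n. Im (cnj (p i) * p (Suc i mod n))
      + (Im (cnj (p 0) * p i) - Im (cnj (p 0) * p (Suc i mod n)))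
      - \<mu> i * (cmod (p (Suc i mod n) - p i))\<^sup>2)"
    unfolding poly_form_def cmod_power2
    by (intro sum.cong refl) (simp add: algebra_simps power2_eq_square)
  also have "\<dots> = (\<Sum>i<n. Im (cnj (p i) * p (Suc i mod n))) - (\<Sum>i<n. \<mu> i * (cmod (p (Suc i mod n) - p i))\<^sup>2)"
    using sum_cyclic_diff[OF assms, of "\<lambda>i. Im (cnj (p 0) * p i)"]
    by (simp only: sum.distrib sum_subtractf)
  finally show ?thesis by (simp add: oriented_area_cross diff_divide_distrib)
qed

text \<open>For an edge of a circle with center \<open>O'\<close> the quotient is purely imaginary.
  The multiplier is half the cotangent of half the central angle, that is, the distance of the
  center from the edge divided by the edge length, with positive sign if the center lies to the
  left.\<close>

definition edge_multiplier :: "complex \<Rightarrow> complex \<Rightarrow> complex \<Rightarrow> real" where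
  "edge_multiplier O' p q = - Im ((p + q - 2 * O') / (q - p)) / 2"

lemma edge_multiplier:
  assumes "dist O' p = dist O' q" "p \<noteq> q"
  shows "Im (cnj (p + q - 2 * O') * w) / 2 = edge_multiplier O' p q * Re (cnj (q - p) * w)"
proof -
  have "(cmod (p - O'))\<^sup>2 = (cmod (q - O'))\<^sup>2" using assms(1) by (simp add: dist_norm norm_minus_commute)
  then have "Re (cnj (q - p) * (p + q - 2 * O')) = 0"
    unfolding cmod_power2 by (simp add: algebra_simps power2_eq_square)
  from perpendicular_complex[OF this] assms(2)
  have M: "p + q - 2 * O' = \<i> * of_real (- 2 * edge_multiplier O' p q) * (q - p)"
    by (simp add: edge_multiplier_def)
  show ?thesis unfolding M by (simp add: field_simps)
qed

text \<open>Discrete integration by parts: the first variation of the area pairs the midpoint of an edge,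
  seen from the center, with the variation of the edge; the two are perpendicular to each other.\<close>

lemma poly_form_critical:
  assumes n: "0 < n" and circ: "\<And>i. i < n \<Longrightarrow> dist O' (p i) = R"
    and e: "\<And>i. i < n \<Longrightarrow> p (Suc i mod n) \<noteq> p i"
    and \<mu>: "\<And>i. i < n \<Longrightarrow> \<mu> i = edge_multiplier O' (p i) (p (Suc i mod n))"
  shows "poly_form n \<mu> p w = 0"
proof -
  let ?s = "\<lambda>i. Suc i mod n"
  \<comment> \<open>The boundary term of the summation by parts; its increments sum to 0 around the
    cycle.\<close>
  define g where "g i = Im (cnj (p i - p 0) * (w i - w 0)) / 2 + Im (cnj (p 0 - O') * (w i - w 0))" for i
  have "poly_form n \<mu> p w = (\<Sum>i<n. - (g (?s i) - g i))"
    unfolding poly_form_def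
  proof (intro sum.cong refl)
    fix i assume "i \<in> {..<n}"
    then have i: "i < n" "?s i < n" using n by auto
    have M: "Im (cnj (p i + p (?s i) - 2 * O') * (w (?s i) - w i)) / 2 = \<mu> i * Re (cnj (p (?s i) - p i) * (w (?s i) - w i))"
      unfolding \<mu>[OF i(1)] by (rule edge_multiplier) (use circ i e[OF i(1)] in auto)
    have "(Re (- \<i> / 2 * cnj (p i - p 0) * (w (?s i) - w 0)) + Re (- \<i> / 2 * cnj (w i - w 0) * (p (?s i) - p 0)))
      = Im (cnj (p i + p (?s i) - 2 * O') * (w (?s i) - w i)) / 2 - (g (?s i) - g i)"
      by (simp add: g_def field_simps)
    moreover have "Re (1 / 2 * cnj (p (?s i) - p i) * (w (?s i) - w i)) + Re (1 / 2 * cnj (w (?s i) - w i) * (p (?s i) - p i))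
      = Re (cnj (p (?s i) - p i) * (w (?s i) - w i))"
      by (simp add: field_simps)
    ultimately show "(Re (- \<i> / 2 * cnj (p i - p 0) * (w (?s i) - w 0)) + Re (- \<i> / 2 * cnj (w i - w 0) * (p (?s i) - p 0)))
      + - \<mu> i * (Re (1 / 2 * cnj (p (?s i) - p i) * (w (?s i) - w i)) + Re (1 / 2 * cnj (w (?s i) - w i) * (p (?s i) - p i)))
      = - (g (?s i) - g i)"
      unfolding M by simp
  qed
  also have "\<dots> = 0" using sum_cyclic_diff[OF n, of g] by (simp only: sum_negf)
  finally show ?thesis .
qed

definition cyclic_multipliers :: "nat \<Rightarrow> complex \<Rightarrow> (nat \<Rightarrow> complex) \<Rightarrow> nat \<Rightarrow> real" where
  "cyclic_multipliers n O' p i = edge_multiplier O' (p i) (p (Suc i mod n))"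

context bent_polygon
begin

text \<open>Subtracting an infinitesimal rigid motion makes both ends of the closing edge stand
  still. What is left is a motion of a chain with fixed ends, which \<open>bend\<close>
  realizes.\<close>

lemma polygon_velocity:
  assumes "v \<in> tangent_vectors L (\<lambda>k\<in>{..<Suc m}. p k)"
  shows "config_velocity L (\<lambda>k\<in>{..<Suc m}. p k) v"
proof -
  have orth: "Re (cnj (p i - p (Suc i mod Suc m)) * (v i - v (Suc i mod Suc m))) = 0" if "i < Suc m" for i
  proof -
    have "(i, Suc i mod Suc m, dist (p i) (p (Suc i mod Suc m))) \<in> snd L"
      using that by (simp add: snd_polygon_linkage)
    then show ?thesis using assms that unfolding tangent_vectors_def by fastforce
  qed
  have eo: "Re (cnj (p (Suc i) - p i) * (v (Suc i) - v i)) = 0" if "i < m" for i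
    using orth[of i] that by (simp add: algebra_simps)
  have "Re (cnj (p m - p 0) * (v m - v 0)) = 0" using orth[of m] by simp
  from perpendicular_complex[OF this] closing obtain s where s: "v m - v 0 = \<i> * of_real s * (p m - p 0)" by auto
  define v' where "v' k = v k - (\<i> * of_real s * (p k - p 0) + v 0)" for k
  have v'0: "v' 0 = 0" "v' m = 0" using s by (simp_all add: v'_def algebra_simps)
  have v'o: "Re (cnj (p (Suc i) - p i) * (v' (Suc i) - v' i)) = 0" if "i < m" for i
  proof -
    have "v' (Suc i) - v' i = (v (Suc i) - v i) - \<i> * of_real s * (p (Suc i) - p i)"
      by (simp add: v'_def algebra_simps)
    then have "Re (cnj (p (Suc i) - p i) * (v' (Suc i) - v' i))
      = Re (cnj (p (Suc i) - p i) * (v (Suc i) - v i)) - Re (\<i> * of_real s * (cnj (p (Suc i) - p i) * (p (Suc i) - p i)))"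
      by (simp only: right_diff_distrib minus_complex.sel) (simp add: algebra_simps)
    also have "cnj (p (Suc i) - p i) * (p (Suc i) - p i) = of_real ((cmod (p (Suc i) - p i))\<^sup>2)"
      by (simp only: complex_norm_square mult.commute)
    finally show ?thesis by (simp only: eo[OF that]) simp
  qed
  define y where "y i = Im ((v' (Suc i) - v' i) / (p (Suc i) - p i))" for i
  let ?\<gamma> = "\<lambda>t. \<lambda>k\<in>{..<Suc m}. bend p m j (p m) (\<lambda>i. y i * t) k"
  have q: "((\<lambda>t. p m) has_vector_derivative v' m) (at 0)" by (simp add: v'0)
  have ok: "\<forall>\<^sub>F t in nhds 0. bend_ok (p m) (\<lambda>i. y i * t)"
    by (rule bend_velocity(1)[where q = "\<lambda>t. p m" and v = v' and y = y])
      (rule q refl v'0(1) y_def | erule edges | erule v'o)+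
  have vel: "((\<lambda>t. bend p m j (p m) (\<lambda>i. y i * t) k) has_vector_derivative v' k) (at 0)" if "k \<le> m" for k
    by (rule bend_velocity(2)[where q = "\<lambda>t. p m" and v = v' and y = y])
      (rule q refl v'0(1) y_def that | erule edges | erule v'o)+
  have "config_velocity L (\<lambda>k\<in>{..<Suc m}. p k) v'"
  proof (rule config_velocityI[where \<gamma> = ?\<gamma>])
    show "\<forall>\<^sub>F t in nhds 0. ?\<gamma> t \<in> configs L"
      using ok by eventually_elim (simp add: polygon_configs bend_dist bend_0 bend_m)
  next
    fix a assume "a \<in> fst L"
    then have a: "a \<le> m" by (simp add: fst_polygon_linkage)
    then show "?\<gamma> 0 a = (\<lambda>k\<in>{..<Suc m}. p k) a" using bend_id(2)[OF a] by simp
    show "((\<lambda>t. ?\<gamma> t a) has_vector_derivative v' a) (at 0)" using vel[OF a] a by simp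
  qed
  then show ?thesis
    by (rule config_velocity_add_rigid[where s = s and b = "v 0 - \<i> * of_real s * p 0"])
      (use polygon_wf in \<open>auto simp: v'_def fst_polygon_linkage algebra_simps\<close>)
qed

lemma polygon_index:
  assumes circ: "\<And>i. i \<le> m \<Longrightarrow> dist O' (p i) = R"
  shows "has_index (poly_form (Suc m) (cyclic_multipliers (Suc m) O' p)) (tangent_vectors L (\<lambda>k\<in>{..<Suc m}. p k))
    (polygon_morse_index (map p [0..<Suc m]))"
proof -
  let ?P = "\<lambda>k\<in>{..<Suc m}. p k" and ?\<mu> = "cyclic_multipliers (Suc m) O' p"
  let ?F = "\<lambda>q. oriented_area (map q [0..<Suc m])"
  have sides: "side_lengths (map p [0..<Suc m]) = polygon_lengths (Suc m) p"
    unfolding side_lengths_def polygon_lengths_def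
    by (rule map_cong) (auto simp: nth_append simp del: upt_Suc)
  have P: "(\<lambda>i\<in>{..<length (map p [0..<Suc m])}. map p [0..<Suc m] ! i) = ?P"
    by (auto simp: restrict_def fun_eq_iff simp del: upt_Suc)
  have morse: "polygon_morse_index (map p [0..<Suc m]) = morse_index L ?F ?P"
    unfolding polygon_morse_index_def sides P by simp
  have e: "p (Suc i mod Suc m) \<noteq> p i" if "i < Suc m" for i
    using edges[of i] closing that by (cases "i = m") auto
  define k where "k = (\<Sum>i<Suc m. ?\<mu> i * (cmod (p (Suc i mod Suc m) - p i))\<^sup>2) / 2"
  have F: "?F q = poly_form (Suc m) ?\<mu> q q / 2 + k" if "q \<in> configs L" for q
  proof -
    have "cmod (q (Suc i mod Suc m) - q i) = cmod (p (Suc i mod Suc m) - p i)" if "i < Suc m" for i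
    proof -
      have "(i, Suc i mod Suc m, dist (p i) (p (Suc i mod Suc m))) \<in> snd L"
        using that by (simp add: snd_polygon_linkage)
      from configs_dist[OF \<open>q \<in> configs L\<close> this] show ?thesis by (simp add: dist_norm norm_minus_commute)
    qed
    then have "(\<Sum>i<Suc m. ?\<mu> i * (cmod (q (Suc i mod Suc m) - q i))\<^sup>2)
        = (\<Sum>i<Suc m. ?\<mu> i * (cmod (p (Suc i mod Suc m) - p i))\<^sup>2)"
      by (intro sum.cong) auto
    then show ?thesis unfolding poly_form_area[OF zero_less_Suc] k_def by simp
  qed
  have crit: "poly_form (Suc m) ?\<mu> ?P w = 0" for w
  proof -
    have "poly_form (Suc m) ?\<mu> ?P w = poly_form (Suc m) ?\<mu> p w"
      by (rule plane_form_cong[OF plane_form_poly[OF zero_less_Suc]]) simp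
    also have "\<dots> = 0"
      by (rule poly_form_critical[where O' = O' and R = R]) (use circ e in \<open>auto simp: cyclic_multipliers_def\<close>)
    finally show ?thesis .
  qed
  have edge: "(0, 1 mod Suc m, dist (p 0) (p (1 mod Suc m))) \<in> snd L" by (simp add: snd_polygon_linkage)
  have pos: "dist (p 0) (p (1 mod Suc m)) > 0" using e[of 0] by auto
  show ?thesis
    unfolding morse
    by (rule morse_index_has_index[where \<phi> = chart and x = "\<lambda>_. 0" and k = k and F = ?F and P = ?P and L = L
        and B = "poly_form (Suc m) ?\<mu>", OF reduced_chart_polygon
        chart_at_polygon(1) _ _ F crit polygon_wf edge pos polygon_velocity])
      (simp_all add: chart_at_polygon(2) fst_polygon_linkage plane_form_poly)
qed

end

lemma polygon_has_index:
  assumes m: "0 < m" and e: "\<And>i. i < m \<Longrightarrow> p (Suc i) \<noteq> p i" and closing: "p m \<noteq> p 0"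
    and nc: "\<not> collinear (p ` {..m})" and circ: "\<And>i. i \<le> m \<Longrightarrow> dist O' (p i) = R"
  shows "has_index (poly_form (Suc m) (cyclic_multipliers (Suc m) O' p))
    (tangent_vectors (polygon_linkage (polygon_lengths (Suc m) p)) p)
    (polygon_morse_index (map p [0..<Suc m]))"
proof -
  obtain j where "bendable p m j" using exists_bent_vertex[OF e nc] by blast
  then interpret bent_polygon p m j
    unfolding bent_polygon_def bent_polygon_axioms_def using e closing by blast
  have "tangent_vectors L (\<lambda>k\<in>{..<Suc m}. p k) = tangent_vectors L p"
    by (auto simp: tangent_vectors_def snd_polygon_linkage)
  with polygon_index[OF circ] show ?thesis by simp
qed

section \<open>The form on an aligned chain\<close>

text \<open>\<open>p\<close> preserves the forms, and \<open>s\<close> inverts it up to the radical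
  of \<open>B'\<close>. A spanning family lifts along \<open>s\<close> with the same Gram
  matrix.\<close>

lemma has_index_transfer:
  assumes sym: "\<And>v w. v \<in> T' \<Longrightarrow> w \<in> T' \<Longrightarrow> B' v w = B' w v"
    and B: "\<And>v w. v \<in> T \<Longrightarrow> w \<in> T \<Longrightarrow> B v w = B' (p v) (p w)" and p: "\<And>v. v \<in> T \<Longrightarrow> p v \<in> T'"
    and s: "\<And>v. v \<in> T' \<Longrightarrow> s v \<in> T" and ps: "\<And>v w. v \<in> T' \<Longrightarrow> w \<in> T' \<Longrightarrow> B' (p (s v)) w = B' v w"
    and i: "has_index B' T' k"
  shows "has_index B T k"
proof -
  obtain d u where u: "spans_form B' T' d u" and k: "k = num_neg_eigenvalues (gram B' d u)"
    using i by (auto simp: has_index_def)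
  have uT: "u i \<in> T'" if "i < d" for i using u that by (auto simp: spans_form_def)
  have Bs: "B (s v) w = B' v (p w)" if "v \<in> T'" "w \<in> T" for v w
    using that by (simp add: B s ps p)
  have "spans_form B T d (\<lambda>i. s (u i))"
    unfolding spans_form_def
  proof (intro conjI allI impI ballI s uT)
    fix v assume v: "v \<in> T"
    then obtain c where c: "\<forall>w\<in>T'. B' (p v) w = (\<Sum>i<d. c i * B' (u i) w)"
      using u p unfolding spans_form_def by blast
    have "B v w = (\<Sum>i<d. c i * B (s (u i)) w)" if w: "w \<in> T" for w
      using c p[OF w] by (simp add: B[OF v w] Bs uT w)
    then show "\<exists>c. \<forall>w\<in>T. B v w = (\<Sum>i<d. c i * B (s (u i)) w)" by blast
  qed
  moreover have "gram B d (\<lambda>i. s (u i)) = gram B' d u"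
  proof -
    have "B (s (u i)) (s (u j)) = B' (u i) (u j)" if "i < d" "j < d" for i j
    proof -
      have "B (s (u i)) (s (u j)) = B' (p (s (u j))) (u i)"
        using that by (simp add: Bs uT s sym[OF uT p[OF s[OF uT]]])
      also have "\<dots> = B' (u j) (u i)" using that by (simp add: ps uT)
      also have "\<dots> = B' (u i) (u j)" using that by (intro sym uT)
      finally show ?thesis .
    qed
    then show ?thesis unfolding gram_def by (intro cong_mat) auto
  qed
  ultimately show ?thesis unfolding has_index_def
    by (intro exI[of _ d] exI[of _ "\<lambda>i. s (u i)"] conjI) (simp_all add: k)
qed

text \<open>\<open>o1\<close> and \<open>o2\<close> lie in the radicals and take the place of zero
  vectors in the two components.\<close>

lemma has_index_prod:
  assumes sym1: "\<And>v w. v \<in> T1 \<Longrightarrow> w \<in> T1 \<Longrightarrow> B1 v w = B1 w v"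
    and sym2: "\<And>v w. v \<in> T2 \<Longrightarrow> w \<in> T2 \<Longrightarrow> B2 v w = B2 w v"
    and o1: "o1 \<in> T1" "\<And>w. w \<in> T1 \<Longrightarrow> B1 o1 w = 0" and o2: "o2 \<in> T2" "\<And>w. w \<in> T2 \<Longrightarrow> B2 o2 w = 0"
    and "has_index B1 T1 m1" "has_index B2 T2 m2"
  shows "has_index (\<lambda>v w. B1 (fst v) (fst w) + B2 (snd v) (snd w)) (T1 \<times> T2) (m1 + m2)"
  by (rule has_index_sum[where ?p1.0 = fst and ?p2.0 = snd and ?s1.0 = "\<lambda>a. (a, o2)" and ?s2.0 = "\<lambda>b. (o1, b)"
        and ?B1.0 = B1 and ?B2.0 = B2 and ?T1.0 = T1 and ?T2.0 = T2])
    (use assms in auto)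

text \<open>For an aligned chain whose edges are the multiples \<open>t e\<close> of the vector from its initial to its
  terminal vertex, \<open>y e\<close> is the rotation speed of edge \<open>e\<close> times \<open>t e\<close>.\<close>

definition aligned_form :: "real \<Rightarrow> nat \<Rightarrow> (nat \<Rightarrow> real) \<Rightarrow> (nat \<Rightarrow> real) \<Rightarrow> (nat \<Rightarrow> real) \<Rightarrow> real" where
  "aligned_form \<kappa> r t y y' = \<kappa> * ((\<Sum>e<r. y e) * (\<Sum>e<r. y' e) - (\<Sum>e<r. inverse (t e) * y e * y' e))"

lemma aligned_form_sym: "aligned_form \<kappa> r t y y' = aligned_form \<kappa> r t y' y"
  by (simp add: aligned_form_def mult.commute mult.left_commute)

text \<open>The vector \<open>t\<close>, the rotation of the whole chain, lies in the radical
  because its entries sum to 1.\<close>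

lemma aligned_form_add_radical:
  assumes t: "\<And>e. e < r \<Longrightarrow> t e \<noteq> 0" and sum: "(\<Sum>e<r. t e) = 1"
    and x: "\<And>e. e < r \<Longrightarrow> x e = s * t e + y e"
  shows "aligned_form \<kappa> r t x y' = aligned_form \<kappa> r t y y'"
proof -
  have "(\<Sum>e<r. x e) = s * (\<Sum>e<r. t e) + (\<Sum>e<r. y e)"
    by (simp add: x sum.distrib sum_distrib_left)
  moreover have "(\<Sum>e<r. inverse (t e) * x e * y' e) = (\<Sum>e<r. s * y' e + inverse (t e) * y e * y' e)"
    by (intro sum.cong refl) (simp add: x t field_simps)
  then have "(\<Sum>e<r. inverse (t e) * x e * y' e) = s * (\<Sum>e<r. y' e) + (\<Sum>e<r. inverse (t e) * y e * y' e)"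
    by (simp add: sum.distrib sum_distrib_left)
  ultimately show ?thesis unfolding aligned_form_def sum by (simp add: algebra_simps)
qed

text \<open>The standard basis gives some index; its value is found afterwards by comparison with a
  diagonal form.\<close>

lemma aligned_form_has_some_index: "\<exists>m. has_index (aligned_form \<kappa> r t) UNIV m"
proof -
  let ?u = "\<lambda>i e. if e = i then 1 else (0::real)"
  have Bu: "aligned_form \<kappa> r t (?u i) w = \<kappa> * ((\<Sum>e<r. w e) - inverse (t i) * w i)" if "i < r" for i w
  proof -
    have "(\<Sum>e<r. ?u i e) = 1" using that by simp
    moreover have "(\<Sum>e<r. inverse (t e) * ?u i e * w e) = (\<Sum>e<r. if e = i then inverse (t e) * w e else 0)"
      by (intro sum.cong) auto
    ultimately show ?thesis using that by (simp add: aligned_form_def)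
  qed
  have "spans_form (aligned_form \<kappa> r t) UNIV r ?u"
    unfolding spans_form_def
  proof (intro conjI ballI)
    fix v :: "nat \<Rightarrow> real"
    have "aligned_form \<kappa> r t v w = (\<Sum>i<r. v i * aligned_form \<kappa> r t (?u i) w)" for w
    proof -
      have "(\<Sum>i<r. v i * aligned_form \<kappa> r t (?u i) w) = (\<Sum>i<r. \<kappa> * ((\<Sum>e<r. w e) * v i) - \<kappa> * (inverse (t i) * v i * w i))"
        by (intro sum.cong refl) (simp only: Bu lessThan_iff, simp add: algebra_simps)
      also have "\<dots> = aligned_form \<kappa> r t v w"
        by (simp add: sum_subtractf aligned_form_def sum_distrib_left[symmetric] sum_distrib_right[symmetric] right_diff_distrib mult_ac)
      finally show ?thesis by simp
    qed
    then show "\<exists>c. \<forall>w\<in>UNIV. aligned_form \<kappa> r t v w = (\<Sum>i<r. c i * aligned_form \<kappa> r t (?u i) w)" by blast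
  qed simp
  then show ?thesis unfolding has_index_def by blast
qed

text \<open>The diagonal form \<open>- \<kappa> * (\<Sum>e<r. y e * y' e / t e)\<close> is the sum of the form in question and of
  \<open>- \<kappa> * (\<Sum>e<r. y e) * (\<Sum>e<r. y' e)\<close>, on complementary subspaces.\<close>

lemma has_index_aligned_form:
  assumes t: "\<And>e. e < r \<Longrightarrow> t e \<noteq> 0" and sum: "(\<Sum>e<r. t e) = 1" and \<kappa>: "\<kappa> \<noteq> 0"
  shows "\<exists>m. has_index (aligned_form \<kappa> r t) UNIV m \<and>
    int m = (if \<kappa> > 0 then int (card {e. e < r \<and> t e > 0}) - 1 else int r - int (card {e. e < r \<and> t e > 0}))"
proof -
  let ?D = "\<lambda>y y'. \<Sum>e<r. - \<kappa> * inverse (t e) * y e * y' e"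
  let ?E = "\<lambda>y y'. \<Sum>e<(1::nat). - \<kappa> * y e * y' e"
  obtain m where m: "has_index (aligned_form \<kappa> r t) UNIV m" using aligned_form_has_some_index by blast
  have E: "has_index ?E UNIV (if \<kappa> > 0 then 1 else 0)"
  proof -
    have "{e. e < (1::nat) \<and> - \<kappa> < 0} = (if \<kappa> > 0 then {0} else {})" by auto
    then show ?thesis using has_index_diagonal[of "\<lambda>_. - \<kappa>" 1] by (auto split: if_splits)
  qed
  \<comment> \<open>\<open>?s1\<close> projects along \<open>t\<close> to the vectors of sum 0, and
    \<open>?s2\<close> runs along \<open>t\<close>; these are the complementary subspaces.\<close>
  have D1: "has_index ?D UNIV (m + (if \<kappa> > 0 then 1 else 0))"
  proof (rule has_index_sum[where ?B1.0 = "aligned_form \<kappa> r t" and ?B2.0 = ?E and ?T1.0 = UNIV and ?T2.0 = UNIV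
        and ?p1.0 = "\<lambda>y. y" and ?p2.0 = "\<lambda>y _. \<Sum>e<r. y e"
        and ?s1.0 = "\<lambda>y e. (- (\<Sum>e<r. y e)) * t e + y e" and ?s2.0 = "\<lambda>x e. x 0 * t e + 0"])
    fix v w :: "nat \<Rightarrow> real"
    show "?D v w = aligned_form \<kappa> r t v w + ?E (\<lambda>_. \<Sum>e<r. v e) (\<lambda>_. \<Sum>e<r. w e)"
      by (simp add: aligned_form_def sum_negf sum_distrib_left[symmetric] algebra_simps mult.assoc)
    show "aligned_form \<kappa> r t (\<lambda>e. (- (\<Sum>e<r. v e)) * t e + v e) w = aligned_form \<kappa> r t v w"
      by (rule aligned_form_add_radical[OF t sum refl])
    show "aligned_form \<kappa> r t (\<lambda>e. v 0 * t e + 0) w = 0"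
      using aligned_form_add_radical[where s = "v 0" and y = "\<lambda>_. 0" and \<kappa> = \<kappa> and y' = w, OF t sum refl] by (simp add: aligned_form_def)
    show "?E (\<lambda>_. \<Sum>e<r. (- (\<Sum>e<r. v e)) * t e + v e) w = 0"
    proof -
      have "(\<Sum>e<r. (- (\<Sum>e<r. v e)) * t e + v e) = 0"
        by (simp only: sum.distrib sum_distrib_left[symmetric] sum)
      then show ?thesis by (simp only:) simp
    qed
    show "?E (\<lambda>_. \<Sum>e<r. v 0 * t e + 0) w = ?E v w"
      by (simp add: sum_distrib_left[symmetric] sum)
  qed (use m E in \<open>auto simp: aligned_form_sym mult_ac\<close>)
  have D2: "has_index ?D UNIV (card {e. e < r \<and> - \<kappa> * inverse (t e) < 0})"
    by (rule has_index_diagonal)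
  \<comment> \<open>Two computations of the index of the same diagonal form determine
    \<open>m\<close>.\<close>
  have eq: "card {e. e < r \<and> - \<kappa> * inverse (t e) < 0} = m + (if \<kappa> > 0 then 1 else 0)"
    by (rule has_index_unique[OF _ D2 D1]) (simp add: mult_ac)
  show ?thesis
  proof (cases "\<kappa> > 0")
    case True
    then have "{e. e < r \<and> - \<kappa> * inverse (t e) < 0} = {e. e < r \<and> t e > 0}"
      by (auto simp: zero_less_mult_iff)
    then show ?thesis using m eq True by (intro exI[of _ m]) simp
  next
    case False
    then have "{e. e < r \<and> - \<kappa> * inverse (t e) < 0} = {..<r} - {e. e < r \<and> t e > 0}"
      using \<kappa> t by (auto simp: mult_less_0_iff zero_less_mult_iff not_less le_less)
    moreover have "card ({..<r} - {e. e < r \<and> t e > 0}) = r - card {e. e < r \<and> t e > 0}"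
      by (subst card_Diff_subset) auto
    moreover have "card {e. e < r \<and> t e > 0} \<le> r" using card_mono[of "{..<r}" "{e. e < r \<and> t e > 0}"] by auto
    ultimately show ?thesis using m eq False by (intro exI[of _ m]) simp
  qed
qed

section \<open>Three-chains\<close>

definition cv :: "(nat \<Rightarrow> vertex) \<Rightarrow> nat \<Rightarrow> nat \<Rightarrow> vertex" where
  "cv K n i = (if i = 0 then Init else if i = n then Term else K i)"

text \<open>The order of \<open>BW_vertices\<close>. The diagonal is edge \<open>0\<close> of BW,
  whereas in AW it is the last edge; the other edges run through B backwards.\<close>

definition bw :: "nat \<Rightarrow> nat \<Rightarrow> vertex" where
  "bw n i = (if i = 0 then Init else cv VB n (Suc n - i))"

lemma cv_0: "cv K n 0 = Init" and cv_n: "n \<ge> 1 \<Longrightarrow> cv K n n = Term"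
  by (simp_all add: cv_def)

lemma chain_vertices_map: "n \<ge> 1 \<Longrightarrow> chain_vertices K n = map (cv K n) [0..<Suc n]"
  unfolding chain_vertices_def
  by (rule nth_equalityI) (auto simp: cv_def nth_append nth_Cons' simp del: upt_Suc)

lemma BW_vertices_map: "n \<ge> 1 \<Longrightarrow> BW_vertices n = map (bw n) [0..<Suc n]"
  unfolding BW_vertices_def
  by (rule nth_equalityI) (auto simp: bw_def cv_def rev_nth nth_Cons' simp del: upt_Suc)

lemma chain_edges_iff:
  assumes "length ls \<ge> 1"
  shows "(u, v, l) \<in> chain_edges K ls \<longleftrightarrow>
    (\<exists>i<length ls. u = cv K (length ls) i \<and> v = cv K (length ls) (Suc i) \<and> l = ls ! i)"
proof -
  have nth: "chain_vertices K (length ls) ! i = cv K (length ls) i" if "i \<le> length ls" for i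
    using that by (simp add: chain_vertices_map[OF assms] del: upt_Suc)
  have "(\<exists>i. (u, v, l) = (chain_vertices K (length ls) ! i, chain_vertices K (length ls) ! Suc i, ls ! i) \<and> i < length ls)
    \<longleftrightarrow> (\<exists>i<length ls. u = cv K (length ls) i \<and> v = cv K (length ls) (Suc i) \<and> l = ls ! i)"
    by (rule ex_cong1) (auto simp: nth)
  then show ?thesis unfolding chain_edges_def Let_def by simp
qed

lemma set_chain_vertices: "n \<ge> 1 \<Longrightarrow> set (chain_vertices K n) = cv K n ` {..n}"
  by (simp add: chain_vertices_map atLeast0LessThan lessThan_Suc_atMost del: upt_Suc)

lemma collinear_through:
  assumes "collinear X" "i \<in> X" "t \<in> X" "i \<noteq> t" "x \<in> X" "y \<in> X"
  shows "\<exists>r. x - y = of_real r * (t - i :: complex)"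
proof -
  obtain u where u: "\<And>x y. x \<in> X \<Longrightarrow> y \<in> X \<Longrightarrow> \<exists>c. x - y = c *\<^sub>R u"
    using assms(1) unfolding collinear_def by blast
  obtain c where c: "t - i = c *\<^sub>R u" using u[OF assms(3,2)] by blast
  obtain c' where c': "x - y = c' *\<^sub>R u" using u[OF assms(5,6)] by blast
  have "c \<noteq> 0" using c assms(4) by auto
  then have "x - y = of_real (c' / c) * (t - i)" unfolding c c' by (simp add: scaleR_conv_of_real)
  then show ?thesis by blast
qed

lemma rigid_orthogonal: "Re (cnj z * (\<i> * of_real s * z)) = 0"
proof -
  have "cnj z * (\<i> * of_real s * z) = \<i> * of_real (s * (cmod z)\<^sup>2)"
    by (simp add: complex_norm_square mult_ac del: of_real_power)
  then show ?thesis by simp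
qed

lemma oriented_area_closed:
  assumes n: "length ps = n" "n > 0" and f: "\<And>i. i < n \<Longrightarrow> ps ! i = f i" "f n = f 0"
  shows "oriented_area ps = (\<Sum>i<n. Im (cnj (f i) * f (Suc i))) / 2"
proof -
  have "ps = map f [0..<n]" by (rule nth_equalityI) (use n f in auto)
  then have "oriented_area ps = (\<Sum>i<n. Im (cnj (f i) * f (Suc i mod n))) / 2"
    by (simp add: oriented_area_cross)
  also have "(\<Sum>i<n. Im (cnj (f i) * f (Suc i mod n))) = (\<Sum>i<n. Im (cnj (f i) * f (Suc i)))"
  proof (rule sum.cong[OF refl])
    fix i assume "i \<in> {..<n}"
    then have "f (Suc i mod n) = f (Suc i)" using f(2) by (cases "Suc i = n") auto
    then show "Im (cnj (f i) * f (Suc i mod n)) = Im (cnj (f i) * f (Suc i))" by simp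
  qed
  finally show ?thesis .
qed

text \<open>The two polygons traverse the diagonal in opposite directions, so its two cross products
  cancel.\<close>

lemma Gamma_area_split:
  assumes "nA \<ge> 1" "nB \<ge> 1"
  shows "Gamma_area nA nB q = oriented_area (map (\<lambda>i. q (cv VA nA i)) [0..<Suc nA])
    + oriented_area (map (\<lambda>i. q (bw nB i)) [0..<Suc nB])"
proof -
  define fA where "fA i = (if i = Suc nA then q Init else q (cv VA nA i))" for i
  define fB where "fB i = q (cv VB nB (nB - i))" for i
  define f where "f i = (if i \<le> nA then q (cv VA nA i) else q (cv VB nB (nA + nB - i)))" for i
  let ?X = "\<lambda>u v. Im (cnj u * v)"
  have A: "oriented_area (map (\<lambda>i. q (cv VA nA i)) [0..<Suc nA])
      = ((\<Sum>i<nA. ?X (q (cv VA nA i)) (q (cv VA nA (Suc i)))) + ?X (q Term) (q Init)) / 2"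
  proof -
    have "oriented_area (map (\<lambda>i. q (cv VA nA i)) [0..<Suc nA]) = (\<Sum>i<Suc nA. ?X (fA i) (fA (Suc i))) / 2"
      by (rule oriented_area_closed) (auto simp: fA_def cv_0 nth_append simp del: upt_Suc)
    also have "(\<Sum>i<Suc nA. ?X (fA i) (fA (Suc i))) = (\<Sum>i<nA. ?X (q (cv VA nA i)) (q (cv VA nA (Suc i)))) + ?X (q Term) (q Init)"
      using assms by (simp add: fA_def cv_n)
    finally show ?thesis .
  qed
  have B: "oriented_area (map (\<lambda>i. q (bw nB i)) [0..<Suc nB]) = (?X (q Init) (q Term) + (\<Sum>i<nB. ?X (fB i) (fB (Suc i)))) / 2"
  proof -
    let ?f = "\<lambda>i. if i = 0 then q Init else fB (i - 1)"
    have "oriented_area (map (\<lambda>i. q (bw nB i)) [0..<Suc nB]) = (\<Sum>i<Suc nB. ?X (?f i) (?f (Suc i))) / 2"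
      by (rule oriented_area_closed) (auto simp: fB_def bw_def cv_0 nth_append simp del: upt_Suc)
    also have "(\<Sum>i<Suc nB. ?X (?f i) (?f (Suc i))) = ?X (q Init) (q Term) + (\<Sum>i<nB. ?X (fB i) (fB (Suc i)))"
      using assms by (subst sum.lessThan_Suc_shift) (simp add: fB_def cv_n)
    finally show ?thesis .
  qed
  have G: "Gamma_area nA nB q = (\<Sum>i<nA + nB. ?X (f i) (f (Suc i))) / 2"
    unfolding Gamma_area_def
  proof (rule oriented_area_closed)
    show "length (map q (Gamma_vertices nA nB)) = nA + nB"
      using assms by (simp add: Gamma_vertices_def chain_vertices_def)
    show "map q (Gamma_vertices nA nB) ! i = f i" if "i < nA + nB" for i
    proof -
      have "Gamma_vertices nA nB = map (cv VA nA) [0..<Suc nA] @ rev (map VB [1..<nB])"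
        by (simp add: Gamma_vertices_def chain_vertices_map[OF assms(1)])
      then have "Gamma_vertices nA nB ! i = (if i \<le> nA then cv VA nA i else VB (nA + nB - i))"
        using that by (auto simp: nth_append rev_nth less_Suc_eq_le simp del: upt_Suc)
      moreover have "length (Gamma_vertices nA nB) = nA + nB"
        using assms by (simp add: Gamma_vertices_def chain_vertices_def)
      ultimately show ?thesis using that assms by (auto simp: f_def cv_def)
    qed
  qed (use assms in \<open>auto simp: f_def cv_0\<close>)
  have "(\<Sum>i<nA + nB. ?X (f i) (f (Suc i))) = (\<Sum>i<nA. ?X (f i) (f (Suc i))) + (\<Sum>i<nB. ?X (f (nA + i)) (f (Suc (nA + i))))"
    using sum.atLeastLessThan_concat[of 0 nA "nA + nB" "\<lambda>i. ?X (f i) (f (Suc i))"]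
      sum.shift_bounds_nat_ivl[of "\<lambda>i. ?X (f i) (f (Suc i))" 0 nA nB]
    by (simp add: atLeast0LessThan add.commute)
  also have "(\<Sum>i<nA. ?X (f i) (f (Suc i))) = (\<Sum>i<nA. ?X (q (cv VA nA i)) (q (cv VA nA (Suc i))))"
    by (intro sum.cong refl) (simp add: f_def)
  also have "(\<Sum>i<nB. ?X (f (nA + i)) (f (Suc (nA + i)))) = (\<Sum>i<nB. ?X (fB i) (fB (Suc i)))"
  proof (rule sum.cong[OF refl])
    fix i assume "i \<in> {..<nB}"
    have fB: "f (nA + i) = fB i" for i
      using assms by (cases "i = 0") (auto simp: f_def fB_def cv_n)
    show "?X (f (nA + i)) (f (Suc (nA + i))) = ?X (fB i) (fB (Suc i))"
      using fB[of i] fB[of "Suc i"] by simp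
  qed
  finally show ?thesis unfolding A B G by (simp add: field_simps)
qed

section \<open>The Lagrange function at an aligned critical configuration\<close>

locale aligned_three_chain =
  fixes a b z :: "real list" and P :: "vertex \<Rightarrow> complex" and OA OB :: complex
  assumes len: "length a \<ge> 1" "length b \<ge> 1" "length z \<ge> 1"
    and pos: "\<And>l. l \<in> set (a @ b @ z) \<Longrightarrow> 0 < l"
    and P: "P \<in> configs (three_chain a b z)"
    and Z_aligned: "collinear (P ` set (chain_vertices VZ (length z)))"
    and A_not_aligned: "\<not> collinear (P ` set (chain_vertices VA (length a)))"
    and B_not_aligned: "\<not> collinear (P ` set (chain_vertices VB (length b)))"
    and circA: "circumcenter OA (P ` set (chain_vertices VA (length a)))"
    and circB: "circumcenter OB (P ` set (chain_vertices VB (length b)))"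
    and W_nonzero: "P Init \<noteq> P Term"
begin

abbreviation "L \<equiv> three_chain a b z"
abbreviation "nA \<equiv> length a"
abbreviation "nB \<equiv> length b"
abbreviation "r \<equiv> length z"
abbreviation "W \<equiv> P Term - P Init"
abbreviation "pA \<equiv> \<lambda>i. P (cv VA nA i)"
abbreviation "pB \<equiv> \<lambda>i. P (bw nB i)"

lemma fst_L: "fst L = cv VA nA ` {..nA} \<union> cv VB nB ` {..nB} \<union> cv VZ r ` {..r}"
  using len by (simp add: three_chain_def set_chain_vertices)

lemma snd_L: "(u, v, l) \<in> snd L \<longleftrightarrow>
    (\<exists>i<nA. u = cv VA nA i \<and> v = cv VA nA (Suc i) \<and> l = a ! i) \<or>
    (\<exists>i<nB. u = cv VB nB i \<and> v = cv VB nB (Suc i) \<and> l = b ! i) \<or>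
    (\<exists>i<r. u = cv VZ r i \<and> v = cv VZ r (Suc i) \<and> l = z ! i)"
  using len by (simp add: three_chain_def chain_edges_iff)

lemma wf: "(u, v, l) \<in> snd L \<Longrightarrow> u \<in> fst L \<and> v \<in> fst L"
  unfolding snd_L fst_L by auto

lemma config_iff: "q \<in> configs L \<longleftrightarrow> q \<in> extensional (fst L) \<and>
    (\<forall>i<nA. dist (q (cv VA nA i)) (q (cv VA nA (Suc i))) = a ! i) \<and>
    (\<forall>i<nB. dist (q (cv VB nB i)) (q (cv VB nB (Suc i))) = b ! i) \<and>
    (\<forall>i<r. dist (q (cv VZ r i)) (q (cv VZ r (Suc i))) = z ! i)"
proof -
  have "q \<in> configs L \<longleftrightarrow> q \<in> extensional (fst L) \<and> (\<forall>u v l. (u, v, l) \<in> snd L \<longrightarrow> dist (q u) (q v) = l)"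
    unfolding configs_def by (simp add: PiE_def Ball_def split_paired_All)
  then show ?thesis unfolding snd_L by blast
qed

lemma tangent_iff: "v \<in> tangent_vectors L P \<longleftrightarrow>
    (\<forall>i<nA. Re (cnj (P (cv VA nA i) - P (cv VA nA (Suc i))) * (v (cv VA nA i) - v (cv VA nA (Suc i)))) = 0) \<and>
    (\<forall>i<nB. Re (cnj (P (cv VB nB i) - P (cv VB nB (Suc i))) * (v (cv VB nB i) - v (cv VB nB (Suc i)))) = 0) \<and>
    (\<forall>i<r. Re (cnj (P (cv VZ r i) - P (cv VZ r (Suc i))) * (v (cv VZ r i) - v (cv VZ r (Suc i)))) = 0)"
proof -
  have "v \<in> tangent_vectors L P \<longleftrightarrow>
      (\<forall>x y l. (x, y, l) \<in> snd L \<longrightarrow> Re (cnj (P x - P y) * (v x - v y)) = 0)"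
    unfolding tangent_vectors_def by (simp only: mem_Collect_eq Ball_def split_paired_All case_prod_conv)
  then show ?thesis unfolding snd_L by blast
qed

lemma edge_nonzero:
  "i < nA \<Longrightarrow> P (cv VA nA (Suc i)) \<noteq> P (cv VA nA i)"
  "i < nB \<Longrightarrow> P (cv VB nB (Suc i)) \<noteq> P (cv VB nB i)"
  "i < r \<Longrightarrow> P (cv VZ r (Suc i)) \<noteq> P (cv VZ r i)"
proof -
  have "a ! i > 0" if "i < nA" for i using pos that by simp
  then show "P (cv VA nA (Suc i)) \<noteq> P (cv VA nA i)" if "i < nA"
    using P[unfolded config_iff] that by fastforce
  have "b ! i > 0" if "i < nB" for i using pos that by simp
  then show "P (cv VB nB (Suc i)) \<noteq> P (cv VB nB i)" if "i < nB"
    using P[unfolded config_iff] that by fastforce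
  have "z ! i > 0" if "i < r" for i using pos that by simp
  then show "P (cv VZ r (Suc i)) \<noteq> P (cv VZ r i)" if "i < r"
    using P[unfolded config_iff] that by fastforce
qed

text \<open>The signed ratio of an edge of Z to W. It is positive exactly for forward edges, and the
  ratios sum to 1.\<close>

definition t :: "nat \<Rightarrow> real" where
  "t e = Re ((P (cv VZ r (Suc e)) - P (cv VZ r e)) / W)"

lemma W0: "W \<noteq> 0" using W_nonzero by simp

lemma Z_edge: "e < r \<Longrightarrow> P (cv VZ r (Suc e)) - P (cv VZ r e) = of_real (t e) * W"
proof -
  assume e: "e < r"
  let ?X = "P ` set (chain_vertices VZ r)"
  have in_X: "P (cv VZ r i) \<in> ?X" if "i \<le> r" for i
    using that len by (simp add: set_chain_vertices)
  have "P Init \<in> ?X" "P Term \<in> ?X" using in_X[of 0] in_X[of r] len by (simp_all add: cv_0 cv_n)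
  from collinear_through[OF Z_aligned this W_nonzero in_X in_X, of "Suc e" e] e
  obtain s where s: "P (cv VZ r (Suc e)) - P (cv VZ r e) = of_real s * W" by auto
  then show ?thesis using W0 by (simp add: t_def)
qed

lemma t_nonzero: "e < r \<Longrightarrow> t e \<noteq> 0"
  using Z_edge edge_nonzero(3) by fastforce

lemma t_sum: "(\<Sum>e<r. t e) = 1"
proof -
  have "(\<Sum>e<r. P (cv VZ r (Suc e)) - P (cv VZ r e)) = W"
    using sum_lessThan_telescope[of "\<lambda>e. P (cv VZ r e)" r] len by (simp add: cv_0 cv_n)
  then have "of_real (\<Sum>e<r. t e) * W = 1 * W" by (simp add: Z_edge sum_distrib_right)
  then have "complex_of_real (\<Sum>e<r. t e) = 1" by (rule mult_right_cancel[OF W0, THEN iffD1])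
  then show ?thesis by (simp only: of_real_eq_1_iff)
qed

lemma nonempty [simp]: "a \<noteq> []" "b \<noteq> []" "z \<noteq> []"
  using len by auto

lemma bw_cv: "i \<le> nB \<Longrightarrow> \<exists>k\<le>nB. bw nB i = cv VB nB k"
  by (cases "i = 0") (auto simp: bw_def cv_0 intro: exI[of _ 0] exI[of _ "Suc nB - i"])

lemma dist_A: "\<exists>R. \<forall>i\<le>nA. dist OA (pA i) = R"
  using circA len unfolding circumcenter_def set_chain_vertices[OF len(1)] by auto

lemma dist_B: "\<exists>R. \<forall>i\<le>nB. dist OB (pB i) = R"
proof -
  have "pB i \<in> P ` set (chain_vertices VB nB)" if "i \<le> nB" for i
    using bw_cv[OF that] unfolding set_chain_vertices[OF len(2)] by auto
  then show ?thesis using circB unfolding circumcenter_def by blast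
qed

lemma bw_simps: "bw nB 0 = Init" "bw nB (Suc 0) = Term"
  using len by (simp_all add: bw_def cv_n)

definition "\<mu>A = cyclic_multipliers (Suc nA) OA pA"
definition "\<mu>B = cyclic_multipliers (Suc nB) OB pB"
definition "c = Im ((OB - OA) / W)"

text \<open>The midpoint of the diagonal enters the two multipliers with opposite signs, so only the
  difference of the centers remains.\<close>

lemma c_eq: "\<mu>A nA + \<mu>B 0 = c"
proof -
  have "\<mu>A nA = - Im ((P Term + P Init - 2 * OA) / (P Init - P Term)) / 2"
    using len by (simp add: \<mu>A_def cyclic_multipliers_def edge_multiplier_def cv_0 cv_n)
  also have "(P Term + P Init - 2 * OA) / (P Init - P Term) = - ((P Term + P Init - 2 * OA) / W)"
    by (metis minus_diff_eq minus_divide_right)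
  finally have A: "\<mu>A nA = Im ((P Term + P Init - 2 * OA) / W) / 2" by simp
  have B: "\<mu>B 0 = - Im ((P Init + P Term - 2 * OB) / W) / 2"
    using len by (simp add: \<mu>B_def cyclic_multipliers_def edge_multiplier_def bw_simps)
  have "(OB - OA) / W = ((P Term + P Init - 2 * OA) / W - (P Init + P Term - 2 * OB) / W) / 2"
  proof -
    have "(P Term + P Init - 2 * OA) / W - (P Init + P Term - 2 * OB) / W = 2 * (OB - OA) / W"
      unfolding diff_divide_distrib[symmetric] by (rule arg_cong2[where f = "(/)"]) (simp_all add: algebra_simps)
    moreover have "x / w = 2 * x / w / 2" for x w :: complex by simp
    ultimately show ?thesis by metis
  qed
  then have "c = Im (((P Term + P Init - 2 * OA) / W - (P Init + P Term - 2 * OB) / W) / 2)"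
    unfolding c_def by (simp only:)
  then show ?thesis unfolding A B by simp
qed

abbreviation "FA \<equiv> poly_form (Suc nA) \<mu>A"
abbreviation "FB \<equiv> poly_form (Suc nB) \<mu>B"

definition edge_form :: "vertex \<Rightarrow> vertex \<Rightarrow> (vertex \<Rightarrow> complex) \<Rightarrow> (vertex \<Rightarrow> complex) \<Rightarrow> real" where
  "edge_form x y v w = Re (1 / 2 * cnj (v x - v y) * (w x - w y)) + Re (1 / 2 * cnj (w x - w y) * (v x - v y))"

lemma edge_form_eq: "edge_form x y v w = Re (cnj (v x - v y) * (w x - w y))"
  by (simp add: edge_form_def field_simps)

text \<open>The first term cancels the multipliers of the diagonal, which is not an edge of the
  linkage. The others give edge \<open>e\<close> of Z the multiplier \<open>c / t e\<close>, the
  choice that makes \<open>P\<close> critical.\<close>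

definition chain_form :: "(vertex \<Rightarrow> complex) \<Rightarrow> (vertex \<Rightarrow> complex) \<Rightarrow> real" where
  "chain_form v w = c * (edge_form Term Init v w +
     (\<Sum>e<r. - inverse (t e) * edge_form (cv VZ r (Suc e)) (cv VZ r e) v w))"

definition total_form :: "(vertex \<Rightarrow> complex) \<Rightarrow> (vertex \<Rightarrow> complex) \<Rightarrow> real" where
  "total_form v w = FA (\<lambda>i. v (cv VA nA i)) (\<lambda>i. w (cv VA nA i)) +
     FB (\<lambda>i. v (bw nB i)) (\<lambda>i. w (bw nB i)) + chain_form v w"

lemma vertices_in: "i \<le> nA \<Longrightarrow> cv VA nA i \<in> fst L" "i \<le> nB \<Longrightarrow> cv VB nB i \<in> fst L"
  "i \<le> r \<Longrightarrow> cv VZ r i \<in> fst L" "i \<le> nB \<Longrightarrow> bw nB i \<in> fst L" "Init \<in> fst L" "Term \<in> fst L"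
proof -
  show *: "i \<le> nA \<Longrightarrow> cv VA nA i \<in> fst L" "i \<le> nB \<Longrightarrow> cv VB nB i \<in> fst L" "i \<le> r \<Longrightarrow> cv VZ r i \<in> fst L" for i
    unfolding fst_L by auto
  show "i \<le> nB \<Longrightarrow> bw nB i \<in> fst L" using bw_cv[of i] *(2) by auto
  show "Init \<in> fst L" "Term \<in> fst L" using *(1)[of 0] *(1)[of nA] len by (simp_all add: cv_0 cv_n)
qed

lemma plane_form_total: "plane_form (fst L) total_form"
proof -
  have "plane_form (fst L) (\<lambda>v w. FA (\<lambda>i. v (cv VA nA i)) (\<lambda>i. w (cv VA nA i)))"
    by (rule plane_form_reindex[OF plane_form_poly]) (auto intro: vertices_in)
  moreover have "plane_form (fst L) (\<lambda>v w. FB (\<lambda>i. v (bw nB i)) (\<lambda>i. w (bw nB i)))"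
    by (rule plane_form_reindex[OF plane_form_poly]) (auto intro: vertices_in)
  moreover have "plane_form (fst L) (\<lambda>v w. chain_form v w)"
    unfolding chain_form_def edge_form_def
    by (intro plane_form_mult plane_form_plus plane_form_sum plane_form_basic) (auto intro: vertices_in)
  ultimately have "plane_form (fst L) (\<lambda>v w. FA (\<lambda>i. v (cv VA nA i)) (\<lambda>i. w (cv VA nA i)) +
     FB (\<lambda>i. v (bw nB i)) (\<lambda>i. w (bw nB i)) + chain_form v w)"
    by (intro plane_form_plus)
  then show ?thesis by (simp only: total_form_def[abs_def])
qed

lemma pB_edge': "0 < i \<Longrightarrow> i \<le> nB \<Longrightarrow> bw nB i = cv VB nB (Suc (nB - i)) \<and> bw nB (Suc i mod Suc nB) = cv VB nB (nB - i)"
  by (cases "i = nB") (auto simp: bw_def Suc_diff_le cv_0)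

lemma critA: "FA pA w = 0"
proof -
  obtain R where R: "\<And>i. i \<le> nA \<Longrightarrow> dist OA (pA i) = R" using dist_A by blast
  show ?thesis
  proof (rule poly_form_critical[where O' = OA and R = R])
    fix i assume i: "i < Suc nA"
    show "dist OA (pA i) = R" using R i by simp
    show "pA (Suc i mod Suc nA) \<noteq> pA i"
      using i edge_nonzero(1)[of i] W_nonzero len by (cases "i = nA") (auto simp: cv_0 cv_n)
  qed (simp_all add: \<mu>A_def cyclic_multipliers_def)
qed

lemma pB_edge_nonzero: "i < Suc nB \<Longrightarrow> pB (Suc i mod Suc nB) \<noteq> pB i"
proof (cases "i = 0")
  case True
  then show ?thesis using W_nonzero len by (simp add: bw_simps)
next
  case False
  assume "i < Suc nB"
  then show ?thesis using False pB_edge'[of i] edge_nonzero(2)[of "nB - i"] by auto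
qed

lemma critB: "FB pB w = 0"
proof -
  obtain R where R: "\<And>i. i \<le> nB \<Longrightarrow> dist OB (pB i) = R" using dist_B by blast
  show ?thesis
  proof (rule poly_form_critical[where O' = OB and R = R])
    fix i assume i: "i < Suc nB"
    show "dist OB (pB i) = R" using R i by simp
    show "pB (Suc i mod Suc nB) \<noteq> pB i" by (rule pB_edge_nonzero[OF i])
  qed (simp_all add: \<mu>B_def cyclic_multipliers_def)
qed

text \<open>Edge \<open>e\<close> of Z is \<open>t e\<close> times W, so the factor
  \<open>inverse (t e)\<close> cancels and the sum over Z telescopes to the term of the
  diagonal.\<close>

lemma crit: "total_form P w = 0"
proof -
  have "(\<Sum>e<r. - inverse (t e) * edge_form (cv VZ r (Suc e)) (cv VZ r e) P w)
      = (\<Sum>e<r. - Re (cnj W * (w (cv VZ r (Suc e)) - w (cv VZ r e))))"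
    by (intro sum.cong refl) (simp add: edge_form_eq Z_edge t_nonzero field_simps)
  also have "\<dots> = - Re (cnj W * (\<Sum>e<r. w (cv VZ r (Suc e)) - w (cv VZ r e)))"
    by (simp only: sum_negf Re_sum sum_distrib_left)
  also have "(\<Sum>e<r. w (cv VZ r (Suc e)) - w (cv VZ r e)) = w Term - w Init"
    using sum_lessThan_telescope[of "\<lambda>e. w (cv VZ r e)" r] len by (simp add: cv_0 cv_n)
  finally have "chain_form P w = 0" by (simp add: chain_form_def edge_form_eq)
  then show ?thesis by (simp add: total_form_def critA critB)
qed

text \<open>Of all lengths involved, only that of the diagonal varies over the configurations. By
  \<open>c_eq\<close> its contributions from the two polygons and from \<open>chain_form\<close>
  cancel.\<close>

lemma area_eq:
  "\<exists>k. \<forall>q\<in>configs L. Gamma_area nA nB q = total_form q q / 2 + k"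
proof -
  define kA where "kA = (\<Sum>i<nA. \<mu>A i * (a ! i)\<^sup>2)"
  \<comment> \<open>Edge \<open>Suc i\<close> of BW is edge \<open>nB - Suc i\<close> of B,
    traversed backwards.\<close>
  define kB where "kB = (\<Sum>i<nB. \<mu>B (Suc i) * (b ! (nB - Suc i))\<^sup>2)"
  define kZ where "kZ = c * (\<Sum>e<r. inverse (t e) * (z ! e)\<^sup>2)"
  have "Gamma_area nA nB q = total_form q q / 2 + (kA + kB + kZ) / 2" if q: "q \<in> configs L" for q
  proof -
    note Q = q[unfolded config_iff]
    have w2: "(cmod (q Init - q Term))\<^sup>2 = (cmod (q Term - q Init))\<^sup>2" by (simp add: norm_minus_commute)
    have "(\<Sum>i<Suc nA. \<mu>A i * (cmod (q (cv VA nA (Suc i mod Suc nA)) - q (cv VA nA i)))\<^sup>2)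
        = kA + \<mu>A nA * (cmod (q Term - q Init))\<^sup>2"
    proof -
      have "(\<Sum>i<nA. \<mu>A i * (cmod (q (cv VA nA (Suc i mod Suc nA)) - q (cv VA nA i)))\<^sup>2) = kA"
        unfolding kA_def by (intro sum.cong refl) (use Q in \<open>auto simp: dist_norm norm_minus_commute\<close>)
      then show ?thesis using len by (simp add: cv_0 cv_n w2)
    qed
    then have A: "FA (\<lambda>i. q (cv VA nA i)) (\<lambda>i. q (cv VA nA i)) / 2
        = oriented_area (map (\<lambda>i. q (cv VA nA i)) [0..<Suc nA]) - (kA + \<mu>A nA * (cmod (q Term - q Init))\<^sup>2) / 2"
      unfolding poly_form_area[OF zero_less_Suc] by (simp only:)
    have "(\<Sum>i<Suc nB. \<mu>B i * (cmod (q (bw nB (Suc i mod Suc nB)) - q (bw nB i)))\<^sup>2)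
        = \<mu>B 0 * (cmod (q Term - q Init))\<^sup>2 + kB"
    proof -
      have "(\<Sum>i<nB. \<mu>B (Suc i) * (cmod (q (bw nB (Suc (Suc i) mod Suc nB)) - q (bw nB (Suc i))))\<^sup>2) = kB"
        unfolding kB_def
      proof (rule sum.cong[OF refl])
        fix i assume "i \<in> {..<nB}"
        then have i: "0 < Suc i" "Suc i \<le> nB" "nB - Suc i < nB" by auto
        have "cmod (q (cv VB nB (nB - Suc i)) - q (cv VB nB (Suc (nB - Suc i)))) = b ! (nB - Suc i)"
          using Q i(3) by (auto simp: dist_norm)
        then show "\<mu>B (Suc i) * (cmod (q (bw nB (Suc (Suc i) mod Suc nB)) - q (bw nB (Suc i))))\<^sup>2 = \<mu>B (Suc i) * (b ! (nB - Suc i))\<^sup>2"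
          using pB_edge'[OF i(1,2)] by simp
      qed
      moreover have "bw nB (Suc 0 mod Suc nB) = Term" using len by (simp add: bw_simps)
      ultimately show ?thesis by (subst sum.lessThan_Suc_shift) (simp only: bw_simps)
    qed
    then have B: "FB (\<lambda>i. q (bw nB i)) (\<lambda>i. q (bw nB i)) / 2
        = oriented_area (map (\<lambda>i. q (bw nB i)) [0..<Suc nB]) - (\<mu>B 0 * (cmod (q Term - q Init))\<^sup>2 + kB) / 2"
      unfolding poly_form_area[OF zero_less_Suc] by (simp only:)
    have self: "edge_form x y q q = (cmod (q x - q y))\<^sup>2" for x y
      unfolding edge_form_eq cmod_power2 by (simp add: power2_eq_square algebra_simps)
    have "(\<Sum>e<r. - inverse (t e) * edge_form (cv VZ r (Suc e)) (cv VZ r e) q q) = - (\<Sum>e<r. inverse (t e) * (z ! e)\<^sup>2)"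
      unfolding self sum_negf[symmetric]
      by (intro sum.cong refl) (use Q in \<open>auto simp: dist_norm norm_minus_commute\<close>)
    then have Z: "chain_form q q = c * (cmod (q Term - q Init))\<^sup>2 - kZ"
      by (simp add: chain_form_def self kZ_def algebra_simps)
    show ?thesis
      unfolding Gamma_area_split[OF len(1,2)] total_form_def add_divide_distrib A B Z c_eq[symmetric]
      by (simp add: field_simps)
  qed
  then show ?thesis by blast
qed

end

section \<open>Splitting tangent vectors along the three chains\<close>

lemma polygon_tangent_iff:
  "v \<in> tangent_vectors (polygon_linkage (polygon_lengths (Suc m) p)) p \<longleftrightarrow>
    (\<forall>i<Suc m. Re (cnj (p i - p (Suc i mod Suc m)) * (v i - v (Suc i mod Suc m))) = 0)"
proof -
  have "v \<in> tangent_vectors (polygon_linkage (polygon_lengths (Suc m) p)) p \<longleftrightarrow>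
      (\<forall>x y l. (x, y, l) \<in> snd (polygon_linkage (polygon_lengths (Suc m) p)) \<longrightarrow> Re (cnj (p x - p y) * (v x - v y)) = 0)"
    unfolding tangent_vectors_def by (simp only: mem_Collect_eq Ball_def split_paired_All case_prod_conv)
  then show ?thesis unfolding snd_polygon_linkage by blast
qed

lemma tangent_vectors_add:
  assumes "v \<in> tangent_vectors L P" "w \<in> tangent_vectors L P"
  shows "(\<lambda>a. v a + w a) \<in> tangent_vectors L P"
  unfolding tangent_vectors_def
proof (clarify)
  fix a b l assume e: "(a, b, l) \<in> snd L"
  then have "Re (cnj (P a - P b) * (v a - v b)) = 0" "Re (cnj (P a - P b) * (w a - w b)) = 0"
    using assms unfolding tangent_vectors_def by blast+
  moreover have "cnj (P a - P b) * (v a + w a - (v b + w b))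
      = cnj (P a - P b) * (v a - v b) + cnj (P a - P b) * (w a - w b)"
    by (simp only: distrib_left[symmetric]) (simp add: algebra_simps)
  ultimately show "Re (cnj (P a - P b) * (v a + w a - (v b + w b))) = 0"
    by (simp only: plus_complex.sel)
qed

lemma Re_of_real_times: "Re (of_real x * z) = x * Re z"
  by simp

lemma Re_perpendicular_product:
  "Re (cnj (\<i> * of_real x * w) * (\<i> * of_real y * w)) = x * y * (cmod w)\<^sup>2"
proof -
  have "cnj (\<i> * of_real x * w) * (\<i> * of_real y * w) = of_real (x * y) * (w * cnj w)"
    by (simp add: algebra_simps)
  also have "\<dots> = of_real (x * y * (cmod w)\<^sup>2)" by (simp only: complex_norm_square of_real_mult)
  finally show ?thesis by (simp only: Re_complex_of_real)
qed

lemma rigid_edge: "Re (cnj (p - q) * (k + \<i> * of_real s * (p - o') - (k + \<i> * of_real s * (q - o')))) = 0"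
proof -
  have "k + \<i> * of_real s * (p - o') - (k + \<i> * of_real s * (q - o')) = \<i> * of_real s * (p - q)"
    by (simp add: algebra_simps)
  then show ?thesis by (simp only: rigid_orthogonal)
qed

lemma rigid_edge': "Re (cnj (p - q) * (\<i> * of_real s * (p - o') - \<i> * of_real s * (q - o'))) = 0"
  using rigid_edge[of p q 0 s o'] by simp

context aligned_three_chain
begin

abbreviation "TA \<equiv> tangent_vectors (polygon_linkage (polygon_lengths (Suc nA) pA)) pA"
abbreviation "TB \<equiv> tangent_vectors (polygon_linkage (polygon_lengths (Suc nB) pB)) pB"
abbreviation "T \<equiv> tangent_vectors L P"

text \<open>The velocity of an edge is divided by W and not by the edge, so that the values add up
  along Z to the rotation speed of the diagonal.\<close>

definition rot :: "(vertex \<Rightarrow> complex) \<Rightarrow> nat \<Rightarrow> real" where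
  "rot v e = Im ((v (cv VZ r (Suc e)) - v (cv VZ r e)) / W)"

lemma Z_rot:
  assumes v: "v \<in> T" and e: "e < r"
  shows "v (cv VZ r (Suc e)) - v (cv VZ r e) = \<i> * of_real (rot v e) * W"
proof -
  let ?d = "v (cv VZ r (Suc e)) - v (cv VZ r e)"
  have "Re (cnj (P (cv VZ r e) - P (cv VZ r (Suc e))) * (v (cv VZ r e) - v (cv VZ r (Suc e)))) = 0"
    using v e unfolding tangent_iff by blast
  moreover have "P (cv VZ r e) - P (cv VZ r (Suc e)) = - (of_real (t e) * W)"
    using Z_edge[OF e] by (metis minus_diff_eq)
  moreover have "v (cv VZ r e) - v (cv VZ r (Suc e)) = - ?d" by simp
  ultimately have "Re (cnj (- (of_real (t e) * W)) * - ?d) = 0" by (simp only:)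
  moreover have "cnj (- (of_real (t e) * W)) * - ?d = of_real (t e) * (cnj W * ?d)"
    by (simp only: complex_cnj_minus complex_cnj_mult complex_cnj_complex_of_real minus_mult_minus mult.assoc)
  ultimately have "t e * Re (cnj W * ?d) = 0" by (simp only: Re_of_real_times)
  then have "Re (cnj W * ?d) = 0" using t_nonzero[OF e] by (simp only: mult_eq_0_iff) blast
  from perpendicular_complex[OF this W0] show ?thesis by (simp only: rot_def)
qed

lemma T_rot: "v \<in> T \<Longrightarrow> v Term - v Init = \<i> * of_real (\<Sum>e<r. rot v e) * W"
proof -
  assume v: "v \<in> T"
  have "v Term - v Init = (\<Sum>e<r. v (cv VZ r (Suc e)) - v (cv VZ r e))"
    using sum_lessThan_telescope[of "\<lambda>e. v (cv VZ r e)" r] len by (simp add: cv_0 cv_n)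
  also have "\<dots> = (\<Sum>e<r. \<i> * of_real (rot v e) * W)" by (intro sum.cong refl) (simp only: Z_rot[OF v] lessThan_iff)
  finally show ?thesis by (simp only: of_real_sum sum_distrib_left sum_distrib_right)
qed

text \<open>All edges of Z move perpendicularly to W, so the length of the diagonal is stationary.
  This makes the restrictions to A and B tangent to polygon spaces in which W is a side of fixed
  length.\<close>

lemma T_closing: "v \<in> T \<Longrightarrow> Re (cnj W * (v Term - v Init)) = 0"
  unfolding T_rot
proof -
  have "cnj W * (\<i> * of_real s * W) = cnj W * (\<i> * of_real s * W)" for s ..
  show "Re (cnj W * (\<i> * of_real (\<Sum>e<r. rot v e) * W)) = 0" by (rule rigid_orthogonal)
qed

lemma restrict_A: "v \<in> T \<Longrightarrow> (\<lambda>i. v (cv VA nA i)) \<in> TA"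
  unfolding polygon_tangent_iff
proof (intro allI impI)
  fix i assume v: "v \<in> T" and i: "i < Suc nA"
  show "Re (cnj (pA i - pA (Suc i mod Suc nA)) * (v (cv VA nA i) - v (cv VA nA (Suc i mod Suc nA)))) = 0"
  proof (cases "i = nA")
    case True
    then show ?thesis using T_closing[OF v] len by (simp only: mod_self cv_0 cv_n)
  next
    case False
    then have "i < nA" "Suc i mod Suc nA = Suc i" using i by auto
    then show ?thesis using v unfolding tangent_iff by (simp only:)
  qed
qed

lemma Re_cnj_swap: "Re (cnj (x - y) * (u - v)) = Re (cnj (y - x) * (v - u))"
proof -
  have "cnj (x - y) * (u - v) = cnj (y - x) * (v - u)" by (simp add: algebra_simps)
  then show ?thesis by simp
qed

lemma restrict_B: "v \<in> T \<Longrightarrow> (\<lambda>i. v (bw nB i)) \<in> TB"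
  unfolding polygon_tangent_iff
proof (intro allI impI)
  fix i assume v: "v \<in> T" and i: "i < Suc nB"
  show "Re (cnj (pB i - pB (Suc i mod Suc nB)) * (v (bw nB i) - v (bw nB (Suc i mod Suc nB)))) = 0"
  proof (cases "i = 0")
    case True
    have "Suc i mod Suc nB = Suc 0" using True by simp
    then show ?thesis unfolding True using T_closing[OF v] by (simp only: bw_simps Re_cnj_swap[of "P Init"])
  next
    case False
    then have k: "0 < i" "i \<le> nB" "nB - i < nB" using i by auto
    have "Re (cnj (P (cv VB nB (nB - i)) - P (cv VB nB (Suc (nB - i)))) * (v (cv VB nB (nB - i)) - v (cv VB nB (Suc (nB - i))))) = 0"
      using v k(3) unfolding tangent_iff by blast
    then show ?thesis using pB_edge'[OF k(1,2)] by (simp only: Re_cnj_swap[of "P (cv VB nB (Suc (nB - i)))"])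
  qed
qed

definition "\<kappa> = c * (cmod W)\<^sup>2"

text \<open>On tangent vectors the diagonal and all edges of Z move by real multiples of \<i>W. All
  inner products in \<open>chain_form\<close> thus reduce to products of reals with the common
  factor \<open>(cmod W)\<^sup>2\<close>.\<close>

lemma total_form_split:
  assumes v: "v \<in> T" and w: "w \<in> T"
  shows "total_form v w = FA (\<lambda>i. v (cv VA nA i)) (\<lambda>i. w (cv VA nA i)) +
    (FB (\<lambda>i. v (bw nB i)) (\<lambda>i. w (bw nB i)) + aligned_form \<kappa> r t (rot v) (rot w))"
proof -
  have d: "Re (cnj (\<i> * of_real x * W) * (\<i> * of_real y * W)) = x * y * (cmod W)\<^sup>2" for x y
    by (rule Re_perpendicular_product)
  have "chain_form v w = c * ((\<Sum>e<r. rot v e) * (\<Sum>e<r. rot w e) * (cmod W)\<^sup>2 +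
      (\<Sum>e<r. - inverse (t e) * (rot v e * rot w e * (cmod W)\<^sup>2)))"
    unfolding chain_form_def edge_form_eq T_rot[OF v] T_rot[OF w] d
    by (intro arg_cong2[where f = "(*)"] arg_cong2[where f = "(+)"] refl sum.cong)
      (simp only: Z_rot[OF v] Z_rot[OF w] d lessThan_iff)
  also have "\<dots> = aligned_form \<kappa> r t (rot v) (rot w)"
    by (simp add: aligned_form_def \<kappa>_def sum_negf sum_distrib_right[symmetric] sum_distrib_left[symmetric]
        right_diff_distrib mult.assoc[symmetric])
  finally show ?thesis by (simp add: total_form_def)
qed

text \<open>A variation of one of the three chains is extended to the other two by the rigid motion
  that agrees with it at the two common vertices.\<close>

definition ext_A :: "(nat \<Rightarrow> complex) \<Rightarrow> vertex \<Rightarrow> complex" where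
  "ext_A u v = (case v of VA i \<Rightarrow> u i | _ \<Rightarrow> u 0 + \<i> * of_real (Im ((u nA - u 0) / W)) * (P v - P Init))"

definition ext_B :: "(nat \<Rightarrow> complex) \<Rightarrow> vertex \<Rightarrow> complex" where
  "ext_B u v = (case v of VB i \<Rightarrow> u (Suc nB - i) | _ \<Rightarrow> u 0 + \<i> * of_real (Im ((u 1 - u 0) / W)) * (P v - P Init))"

definition ext_Z :: "(nat \<Rightarrow> real) \<Rightarrow> vertex \<Rightarrow> complex" where
  "ext_Z y v = (case v of VZ k \<Rightarrow> \<i> * of_real (\<Sum>e<k. y e) * W | _ \<Rightarrow> \<i> * of_real (\<Sum>e<r. y e) * (P v - P Init))"

lemma TA_closing: "u \<in> TA \<Longrightarrow> u nA = u 0 + \<i> * of_real (Im ((u nA - u 0) / W)) * W"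
proof -
  assume "u \<in> TA"
  then have "Re (cnj (pA nA - pA (Suc nA mod Suc nA)) * (u nA - u (Suc nA mod Suc nA))) = 0"
    unfolding polygon_tangent_iff by blast
  then have "Re (cnj W * (u nA - u 0)) = 0" using len by (simp only: mod_self cv_0 cv_n)
  from perpendicular_complex[OF this W0] show ?thesis by (simp only: diff_eq_eq add.commute)
qed

lemma TB_closing: "u \<in> TB \<Longrightarrow> u 1 = u 0 + \<i> * of_real (Im ((u 1 - u 0) / W)) * W"
proof -
  assume u: "u \<in> TB"
  have "Suc 0 mod Suc nB = Suc 0" using len by simp
  then have "Re (cnj (pB 0 - pB (Suc 0)) * (u 0 - u (Suc 0))) = 0"
    using u unfolding polygon_tangent_iff by (metis zero_less_Suc)
  then have "Re (cnj W * (u 1 - u 0)) = 0" unfolding bw_simps Re_cnj_swap[of "P Init"] by simp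
  from perpendicular_complex[OF this W0] show ?thesis by (simp only: diff_eq_eq add.commute)
qed

lemma ext_A_simps:
  assumes u: "u \<in> TA"
  shows "i \<le> nA \<Longrightarrow> ext_A u (cv VA nA i) = u i"
    and "ext_A u (cv VB k i) = u 0 + \<i> * of_real (Im ((u nA - u 0) / W)) * (P (cv VB k i) - P Init)"
    and "ext_A u (cv VZ k i) = u 0 + \<i> * of_real (Im ((u nA - u 0) / W)) * (P (cv VZ k i) - P Init)"
  using TA_closing[OF u] by (auto simp: ext_A_def cv_def)

lemma ext_B_simps:
  assumes u: "u \<in> TB"
  shows "i \<le> nB \<Longrightarrow> ext_B u (bw nB i) = u i"
    and "ext_B u (cv VA k i) = u 0 + \<i> * of_real (Im ((u 1 - u 0) / W)) * (P (cv VA k i) - P Init)"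
    and "ext_B u (cv VZ k i) = u 0 + \<i> * of_real (Im ((u 1 - u 0) / W)) * (P (cv VZ k i) - P Init)"
proof -
  show "ext_B u (bw nB i) = u i" if "i \<le> nB"
  proof -
    consider "i = 0" | "i = 1" | "1 < i" by linarith
    then show ?thesis
    proof cases
      case 2
      then show ?thesis using TB_closing[OF u] by (simp add: ext_B_def bw_simps)
    next
      case 3
      then show ?thesis using that by (auto simp: ext_B_def bw_def cv_def)
    qed (simp add: ext_B_def bw_simps)
  qed
qed (auto simp: ext_B_def cv_def)

lemma ext_Z_simps:
  "k \<le> r \<Longrightarrow> ext_Z y (cv VZ r k) = \<i> * of_real (\<Sum>e<k. y e) * W"
  "ext_Z y (cv VA n i) = \<i> * of_real (\<Sum>e<r. y e) * (P (cv VA n i) - P Init)"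
  "ext_Z y (cv VB n i) = \<i> * of_real (\<Sum>e<r. y e) * (P (cv VB n i) - P Init)"
  by (auto simp: ext_Z_def cv_def)

lemma ext_A_tangent: assumes u: "u \<in> TA" shows "ext_A u \<in> T"
  unfolding tangent_iff
proof (intro conjI allI impI)
  fix i assume i: "i < nA"
  have "Re (cnj (pA i - pA (Suc i mod Suc nA)) * (u i - u (Suc i mod Suc nA))) = 0"
    using u i unfolding polygon_tangent_iff by (meson less_SucI)
  moreover have "Suc i mod Suc nA = Suc i" using i by simp
  ultimately show "Re (cnj (P (cv VA nA i) - P (cv VA nA (Suc i))) * (ext_A u (cv VA nA i) - ext_A u (cv VA nA (Suc i)))) = 0"
    using i by (simp only: ext_A_simps(1)[OF u] less_imp_le Suc_le_eq)
qed (simp_all only: ext_A_simps[OF u] rigid_edge)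

lemma ext_B_tangent: assumes u: "u \<in> TB" shows "ext_B u \<in> T"
  unfolding tangent_iff
proof (intro conjI allI impI)
  fix i assume i: "i < nB"
  define k where "k = nB - i"
  have k: "0 < k" "k \<le> nB" "nB - k = i" "k < Suc nB" using i by (auto simp: k_def)
  have "Re (cnj (pB k - pB (Suc k mod Suc nB)) * (u k - u (Suc k mod Suc nB))) = 0"
    using u k(4) unfolding polygon_tangent_iff by blast
  moreover have "u k = ext_B u (bw nB k)" by (rule ext_B_simps(1)[OF u k(2), symmetric])
  moreover have "u (Suc k mod Suc nB) = ext_B u (bw nB (Suc k mod Suc nB))"
    by (rule ext_B_simps(1)[OF u, symmetric]) (simp add: less_Suc_eq_le[symmetric])
  ultimately have "Re (cnj (P (cv VB nB (Suc i)) - P (cv VB nB i)) * (ext_B u (cv VB nB (Suc i)) - ext_B u (cv VB nB i))) = 0"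
    using pB_edge'[OF k(1,2)] k(3) by (simp only:)
  then show "Re (cnj (P (cv VB nB i) - P (cv VB nB (Suc i))) * (ext_B u (cv VB nB i) - ext_B u (cv VB nB (Suc i)))) = 0"
    by (simp only: Re_cnj_swap[of "P (cv VB nB i)"])
qed (simp_all only: ext_B_simps[OF u] rigid_edge)

lemma ext_Z_tangent: "ext_Z y \<in> T"
  unfolding tangent_iff
proof (intro conjI allI impI)
  fix i assume i: "i < r"
  have "ext_Z y (cv VZ r (Suc i)) - ext_Z y (cv VZ r i) = \<i> * of_real (y i) * W"
    using i by (simp add: ext_Z_simps algebra_simps)
  moreover have "P (cv VZ r (Suc i)) - P (cv VZ r i) = of_real (t i) * W" by (rule Z_edge[OF i])
  moreover have "cnj (of_real (t i) * W) * (\<i> * of_real (y i) * W) = of_real (t i) * (cnj W * (\<i> * of_real (y i) * W))"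
    by (simp only: complex_cnj_mult complex_cnj_complex_of_real mult.assoc)
  ultimately show "Re (cnj (P (cv VZ r i) - P (cv VZ r (Suc i))) * (ext_Z y (cv VZ r i) - ext_Z y (cv VZ r (Suc i)))) = 0"
    unfolding Re_cnj_swap[of "P (cv VZ r i)"] by (simp only: Re_of_real_times rigid_orthogonal mult_zero_right)
qed (simp_all only: ext_Z_simps rigid_edge')

definition ext :: "(nat \<Rightarrow> complex) \<times> (nat \<Rightarrow> complex) \<times> (nat \<Rightarrow> real) \<Rightarrow> vertex \<Rightarrow> complex" where
  "ext x v = ext_A (fst x) v + (ext_B (fst (snd x)) v + ext_Z (snd (snd x)) v)"

lemma ext_tangent: "u \<in> TA \<Longrightarrow> w \<in> TB \<Longrightarrow> ext (u, w, y) \<in> T"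
  unfolding ext_def fst_conv snd_conv
  by (intro tangent_vectors_add ext_A_tangent ext_B_tangent ext_Z_tangent)

text \<open>On A, the extensions of the parts belonging to B and Z are rigid motions, which the
  polygon form does not see at its critical point.\<close>

lemma FA_ext:
  assumes u: "u \<in> TA" and w: "w \<in> TB"
  shows "FA (\<lambda>i. ext (u, w, y) (cv VA nA i)) f = FA u f"
proof -
  \<comment> \<open>The rotation speed of A induced by the other two parts together.\<close>
  define s where "s = Im ((w 1 - w 0) / W) + (\<Sum>e<r. y e)"
  have "FA (\<lambda>i. ext (u, w, y) (cv VA nA i)) f = FA (\<lambda>i. u i + (\<i> * of_real s * pA i + (w 0 - \<i> * of_real s * P Init))) f"
    by (rule plane_form_cong[OF plane_form_poly[OF zero_less_Suc]])
      (simp add: ext_def ext_A_simps(1)[OF u] ext_B_simps(2)[OF w] ext_Z_simps(2) s_def algebra_simps)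
  also have "\<dots> = FA u f + FA (\<lambda>i. \<i> * of_real s * pA i + (w 0 - \<i> * of_real s * P Init)) f"
    by (rule plane_form_add[OF plane_form_poly[OF zero_less_Suc]])
  also have "FA (\<lambda>i. \<i> * of_real s * pA i + (w 0 - \<i> * of_real s * P Init)) f = 0"
    by (rule plane_form_rigid[where B = FA and P = pA, OF plane_form_poly[OF zero_less_Suc] critA refl])
  finally show ?thesis by simp
qed

lemma FB_ext:
  assumes u: "u \<in> TA" and w: "w \<in> TB"
  shows "FB (\<lambda>i. ext (u, w, y) (bw nB i)) f = FB w f"
proof -
  define s where "s = Im ((u nA - u 0) / W) + (\<Sum>e<r. y e)"
  have "FB (\<lambda>i. ext (u, w, y) (bw nB i)) f = FB (\<lambda>i. w i + (\<i> * of_real s * pB i + (u 0 - \<i> * of_real s * P Init))) f"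
  proof (rule plane_form_cong[OF plane_form_poly[OF zero_less_Suc]])
    fix i assume "i \<in> {..<Suc nB}"
    then have i: "i \<le> nB" by simp
    obtain k where k: "bw nB i = cv VB nB k" using bw_cv[OF i] by blast
    have "ext_A u (bw nB i) = u 0 + \<i> * of_real (Im ((u nA - u 0) / W)) * (pB i - P Init)"
      "ext_Z y (bw nB i) = \<i> * of_real (\<Sum>e<r. y e) * (pB i - P Init)"
      unfolding k by (rule ext_A_simps(2)[OF u], rule ext_Z_simps(3))
    note AZ = this
    show "ext (u, w, y) (bw nB i) = w i + (\<i> * of_real s * pB i + (u 0 - \<i> * of_real s * P Init))"
      by (simp add: ext_def ext_B_simps(1)[OF w i] AZ s_def algebra_simps)
  qed
  also have "\<dots> = FB w f + FB (\<lambda>i. \<i> * of_real s * pB i + (u 0 - \<i> * of_real s * P Init)) f"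
    by (rule plane_form_add[OF plane_form_poly[OF zero_less_Suc]])
  also have "FB (\<lambda>i. \<i> * of_real s * pB i + (u 0 - \<i> * of_real s * P Init)) f = 0"
    by (rule plane_form_rigid[where B = FB and P = pB, OF plane_form_poly[OF zero_less_Suc] critB refl])
  finally show ?thesis by simp
qed

text \<open>The parts belonging to A and B rotate Z as a whole, which adds a multiple of
  \<open>t\<close>, an element of the radical.\<close>

lemma aligned_ext:
  assumes u: "u \<in> TA" and w: "w \<in> TB"
  shows "aligned_form \<kappa> r t (rot (ext (u, w, y))) y' = aligned_form \<kappa> r t y y'"
proof (rule aligned_form_add_radical[OF t_nonzero t_sum])
  fix e assume e: "e < r"
  define s where "s = Im ((u nA - u 0) / W) + Im ((w 1 - w 0) / W)"
  have "ext (u, w, y) (cv VZ r (Suc e)) - ext (u, w, y) (cv VZ r e)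
      = \<i> * of_real s * (P (cv VZ r (Suc e)) - P (cv VZ r e)) + \<i> * of_real (y e) * W"
    using e by (simp add: ext_def ext_A_simps(3)[OF u] ext_B_simps(3)[OF w] ext_Z_simps(1) s_def algebra_simps)
  also have "\<dots> = \<i> * of_real (s * t e + y e) * W"
    unfolding Z_edge[OF e] by (simp add: algebra_simps)
  finally have "(ext (u, w, y) (cv VZ r (Suc e)) - ext (u, w, y) (cv VZ r e)) / W = \<i> * of_real (s * t e + y e)"
    by (simp only: nonzero_mult_div_cancel_right[OF W0])
  then have "rot (ext (u, w, y)) e = Im (\<i> * of_real (s * t e + y e))" by (simp only: rot_def)
  then show "rot (ext (u, w, y)) e = (Im ((u nA - u 0) / W) + Im ((w 1 - w 0) / W)) * t e + y e"
    by (simp add: s_def)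
qed

text \<open>Restriction to the three chains preserves the forms, and \<open>ext\<close> inverts it
  up to the radicals.\<close>

lemma total_index:
  assumes "has_index FA TA mA" "has_index FB TB mB" "has_index (aligned_form \<kappa> r t) UNIV mZ"
  shows "has_index total_form T (mA + (mB + mZ))"
proof -
  have symA: "FA v w = FA w v" and symB: "FB v w = FB w v" for v w
    by (rule plane_form_sym[OF plane_form_poly[OF zero_less_Suc]])+
  have zA: "FA (\<lambda>_. 0) w = 0" and zB: "FB (\<lambda>_. 0) w = 0" for w
    by (rule plane_form_const[OF plane_form_poly[OF zero_less_Suc]])+
  have zT: "(\<lambda>_. 0) \<in> TA" "(\<lambda>_. 0) \<in> TB" by (auto simp: polygon_tangent_iff)
  have zZ: "aligned_form \<kappa> r t (\<lambda>_. 0) w = 0" for w by (simp add: aligned_form_def)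
  let ?BZ = "\<lambda>v w. FB (fst v) (fst w) + aligned_form \<kappa> r t (snd v) (snd w)"
  let ?F = "\<lambda>v w. FA (fst v) (fst w) + ?BZ (snd v) (snd w)"
  have "has_index ?BZ (TB \<times> UNIV) (mB + mZ)"
    by (rule has_index_prod[where ?o1.0 = "\<lambda>_. 0" and ?o2.0 = "\<lambda>_. 0"])
      (rule symB aligned_form_sym zB zZ zT UNIV_I assms)+
  note BZ = this
  have symZ: "?BZ v w = ?BZ w v" for v w
    by (simp only: symB[of "fst v"] aligned_form_sym[of _ _ _ "snd v"])
  have "has_index ?F (TA \<times> (TB \<times> UNIV)) (mA + (mB + mZ))"
  proof (rule has_index_prod[where ?o1.0 = "\<lambda>_. 0" and ?o2.0 = "(\<lambda>_. 0, \<lambda>_. 0)" and ?B2.0 = ?BZ])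
    show "((\<lambda>_. 0, \<lambda>_. 0) :: (nat \<Rightarrow> complex) \<times> (nat \<Rightarrow> real)) \<in> TB \<times> UNIV" using zT by simp
    show "?BZ (\<lambda>_. 0, \<lambda>_. 0) w = 0" for w by (simp only: fst_conv snd_conv zB zZ)
  qed (rule symA symZ zA zT BZ assms)+
  note F = this
  show ?thesis
  proof (rule has_index_transfer[where B' = ?F and T' = "TA \<times> (TB \<times> UNIV)" and s = ext
        and p = "\<lambda>v. (\<lambda>i. v (cv VA nA i), \<lambda>i. v (bw nB i), rot v)"])
    show "?F v w = ?F w v" for v w by (simp only: symA[of "fst v"] symZ[of "snd v"])
  qed (auto simp: total_form_split restrict_A restrict_B ext_tangent FA_ext FB_ext aligned_ext intro: F)
qed

end

section \<open>Motions of the three-chain and evaluation of the index\<close>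

lemma rotated_edges_derivative:
  fixes p v :: "nat \<Rightarrow> complex"
  assumes e: "\<And>i. i < k \<Longrightarrow> p (Suc i) \<noteq> p i"
    and orth: "\<And>i. i < k \<Longrightarrow> Re (cnj (p (Suc i) - p i) * (v (Suc i) - v i)) = 0" and v0: "v 0 = 0"
  shows "((\<lambda>s. p 0 + (\<Sum>i<k. (p (Suc i) - p i) * cis (Im ((v (Suc i) - v i) / (p (Suc i) - p i)) * s)))
    has_vector_derivative v k) (at 0)"
proof -
  have edge: "((\<lambda>s. (p (Suc i) - p i) * cis (Im ((v (Suc i) - v i) / (p (Suc i) - p i)) * s))
      has_vector_derivative v (Suc i) - v i) (at 0)" if "i < k" for i
  proof -
    have "p (Suc i) - p i \<noteq> 0" using e[OF that] by simp
    from perpendicular_complex[OF orth[OF that] this]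
    have "(p (Suc i) - p i) * (\<i> * of_real (Im ((v (Suc i) - v i) / (p (Suc i) - p i)))) = v (Suc i) - v i"
      by (simp only: mult_ac)
    then show ?thesis
      using has_vector_derivative_mult_right[OF cis_has_vector_derivative, of "p (Suc i) - p i"] by metis
  qed
  have "((\<lambda>s. p 0 + (\<Sum>i<k. (p (Suc i) - p i) * cis (Im ((v (Suc i) - v i) / (p (Suc i) - p i)) * s)))
    has_vector_derivative 0 + (\<Sum>i<k. v (Suc i) - v i)) (at 0)"
    by (intro has_vector_derivative_add has_vector_derivative_const has_vector_derivative_sum edge) simp
  moreover have "(\<Sum>i<k. v (Suc i) - v i) = v k" by (simp only: sum_lessThan_telescope v0 diff_zero)
  ultimately show ?thesis by (simp only: add_0)
qed

context aligned_three_chain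
begin

text \<open>The edges of Z rotate freely, starting from Init, and their end prescribes the position
  of Term. A and B reach it by bending at vertices that exist because they are not aligned. The
  motion keeps Init fixed; the velocity of Init is restored as a translation at the end.\<close>

lemma velocity:
  assumes v: "v \<in> T"
  shows "config_velocity L P v"
proof -
  let ?vA = "\<lambda>i. v (cv VA nA i) - v Init" and ?vB = "\<lambda>i. v (cv VB nB i) - v Init" and ?vZ = "\<lambda>i. v (cv VZ r i) - v Init"
  let ?pB = "\<lambda>i. P (cv VB nB i)" and ?pZ = "\<lambda>i. P (cv VZ r i)"
  have orthA: "Re (cnj (pA (Suc i) - pA i) * (?vA (Suc i) - ?vA i)) = 0" if "i < nA" for i
    using v that unfolding tangent_iff by (simp only: diff_diff_eq2 diff_add_cancel Re_cnj_swap[of "pA (Suc i)"])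
  have orthB: "Re (cnj (?pB (Suc i) - ?pB i) * (?vB (Suc i) - ?vB i)) = 0" if "i < nB" for i
    using v that unfolding tangent_iff by (simp only: diff_diff_eq2 diff_add_cancel Re_cnj_swap[of "?pB (Suc i)"])
  have orthZ: "Re (cnj (?pZ (Suc i) - ?pZ i) * (?vZ (Suc i) - ?vZ i)) = 0" if "i < r" for i
    using v that unfolding tangent_iff by (simp only: diff_diff_eq2 diff_add_cancel Re_cnj_swap[of "?pZ (Suc i)"])
  have ncA: "\<not> collinear (pA ` {..nA})"
    using A_not_aligned unfolding set_chain_vertices[OF len(1)] image_image .
  have ncB: "\<not> collinear (?pB ` {..nB})"
    using B_not_aligned unfolding set_chain_vertices[OF len(2)] image_image .
  obtain jA where "bendable pA nA jA" using exists_bent_vertex[where p = pA, OF edge_nonzero(1) ncA] by blast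
  then interpret A: bendable pA nA jA .
  obtain jB where "bendable ?pB nB jB" using exists_bent_vertex[where p = ?pB, OF edge_nonzero(2) ncB] by blast
  then interpret B: bendable ?pB nB jB .
  define yA where "yA i = Im ((?vA (Suc i) - ?vA i) / (pA (Suc i) - pA i))" for i
  define yB where "yB i = Im ((?vB (Suc i) - ?vB i) / (?pB (Suc i) - ?pB i))" for i
  define yZ where "yZ i = Im ((?vZ (Suc i) - ?vZ i) / (?pZ (Suc i) - ?pZ i))" for i
  define zp where "zp s k = P Init + (\<Sum>i<k. (?pZ (Suc i) - ?pZ i) * cis (yZ i * s))" for s k
  let ?bA = "\<lambda>s. bend pA nA jA (zp s r) (\<lambda>i. yA i * s)" and ?bB = "\<lambda>s. bend ?pB nB jB (zp s r) (\<lambda>i. yB i * s)"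
  define \<gamma> where "\<gamma> s = (\<lambda>x\<in>fst L. case x of Init \<Rightarrow> P Init | Term \<Rightarrow> zp s r | VA i \<Rightarrow> ?bA s i | VB i \<Rightarrow> ?bB s i | VZ k \<Rightarrow> zp s k)" for s
  have zp0: "zp s 0 = P Init" for s by (simp add: zp_def)
  have derZ: "((\<lambda>s. zp s k) has_vector_derivative ?vZ k) (at 0)" if "k \<le> r" for k
    using rotated_edges_derivative[of k ?pZ ?vZ] edge_nonzero(3) orthZ that
    unfolding zp_def yZ_def by (simp add: cv_0 del: complex_cnj_diff)
  have zpr: "zp 0 k = ?pZ k" if "k \<le> r" for k
    using sum_lessThan_telescope[of ?pZ k] by (simp add: zp_def cv_0)
  have qA: "((\<lambda>s. zp s r) has_vector_derivative ?vA nA) (at 0)" "zp 0 r = pA nA"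
    and qB: "((\<lambda>s. zp s r) has_vector_derivative ?vB nB) (at 0)" "zp 0 r = ?pB nB"
    using derZ[of r] zpr[of r] len by (simp_all add: cv_n)
  have v0: "?vA 0 = 0" "?vB 0 = 0" by (simp_all add: cv_0)
  have okA: "\<forall>\<^sub>F s in nhds 0. A.bend_ok (zp s r) (\<lambda>i. yA i * s)"
    by (rule A.bend_velocity(1)[where q = "\<lambda>s. zp s r" and v = ?vA and y = yA])
      (rule qA v0 yA_def | erule edge_nonzero(1) | erule orthA)+
  have derA: "((\<lambda>s. ?bA s k) has_vector_derivative ?vA k) (at 0)" if "k \<le> nA" for k
    by (rule A.bend_velocity(2)[where q = "\<lambda>s. zp s r" and v = ?vA and y = yA])
      (rule qA v0 yA_def that | erule edge_nonzero(1) | erule orthA)+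
  have okB: "\<forall>\<^sub>F s in nhds 0. B.bend_ok (zp s r) (\<lambda>i. yB i * s)"
    by (rule B.bend_velocity(1)[where q = "\<lambda>s. zp s r" and v = ?vB and y = yB])
      (rule qB v0 yB_def | erule edge_nonzero(2) | erule orthB)+
  have derB: "((\<lambda>s. ?bB s k) has_vector_derivative ?vB k) (at 0)" if "k \<le> nB" for k
    by (rule B.bend_velocity(2)[where q = "\<lambda>s. zp s r" and v = ?vB and y = yB])
      (rule qB v0 yB_def that | erule edge_nonzero(2) | erule orthB)+
  have gA: "\<gamma> s (cv VA nA i) = ?bA s i" if "i \<le> nA" for s i
    using vertices_in(1)[OF that] A.bend_0[of "zp s r" "\<lambda>i. yA i * s"] A.bend_m[of "zp s r" "\<lambda>i. yA i * s"]
    unfolding \<gamma>_def by (auto simp: cv_def)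
  have gB: "\<gamma> s (cv VB nB i) = ?bB s i" if "i \<le> nB" for s i
    using vertices_in(2)[OF that] B.bend_0[of "zp s r" "\<lambda>i. yB i * s"] B.bend_m[of "zp s r" "\<lambda>i. yB i * s"]
    unfolding \<gamma>_def by (auto simp: cv_def)
  have gZ: "\<gamma> s (cv VZ r i) = zp s i" if "i \<le> r" for s i
    using vertices_in(3)[OF that] zp0 unfolding \<gamma>_def by (auto simp: cv_def)
  note PC = P[unfolded config_iff]
  have "config_velocity L P (\<lambda>x. v x - v Init)"
  proof (rule config_velocityI[where \<gamma> = \<gamma>])
    show "\<forall>\<^sub>F s in nhds 0. \<gamma> s \<in> configs L"
      using okA okB
    proof eventually_elim
      case (elim s)
      have "dist (\<gamma> s (cv VA nA i)) (\<gamma> s (cv VA nA (Suc i))) = a ! i" if "i < nA" for i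
      proof -
        have "dist (?bA s i) (?bA s (Suc i)) = dist (pA i) (pA (Suc i))"
          using A.bend_dist[OF elim(1) that] by (simp only: dist_norm norm_minus_commute[of "?bA s i"] norm_minus_commute[of "pA i"])
        then show ?thesis using that PC by (simp only: gA less_imp_le Suc_le_eq)
      qed
      moreover have "dist (\<gamma> s (cv VB nB i)) (\<gamma> s (cv VB nB (Suc i))) = b ! i" if "i < nB" for i
      proof -
        have "dist (?bB s i) (?bB s (Suc i)) = dist (?pB i) (?pB (Suc i))"
          using B.bend_dist[OF elim(2) that] by (simp only: dist_norm norm_minus_commute[of "?bB s i"] norm_minus_commute[of "?pB i"])
        then show ?thesis using that PC by (simp only: gB less_imp_le Suc_le_eq)
      qed
      moreover have "dist (\<gamma> s (cv VZ r i)) (\<gamma> s (cv VZ r (Suc i))) = z ! i" if "i < r" for i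
      proof -
        have "zp s (Suc i) - zp s i = (?pZ (Suc i) - ?pZ i) * cis (yZ i * s)" by (simp add: zp_def)
        then have "dist (zp s (Suc i)) (zp s i) = dist (?pZ (Suc i)) (?pZ i)" by (simp add: dist_norm norm_mult)
        then show ?thesis using that PC by (simp only: gZ less_imp_le Suc_le_eq dist_commute[of "zp s i"] dist_commute[of "?pZ (Suc i)"])
      qed
      moreover have "\<gamma> s \<in> extensional (fst L)" by (simp add: \<gamma>_def)
      ultimately show ?case unfolding config_iff by blast
    qed
  next
    fix x assume "x \<in> fst L"
    then consider i where "i \<le> nA" "x = cv VA nA i" | i where "i \<le> nB" "x = cv VB nB i" | i where "i \<le> r" "x = cv VZ r i"
      unfolding fst_L by blast
    then have "\<gamma> 0 x = P x \<and> ((\<lambda>s. \<gamma> s x) has_vector_derivative v x - v Init) (at 0)"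
    proof cases
      case 1
      have "\<gamma> 0 x = P x" unfolding 1(2) gA[OF 1(1)] using A.bend_id(2)[OF 1(1)] by (simp only: qA(2) mult_zero_right)
      then show ?thesis using derA[OF 1(1)] unfolding 1(2) gA[OF 1(1)] by blast
    next
      case 2
      have "\<gamma> 0 x = P x" unfolding 2(2) gB[OF 2(1)] using B.bend_id(2)[OF 2(1)] by (simp only: qB(2) mult_zero_right)
      then show ?thesis using derB[OF 2(1)] unfolding 2(2) gB[OF 2(1)] by blast
    next
      case 3
      then show ?thesis using derZ[OF 3(1)] zpr[OF 3(1)] by (simp only: gZ)
    qed
    then show "\<gamma> 0 x = P x" "((\<lambda>s. \<gamma> s x) has_vector_derivative v x - v Init) (at 0)" by blast+
  qed
  then show ?thesis
    by (rule config_velocity_add_rigid[where s = 0 and b = "v Init"]) (use wf in auto)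
qed

text \<open>Both centers lie on the perpendicular bisector of the diagonal.\<close>

lemma centers_orthogonal: "Re (cnj W * (OB - OA)) = 0"
proof -
  have in_A: "P Init \<in> P ` set (chain_vertices VA nA)" "P Term \<in> P ` set (chain_vertices VA nA)"
    and in_B: "P Init \<in> P ` set (chain_vertices VB nB)" "P Term \<in> P ` set (chain_vertices VB nB)"
    by (auto simp: chain_vertices_def)
  have A: "dist OA (P Init) = dist OA (P Term)" using circA in_A unfolding circumcenter_def by metis
  have B: "dist OB (P Init) = dist OB (P Term)" using circB in_B unfolding circumcenter_def by metis
  have sq: "2 * Re (cnj W * o') = (cmod (P Term))\<^sup>2 - (cmod (P Init))\<^sup>2" if "dist o' (P Init) = dist o' (P Term)" for o'
  proof -
    have "(cmod (o' - P Init))\<^sup>2 = (cmod (o' - P Term))\<^sup>2" using that by (simp add: dist_norm)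
    then show ?thesis unfolding cmod_power2 by (simp add: algebra_simps power2_eq_square)
  qed
  have "Re (cnj W * (OB - OA)) = Re (cnj W * OB) - Re (cnj W * OA)"
    by (simp only: right_diff_distrib minus_complex.sel)
  then show ?thesis using sq[OF A] sq[OF B] by linarith
qed

text \<open>This cross product turns the sign of the coefficient of the aligned form into the
  orientation of the pair formed by W and the vector between the centers.\<close>

lemma \<kappa>_eq: "\<kappa> = Im (cnj W * (OB - OA))"
proof -
  have "(OB - OA) / W = cnj W * (OB - OA) / of_real ((cmod W)\<^sup>2)"
    using W0 by (simp only: complex_norm_square) (simp add: divide_simps)
  then have "c = Im (cnj W * (OB - OA)) / (cmod W)\<^sup>2" by (simp only: c_def Im_divide_of_real)
  moreover have "(cmod W)\<^sup>2 \<noteq> 0" using W0 by (simp only: power_eq_0_iff norm_eq_zero) simp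
  ultimately show ?thesis by (simp only: \<kappa>_def nonzero_divide_eq_eq) simp
qed

lemma \<kappa>_nonzero: "OA \<noteq> OB \<Longrightarrow> \<kappa> \<noteq> 0"
proof
  assume "OA \<noteq> OB" and "\<kappa> = 0"
  then have "Im (cnj W * (OB - OA)) = 0" by (simp only: \<kappa>_eq)
  with centers_orthogonal have "cnj W * (OB - OA) = 0" by (simp only: complex_eq_iff zero_complex.sel)
  then show False using W0 \<open>OA \<noteq> OB\<close> by (simp only: mult_eq_0_iff complex_cnj_zero_iff) simp
qed

lemma num_forward_eq: "num_forward r P = card {e. e < r \<and> t e > 0}"
proof -
  have "(\<exists>s>0. map P (chain_vertices VZ r) ! Suc i - map P (chain_vertices VZ r) ! i = s *\<^sub>R W) \<longleftrightarrow> t i > 0" if i: "i < r" for i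
  proof -
    have "map P (chain_vertices VZ r) ! Suc i - map P (chain_vertices VZ r) ! i = P (cv VZ r (Suc i)) - P (cv VZ r i)"
      using i by (simp add: chain_vertices_map[OF len(3)] del: upt_Suc)
    also have "\<dots> = t i *\<^sub>R W" by (simp only: Z_edge[OF i] scaleR_conv_of_real)
    finally have eq: "map P (chain_vertices VZ r) ! Suc i - map P (chain_vertices VZ r) ! i = t i *\<^sub>R W" .
    have "t i *\<^sub>R W = s *\<^sub>R W \<longleftrightarrow> t i = s" for s using W0 by (simp only: scaleR_cancel_right) simp
    then show ?thesis unfolding eq by auto
  qed
  then show ?thesis unfolding num_forward_def Let_def by (intro arg_cong[where f = card]) blast
qed

text \<open>\<open>critical_config\<close> supplies the chart of the three-chain space. The index of
  \<open>total_form\<close> is then evaluated once through this chart and once through the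
  splitting.\<close>

lemma morse_index_formula:
  assumes crit_P: "critical_config L (Gamma_area nA nB) P" and centers: "OA \<noteq> OB"
  shows "int (morse_index L (Gamma_area nA nB) P) =
    int (polygon_morse_index (map P (AW_vertices nA))) + int (polygon_morse_index (map P (BW_vertices nB))) +
    (if positively_oriented W (OB - OA) then int (num_forward r P) - 1 else int r - int (num_forward r P))"
proof -
  obtain RA where RA: "\<And>i. i \<le> nA \<Longrightarrow> dist OA (pA i) = RA" using dist_A by blast
  obtain RB where RB: "\<And>i. i \<le> nB \<Longrightarrow> dist OB (pB i) = RB" using dist_B by blast
  have ncA: "\<not> collinear (pA ` {..nA})"
    using A_not_aligned unfolding set_chain_vertices[OF len(1)] image_image .
  have ncB: "\<not> collinear (pB ` {..nB})"
  proof -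
    have "cv VB nB k \<in> bw nB ` {..nB}" if "k \<le> nB" for k
    proof (cases "k = 0")
      case True
      then show ?thesis by (intro image_eqI[of _ _ 0]) (auto simp: cv_0 bw_simps)
    next
      case False
      then show ?thesis using that by (intro image_eqI[of _ _ "Suc nB - k"]) (auto simp: bw_def)
    qed
    then have "P ` set (chain_vertices VB nB) \<subseteq> pB ` {..nB}"
      unfolding set_chain_vertices[OF len(2)] image_image[symmetric, of P "bw nB"] by (intro image_mono) blast
    then show ?thesis using B_not_aligned collinear_subset by blast
  qed
  have eB: "pB (Suc i) \<noteq> pB i" if "i < nB" for i using pB_edge_nonzero[of i] that by simp
  have A: "has_index FA TA (polygon_morse_index (map P (AW_vertices nA)))"
  proof -
    have "map P (AW_vertices nA) = map pA [0..<Suc nA]"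
      by (simp only: AW_vertices_def chain_vertices_map[OF len(1)] map_map o_def)
    then show ?thesis unfolding \<mu>A_def
      using polygon_has_index[where p = pA, OF _ edge_nonzero(1) _ ncA RA] len W_nonzero
      by (simp only:) (simp add: cv_0 cv_n)
  qed
  have B: "has_index FB TB (polygon_morse_index (map P (BW_vertices nB)))"
  proof -
    have "pB nB \<noteq> pB 0" using pB_edge_nonzero[of nB] by (simp add: eq_commute)
    moreover have "map P (BW_vertices nB) = map pB [0..<Suc nB]"
      by (simp only: BW_vertices_map[OF len(2)] map_map o_def)
    ultimately show ?thesis unfolding \<mu>B_def
      using polygon_has_index[where p = pB, OF _ eB _ ncB RB] len by simp
  qed
  obtain mZ where mZ: "has_index (aligned_form \<kappa> r t) UNIV mZ"
    "int mZ = (if \<kappa> > 0 then int (card {e. e < r \<and> t e > 0}) - 1 else int r - int (card {e. e < r \<and> t e > 0}))"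
    using has_index_aligned_form[OF t_nonzero t_sum \<kappa>_nonzero[OF centers]] by blast
  obtain d U \<phi> x where chart: "reduced_chart L d U \<phi>" "x \<in> U" "config_class L (\<phi> x) = config_class L P"
    using crit_P unfolding critical_config_def by blast
  obtain k where k: "\<And>q. q \<in> configs L \<Longrightarrow> Gamma_area nA nB q = total_form q q / 2 + k"
    using area_eq by blast
  have edge: "(cv VZ r 0, cv VZ r (Suc 0), z ! 0) \<in> snd L"
  proof -
    have "0 < r" using len by simp
    then show ?thesis unfolding snd_L by blast
  qed
  have "z ! 0 > 0" using pos len by simp
  then have "has_index total_form T (morse_index L (Gamma_area nA nB) P)"
    by (intro morse_index_has_index[where \<phi> = \<phi> and x = x and k = k and L = L and P = P and B = total_form
          and F = "Gamma_area nA nB", OF chart plane_form_total k crit wf edge _ velocity])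
  from has_index_unique[OF plane_form_sym[OF plane_form_total] this total_index[OF A B mZ(1)]]
  have "morse_index L (Gamma_area nA nB) P
    = polygon_morse_index (map P (AW_vertices nA)) + (polygon_morse_index (map P (BW_vertices nB)) + mZ)" .
  moreover have "positively_oriented W (OB - OA) \<longleftrightarrow> \<kappa> > 0"
    unfolding \<kappa>_eq positively_oriented_def by (simp add: algebra_simps)
  ultimately show ?thesis using mZ(2) by (simp add: num_forward_eq)
qed

end

section \<open>Zero sets of polynomials\<close>

definition monomial :: "nat \<Rightarrow> (nat \<Rightarrow> nat) \<Rightarrow> (nat \<Rightarrow> 'a::comm_monoid_mult) \<Rightarrow> 'a" where
  "monomial n \<alpha> x = (\<Prod>i<n. x i ^ \<alpha> i)"

definition covered_by_submanifolds :: "nat \<Rightarrow> (nat \<Rightarrow> real) set \<Rightarrow> bool" where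
  "covered_by_submanifolds n X \<longleftrightarrow>
     (\<exists>\<M>. finite \<M> \<and> (\<forall>M\<in>\<M>. \<exists>k\<ge>1. submanifold_codim n k M) \<and> X \<subseteq> \<Union>\<M>)"

lemma covered_by_submanifolds_UN:
  assumes "finite I" "\<And>i. i \<in> I \<Longrightarrow> covered_by_submanifolds n (X i)"
  shows "covered_by_submanifolds n (\<Union>i\<in>I. X i)"
proof -
  obtain M where M: "\<And>i. i \<in> I \<Longrightarrow> finite (M i) \<and> (\<forall>N\<in>M i. \<exists>k\<ge>1. submanifold_codim n k N) \<and> X i \<subseteq> \<Union>(M i)"
    using assms(2) unfolding covered_by_submanifolds_def by metis
  show ?thesis unfolding covered_by_submanifolds_def
  proof (intro exI[of _ "\<Union>i\<in>I. M i"] conjI ballI)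
    show "finite (\<Union>i\<in>I. M i)" using assms(1) M by simp
    show "(\<Union>i\<in>I. X i) \<subseteq> \<Union>(\<Union>i\<in>I. M i)"
    proof
      fix x assume "x \<in> (\<Union>i\<in>I. X i)"
      then obtain i where "i \<in> I" "x \<in> X i" by blast
      moreover from this have "x \<in> \<Union>(M i)" using M[of i] by blast
      ultimately show "x \<in> \<Union>(\<Union>i\<in>I. M i)" by blast
    qed
    fix N assume "N \<in> (\<Union>i\<in>I. M i)"
    then obtain i where "i \<in> I" "N \<in> M i" by blast
    then show "\<exists>k\<ge>1. submanifold_codim n k N" using M[of i] by simp
  qed
qed

lemma covered_by_submanifolds_subset:
  "covered_by_submanifolds n Y \<Longrightarrow> X \<subseteq> Y \<Longrightarrow> covered_by_submanifolds n X"
  unfolding covered_by_submanifolds_def by (meson order_trans)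

lemma covered_by_submanifolds_Un:
  assumes "covered_by_submanifolds n X" "covered_by_submanifolds n Y"
  shows "covered_by_submanifolds n (X \<union> Y)"
proof -
  have "covered_by_submanifolds n (\<Union>b\<in>UNIV. if b then X else Y)"
    by (rule covered_by_submanifolds_UN) (use assms in auto)
  moreover have "X \<union> Y = (\<Union>b\<in>UNIV. if b then X else Y)" by (auto split: if_splits)
  ultimately show ?thesis by simp
qed

text \<open>For \<open>\<alpha> l = 0\<close> the truncated subtraction does no harm, because the
  factor \<open>real (\<alpha> l)\<close> is 0.\<close>

lemma monomial_derivative:
  fixes x :: "nat \<Rightarrow> real"
  assumes l: "l < n"
  shows "((\<lambda>t. monomial n \<alpha> (x(l := t))) has_real_derivative
    real (\<alpha> l) * monomial n (\<alpha>(l := \<alpha> l - 1)) x) (at (x l))"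
proof -
  have split: "monomial n \<beta> (x(l := t)) = t ^ \<beta> l * (\<Prod>i\<in>{..<n} - {l}. x i ^ \<beta> i)" for \<beta> t
  proof -
    have "monomial n \<beta> (x(l := t)) = (x(l := t)) l ^ \<beta> l * (\<Prod>i\<in>{..<n} - {l}. (x(l := t)) i ^ \<beta> i)"
      unfolding monomial_def using l by (intro prod.remove) auto
    also have "(\<Prod>i\<in>{..<n} - {l}. (x(l := t)) i ^ \<beta> i) = (\<Prod>i\<in>{..<n} - {l}. x i ^ \<beta> i)"
      by (intro prod.cong) auto
    finally show ?thesis by (simp only: fun_upd_same)
  qed
  have "(\<Prod>i\<in>{..<n} - {l}. x i ^ (\<alpha>(l := \<alpha> l - 1)) i) = (\<Prod>i\<in>{..<n} - {l}. x i ^ \<alpha> i)"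
    by (intro prod.cong) auto
  then have "monomial n (\<alpha>(l := \<alpha> l - 1)) x = x l ^ (\<alpha> l - 1) * (\<Prod>i\<in>{..<n} - {l}. x i ^ \<alpha> i)"
    using split[of "\<alpha>(l := \<alpha> l - 1)" "x l"] by simp
  then have eq: "real (\<alpha> l) * x l ^ (\<alpha> l - 1) * (\<Prod>i\<in>{..<n} - {l}. x i ^ \<alpha> i)
      = real (\<alpha> l) * monomial n (\<alpha>(l := \<alpha> l - 1)) x" by simp
  have "((\<lambda>t. t ^ \<alpha> l * (\<Prod>i\<in>{..<n} - {l}. x i ^ \<alpha> i)) has_real_derivative
      real (\<alpha> l) * x l ^ (\<alpha> l - 1) * (\<Prod>i\<in>{..<n} - {l}. x i ^ \<alpha> i)) (at (x l))"
    by (auto intro!: derivative_eq_intros)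
  then show ?thesis unfolding split eq .
qed

lemma smooth_fun_on_monomial:
  assumes "openin (Euclidean_space n) U"
  shows "smooth_fun_on n U (monomial m \<alpha>)"
proof -
  have "smooth_fun_on n U (\<lambda>x. \<Prod>i<m. x i ^ \<alpha> i)"
    by (intro smooth_fun_on_prod[OF assms] smooth_fun_on_power[OF assms] smooth_fun_on_coord[OF assms]) simp
  then show ?thesis by (simp add: monomial_def[abs_def])
qed

lemma smooth_fun_on_polynomial:
  assumes "openin (Euclidean_space n) U" "finite S"
  shows "smooth_fun_on n U (\<lambda>x. \<Sum>\<alpha>\<in>S. c \<alpha> * monomial m \<alpha> x)"
  by (intro smooth_fun_on_sum[OF assms(1)] smooth_fun_on_mult[OF assms(1)] smooth_fun_on_const[OF assms(1)]
      smooth_fun_on_monomial[OF assms(1)] assms(2))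

text \<open>Differentiating once in a suitable direction lowers the degree and keeps the polynomial nonzero.
  The zeros at which this derivative does not vanish form a hypersurface.\<close>

lemma polynomial_zeros_covered:
  fixes c :: "(nat \<Rightarrow> nat) \<Rightarrow> real"
  assumes "finite S" "S \<noteq> {}" "\<And>\<alpha>. \<alpha> \<in> S \<Longrightarrow> c \<alpha> \<noteq> 0" "\<And>\<alpha>. \<alpha> \<in> S \<Longrightarrow> \<forall>i\<ge>n. \<alpha> i = 0"
    "\<And>\<alpha>. \<alpha> \<in> S \<Longrightarrow> (\<Sum>i<n. \<alpha> i) \<le> N"
  shows "covered_by_submanifolds n {x \<in> topspace (Euclidean_space n). (\<Sum>\<alpha>\<in>S. c \<alpha> * monomial n \<alpha> x) = 0}"
  using assms
proof (induction N arbitrary: S c)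
  case N: (0)
  show ?case
  proof (cases "S = {\<lambda>_. 0}")
    case True
    have "{x \<in> topspace (Euclidean_space n). (\<Sum>\<alpha>\<in>S. c \<alpha> * monomial n \<alpha> x) = 0} = {}"
      using N.prems(3) True by (auto simp: monomial_def)
    then show ?thesis unfolding covered_by_submanifolds_def by (intro exI[of _ "{}"]) auto
  next
    case False
    have "\<alpha> = (\<lambda>_. 0)" if "\<alpha> \<in> S" for \<alpha>
    proof
      fix i show "\<alpha> i = 0" using N.prems(4,5)[OF that] by (cases "i < n") auto
    qed
    then show ?thesis using False N.prems(2) by blast
  qed
next
  case (Suc N)
  show ?case
  proof (cases "\<forall>\<alpha>\<in>S. (\<Sum>i<n. \<alpha> i) \<le> N")
    case True
    then show ?thesis using Suc.IH[of S c] Suc.prems by blast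
  next
    case False
    then obtain \<alpha>0 where \<alpha>0: "\<alpha>0 \<in> S" "(\<Sum>i<n. \<alpha>0 i) > N" by auto
    then obtain l where l: "l < n" "\<alpha>0 l > 0"
      by (metis (no_types, lifting) gr0I lessThan_iff not_less_zero sum.neutral)
    define f where "f x = (\<Sum>\<alpha>\<in>S. c \<alpha> * monomial n \<alpha> x)" for x :: "nat \<Rightarrow> real"
    \<comment> \<open>\<open>S1\<close> holds the monomials that contain variable \<open>l\<close>.
      Lowering the exponent is injective on it, so no two terms of the derivative merge and its
      coefficients stay nonzero.\<close>
    define S1 where "S1 = {\<alpha> \<in> S. \<alpha> l > 0}"
    define low where "low \<alpha> = \<alpha>(l := \<alpha> l - 1)" for \<alpha> :: "nat \<Rightarrow> nat"
    define c' where "c' \<beta> = real (\<beta> l + 1) * c (\<beta>(l := \<beta> l + 1))" for \<beta>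
    define g where "g x = (\<Sum>\<beta>\<in>low ` S1. c' \<beta> * monomial n \<beta> x)" for x :: "nat \<Rightarrow> real"
    have up: "(low \<alpha>)(l := low \<alpha> l + 1) = \<alpha>" "c' (low \<alpha>) = real (\<alpha> l) * c \<alpha>" if "\<alpha> \<in> S1" for \<alpha>
    proof -
      show 1: "(low \<alpha>)(l := low \<alpha> l + 1) = \<alpha>" using that by (auto simp: low_def S1_def)
      have "low \<alpha> l + 1 = \<alpha> l" using that by (simp add: low_def S1_def)
      then show "c' (low \<alpha>) = real (\<alpha> l) * c \<alpha>" unfolding c'_def 1 by simp
    qed
    have inj: "inj_on low S1" by (rule inj_on_inverseI[where g = "\<lambda>\<beta>. \<beta>(l := \<beta> l + 1)"]) (rule up)
    have gx: "g x = (\<Sum>\<alpha>\<in>S. c \<alpha> * (real (\<alpha> l) * monomial n (\<alpha>(l := \<alpha> l - 1)) x))" for x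
    proof -
      have "g x = (\<Sum>\<alpha>\<in>S1. c' (low \<alpha>) * monomial n (low \<alpha>) x)"
        unfolding g_def by (simp add: sum.reindex[OF inj])
      also have "\<dots> = (\<Sum>\<alpha>\<in>S1. c \<alpha> * (real (\<alpha> l) * monomial n (\<alpha>(l := \<alpha> l - 1)) x))"
        by (intro sum.cong refl) (simp only: up(2), simp add: low_def)
      also have "\<dots> = (\<Sum>\<alpha>\<in>S. c \<alpha> * (real (\<alpha> l) * monomial n (\<alpha>(l := \<alpha> l - 1)) x))"
        using Suc.prems(1) by (intro sum.mono_neutral_left) (auto simp: S1_def)
      finally show ?thesis .
    qed
    have der: "pderiv_at l f x = g x" for x
    proof -
      have "((\<lambda>t. f (x(l := t))) has_real_derivative g x) (at (x l))"
        unfolding f_def gx by (intro DERIV_sum DERIV_cmult monomial_derivative l)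
      then show ?thesis unfolding pderiv_at_def by (rule DERIV_imp_deriv)
    qed
    have "covered_by_submanifolds n {x \<in> topspace (Euclidean_space n). g x = 0}"
      unfolding g_def
    proof (rule Suc.IH)
      show "finite (low ` S1)" using Suc.prems(1) by (simp add: S1_def)
      show "low ` S1 \<noteq> {}" using \<alpha>0(1) l by (auto simp: S1_def)
    next
      fix \<beta> assume "\<beta> \<in> low ` S1"
      then obtain \<alpha> where \<alpha>: "\<alpha> \<in> S1" "\<beta> = low \<alpha>" by blast
      then have S: "\<alpha> \<in> S" "\<alpha> l > 0" by (auto simp: S1_def)
      show "c' \<beta> \<noteq> 0" using up(2)[OF \<alpha>(1)] S Suc.prems(3) \<alpha>(2) by simp
      show "\<forall>i\<ge>n. \<beta> i = 0" using Suc.prems(4)[OF S(1)] l by (simp add: \<alpha>(2) low_def)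
      have "(\<Sum>i<n. \<alpha> i) = \<alpha> l + (\<Sum>i\<in>{..<n} - {l}. \<alpha> i)" using l by (intro sum.remove) auto
      moreover have "(\<Sum>i<n. \<beta> i) = \<beta> l + (\<Sum>i\<in>{..<n} - {l}. \<beta> i)" using l by (intro sum.remove) auto
      moreover have "(\<Sum>i\<in>{..<n} - {l}. \<beta> i) = (\<Sum>i\<in>{..<n} - {l}. \<alpha> i)"
        by (intro sum.cong) (auto simp: \<alpha>(2) low_def)
      moreover have "\<beta> l = \<alpha> l - 1" by (simp add: \<alpha>(2) low_def)
      ultimately show "(\<Sum>i<n. \<beta> i) \<le> N" using Suc.prems(5)[OF S(1)] S(2) by linarith
    qed
    \<comment> \<open>Here the partial derivative in direction \<open>l\<close> is nonzero, so the
      single equation \<open>f x = 0\<close> is regular.\<close>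
    moreover have "covered_by_submanifolds n {x \<in> topspace (Euclidean_space n). f x = 0 \<and> g x \<noteq> 0}"
    proof -
      let ?M = "{x \<in> topspace (Euclidean_space n). f x = 0 \<and> g x \<noteq> 0}"
      let ?U = "{x \<in> topspace (Euclidean_space n). g x \<noteq> 0}"
      have top: "openin (Euclidean_space n) (topspace (Euclidean_space n))" by simp
      have "smooth_fun_on n (topspace (Euclidean_space n)) g"
        unfolding g_def using Suc.prems(1) by (intro smooth_fun_on_polynomial[OF top]) (simp add: S1_def)
      then have "C_on 0 n (topspace (Euclidean_space n)) g" unfolding smooth_fun_on_def by blast
      then have "continuous_map (Euclidean_space n) euclideanreal g" by (simp add: subtopology_topspace)
      from openin_continuous_map_preimage[OF this, of "- {0}"]
      have U: "openin (Euclidean_space n) ?U" by (simp add: open_Compl)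
      have "submanifold_codim n 1 ?M"
        unfolding submanifold_codim_def
      proof (intro conjI ballI)
        show "1 \<le> n" using l by simp
        fix x assume x: "x \<in> ?M"
        show "\<exists>U g. openin (Euclidean_space n) U \<and> x \<in> U \<and> (\<forall>j<1. smooth_fun_on n U (g j)) \<and>
          ?M \<inter> U = {y \<in> U. \<forall>j<1. g j y = 0} \<and>
          (\<forall>y\<in>U. \<forall>c :: nat \<Rightarrow> real. (\<forall>i<n. (\<Sum>j<1. c j * pderiv_at i (g j) y) = 0) \<longrightarrow> (\<forall>j<1. c j = 0))"
        proof (intro exI[of _ ?U] exI[of _ "\<lambda>_::nat. f"] conjI)
          show "\<forall>j<(1::nat). smooth_fun_on n ?U f"
            unfolding f_def using smooth_fun_on_polynomial[OF U Suc.prems(1)] by blast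
          show "\<forall>y\<in>?U. \<forall>c :: nat \<Rightarrow> real. (\<forall>i<n. (\<Sum>j<1. c j * pderiv_at i f y) = 0) \<longrightarrow> (\<forall>j<1. c j = 0)"
          proof (intro ballI allI impI)
            fix y and c :: "nat \<Rightarrow> real" and j :: nat
            assume y: "y \<in> ?U" and z: "\<forall>i<n. (\<Sum>j<1. c j * pderiv_at i f y) = 0" and j: "j < 1"
            have "c 0 * g y = 0" using z[rule_format, OF l(1)] by (simp add: der)
            then show "c j = 0" using y j by simp
          qed
        qed (use U x in auto)
      qed auto
      then show ?thesis unfolding covered_by_submanifolds_def by (intro exI[of _ "{?M}"]) auto
    qed
    ultimately have "covered_by_submanifolds n ({x \<in> topspace (Euclidean_space n). g x = 0} \<union>
        {x \<in> topspace (Euclidean_space n). f x = 0 \<and> g x \<noteq> 0})"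
      by (rule covered_by_submanifolds_Un)
    then show ?thesis by (rule covered_by_submanifolds_subset) (auto simp: f_def)
  qed
qed

section \<open>Algebraic dependence of Laurent polynomials\<close>

text \<open>Values from \<open>N\<close> on are pinned to 0, so that these sets of functions can be
  counted.\<close>

definition fun_box :: "nat \<Rightarrow> 'a::zero set \<Rightarrow> (nat \<Rightarrow> 'a) set" where
  "fun_box N A = {f. (\<forall>i<N. f i \<in> A) \<and> (\<forall>i\<ge>N. f i = 0)}"

lemma finite_fun_box: "finite A \<Longrightarrow> finite (fun_box N A)" and card_fun_box: "card (fun_box N A) = card A ^ N"
proof -
  let ?h = "\<lambda>f i. if i < N then f i else (0::'a)"
  have "fun_box N A \<subseteq> ?h ` PiE {..<N} (\<lambda>_. A)"
  proof
    fix f assume f: "f \<in> fun_box N A"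
    have "f = ?h (restrict f {..<N})" using f by (auto simp: fun_box_def)
    moreover have "restrict f {..<N} \<in> PiE {..<N} (\<lambda>_. A)" using f by (auto simp: fun_box_def)
    ultimately show "f \<in> ?h ` PiE {..<N} (\<lambda>_. A)" by (rule image_eqI)
  qed
  then have im: "fun_box N A = ?h ` PiE {..<N} (\<lambda>_. A)" by (auto simp: fun_box_def PiE_iff)
  have inj: "inj_on ?h (PiE {..<N} (\<lambda>_. A))"
  proof (rule inj_onI, rule ext)
    fix f g i assume f: "f \<in> PiE {..<N} (\<lambda>_. A)" and g: "g \<in> PiE {..<N} (\<lambda>_. A)" and eq: "?h f = ?h g"
    show "f i = g i"
      using fun_cong[OF eq, of i] PiE_arb[OF f, of i] PiE_arb[OF g, of i] by (cases "i < N") simp_all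
  qed
  show "finite (fun_box N A)" if "finite A" unfolding im using that by (intro finite_imageI finite_PiE) auto
  show "card (fun_box N A) = card A ^ N" unfolding im card_image[OF inj] by (simp add: card_PiE)
qed

definition laurent_box :: "nat \<Rightarrow> nat \<Rightarrow> (nat \<Rightarrow> int) set" where
  "laurent_box N d = fun_box N {- int d..int d}"

lemma laurent_box_iff: "k \<in> laurent_box N d \<longleftrightarrow> (\<forall>i<N. \<bar>k i\<bar> \<le> int d) \<and> (\<forall>i\<ge>N. k i = 0)"
  by (auto simp: laurent_box_def fun_box_def abs_le_iff minus_le_iff)

lemma finite_laurent_box: "finite (laurent_box N d)"
  unfolding laurent_box_def by (simp add: finite_fun_box)

lemma card_laurent_box: "card (laurent_box N d) = (2 * d + 1) ^ N"
proof -
  have "nat (int d - - int d + 1) = 2 * d + 1" by linarith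
  then show ?thesis unfolding laurent_box_def card_fun_box by simp
qed

definition laurent_monomial :: "nat \<Rightarrow> (nat \<Rightarrow> int) \<Rightarrow> (nat \<Rightarrow> complex) \<Rightarrow> complex" where
  "laurent_monomial N k p = (\<Prod>i<N. p i powi k i)"

text \<open>\<open>d\<close> bounds the exponents in absolute value, which makes the dimension count
  possible. The identity is demanded where all variables are invertible.\<close>

definition laurent :: "nat \<Rightarrow> nat \<Rightarrow> ((nat \<Rightarrow> complex) \<Rightarrow> complex) \<Rightarrow> bool" where
  "laurent N d f \<longleftrightarrow> (\<exists>G. \<forall>p. (\<forall>i<N. p i \<noteq> 0) \<longrightarrow> f p = (\<Sum>k\<in>laurent_box N d. G k * laurent_monomial N k p))"

lemma laurent_mono: "laurent N d f \<Longrightarrow> d \<le> e \<Longrightarrow> laurent N e f"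
proof -
  assume f: "laurent N d f" and de: "d \<le> e"
  obtain G where G: "\<And>p. \<forall>i<N. p i \<noteq> 0 \<Longrightarrow> f p = (\<Sum>k\<in>laurent_box N d. G k * laurent_monomial N k p)"
    using f unfolding laurent_def by blast
  have sub: "laurent_box N d \<subseteq> laurent_box N e" using de by (force simp: laurent_box_iff)
  show ?thesis unfolding laurent_def
  proof (intro exI allI impI)
    fix p :: "nat \<Rightarrow> complex" assume "\<forall>i<N. p i \<noteq> 0"
    then show "f p = (\<Sum>k\<in>laurent_box N e. (if k \<in> laurent_box N d then G k else 0) * laurent_monomial N k p)"
      unfolding G[OF \<open>\<forall>i<N. p i \<noteq> 0\<close>]
      by (intro sum.mono_neutral_cong_left finite_laurent_box sub) auto
  qed
qed

lemma laurent_single: "k \<in> laurent_box N d \<Longrightarrow> laurent N d (\<lambda>p. c * laurent_monomial N k p)"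
  unfolding laurent_def
proof (intro exI allI impI)
  fix p :: "nat \<Rightarrow> complex" assume k: "k \<in> laurent_box N d"
  have "(\<Sum>l\<in>laurent_box N d. (if l = k then c else 0) * laurent_monomial N l p)
      = (\<Sum>l\<in>laurent_box N d. if l = k then c * laurent_monomial N l p else 0)"
    by (intro sum.cong) auto
  then show "c * laurent_monomial N k p = (\<Sum>l\<in>laurent_box N d. (if l = k then c else 0) * laurent_monomial N l p)"
    using k finite_laurent_box by simp
qed

lemma laurent_const: "laurent N 0 (\<lambda>_. c)"
  using laurent_single[of "\<lambda>_. 0" N 0 c] by (simp add: laurent_box_iff laurent_monomial_def)

lemma laurent_monomial_unit:
  assumes "i < N" shows "laurent_monomial N (\<lambda>l. if l = i then s else 0) p = p i powi s"
proof -
  have "laurent_monomial N (\<lambda>l. if l = i then s else 0) p = (\<Prod>l<N. if l = i then p l powi s else 1)"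
    unfolding laurent_monomial_def by (intro prod.cong) auto
  then show ?thesis using assms by simp
qed

lemma laurent_coord: "i < N \<Longrightarrow> laurent N 1 (\<lambda>p. p i)"
  using laurent_single[of "\<lambda>l. if l = i then 1 else 0" N 1 1] by (simp add: laurent_box_iff laurent_monomial_unit)

lemma laurent_inverse_coord: "i < N \<Longrightarrow> laurent N 1 (\<lambda>p. inverse (p i))"
  using laurent_single[of "\<lambda>l. if l = i then - 1 else 0" N 1 1] by (simp add: laurent_box_iff laurent_monomial_unit power_int_minus)

lemma laurent_add_same: "laurent N d f \<Longrightarrow> laurent N d g \<Longrightarrow> laurent N d (\<lambda>p. f p + g p)"
proof -
  assume "laurent N d f" "laurent N d g"
  then obtain F G where "\<And>p. \<forall>i<N. p i \<noteq> 0 \<Longrightarrow> f p = (\<Sum>k\<in>laurent_box N d. F k * laurent_monomial N k p)"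
     "\<And>p. \<forall>i<N. p i \<noteq> 0 \<Longrightarrow> g p = (\<Sum>k\<in>laurent_box N d. G k * laurent_monomial N k p)"
    unfolding laurent_def by blast
  then show ?thesis unfolding laurent_def
    by (intro exI[of _ "\<lambda>k. F k + G k"]) (simp add: distrib_right sum.distrib)
qed

text \<open>Convolution of coefficients: exponents add, and so do their bounds.\<close>

lemma laurent_mult: "laurent N d f \<Longrightarrow> laurent N e g \<Longrightarrow> laurent N (d + e) (\<lambda>p. f p * g p)"
proof -
  assume "laurent N d f" "laurent N e g"
  then obtain F G where F: "\<And>p. \<forall>i<N. p i \<noteq> 0 \<Longrightarrow> f p = (\<Sum>k\<in>laurent_box N d. F k * laurent_monomial N k p)"
    and G: "\<And>p. \<forall>i<N. p i \<noteq> 0 \<Longrightarrow> g p = (\<Sum>k\<in>laurent_box N e. G k * laurent_monomial N k p)"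
    unfolding laurent_def by blast
  let ?S = "laurent_box N d \<times> laurent_box N e" and ?s = "\<lambda>(k :: nat \<Rightarrow> int, l). (\<lambda>i. k i + l i)"
  define H where "H j = (\<Sum>x\<in>{x \<in> ?S. ?s x = j}. F (fst x) * G (snd x))" for j
  have im: "?s ` ?S \<subseteq> laurent_box N (d + e)"
  proof (clarsimp simp: laurent_box_iff)
    fix k l :: "nat \<Rightarrow> int" and i assume "\<forall>i<N. \<bar>k i\<bar> \<le> int d" "\<forall>i<N. \<bar>l i\<bar> \<le> int e" "i < N"
    then have "\<bar>k i\<bar> \<le> int d" "\<bar>l i\<bar> \<le> int e" by blast+
    then show "\<bar>k i + l i\<bar> \<le> int d + int e" by linarith
  qed
  show ?thesis unfolding laurent_def
  proof (intro exI[of _ H] allI impI)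
    fix p :: "nat \<Rightarrow> complex" assume p: "\<forall>i<N. p i \<noteq> 0"
    have mono: "laurent_monomial N (?s (k, l)) p = laurent_monomial N k p * laurent_monomial N l p" for k l
      unfolding laurent_monomial_def prod.distrib[symmetric] by (intro prod.cong refl) (use p in \<open>simp add: power_int_add\<close>)
    have "f p * g p = (\<Sum>x\<in>?S. F (fst x) * G (snd x) * laurent_monomial N (?s x) p)"
      unfolding F[OF p] G[OF p] sum_product sum.cartesian_product
      by (intro sum.cong refl) (clarsimp simp: mono[simplified])
    also have "\<dots> = (\<Sum>j\<in>laurent_box N (d + e). \<Sum>x\<in>{x \<in> ?S. ?s x = j}. F (fst x) * G (snd x) * laurent_monomial N (?s x) p)"
      by (intro sum.group[symmetric] finite_cartesian_product finite_laurent_box im)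
    also have "\<dots> = (\<Sum>j\<in>laurent_box N (d + e). H j * laurent_monomial N j p)"
      unfolding H_def sum_distrib_right by (intro sum.cong refl) auto
    finally show "f p * g p = (\<Sum>j\<in>laurent_box N (d + e). H j * laurent_monomial N j p)" .
  qed
qed

lemma laurent_power: "laurent N d f \<Longrightarrow> laurent N (k * d) (\<lambda>p. f p ^ k)"
  by (induction k) (auto intro: laurent_const laurent_mult)

lemma laurent_prod:
  "finite I \<Longrightarrow> (\<And>i. i \<in> I \<Longrightarrow> laurent N (d i) (f i)) \<Longrightarrow> laurent N (\<Sum>i\<in>I. d i) (\<lambda>p. \<Prod>i\<in>I. f i p)"
  by (induction I rule: finite_induct) (auto intro: laurent_const laurent_mult)

text \<open>A dimension count: the monomials of degree at most \<open>D\<close> in each of \<open>N + 1\<close> quantities are more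
  numerous than the Laurent monomials in \<open>N\<close> variables that they involve.\<close>

lemma algebraic_dependence:
  assumes g: "\<And>j. j < Suc N \<Longrightarrow> laurent N d (g j)"
  shows "\<exists>S c. finite S \<and> S \<noteq> {} \<and> (\<forall>\<alpha>\<in>S. c \<alpha> \<noteq> (0::real) \<and> (\<forall>i\<ge>Suc N. \<alpha> i = 0)) \<and>
    (\<forall>p x. (\<forall>i<N. p i \<noteq> 0) \<longrightarrow> (\<forall>j<Suc N. g j p = of_real (x j)) \<longrightarrow> (\<Sum>\<alpha>\<in>S. c \<alpha> * monomial (Suc N) \<alpha> x) = 0)"
proof -
  \<comment> \<open>\<open>e\<close> bounds the Laurent exponents of all monomials in
    \<open>A\<close>. With \<open>D = K ^ N\<close> the count closes: (2e + 1)^N \<le> (K(D + 1))^N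
    = D(D + 1)^N < (D + 1)^(N + 1).\<close>
  define K where "K = 2 * d * Suc N + 1"
  define D where "D = K ^ N"
  define e where "e = d * Suc N * D"
  define A where "A = fun_box (Suc N) {..D}"
  have A_iff: "\<alpha> \<in> A \<longleftrightarrow> (\<forall>i<Suc N. \<alpha> i \<le> D) \<and> (\<forall>i\<ge>Suc N. \<alpha> i = 0)" for \<alpha>
    by (auto simp: A_def fun_box_def)
  have finA: "finite A" unfolding A_def by (simp add: finite_fun_box)
  have cardA: "card A = (D + 1) ^ Suc N" unfolding A_def card_fun_box by simp
  have "(2 * e + 1) ^ N \<le> (K * (D + 1)) ^ N"
    by (intro power_mono) (simp_all add: e_def K_def algebra_simps)
  also have "\<dots> = D * (D + 1) ^ N" by (simp only: power_mult_distrib D_def)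
  also have "\<dots> < (D + 1) ^ Suc N" by simp
  finally have less: "card (laurent_box N e) < card A" by (simp only: card_laurent_box cardA)
  have "\<exists>G. \<forall>p. (\<forall>i<N. p i \<noteq> 0) \<longrightarrow> monomial (Suc N) \<alpha> (\<lambda>j. g j p) = (\<Sum>k\<in>laurent_box N e. G k * laurent_monomial N k p)"
    if \<alpha>: "\<alpha> \<in> A" for \<alpha>
  proof -
    have "laurent N (\<Sum>j<Suc N. \<alpha> j * d) (\<lambda>p. \<Prod>j<Suc N. g j p ^ \<alpha> j)"
      by (intro laurent_prod laurent_power g) auto
    moreover have "(\<Sum>j<Suc N. \<alpha> j * d) \<le> e"
    proof -
      have "(\<Sum>j<Suc N. \<alpha> j * d) \<le> (\<Sum>j<Suc N. D * d)"
        using \<alpha> unfolding A_iff by (intro sum_mono mult_right_mono) auto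
      then show ?thesis by (simp add: e_def algebra_simps)
    qed
    ultimately have "laurent N e (\<lambda>p. \<Prod>j<Suc N. g j p ^ \<alpha> j)" by (rule laurent_mono)
    then show ?thesis by (simp only: monomial_def laurent_def)
  qed
  then obtain M where M: "\<And>\<alpha> p. \<alpha> \<in> A \<Longrightarrow> \<forall>i<N. p i \<noteq> 0 \<Longrightarrow>
      monomial (Suc N) \<alpha> (\<lambda>j. g j p) = (\<Sum>k\<in>laurent_box N e. M \<alpha> k * laurent_monomial N k p)" by metis
  obtain c :: "(nat \<Rightarrow> nat) \<Rightarrow> complex" where c: "\<exists>\<alpha>\<in>A. c \<alpha> \<noteq> 0" "\<And>k. k \<in> laurent_box N e \<Longrightarrow> (\<Sum>\<alpha>\<in>A. c \<alpha> * M \<alpha> k) = 0"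
    using underdetermined_system[OF finite_laurent_box finA less, of M] by blast
  have zero: "(\<Sum>\<alpha>\<in>A. c \<alpha> * monomial (Suc N) \<alpha> (\<lambda>j. g j p)) = 0" if p: "\<forall>i<N. p i \<noteq> 0" for p
  proof -
    have "(\<Sum>\<alpha>\<in>A. c \<alpha> * monomial (Suc N) \<alpha> (\<lambda>j. g j p))
        = (\<Sum>\<alpha>\<in>A. \<Sum>k\<in>laurent_box N e. c \<alpha> * M \<alpha> k * laurent_monomial N k p)"
      by (intro sum.cong refl) (simp add: M[OF _ p] sum_distrib_left mult.assoc)
    also have "\<dots> = (\<Sum>k\<in>laurent_box N e. \<Sum>\<alpha>\<in>A. c \<alpha> * M \<alpha> k * laurent_monomial N k p)" by (rule sum.swap)
    also have "\<dots> = 0" by (rule sum.neutral, rule ballI) (simp only: sum_distrib_right[symmetric] c(2) mult_zero_left)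
    finally show ?thesis .
  qed
  obtain \<alpha>0 where \<alpha>0: "\<alpha>0 \<in> A" "c \<alpha>0 \<noteq> 0" using c(1) by blast
  \<comment> \<open>The monomials have real values at the points in question, so the real and the
    imaginary parts of the coefficients each give a real relation, and one of the two is
    nontrivial.\<close>
  obtain q :: "complex \<Rightarrow> real" where q: "q = Re \<or> q = Im" "q (c \<alpha>0) \<noteq> 0"
    using \<alpha>0(2) by (metis complex_eq_iff zero_complex.sel)
  define S where "S = {\<alpha> \<in> A. q (c \<alpha>) \<noteq> 0}"
  have "(\<Sum>\<alpha>\<in>S. q (c \<alpha>) * monomial (Suc N) \<alpha> x) = 0"
    if p: "\<forall>i<N. p i \<noteq> 0" and x: "\<forall>j<Suc N. g j p = of_real (x j)" for p x
  proof -
    have "monomial (Suc N) \<alpha> (\<lambda>j. g j p) = of_real (monomial (Suc N) \<alpha> x)" for \<alpha>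
      using x by (simp add: monomial_def del: prod.lessThan_Suc)
    then have "(\<Sum>\<alpha>\<in>A. c \<alpha> * of_real (monomial (Suc N) \<alpha> x)) = 0" using zero[OF p] by simp
    then have "q (\<Sum>\<alpha>\<in>A. c \<alpha> * of_real (monomial (Suc N) \<alpha> x)) = 0" using q(1) by auto
    then have "(\<Sum>\<alpha>\<in>A. q (c \<alpha>) * monomial (Suc N) \<alpha> x) = 0" using q(1) by auto
    moreover have "(\<Sum>\<alpha>\<in>S. q (c \<alpha>) * monomial (Suc N) \<alpha> x) = (\<Sum>\<alpha>\<in>A. q (c \<alpha>) * monomial (Suc N) \<alpha> x)"
      unfolding S_def by (intro sum.mono_neutral_left finA) auto
    ultimately show ?thesis by simp
  qed
  moreover have "finite S" using finA by (simp add: S_def)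
  ultimately show ?thesis
    using \<alpha>0(1) q(2) by (intro exI[of _ S] exI[of _ "\<lambda>\<alpha>. q (c \<alpha>)"]) (auto simp: S_def A_iff)
qed

lemma laurent_common_degree:
  assumes "\<And>j::nat. j < m \<Longrightarrow> \<exists>d. laurent N d (g j)"
  shows "\<exists>d. \<forall>j<m. laurent N d (g j)"
proof -
  obtain D where D: "\<And>j. j < m \<Longrightarrow> laurent N (D j) (g j)" using assms by metis
  have "laurent N (\<Sum>j<m. D j) (g j)" if j: "j < m" for j
    by (rule laurent_mono[OF D[OF j]]) (use j in \<open>auto intro!: member_le_sum\<close>)
  then show ?thesis by blast
qed

lemma dependent_covered:
  assumes "\<And>j. j < Suc N \<Longrightarrow> \<exists>d. laurent N d (g j)"
  shows "covered_by_submanifolds (Suc N) {x \<in> topspace (Euclidean_space (Suc N)).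
    \<exists>p. (\<forall>i<N. p i \<noteq> 0) \<and> (\<forall>j<Suc N. g j p = of_real (x j))}"
proof -
  obtain d where g: "\<And>j. j < Suc N \<Longrightarrow> laurent N d (g j)"
    using laurent_common_degree[of "Suc N" N g] assms by blast
  have "\<exists>S c. finite S \<and> S \<noteq> {} \<and> (\<forall>\<alpha>\<in>S. c \<alpha> \<noteq> (0::real) \<and> (\<forall>i\<ge>Suc N. \<alpha> i = 0)) \<and>
    (\<forall>p x. (\<forall>i<N. p i \<noteq> 0) \<longrightarrow> (\<forall>j<Suc N. g j p = of_real (x j)) \<longrightarrow> (\<Sum>\<alpha>\<in>S. c \<alpha> * monomial (Suc N) \<alpha> x) = 0)"
    by (rule algebraic_dependence) (rule g)
  then obtain S c where SC: "finite S \<and> S \<noteq> {} \<and> (\<forall>\<alpha>\<in>S. c \<alpha> \<noteq> (0::real) \<and> (\<forall>i\<ge>Suc N. \<alpha> i = 0)) \<and>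
    (\<forall>p x. (\<forall>i<N. p i \<noteq> 0) \<longrightarrow> (\<forall>j<Suc N. g j p = of_real (x j)) \<longrightarrow> (\<Sum>\<alpha>\<in>S. c \<alpha> * monomial (Suc N) \<alpha> x) = 0)"
    by (elim exE) (rule that)
  then have S: "finite S" "S \<noteq> {}" "\<And>\<alpha>. \<alpha> \<in> S \<Longrightarrow> c \<alpha> \<noteq> (0::real)" "\<And>\<alpha>. \<alpha> \<in> S \<Longrightarrow> \<forall>i\<ge>Suc N. \<alpha> i = 0"
    by simp_all
  have z: "(\<Sum>\<alpha>\<in>S. c \<alpha> * monomial (Suc N) \<alpha> x) = 0"
    if "\<forall>i<N. p i \<noteq> 0" "\<forall>j<Suc N. g j p = of_real (x j)" for p x
    using SC that by blast
  \<comment> \<open>The sum of the degrees of all monomials serves as a crude bound for the total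
    degree.\<close>
  have "(\<Sum>i<Suc N. \<alpha> i) \<le> (\<Sum>\<alpha>\<in>S. \<Sum>i<Suc N. \<alpha> i)" if "\<alpha> \<in> S" for \<alpha>
    using member_le_sum[OF that, of "\<lambda>\<alpha>. \<Sum>i<Suc N. \<alpha> i"] S(1) by simp
  then have "covered_by_submanifolds (Suc N) {x \<in> topspace (Euclidean_space (Suc N)). (\<Sum>\<alpha>\<in>S. c \<alpha> * monomial (Suc N) \<alpha> x) = 0}"
    by (intro polynomial_zeros_covered[where c = c and N = "\<Sum>\<alpha>\<in>S. \<Sum>i<Suc N. \<alpha> i"] S)
  then show ?thesis
  proof (rule covered_by_submanifolds_subset, intro subsetI, elim CollectE conjE exE, intro CollectI conjI)
    fix x p assume "\<forall>i<N. p i \<noteq> 0" "\<forall>j<Suc N. g j p = of_real (x j)"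
    then show "(\<Sum>\<alpha>\<in>S. c \<alpha> * monomial (Suc N) \<alpha> x) = 0" by (rule z)
  qed
qed

section \<open>Exceptional edge lengths\<close>

lemma laurent_add: "\<exists>d. laurent N d f \<Longrightarrow> \<exists>d. laurent N d g \<Longrightarrow> \<exists>d. laurent N d (\<lambda>p. f p + g p)"
proof (elim exE)
  fix d e assume "laurent N d f" "laurent N e g"
  then have "laurent N (max d e) f" "laurent N (max d e) g" by (auto intro: laurent_mono)
  then show "\<exists>d. laurent N d (\<lambda>p. f p + g p)" by (blast intro: laurent_add_same)
qed

lemma laurent_times: "\<exists>d. laurent N d f \<Longrightarrow> \<exists>d. laurent N d g \<Longrightarrow> \<exists>d. laurent N d (\<lambda>p. f p * g p)"
  using laurent_mult by blast

lemma laurent_constant: "\<exists>d. laurent N d (\<lambda>_. c)"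
  using laurent_const by blast

lemma laurent_diff:
  assumes "\<exists>d. laurent N d f" "\<exists>d. laurent N d g"
  shows "\<exists>d. laurent N d (\<lambda>p. f p - g p)"
  using laurent_add[OF assms(1) laurent_times[OF laurent_constant[of N "- 1"] assms(2)]] by simp

lemma laurent_sum:
  "finite I \<Longrightarrow> (\<And>i. i \<in> I \<Longrightarrow> \<exists>d. laurent N d (f i)) \<Longrightarrow> \<exists>d. laurent N d (\<lambda>p. \<Sum>i\<in>I. f i p)"
  by (induction I rule: finite_induct) (simp_all add: laurent_constant laurent_add)

lemma laurent_product:
  "finite I \<Longrightarrow> (\<And>i. i \<in> I \<Longrightarrow> \<exists>d. laurent N d (f i)) \<Longrightarrow> \<exists>d. laurent N d (\<lambda>p. \<Prod>i\<in>I. f i p)"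
  by (induction I rule: finite_induct) (simp_all add: laurent_constant laurent_times)

lemma laurent_var: "i < N \<Longrightarrow> \<exists>d. laurent N d (\<lambda>p. p i)" "i < N \<Longrightarrow> \<exists>d. laurent N d (\<lambda>p. inverse (p i))"
  using laurent_coord laurent_inverse_coord by blast+

text \<open>For a unit \<open>u\<close> and \<open>u' = inverse u\<close> this is 2 R Im u, the
  signed chord over the central angle 2 arg u. With \<open>u'\<close> as a separate argument no
  conjugation occurs, and lengths become Laurent polynomials.\<close>

definition chord :: "complex \<Rightarrow> complex \<Rightarrow> complex \<Rightarrow> complex" where
  "chord R u u' = - \<i> * R * (u - u')"

lemma laurent_chord:
  "\<exists>d. laurent N d f \<Longrightarrow> \<exists>d. laurent N d g \<Longrightarrow> \<exists>d. laurent N d h \<Longrightarrow> \<exists>d. laurent N d (\<lambda>p. chord (f p) (g p) (h p))"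
  unfolding chord_def by (intro laurent_times laurent_diff laurent_constant)

abbreviation signs :: "complex set" where
  "signs \<equiv> {1, - 1}"

text \<open>The edge lengths of a three-chain with \<open>A\<close> and \<open>B\<close> inscribed in a common circle and \<open>Z\<close> aligned,
  in terms of the radius \<open>p 0\<close>, the units \<open>p 1, \<dots>, p (nA + nB - 1)\<close> whose squares rotate each edge of
  \<open>A\<close> and all but the last one of \<open>B\<close> to the next vertex, and all but the last length of \<open>Z\<close>.\<close>

definition concentric_map ::
    "nat \<Rightarrow> nat \<Rightarrow> nat \<Rightarrow> complex \<Rightarrow> complex \<Rightarrow> (nat \<Rightarrow> complex) \<Rightarrow> nat \<Rightarrow> (nat \<Rightarrow> complex) \<Rightarrow> complex" where
  "concentric_map nA nB r \<delta> \<tau> \<sigma> j p =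
    (if j < nA + nB - 1 then chord (p 0) (p (Suc j)) (inverse (p (Suc j)))
     else if j = nA + nB - 1 then
       \<delta> * chord (p 0) ((\<Prod>i<nA. p (Suc i)) * (\<Prod>i<nB - 1. inverse (p (Suc (nA + i)))))
         ((\<Prod>i<nA. inverse (p (Suc i))) * (\<Prod>i<nB - 1. p (Suc (nA + i))))
     else if j < nA + nB + r - 1 then p j
     else \<tau> * chord (p 0) (\<Prod>i<nA. p (Suc i)) (\<Prod>i<nA. inverse (p (Suc i))) + (\<Sum>e<r - 1. \<sigma> e * p (nA + nB + e)))"

lemma laurent_concentric_map:
  assumes n: "nA \<ge> 1" "nB \<ge> 1" "r \<ge> 1" and j: "j < nA + nB + r"
  shows "\<exists>d. laurent (nA + nB + r - 1) d (concentric_map nA nB r \<delta> \<tau> \<sigma> j)"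
proof -
  consider "j < nA + nB - 1" | "j = nA + nB - 1" | "\<not> j < nA + nB - 1" "j \<noteq> nA + nB - 1" "j < nA + nB + r - 1"
    | "\<not> j < nA + nB - 1" "j \<noteq> nA + nB - 1" "\<not> j < nA + nB + r - 1" by blast
  then show ?thesis
  proof cases
    case 1
    have "\<exists>d. laurent (nA + nB + r - 1) d (\<lambda>p. chord (p 0) (p (Suc j)) (inverse (p (Suc j))))"
      by (intro laurent_chord laurent_var) (use n 1 in auto)
    then show ?thesis using 1 by (simp add: concentric_map_def[abs_def])
  next
    case 2
    have "\<exists>d. laurent (nA + nB + r - 1) d (\<lambda>p. \<delta> * chord (p 0) ((\<Prod>i<nA. p (Suc i)) * (\<Prod>i<nB - 1. inverse (p (Suc (nA + i)))))
         ((\<Prod>i<nA. inverse (p (Suc i))) * (\<Prod>i<nB - 1. p (Suc (nA + i)))))"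
      by (intro laurent_chord laurent_var laurent_times laurent_constant laurent_product) (use n 2 in auto)
    then show ?thesis using 2 by (simp add: concentric_map_def[abs_def])
  next
    case 3
    then show ?thesis using laurent_var(1)[OF 3(3)] by (simp add: concentric_map_def[abs_def])
  next
    case 4
    have "\<exists>d. laurent (nA + nB + r - 1) d (\<lambda>p. \<tau> * chord (p 0) (\<Prod>i<nA. p (Suc i)) (\<Prod>i<nA. inverse (p (Suc i)))
        + (\<Sum>e<r - 1. \<sigma> e * p (nA + nB + e)))"
      by (intro laurent_add laurent_chord laurent_var laurent_times laurent_constant laurent_product laurent_sum)
        (use n 4 in auto)
    then show ?thesis using 4 by (simp add: concentric_map_def[abs_def])
  qed
qed

text \<open>\<open>\<delta>\<close> reflects that units are compared through their squares;
  \<open>\<tau>\<close> and \<open>\<sigma>\<close> record directions along Z. There are finitely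
  many choices of signs, and each gives the image of a Laurent map with one parameter fewer than
  there are lengths.\<close>

definition concentric_lengths :: "nat \<Rightarrow> nat \<Rightarrow> nat \<Rightarrow> (nat \<Rightarrow> real) set" where
  "concentric_lengths nA nB r =
    (\<Union>(\<delta>, \<tau>, \<sigma>)\<in>signs \<times> signs \<times> fun_box (r - 1) signs. {x \<in> topspace (Euclidean_space (nA + nB + r)).
      \<exists>p. (\<forall>i<nA + nB + r - 1. p i \<noteq> 0) \<and> (\<forall>j<nA + nB + r. concentric_map nA nB r \<delta> \<tau> \<sigma> j p = of_real (x j))})"

lemma concentric_lengths_covered:
  assumes n: "nA \<ge> 1" "nB \<ge> 1" "r \<ge> 1"
  shows "covered_by_submanifolds (nA + nB + r) (concentric_lengths nA nB r)"
proof -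
  have N: "Suc (nA + nB + r - 1) = nA + nB + r" using n by simp
  have "covered_by_submanifolds (nA + nB + r) {x \<in> topspace (Euclidean_space (nA + nB + r)).
      \<exists>p. (\<forall>i<nA + nB + r - 1. p i \<noteq> 0) \<and> (\<forall>j<nA + nB + r. concentric_map nA nB r \<delta> \<tau> \<sigma> j p = of_real (x j))}"
    for \<delta> \<tau> \<sigma>
    using dependent_covered[of "nA + nB + r - 1" "concentric_map nA nB r \<delta> \<tau> \<sigma>"] laurent_concentric_map[OF n]
    unfolding N by blast
  then show ?thesis unfolding concentric_lengths_def
    by (intro covered_by_submanifolds_UN) (auto intro!: finite_fun_box)
qed

text \<open>The case W = 0: an aligned Z that closes up. Its last length is a signed sum of its
  other lengths, and all lengths but this one serve as parameters.\<close>

definition folded_lengths :: "nat \<Rightarrow> nat \<Rightarrow> (nat \<Rightarrow> real) set" where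
  "folded_lengths m r =
    (\<Union>\<sigma>\<in>fun_box (r - 1) signs. {x \<in> topspace (Euclidean_space (m + r)).
      \<exists>p. (\<forall>i<m + r - 1. p i \<noteq> 0) \<and>
        (\<forall>j<m + r. (if j < m + r - 1 then p j else \<Sum>e<r - 1. \<sigma> e * p (m + e)) = of_real (x j))})"

lemma folded_lengths_covered:
  assumes r: "r \<ge> 1"
  shows "covered_by_submanifolds (m + r) (folded_lengths m r)"
proof -
  have N: "Suc (m + r - 1) = m + r" using r by simp
  have cov: "covered_by_submanifolds (m + r) {x \<in> topspace (Euclidean_space (m + r)).
      \<exists>p. (\<forall>i<m + r - 1. p i \<noteq> 0) \<and>
        (\<forall>j<m + r. (if j < m + r - 1 then p j else \<Sum>e<r - 1. \<sigma> e * p (m + e)) = of_real (x j))}" for \<sigma> :: "nat \<Rightarrow> complex"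
  proof (rule dependent_covered[of "m + r - 1" "\<lambda>j p. if j < m + r - 1 then p j else \<Sum>e<r - 1. \<sigma> e * p (m + e)", unfolded N])
    fix j assume "j < m + r"
    have "\<exists>d. laurent (m + r - 1) d (\<lambda>p. \<Sum>e<r - 1. \<sigma> e * p (m + e))"
      by (intro laurent_sum laurent_times laurent_constant laurent_var) auto
    then show "\<exists>d. laurent (m + r - 1) d (\<lambda>p. if j < m + r - 1 then p j else \<Sum>e<r - 1. \<sigma> e * p (m + e))"
      using laurent_var(1)[of j "m + r - 1"] by (cases "j < m + r - 1") simp_all
  qed
  show ?thesis unfolding folded_lengths_def
    by (intro covered_by_submanifolds_UN finite_fun_box cov) auto
qed

section \<open>Half angles on a circle and signed lengths on a line\<close>

lemma inverse_unit: "cmod u = 1 \<Longrightarrow> inverse u = cnj u"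
  by (rule inverse_unique) (simp add: complex_norm_square[symmetric])

lemma chord_unit:
  assumes "cmod u = 1" shows "chord (of_real R) u (inverse u) = of_real (2 * R * Im u)"
  unfolding inverse_unit[OF assms] chord_def by (simp add: complex_eq_iff)

lemma dist_chord:
  assumes "cmod u = 1" "q - c = (p - c) * u\<^sup>2" "dist c p = R"
  shows "dist p q = 2 * R * \<bar>Im u\<bar>"
proof -
  have u0: "u \<noteq> 0" using assms(1) by auto
  have "q - p = (q - c) - (p - c)" by simp
  also have "\<dots> = (p - c) * u * (u - inverse u)"
    unfolding assms(2) using u0 by (simp add: algebra_simps power2_eq_square)
  finally have "cmod (q - p) = cmod (p - c) * cmod (u - cnj u)"
    by (simp add: norm_mult assms(1) inverse_unit)
  also have "cmod (u - cnj u) = 2 * \<bar>Im u\<bar>" by (simp add: complex_diff_cnj norm_mult)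
  finally show ?thesis using assms(3) by (simp add: dist_norm norm_minus_commute)
qed

text \<open>The rotation about the center that takes \<open>p\<close> to \<open>q\<close> has two
  square roots; the one with nonnegative imaginary part makes the signed chord equal to the
  distance.\<close>

lemma half_angle:
  assumes R: "R > 0" and "dist c p = R" "dist c q = R"
  shows "\<exists>u. cmod u = 1 \<and> q - c = (p - c) * u\<^sup>2 \<and> chord (of_real R) u (inverse u) = of_real (dist p q)"
proof -
  have p: "cmod (p - c) = R" and q: "cmod (q - c) = R"
    using assms(2,3) by (simp_all add: dist_norm norm_minus_commute)
  then have p0: "p - c \<noteq> 0" using R by auto
  define w where "w = csqrt ((q - c) / (p - c))"
  have w2: "w\<^sup>2 = (q - c) / (p - c)" by (simp add: w_def)
  have "(cmod w)\<^sup>2 = 1" unfolding norm_power[symmetric] w2 using p q R by (simp add: norm_divide)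
  then have "cmod w = 1" by (metis norm_ge_zero one_power2 power2_eq_iff_nonneg zero_le_one)
  define u where "u = (if Im w \<ge> 0 then w else - w)"
  have u: "cmod u = 1" "u\<^sup>2 = w\<^sup>2" "Im u \<ge> 0" using \<open>cmod w = 1\<close> by (simp_all add: u_def)
  have "q - c = (p - c) * u\<^sup>2" using p0 by (simp add: u(2) w2)
  moreover have "chord (of_real R) u (inverse u) = of_real (dist p q)"
    using dist_chord[OF u(1) \<open>q - c = (p - c) * u\<^sup>2\<close> assms(2)] u(3) by (simp only: chord_unit[OF u(1)] abs_of_nonneg)
  ultimately show ?thesis using u(1) by blast
qed

text \<open>Rotations about a common center multiply, so the half-angle units of the edges combine
  to one for the whole chain.\<close>

lemma concyclic_chain:
  assumes R: "R > 0" and d: "\<And>i. i \<le> n \<Longrightarrow> dist c (p i) = R"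
  shows "\<exists>u. (\<forall>i<n. cmod (u i) = 1 \<and> chord (of_real R) (u i) (inverse (u i)) = of_real (dist (p i) (p (Suc i)))) \<and>
    p n - c = (p 0 - c) * (\<Prod>i<n. u i)\<^sup>2"
proof -
  have "\<forall>i. \<exists>u. i < n \<longrightarrow> cmod u = 1 \<and> p (Suc i) - c = (p i - c) * u\<^sup>2 \<and>
      chord (of_real R) u (inverse u) = of_real (dist (p i) (p (Suc i)))"
    using half_angle[OF R d d] by (metis Suc_leI less_imp_le_nat)
  from choice[OF this] obtain u where u: "\<And>i. i < n \<Longrightarrow> cmod (u i) = 1 \<and> p (Suc i) - c = (p i - c) * (u i)\<^sup>2 \<and>
      chord (of_real R) (u i) (inverse (u i)) = of_real (dist (p i) (p (Suc i)))" by blast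
  have "k \<le> n \<Longrightarrow> p k - c = (p 0 - c) * (\<Prod>i<k. u i)\<^sup>2" for k
    by (induction k) (simp_all add: u power_mult_distrib)
  then show ?thesis using u by blast
qed

lemma collinear_chain_signs:
  fixes p :: "nat \<Rightarrow> complex"
  assumes coll: "collinear (p ` {..r})" and ne: "\<And>e. e < r \<Longrightarrow> p (Suc e) \<noteq> p e"
  shows "\<exists>s. (\<forall>e<r. s e = 1 \<or> s e = -1) \<and> (\<Sum>e<r. s e * dist (p e) (p (Suc e))) = dist (p 0) (p r)"
proof -
  obtain u where u: "\<And>x y. x \<in> p ` {..r} \<Longrightarrow> y \<in> p ` {..r} \<Longrightarrow> \<exists>c. x - y = c *\<^sub>R u"
    using coll unfolding collinear_def by blast
  have "\<forall>e. \<exists>k. e < r \<longrightarrow> p (Suc e) - p e = k *\<^sub>R u" using u by simp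
  from choice[OF this] obtain k where k: "\<And>e. e < r \<Longrightarrow> p (Suc e) - p e = k e *\<^sub>R u" by blast
  define K where "K = (\<Sum>e<r. k e)"
  \<comment> \<open>Orients the line from \<open>p 0\<close> towards \<open>p r\<close>, so that the
    signed sum is the distance itself.\<close>
  define \<eta> :: real where "\<eta> = (if K \<ge> 0 then 1 else -1)"
  have "p r - p 0 = (\<Sum>e<r. p (Suc e) - p e)" using sum_lessThan_telescope[of p r] by simp
  also have "\<dots> = K *\<^sub>R u" by (simp add: k K_def scaleR_sum_left)
  finally have "dist (p 0) (p r) = \<bar>K\<bar> * cmod u" by (metis dist_commute dist_norm norm_scaleR)
  also have "\<bar>K\<bar> = \<eta> * K" by (simp add: \<eta>_def)
  also have "\<eta> * K * cmod u = (\<Sum>e<r. \<eta> * sgn (k e) * (\<bar>k e\<bar> * cmod u))"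
    unfolding K_def sum_distrib_left sum_distrib_right by (intro sum.cong refl) (simp add: sgn_mult_abs mult.assoc[symmetric])
  also have "\<dots> = (\<Sum>e<r. \<eta> * sgn (k e) * dist (p e) (p (Suc e)))"
  proof (intro sum.cong refl)
    fix e assume "e \<in> {..<r}"
    then have "dist (p e) (p (Suc e)) = \<bar>k e\<bar> * cmod u" using k[of e] by (simp add: dist_norm norm_minus_commute[of "p e"])
    then show "\<eta> * sgn (k e) * (\<bar>k e\<bar> * cmod u) = \<eta> * sgn (k e) * dist (p e) (p (Suc e))" by simp
  qed
  finally have "(\<Sum>e<r. \<eta> * sgn (k e) * dist (p e) (p (Suc e))) = dist (p 0) (p r)" by simp
  moreover have "\<eta> * sgn (k e) = 1 \<or> \<eta> * sgn (k e) = -1" if "e < r" for e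
    using k[OF that] ne[OF that] by (auto simp: \<eta>_def sgn_if)
  ultimately show ?thesis by (intro exI[of _ "\<lambda>e. \<eta> * sgn (k e)"]) simp
qed

text \<open>The signed relation along the line is solved for the last length by multiplying with the
  sign of that edge, which is its own inverse.\<close>

lemma last_edge_collinear:
  fixes p :: "nat \<Rightarrow> complex"
  assumes "collinear (p ` {..r})" "\<And>e. e < r \<Longrightarrow> p (Suc e) \<noteq> p e" and r: "r \<ge> 1"
  shows "\<exists>\<tau>\<in>signs. \<exists>\<sigma>\<in>fun_box (r - 1) signs.
    of_real (dist (p (r - 1)) (p r)) = \<tau> * of_real (dist (p 0) (p r)) + (\<Sum>e<r - 1. \<sigma> e * of_real (dist (p e) (p (Suc e))))"
proof -
  obtain s where s: "\<And>e. e < r \<Longrightarrow> s e = 1 \<or> s e = -1"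
    and sum: "(\<Sum>e<r. s e * dist (p e) (p (Suc e))) = dist (p 0) (p r)"
    using collinear_chain_signs[OF assms(1,2)] by blast
  let ?s = "s (r - 1)"
  have r1: "Suc (r - 1) = r" using r by simp
  have s2: "?s * ?s = 1" using s[of "r - 1"] r by auto
  have "(\<Sum>e<r - 1. s e * dist (p e) (p (Suc e))) + ?s * dist (p (r - 1)) (p r) = dist (p 0) (p r)"
    using sum sum.lessThan_Suc[of "\<lambda>e. s e * dist (p e) (p (Suc e))" "r - 1"] unfolding r1 by simp
  then have "?s * ?s * dist (p (r - 1)) (p r) = ?s * (dist (p 0) (p r) - (\<Sum>e<r - 1. s e * dist (p e) (p (Suc e))))"
    by (simp add: mult.assoc)
  then have "dist (p (r - 1)) (p r) = ?s * (dist (p 0) (p r) - (\<Sum>e<r - 1. s e * dist (p e) (p (Suc e))))"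
    unfolding s2 by simp
  then have "dist (p (r - 1)) (p r) = ?s * dist (p 0) (p r) + (\<Sum>e<r - 1. - ?s * s e * dist (p e) (p (Suc e)))"
    by (simp add: right_diff_distrib sum_distrib_left mult.assoc sum_negf)
  then have "complex_of_real (dist (p (r - 1)) (p r)) = of_real ?s * of_real (dist (p 0) (p r))
      + (\<Sum>e<r - 1. of_real (- ?s * s e) * of_real (dist (p e) (p (Suc e))))"
    by (simp only: of_real_add of_real_mult of_real_sum)
  also have "(\<Sum>e<r - 1. of_real (- ?s * s e) * complex_of_real (dist (p e) (p (Suc e))))
      = (\<Sum>e<r - 1. (if e < r - 1 then of_real (- ?s * s e) else 0) * of_real (dist (p e) (p (Suc e))))"
    by (intro sum.cong) auto
  finally have eq: "complex_of_real (dist (p (r - 1)) (p r)) = of_real ?s * of_real (dist (p 0) (p r))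
      + (\<Sum>e<r - 1. (if e < r - 1 then of_real (- ?s * s e) else 0) * of_real (dist (p e) (p (Suc e))))" .
  have "(\<lambda>e. if e < r - 1 then complex_of_real (- ?s * s e) else 0) \<in> fun_box (r - 1) signs"
  proof -
    have "- ?s * s e = 1 \<or> - ?s * s e = -1" if "e < r - 1" for e
      using s[of e] s[of "r - 1"] that r by auto
    then have "complex_of_real (- ?s * s e) \<in> signs" if "e < r - 1" for e using that by fastforce
    then show ?thesis by (simp add: fun_box_def)
  qed
  moreover have "complex_of_real ?s \<in> signs" using s[of "r - 1"] r by auto
  ultimately show ?thesis
    using eq by (intro bexI[of _ "complex_of_real ?s"] bexI[of _ "\<lambda>e. if e < r - 1 then complex_of_real (- ?s * s e) else 0"])
qed

lemma vec_of_topspace: "length xs = n \<Longrightarrow> vec_of xs \<in> topspace (Euclidean_space n)"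
  by (simp add: vec_of_def topspace_Euclidean_space)

lemma vec_of_append3:
  "j < length a \<Longrightarrow> vec_of (a @ b @ z) j = a ! j"
  "j < length b \<Longrightarrow> vec_of (a @ b @ z) (length a + j) = b ! j"
  "j < length z \<Longrightarrow> vec_of (a @ b @ z) (length a + length b + j) = z ! j"
  by (simp_all add: vec_of_def nth_append)

lemma three_chain_dist:
  assumes P: "P \<in> configs (three_chain a b z)" and len: "length a \<ge> 1" "length b \<ge> 1" "length z \<ge> 1"
  shows "i < length a \<Longrightarrow> dist (P (cv VA (length a) i)) (P (cv VA (length a) (Suc i))) = a ! i"
    "i < length b \<Longrightarrow> dist (P (cv VB (length b) i)) (P (cv VB (length b) (Suc i))) = b ! i"
    "i < length z \<Longrightarrow> dist (P (cv VZ (length z) i)) (P (cv VZ (length z) (Suc i))) = z ! i"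
proof -
  have all: "\<forall>(u, v, l)\<in>chain_edges VA a \<union> chain_edges VB b \<union> chain_edges VZ z. dist (P u) (P v) = l"
    using P by (simp only: configs_def three_chain_def mem_Collect_eq snd_conv) (erule conjunct2)
  have edge: "dist (P u) (P v) = l" if mem: "(u, v, l) \<in> chain_edges VA a \<union> chain_edges VB b \<union> chain_edges VZ z" for u v l
    using bspec[OF all mem] by (simp only: case_prod_conv)
  show "i < length a \<Longrightarrow> dist (P (cv VA (length a) i)) (P (cv VA (length a) (Suc i))) = a ! i"
    by (rule edge) (auto simp: chain_edges_iff len)
  show "i < length b \<Longrightarrow> dist (P (cv VB (length b) i)) (P (cv VB (length b) (Suc i))) = b ! i"
    by (rule edge) (auto simp: chain_edges_iff len)
  show "i < length z \<Longrightarrow> dist (P (cv VZ (length z) i)) (P (cv VZ (length z) (Suc i))) = z ! i"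
    by (rule edge) (auto simp: chain_edges_iff len)
qed

text \<open>Both exceptional sets rest on this relation. For W = 0 it is a dependence among the
  lengths of Z alone; for concentric circles the length of W is a further chord.\<close>

lemma aligned_three_chain_last:
  assumes P: "P \<in> configs (three_chain a b z)" and len: "length a \<ge> 1" "length b \<ge> 1" "length z \<ge> 1"
    and pos: "\<forall>l\<in>set (a @ b @ z). 0 < l" and Z: "collinear (P ` set (chain_vertices VZ (length z)))"
  shows "\<exists>\<tau>\<in>signs. \<exists>\<sigma>\<in>fun_box (length z - 1) signs.
    complex_of_real (z ! (length z - 1)) = \<tau> * of_real (dist (P Init) (P Term)) + (\<Sum>e<length z - 1. \<sigma> e * of_real (z ! e))"
proof -
  let ?r = "length z" and ?p = "\<lambda>i. P (cv VZ (length z) i)"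
  note d = three_chain_dist(3)[OF P len]
  have coll: "collinear (?p ` {..?r})" using Z len by (simp add: set_chain_vertices image_image)
  have ne: "?p (Suc e) \<noteq> ?p e" if "e < ?r" for e
    using d[OF that] pos that nth_mem[OF that] by fastforce
  have "\<exists>\<tau>\<in>signs. \<exists>\<sigma>\<in>fun_box (?r - 1) signs. complex_of_real (dist (?p (?r - 1)) (?p ?r)) = \<tau> * of_real (dist (?p 0) (?p ?r))
      + (\<Sum>e<?r - 1. \<sigma> e * of_real (dist (?p e) (?p (Suc e))))"
    by (rule last_edge_collinear[OF coll _ len(3)]) (rule ne)
  then obtain \<tau> \<sigma> where \<tau>: "\<tau> \<in> signs" and \<sigma>: "\<sigma> \<in> fun_box (?r - 1) signs"
    and eq: "complex_of_real (dist (?p (?r - 1)) (?p ?r)) = \<tau> * of_real (dist (?p 0) (?p ?r))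
      + (\<Sum>e<?r - 1. \<sigma> e * of_real (dist (?p e) (?p (Suc e))))"
    by (elim bexE) (rule that)
  moreover have "dist (?p (?r - 1)) (?p ?r) = z ! (?r - 1)"
  proof -
    have "Suc (?r - 1) = ?r" using len(3) by simp
    then show ?thesis using d[of "?r - 1"] by simp
  qed
  moreover have "(\<Sum>e<?r - 1. \<sigma> e * of_real (dist (?p e) (?p (Suc e)))) = (\<Sum>e<?r - 1. \<sigma> e * complex_of_real (z ! e))"
    by (intro sum.cong refl) (simp add: d)
  ultimately have "complex_of_real (z ! (?r - 1)) = \<tau> * of_real (dist (P Init) (P Term)) + (\<Sum>e<?r - 1. \<sigma> e * of_real (z ! e))"
    using len(3) by (simp only: cv_0 cv_n)
  then show ?thesis using \<tau> \<sigma> by (intro bexI)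
qed

lemma folded_lengths_if_closed:
  assumes P: "P \<in> configs (three_chain a b z)" and len: "length a \<ge> 1" "length b \<ge> 1" "length z \<ge> 1"
    and pos: "\<forall>l\<in>set (a @ b @ z). 0 < l" and Z: "collinear (P ` set (chain_vertices VZ (length z)))"
    and closed: "P Init = P Term"
  shows "vec_of (a @ b @ z) \<in> folded_lengths (length a + length b) (length z)"
proof -
  let ?m = "length a + length b" and ?r = "length z" and ?x = "vec_of (a @ b @ z)"
  obtain \<tau> \<sigma> where \<sigma>: "\<sigma> \<in> fun_box (?r - 1) signs"
    and eq: "complex_of_real (z ! (?r - 1)) = \<tau> * of_real (dist (P Init) (P Term)) + (\<Sum>e<?r - 1. \<sigma> e * of_real (z ! e))"
    using aligned_three_chain_last[OF P len pos Z] by blast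
  have last: "?x (?m + ?r - 1) = z ! (?r - 1)" using vec_of_append3(3)[of "?r - 1" z a b] len(3) by simp
  have "(\<Sum>e<?r - 1. \<sigma> e * complex_of_real (?x (?m + e))) = (\<Sum>e<?r - 1. \<sigma> e * of_real (z ! e))"
    by (intro sum.cong refl) (simp add: vec_of_append3(3))
  with eq closed have sum: "(\<Sum>e<?r - 1. \<sigma> e * complex_of_real (?x (?m + e))) = of_real (?x (?m + ?r - 1))"
    unfolding last by simp
  have "?x j \<noteq> 0" if "j < ?m + ?r" for j
  proof -
    have "?x j = (a @ b @ z) ! j" "(a @ b @ z) ! j \<in> set (a @ b @ z)"
      using that by (simp_all add: vec_of_def del: set_append)
    then show ?thesis using pos by fastforce
  qed
  then have nz: "\<forall>i<?m + ?r - 1. complex_of_real (?x i) \<noteq> 0" by simp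
  have "(if j < ?m + ?r - 1 then complex_of_real (?x j) else \<Sum>e<?r - 1. \<sigma> e * of_real (?x (?m + e))) = of_real (?x j)"
    if "j < ?m + ?r" for j
  proof (cases "j < ?m + ?r - 1")
    case False
    then have "j = ?m + ?r - 1" using that by simp
    then show ?thesis using sum False by simp
  qed simp
  with nz have "\<exists>p. (\<forall>i<?m + ?r - 1. p i \<noteq> (0::complex)) \<and>
      (\<forall>j<?m + ?r. (if j < ?m + ?r - 1 then p j else \<Sum>e<?r - 1. \<sigma> e * p (?m + e)) = of_real (?x j))"
    by (intro exI[of _ "\<lambda>i. of_real (?x i)"]) blast
  then show ?thesis unfolding folded_lengths_def
    by (intro UN_I[OF \<sigma>] CollectI conjI vec_of_topspace) (assumption | simp)+
qed

lemma chord_scale: "chord R (s * x) (s * y) = s * chord R x y"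
  by (simp add: chord_def algebra_simps)

lemma concentric_lengths_if_concyclic:
  assumes P: "P \<in> configs (three_chain a b z)" and len: "length a \<ge> 1" "length b \<ge> 1" "length z \<ge> 1"
    and pos: "\<forall>l\<in>set (a @ b @ z). 0 < l" and Z: "collinear (P ` set (chain_vertices VZ (length z)))"
    and circA: "circumcenter c (P ` set (chain_vertices VA (length a)))"
    and circB: "circumcenter c (P ` set (chain_vertices VB (length b)))"
  shows "vec_of (a @ b @ z) \<in> concentric_lengths (length a) (length b) (length z)"
proof -
  let ?nA = "length a" and ?nB = "length b" and ?r = "length z" and ?x = "vec_of (a @ b @ z)"
  let ?pA = "\<lambda>i. P (cv VA (length a) i)" and ?pB = "\<lambda>i. P (cv VB (length b) i)"
  obtain R where R: "R > 0" and RA: "\<And>i. i \<le> ?nA \<Longrightarrow> dist c (?pA i) = R"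
    using circA len(1) unfolding circumcenter_def by (auto simp: set_chain_vertices)
  obtain R' where RB: "\<And>i. i \<le> ?nB \<Longrightarrow> dist c (?pB i) = R'"
    using circB len(2) unfolding circumcenter_def by (auto simp: set_chain_vertices)
  have "R' = R" using RA[of 0] RB[of 0] by (simp add: cv_0)
  obtain u where u1: "\<And>i. i < ?nA \<Longrightarrow> cmod (u i) = 1"
    and ua: "\<And>i. i < ?nA \<Longrightarrow> chord (of_real R) (u i) (inverse (u i)) = of_real (dist (?pA i) (?pA (Suc i)))"
    and uT: "?pA ?nA - c = (?pA 0 - c) * (\<Prod>i<?nA. u i)\<^sup>2"
    using concyclic_chain[of R ?nA c ?pA, OF R RA] by blast
  obtain v where v1: "\<And>i. i < ?nB \<Longrightarrow> cmod (v i) = 1"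
    and vb: "\<And>i. i < ?nB \<Longrightarrow> chord (of_real R) (v i) (inverse (v i)) = of_real (dist (?pB i) (?pB (Suc i)))"
    and vT: "?pB ?nB - c = (?pB 0 - c) * (\<Prod>i<?nB. v i)\<^sup>2"
    using concyclic_chain[of R ?nB c ?pB, OF R] RB unfolding \<open>R' = R\<close> by blast
  define w where "w = (\<Prod>i<?nA. u i)"
  define w' where "w' = (\<Prod>i<?nB - 1. v i)"
  define y where "y = v (?nB - 1)"
  have nB: "Suc (?nB - 1) = ?nB" using len(2) by simp
  have vw: "(\<Prod>i<?nB. v i) = w' * y"
    using prod.lessThan_Suc[of v "?nB - 1"] unfolding nB w'_def y_def .
  have "?pA 0 - c \<noteq> 0" using RA[of 0] R by auto
  moreover have "(?pA 0 - c) * w\<^sup>2 = (?pA 0 - c) * (w' * y)\<^sup>2"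
    using uT vT len by (simp add: w_def vw cv_0 cv_n)
  ultimately have "w\<^sup>2 = (w' * y)\<^sup>2" by simp
  \<comment> \<open>A and B lead from Init to Term by the same rotation about the common center, so
    the products of their units agree up to a sign. This expresses the last unit of B through the
    others and saves a parameter.\<close>
  then obtain \<delta> where \<delta>: "\<delta> \<in> signs" and wy: "w' * y = \<delta> * w" unfolding power2_eq_iff by fastforce
  have w1: "cmod w = 1" and w'1: "cmod w' = 1"
    by (simp_all add: w_def w'_def prod_norm[symmetric] u1 v1)
  then have "w' \<noteq> 0" by auto
  then have y: "y = \<delta> * (w * inverse w')" using wy by (simp add: field_simps)
  have y': "inverse y = \<delta> * (inverse w * w')" unfolding y using \<delta> by auto
  \<comment> \<open>The signed chord of the whole chain A may be negative; its sign is absorbed into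
    the argument \<open>\<tau>\<close> of \<open>concentric_map\<close>.\<close>
  obtain \<kappa> where \<kappa>: "\<kappa> \<in> signs" "complex_of_real (dist (P Init) (P Term)) = \<kappa> * chord (of_real R) w (inverse w)"
  proof -
    have "dist (?pA 0) (?pA ?nA) = 2 * R * \<bar>Im w\<bar>"
      using dist_chord[OF w1, of "?pA ?nA" c "?pA 0" R] uT RA[of 0] by (simp add: w_def)
    then have "dist (P Init) (P Term) = (if Im w \<ge> 0 then 1 else - 1) * (2 * R * Im w)"
      using len by (simp add: cv_0 cv_n)
    then have "complex_of_real (dist (P Init) (P Term)) = (if Im w \<ge> 0 then 1 else - 1) * chord (of_real R) w (inverse w)"
      unfolding chord_unit[OF w1] by simp
    then show thesis by (intro that[of "if Im w \<ge> 0 then 1 else - 1"]) simp_all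
  qed
  obtain \<tau> \<sigma> where \<tau>: "\<tau> \<in> signs" and \<sigma>: "\<sigma> \<in> fun_box (?r - 1) signs"
    and eq: "complex_of_real (z ! (?r - 1)) = \<tau> * of_real (dist (P Init) (P Term)) + (\<Sum>e<?r - 1. \<sigma> e * of_real (z ! e))"
    using aligned_three_chain_last[OF P len pos Z] by blast
  define p where "p j = (if j = 0 then of_real R else if j \<le> ?nA then u (j - 1)
    else if j < ?nA + ?nB then v (j - 1 - ?nA) else complex_of_real (z ! (j - (?nA + ?nB))))" for j
  have p0: "p 0 = of_real R" by (simp add: p_def)
  have pu: "p (Suc i) = u i" if "i < ?nA" for i using that by (simp add: p_def)
  have pv: "p (Suc (?nA + i)) = v i" if "i < ?nB - 1" for i
  proof -
    have "Suc i < ?nB" using that by linarith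
    then show ?thesis by (simp add: p_def)
  qed
  have pz: "p (?nA + ?nB + e) = of_real (z ! e)" for e using len(2) by (cases b) (simp_all add: p_def)
  have prods: "(\<Prod>i<?nA. p (Suc i)) = w" "(\<Prod>i<?nA. inverse (p (Suc i))) = inverse w"
    "(\<Prod>i<?nB - 1. p (Suc (?nA + i))) = w'" "(\<Prod>i<?nB - 1. inverse (p (Suc (?nA + i)))) = inverse w'"
    by (simp_all add: pu pv w_def w'_def prod_inversef[unfolded o_def, symmetric] cong: prod.cong_simp)
  have nz: "\<forall>i<?nA + ?nB + ?r - 1. p i \<noteq> 0"
  proof (intro allI impI)
    fix i assume i: "i < ?nA + ?nB + ?r - 1"
    have "u (i - 1) \<noteq> 0" if "i \<noteq> 0" "i \<le> ?nA"
    proof -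
      have "i - 1 < ?nA" using that by linarith
      from u1[OF this] show ?thesis by auto
    qed
    moreover have "v (i - 1 - ?nA) \<noteq> 0" if "\<not> i \<le> ?nA" "i < ?nA + ?nB"
    proof -
      have "i - 1 - ?nA < ?nB" using that by linarith
      from v1[OF this] show ?thesis by auto
    qed
    moreover have "z ! (i - (?nA + ?nB)) \<noteq> 0" if "\<not> i < ?nA + ?nB"
    proof -
      have "i - (?nA + ?nB) < ?r" using that i by linarith
      then show ?thesis using pos nth_mem by fastforce
    qed
    ultimately show "p i \<noteq> 0" using R by (simp add: p_def)
  qed
  have val: "concentric_map ?nA ?nB ?r \<delta> (\<tau> * \<kappa>) \<sigma> j p = of_real (?x j)" if j: "j < ?nA + ?nB + ?r" for j
  proof -
    consider "j < ?nA" | i where "j = ?nA + i" "i < ?nB - 1" | "j = ?nA + ?nB - 1"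
      | e where "j = ?nA + ?nB + e" "e < ?r - 1" | "j = ?nA + ?nB + ?r - 1"
    proof -
      have "j < ?nA \<or> (j = ?nA + (j - ?nA) \<and> j - ?nA < ?nB - 1) \<or> j = ?nA + ?nB - 1
        \<or> (j = ?nA + ?nB + (j - (?nA + ?nB)) \<and> j - (?nA + ?nB) < ?r - 1) \<or> j = ?nA + ?nB + ?r - 1"
        using j len by linarith
      then show thesis using that by blast
    qed
    then show ?thesis
    proof cases
      case 1
      then have "j < ?nA + ?nB - 1" using len by linarith
      then show ?thesis using 1 by (simp add: concentric_map_def p0 pu ua three_chain_dist[OF P len] vec_of_append3)
    next
      case 2
      then have "?nA + i < ?nA + ?nB - 1" by linarith
      with 2 show ?thesis
        by (simp add: concentric_map_def p0 pv vb three_chain_dist[OF P len] vec_of_append3)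
    next
      case 3
      have "\<not> j < ?nA + ?nB - 1" using 3 by simp
      then have "concentric_map ?nA ?nB ?r \<delta> (\<tau> * \<kappa>) \<sigma> j p = chord (of_real R) y (inverse y)"
        unfolding concentric_map_def prods p0 y' unfolding y chord_scale using 3 by simp
      also have "\<dots> = of_real (b ! (?nB - 1))"
        using vb[of "?nB - 1"] three_chain_dist(2)[OF P len, of "?nB - 1"] len(2) by (simp add: y_def)
      also have "b ! (?nB - 1) = ?x j"
        using vec_of_append3(2)[of "?nB - 1" b a z] len(2) 3 by simp
      finally show ?thesis .
    next
      case 4
      then have "\<not> j < ?nA + ?nB - 1" "j \<noteq> ?nA + ?nB - 1" "j < ?nA + ?nB + ?r - 1" using len by linarith+
      with 4 show ?thesis by (simp add: concentric_map_def pz vec_of_append3)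
    next
      case 5
      have "\<not> j < ?nA + ?nB - 1" "j \<noteq> ?nA + ?nB - 1" "\<not> j < ?nA + ?nB + ?r - 1" using 5 len by linarith+
      then have "concentric_map ?nA ?nB ?r \<delta> (\<tau> * \<kappa>) \<sigma> j p
          = \<tau> * of_real (dist (P Init) (P Term)) + (\<Sum>e<?r - 1. \<sigma> e * of_real (z ! e))"
        unfolding concentric_map_def prods p0 pz \<kappa>(2) by (simp add: mult.assoc)
      also have "\<dots> = of_real (z ! (?r - 1))" by (rule eq[symmetric])
      also have "z ! (?r - 1) = ?x j"
        using vec_of_append3(3)[of "?r - 1" z a b] len(3) 5 by simp
      finally show ?thesis .
    qed
  qed
  have "(\<delta>, \<tau> * \<kappa>, \<sigma>) \<in> signs \<times> signs \<times> fun_box (?r - 1) signs" using \<delta> \<tau> \<kappa>(1) \<sigma> by auto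
  moreover have "?x \<in> topspace (Euclidean_space (?nA + ?nB + ?r))" by (rule vec_of_topspace) simp
  ultimately show ?thesis unfolding concentric_lengths_def using nz val by blast
qed

section \<open>Aligned chains with common ends\<close>

lemma collinear_Un_line:
  fixes X Y :: "complex set"
  assumes "collinear X" "collinear Y" "i \<in> X" "i \<in> Y" "t \<in> X" "t \<in> Y" "i \<noteq> t"
  shows "collinear (X \<union> Y)"
proof -
  have "\<exists>r. x - i = of_real r * (t - i)" if "x \<in> X \<union> Y" for x
    using that collinear_through[OF assms(1,3,5,7) _ assms(3), of x] collinear_through[OF assms(2,4,6,7) _ assms(4), of x]
    by blast
  then obtain f where f: "\<And>x. x \<in> X \<union> Y \<Longrightarrow> x - i = of_real (f x) * (t - i)" by metis
  have "x - y = (f x - f y) *\<^sub>R (t - i)" if "x \<in> X \<union> Y" "y \<in> X \<union> Y" for x y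
  proof -
    have "x - y = (x - i) - (y - i)" by simp
    then show ?thesis unfolding f[OF that(1)] f[OF that(2)] by (simp add: scaleR_conv_of_real left_diff_distrib)
  qed
  then show ?thesis unfolding collinear_def by blast
qed

text \<open>The common ends are distinct, so both chains lie on the line through them, and gluing
  them gives an aligned polygon.\<close>

lemma aligned_cycle:
  fixes p q :: "nat \<Rightarrow> complex"
  assumes k: "length k \<ge> 1" "length z \<ge> 1" and p: "\<And>i. i < length k \<Longrightarrow> dist (p i) (p (Suc i)) = k ! i"
    and q: "\<And>e. e < length z \<Longrightarrow> dist (q e) (q (Suc e)) = z ! e"
    and ends: "p 0 = q 0" "p (length k) = q (length z)" "p 0 \<noteq> p (length k)"
    and coll: "collinear (p ` {..length k})" "collinear (q ` {..length z})"
  shows "has_aligned_config (polygon_linkage (k @ rev z))"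
proof -
  let ?n = "length k" and ?r = "length z"
  define g where "g = (\<lambda>i\<in>{..<?n + ?r}. if i \<le> ?n then p i else q (?n + ?r - i))"
  have gp: "g i = p i" if "i \<le> ?n" for i using that k(2) by (simp add: g_def)
  have gq: "g i = q (?n + ?r - i)" if "?n \<le> i" "i < ?n + ?r" for i
    using that ends(2) by (cases "i = ?n") (simp_all add: g_def)
  have "dist (g i) (g (Suc i mod (?n + ?r))) = (k @ rev z) ! i" if i: "i < ?n + ?r" for i
  proof (cases "i < ?n")
    case True
    then have "Suc i mod (?n + ?r) = Suc i" using k(2) by simp
    then show ?thesis using True by (simp add: gp p nth_append)
  next
    case False
    define e where "e = ?n + ?r - Suc i"
    have e: "e < ?r" "?n + ?r - i = Suc e" "?r - Suc (i - ?n) = e" using i False by (auto simp: e_def)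
    have "g (Suc i mod (?n + ?r)) = q e"
    proof (cases "Suc i = ?n + ?r")
      case True
      then show ?thesis using gp[of 0] ends(1) by (simp add: e_def)
    next
      case neq: False
      then show ?thesis using gq[of "Suc i"] i False by (simp add: e_def)
    qed
    moreover have "g i = q (Suc e)" using gq[of i] i False e by simp
    moreover have "(k @ rev z) ! i = z ! e" using i False e by (simp add: nth_append rev_nth)
    ultimately show ?thesis using q[OF e(1)] by (simp add: dist_commute)
  qed
  then have "g \<in> configs (polygon_linkage (k @ rev z))"
    unfolding configs_def polygon_linkage_def by (auto simp: g_def PiE_iff)
  moreover have "collinear (g ` {..<?n + ?r})"
  proof (rule collinear_subset)
    show "collinear (p ` {..?n} \<union> q ` {..?r})"
    proof (rule collinear_Un_line[OF coll _ _ _ _ ends(3)])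
      show "p 0 \<in> q ` {..?r}" unfolding ends(1) by simp
      show "p ?n \<in> q ` {..?r}" unfolding ends(2) by simp
    qed auto
    show "g ` {..<?n + ?r} \<subseteq> p ` {..?n} \<union> q ` {..?r}" by (auto simp: g_def)
  qed
  ultimately show ?thesis unfolding has_aligned_config_def by (auto simp: polygon_linkage_def)
qed

theorem theorem7:
  fixes nA nB r :: nat
  assumes "nA \<ge> 1" and "nB \<ge> 1" and "r \<ge> 1"
  shows "for_generic_lengths nA nB r (\<lambda>a b z.
    \<not> has_aligned_config (polygon_linkage (a @ rev b)) \<and>
    \<not> has_aligned_config (polygon_linkage (a @ rev z)) \<and>
    \<not> has_aligned_config (polygon_linkage (b @ rev z)) \<longrightarrow>
    (\<forall>P OA OB.
      critical_config (three_chain a b z) (Gamma_area nA nB) P \<and>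
      collinear (P ` set (chain_vertices VZ r)) \<and>
      circumcenter OA (P ` set (chain_vertices VA nA)) \<and>
      circumcenter OB (P ` set (chain_vertices VB nB)) \<longrightarrow>
      int (morse_index (three_chain a b z) (Gamma_area nA nB) P) =
        int (polygon_morse_index (map P (AW_vertices nA))) +
        int (polygon_morse_index (map P (BW_vertices nB))) +
        (if positively_oriented (P Term - P Init) (OB - OA)
         then int (num_forward r P) - 1
         else int r - int (num_forward r P))))"
proof -
  have "covered_by_submanifolds (nA + nB + r) (concentric_lengths nA nB r \<union> folded_lengths (nA + nB) r)"
    by (intro covered_by_submanifolds_Un concentric_lengths_covered folded_lengths_covered assms)
  then obtain \<M> where \<M>: "finite \<M>" "\<forall>M\<in>\<M>. \<exists>k\<ge>1. submanifold_codim (nA + nB + r) k M"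
    and cov: "concentric_lengths nA nB r \<union> folded_lengths (nA + nB) r \<subseteq> \<Union>\<M>"
    unfolding covered_by_submanifolds_def by blast
  show ?thesis
    unfolding for_generic_lengths_def
  proof (rule exI[of _ \<M>], intro conjI \<M> allI impI, elim conjE)
    fix a b z :: "real list" and P :: "vertex \<Rightarrow> complex" and OA OB
    assume n: "length a = nA" "length b = nB" "length z = r"
      and pos: "\<forall>l\<in>set (a @ b @ z). 0 < l" and generic: "vec_of (a @ b @ z) \<notin> \<Union>\<M>"
      and nAZ: "\<not> has_aligned_config (polygon_linkage (a @ rev z))"
      and nBZ: "\<not> has_aligned_config (polygon_linkage (b @ rev z))"
      and crit: "critical_config (three_chain a b z) (Gamma_area nA nB) P"
      and Z: "collinear (P ` set (chain_vertices VZ r))"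
      and circA: "circumcenter OA (P ` set (chain_vertices VA nA))"
      and circB: "circumcenter OB (P ` set (chain_vertices VB nB))"
    have P: "P \<in> configs (three_chain a b z)" using crit unfolding critical_config_def by blast
    have len: "length a \<ge> 1" "length b \<ge> 1" "length z \<ge> 1" using assms n by simp_all
    \<comment> \<open>Genericity enters here and for \<open>centers\<close>: otherwise the length
      vector would lie in one of the two covered exceptional sets.\<close>
    have W: "P Init \<noteq> P Term"
      using folded_lengths_if_closed[OF P len pos] Z cov generic unfolding n by blast
    have centers: "OA \<noteq> OB"
      using concentric_lengths_if_concyclic[OF P len pos, of OA] Z circA circB cov generic unfolding n by blast
    \<comment> \<open>An aligned A or B would form, with the aligned Z, an aligned configuration of
      the cycle AZ or BZ, since the common ends are distinct.\<close>
    have not_coll: "\<not> collinear (P ` set (chain_vertices K (length k)))"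
      if k: "length k \<ge> 1" "\<not> has_aligned_config (polygon_linkage (k @ rev z))"
        "\<And>i. i < length k \<Longrightarrow> dist (P (cv K (length k) i)) (P (cv K (length k) (Suc i))) = k ! i" for k K
    proof
      assume "collinear (P ` set (chain_vertices K (length k)))"
      then have "has_aligned_config (polygon_linkage (k @ rev z))"
        using aligned_cycle[of k z "\<lambda>i. P (cv K (length k) i)" "\<lambda>i. P (cv VZ (length z) i)", OF k(1) len(3) k(3)
            three_chain_dist(3)[OF P len]] W Z k(1) len(3)
        by (simp add: set_chain_vertices image_image cv_0 cv_n n)
      then show False using k(2) by blast
    qed
    have "aligned_three_chain a b z P OA OB"
      using Z circA circB
      by (intro aligned_three_chain.intro len P W not_coll[OF len(1) nAZ three_chain_dist(1)[OF P len]]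
          not_coll[OF len(2) nBZ three_chain_dist(2)[OF P len]]) (simp_all add: n pos[rule_format])
    from aligned_three_chain.morse_index_formula[OF this, unfolded n, OF crit centers]
    show "int (morse_index (three_chain a b z) (Gamma_area nA nB) P) =
        int (polygon_morse_index (map P (AW_vertices nA))) +
        int (polygon_morse_index (map P (BW_vertices nB))) +
        (if positively_oriented (P Term - P Init) (OB - OA)
         then int (num_forward r P) - 1
         else int r - int (num_forward r P))" .
  qed
qed

end
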